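(* Let $\Sigma=\Sigma_{g,p}$ be a connected oriented punctured surface with genus $g\geqslant 1$ and $p\geqslant 1$ punctures. Let $n\in\mathbb Z$ and $s\in\{\pm1\}^p$. Then the space $\mathcal R_n^s(\Sigma)$ of type-preserving representations with relative Euler class $n$ and sign $s$ is non-empty if and only if $$\chi(\Sigma)+p_+(s)\leqslant n\leqslant -\chi(\Sigma)-p_-(s).$$ Moreover, each non-empty $\mathcal R_n^s(\Sigma)$ above is connected.
   Context: $\Sigma_{g,p}$ is the surface obtained from a closed connected oriented surface of genus $g$ by removing $p$ points; $\chi(\Sigma_{g,p})=2-2g-p$. Fix a presentation $\pi_1(\Sigma)=\langle a_1,b_1,\dots,a_g,b_g,c_1,\dots,c_p\mid [a_1,b_1]\cdots[a_g,b_g]c_1\cdots c_p\rangle$, where $c_1,\dots,c_p$ are the preferred peripheral elements, $c_i$ being represented by a loop freely homotopic to a circle around the $i$-th puncture. A non-trivial element $\pm A\in\mathrm{PSL}(2,\mathbb R)$ is hyperbolic, parabolic, or elliptic if $|\mathrm{tr}(A)|>2$, $=2$, or $<2$ respectively. A parabolic element is positive if it is $\mathrm{PSL}(2,\mathbb R)$-conjugate to $\pm\begin{bmatrix}1&1\\0&1\end{bmatrix}$ and negative if it is conjugate to $\pm\begin{bmatrix}1&-1\\0&1\end{bmatrix}$. A representation (group homomorphism) $\phi:\pi_1(\Sigma)\to\mathrm{PSL}(2,\mathbb R)$ is type-preserving if every $\phi(c_i)$ is parabolic. Its sign $s(\phi)\in\{\pm1\}^p$ has $i$-th component $+1$ if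 $\phi(c_i)$ is positive and $-1$ if $\phi(c_i)$ is negative. For $s\in\{\pm1\}^p$, $p_+(s)$ and $p_-(s)$ are the numbers of components equal to $+1$ and $-1$. Relative Euler class: let $\widetilde{\mathrm{SL}}(2,\mathbb R)$ be the universal covering group of $\mathrm{PSL}(2,\mathbb R)$, with exponential map $\widetilde{\exp}:\mathfrak{sl}_2(\mathbb R)\to\widetilde{\mathrm{SL}}(2,\mathbb R)$, and let $z=\widetilde{\exp}\begin{bmatrix}0&\pi\\-\pi&0\end{bmatrix}$, a generator of the (infinite cyclic) center. A hyperbolic or parabolic element of $\mathrm{PSL}(2,\mathbb R)$ has a unique lift lying in the image of $\widetilde{\exp}$. Let $\widetilde{\phi(c_i)}$ be this lift of $\phi(c_i)$, and $\widetilde{\phi(a_j)},\widetilde{\phi(b_j)}$ arbitrary lifts. Then $e(\phi)=n$ is the integer with $$[\widetilde{\phi(a_1)},\widetilde{\phi(b_1)}]\cdots[\widetilde{\phi(a_g)},\widetilde{\phi(b_g)}]\,\widetilde{\phi(c_1)}\cdots\widetilde{\phi(c_p)}=z^n.$$ $\mathcal R_n^s(\Sigma)$ is the set of type-preserving $\phi$ with $e(\phi)=n$ and $s(\phi)=s$, with the subspace topology from $\mathrm{Hom}(\pi_1(\Sigma),\mathrm{PSL}(2,\mathbb R))$ with the compact-open topology (equivalently pointwise convergence on generators). *)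

theory Defs
  imports "HOL-Analysis.Analysis" "HOL-Algebra.Coset"
begin

section \<open>Groups given by generators and relators\<close>

text \<open>A word is a list of signed generators: \<open>(x, True)\<close> stands for \<open>x\<close> and \<open>(x, False)\<close>
  for the inverse of \<open>x\<close>.\<close>

type_synonym 'x word = "('x \<times> bool) list"

definition words :: "'x set \<Rightarrow> 'x word set" where
  "words S = lists (S \<times> UNIV)"

inductive_set word_equiv :: "'x set \<Rightarrow> 'x word set \<Rightarrow> ('x word \<times> 'x word) set"
  for S :: "'x set" and R :: "'x word set" where
  refl: "w \<in> words S \<Longrightarrow> (w, w) \<in> word_equiv S R"
| sym: "(v, w) \<in> word_equiv S R \<Longrightarrow> (w, v) \<in> word_equiv S R"
| trans: "(u, v) \<in> word_equiv S R \<Longrightarrow> (v, w) \<in> word_equiv S R \<Longrightarrow> (u, w) \<in> word_equiv S R"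
| cancel: "u \<in> words S \<Longrightarrow> v \<in> words S \<Longrightarrow> x \<in> S \<Longrightarrow>
    (u @ [(x, b), (x, \<not> b)] @ v, u @ v) \<in> word_equiv S R"
| relator: "u \<in> words S \<Longrightarrow> v \<in> words S \<Longrightarrow> r \<in> R \<Longrightarrow> r \<in> words S \<Longrightarrow>
    (u @ r @ v, u @ v) \<in> word_equiv S R"

definition word_class :: "'x set \<Rightarrow> 'x word set \<Rightarrow> 'x word \<Rightarrow> 'x word set" where
  "word_class S R w = word_equiv S R `` {w}"

definition presented_group :: "'x set \<Rightarrow> 'x word set \<Rightarrow> 'x word set monoid" where
  "presented_group S R =
    \<lparr>carrier = words S // word_equiv S R,
     mult = (\<lambda>X Y. \<Union>x\<in>X. \<Union>y\<in>Y. word_class S R (x @ y)),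
     one = word_class S R []\<rparr>"


section \<open>The fundamental group of a punctured surface\<close>

text \<open>Indices start from 0: the handle generators are \<open>a j\<close>, \<open>b j\<close> with \<open>j < g\<close>, and the
  peripheral generators are \<open>c i\<close> with \<open>i < p\<close>.\<close>

datatype surface_gen = Gen_a nat | Gen_b nat | Gen_c nat

definition surface_gens :: "nat \<Rightarrow> nat \<Rightarrow> surface_gen set" where
  "surface_gens g p = Gen_a ` {..<g} \<union> Gen_b ` {..<g} \<union> Gen_c ` {..<p}"

definition surface_relator :: "nat \<Rightarrow> nat \<Rightarrow> surface_gen word" where
  "surface_relator g p =
    concat (map (\<lambda>j. [(Gen_a j, True), (Gen_b j, True), (Gen_a j, False), (Gen_b j, False)]) [0..<g])
    @ map (\<lambda>i. (Gen_c i, True)) [0..<p]"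

definition surface_group :: "nat \<Rightarrow> nat \<Rightarrow> surface_gen word set monoid" where
  "surface_group g p = presented_group (surface_gens g p) {surface_relator g p}"

definition surface_elem :: "nat \<Rightarrow> nat \<Rightarrow> surface_gen \<Rightarrow> surface_gen word set" where
  "surface_elem g p x = word_class (surface_gens g p) {surface_relator g p} [(x, True)]"

definition surface_euler_char :: "nat \<Rightarrow> nat \<Rightarrow> int" where
  "surface_euler_char g p = 2 - 2 * int g - int p"


section \<open>The topological group PSL(2,R)\<close>

type_synonym mat2 = "real^2^2"

definition mat2 :: "real \<Rightarrow> real \<Rightarrow> real \<Rightarrow> real \<Rightarrow> mat2" where
  "mat2 a b c d = vector [vector [a, b], vector [c, d]]"

definition SL2R :: "mat2 monoid" where
  "SL2R = \<lparr>carrier = {A. det A = 1}, mult = (**), one = mat 1\<rparr>"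

definition PSL2R :: "mat2 set monoid" where
  "PSL2R = SL2R Mod {mat 1, - mat 1}"

text \<open>The class \<open>\<plusminus>A = {A, -A}\<close> of \<open>A\<close>.\<close>

definition to_PSL :: "mat2 \<Rightarrow> mat2 set" where
  "to_PSL A = {mat 1, - mat 1} #>\<^bsub>SL2R\<^esub> A"

text \<open>The quotient topology; \<open>SL2R\<close> carries the topology of a subspace of the space of matrices.\<close>

definition PSL2R_topology :: "mat2 set topology" where
  "PSL2R_topology = topology (\<lambda>U. U \<subseteq> carrier PSL2R \<and>
     openin (top_of_set (carrier SL2R)) {A \<in> carrier SL2R. to_PSL A \<in> U})"

definition PSL_parabolic :: "mat2 set \<Rightarrow> bool" where
  "PSL_parabolic X \<longleftrightarrow> X \<in> carrier PSL2R \<and> X \<noteq> \<one>\<^bsub>PSL2R\<^esub> \<and> (\<exists>A\<in>X. \<bar>trace A\<bar> = 2)"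

definition PSL_conj :: "mat2 set \<Rightarrow> mat2 set \<Rightarrow> bool" where
  "PSL_conj X Y \<longleftrightarrow> (\<exists>G\<in>carrier PSL2R. X = G \<otimes>\<^bsub>PSL2R\<^esub> Y \<otimes>\<^bsub>PSL2R\<^esub> inv\<^bsub>PSL2R\<^esub> G)"

definition PSL_pos_parabolic :: "mat2 set \<Rightarrow> bool" where
  "PSL_pos_parabolic X \<longleftrightarrow> PSL_conj X (to_PSL (mat2 1 1 0 1))"

definition PSL_neg_parabolic :: "mat2 set \<Rightarrow> bool" where
  "PSL_neg_parabolic X \<longleftrightarrow> PSL_conj X (to_PSL (mat2 1 (- 1) 0 1))"

text \<open>The value 0 is never taken on parabolic elements.\<close>

definition parabolic_sign :: "mat2 set \<Rightarrow> int" where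
  "parabolic_sign X =
    (if PSL_pos_parabolic X then 1 else if PSL_neg_parabolic X then - 1 else 0)"


section \<open>The universal covering group\<close>

text \<open>The universal covering group of a topological group \<open>G\<close> with topology \<open>T\<close>, as a group:
  homotopy classes relative to the endpoints of paths that start at the identity, multiplied
  pointwise.  The covering map sends a class to the common endpoint of its paths.\<close>

definition path_homotopic :: "'a topology \<Rightarrow> (real \<Rightarrow> 'a) \<Rightarrow> (real \<Rightarrow> 'a) \<Rightarrow> bool" where
  "path_homotopic T \<gamma> \<delta> \<longleftrightarrow>
    homotopic_with (\<lambda>r. r 0 = \<gamma> 0 \<and> r 1 = \<gamma> 1) (top_of_set {0..1}) T \<gamma> \<delta>"

definition path_class :: "'a topology \<Rightarrow> (real \<Rightarrow> 'a) \<Rightarrow> (real \<Rightarrow> 'a) set" where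
  "path_class T \<gamma> = {\<delta>. path_homotopic T \<gamma> \<delta>}"

definition universal_cover :: "('a, 'b) monoid_scheme \<Rightarrow> 'a topology \<Rightarrow> (real \<Rightarrow> 'a) set monoid" where
  "universal_cover G T =
    \<lparr>carrier = path_class T ` {\<gamma>. pathin T \<gamma> \<and> \<gamma> 0 = \<one>\<^bsub>G\<^esub>},
     mult = (\<lambda>X Y. \<Union>\<alpha>\<in>X. \<Union>\<beta>\<in>Y. path_class T (\<lambda>t. \<alpha> t \<otimes>\<^bsub>G\<^esub> \<beta> t)),
     one = path_class T (\<lambda>t. \<one>\<^bsub>G\<^esub>)\<rparr>"

definition cover_proj :: "(real \<Rightarrow> 'a) set \<Rightarrow> 'a" where
  "cover_proj X = (THE a. \<forall>\<gamma>\<in>X. \<gamma> 1 = a)"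

definition SL2R_cover :: "(real \<Rightarrow> mat2 set) set monoid" where
  "SL2R_cover = universal_cover PSL2R PSL2R_topology"

definition sl2 :: "mat2 set" where
  "sl2 = {X. trace X = 0}"

text \<open>The library's \<open>exp\<close> and \<open>^\<close> are not available here with the intended meaning, since the
  product of type \<open>real^2^2\<close> is taken componentwise.\<close>

definition mat_exp :: "mat2 \<Rightarrow> mat2" where
  "mat_exp X = (\<Sum>k. (((**) X ^^ k) (mat 1)) /\<^sub>R fact k)"

text \<open>The exponential map of the covering group: the lift of the one-parameter subgroup
  \<open>t \<mapsto> \<plusminus>exp (t X)\<close>, evaluated at \<open>t = 1\<close>.\<close>

definition cover_exp :: "mat2 \<Rightarrow> (real \<Rightarrow> mat2 set) set" where
  "cover_exp X = path_class PSL2R_topology (\<lambda>t. to_PSL (mat_exp (t *\<^sub>R X)))"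

definition cover_z :: "(real \<Rightarrow> mat2 set) set" where
  "cover_z = cover_exp (mat2 0 pi (- pi) 0)"

text \<open>The unique lift in the image of the exponential map, for hyperbolic and parabolic elements.\<close>

definition exp_lift :: "mat2 set \<Rightarrow> (real \<Rightarrow> mat2 set) set" where
  "exp_lift Y = (THE X. X \<in> cover_exp ` sl2 \<and> cover_proj X = Y)"


section \<open>Type-preserving representations\<close>

text \<open>Homomorphisms are taken to be \<open>undefined\<close> outside the carrier, to make them points of the
  product topology below.\<close>

definition Rep :: "nat \<Rightarrow> nat \<Rightarrow> (surface_gen word set \<Rightarrow> mat2 set) set" where
  "Rep g p = hom (surface_group g p) PSL2R \<inter> extensional (carrier (surface_group g p))"

text \<open>The topology of pointwise convergence, which is the compact-open topology as the
  fundamental group is discrete.\<close>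

definition Rep_topology :: "nat \<Rightarrow> nat \<Rightarrow> (surface_gen word set \<Rightarrow> mat2 set) topology" where
  "Rep_topology g p =
    subtopology (product_topology (\<lambda>_. PSL2R_topology) (carrier (surface_group g p))) (Rep g p)"

definition type_preserving :: "nat \<Rightarrow> nat \<Rightarrow> (surface_gen word set \<Rightarrow> mat2 set) \<Rightarrow> bool" where
  "type_preserving g p \<phi> \<longleftrightarrow> (\<forall>i<p. PSL_parabolic (\<phi> (surface_elem g p (Gen_c i))))"

definition rep_sign :: "nat \<Rightarrow> nat \<Rightarrow> (surface_gen word set \<Rightarrow> mat2 set) \<Rightarrow> nat \<Rightarrow> int" where
  "rep_sign g p \<phi> = (\<lambda>i\<in>{..<p}. parabolic_sign (\<phi> (surface_elem g p (Gen_c i))))"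

definition group_commutator :: "('a, 'b) monoid_scheme \<Rightarrow> 'a \<Rightarrow> 'a \<Rightarrow> 'a" where
  "group_commutator G x y = x \<otimes>\<^bsub>G\<^esub> y \<otimes>\<^bsub>G\<^esub> inv\<^bsub>G\<^esub> x \<otimes>\<^bsub>G\<^esub> inv\<^bsub>G\<^esub> y"

definition group_list_prod :: "('a, 'b) monoid_scheme \<Rightarrow> 'a list \<Rightarrow> 'a" where
  "group_list_prod G xs = foldr (mult G) xs \<one>\<^bsub>G\<^esub>"

definition is_cover_lift :: "(real \<Rightarrow> mat2 set) set \<Rightarrow> mat2 set \<Rightarrow> bool" where
  "is_cover_lift X Y \<longleftrightarrow> X \<in> carrier SL2R_cover \<and> cover_proj X = Y"

text \<open>The equation does not depend on the lifts \<open>\<alpha> j\<close>, \<open>\<beta> j\<close> of the images of \<open>a j\<close>, \<open>b j\<close>,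
  hence the quantification over all of them.\<close>

definition rel_euler_class :: "nat \<Rightarrow> nat \<Rightarrow> (surface_gen word set \<Rightarrow> mat2 set) \<Rightarrow> int" where
  "rel_euler_class g p \<phi> = (THE n::int. \<forall>\<alpha> \<beta>.
     (\<forall>j<g. is_cover_lift (\<alpha> j) (\<phi> (surface_elem g p (Gen_a j))) \<and>
            is_cover_lift (\<beta> j) (\<phi> (surface_elem g p (Gen_b j)))) \<longrightarrow>
     group_list_prod SL2R_cover
       (map (\<lambda>j. group_commutator SL2R_cover (\<alpha> j) (\<beta> j)) [0..<g] @
        map (\<lambda>i. exp_lift (\<phi> (surface_elem g p (Gen_c i)))) [0..<p])
     = cover_z [^]\<^bsub>SL2R_cover\<^esub> n)"

definition Rep_n_s :: "nat \<Rightarrow> nat \<Rightarrow> int \<Rightarrow> (nat \<Rightarrow> int) \<Rightarrow> (surface_gen word set \<Rightarrow> mat2 set) set" where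
  "Rep_n_s g p n s =
    {\<phi> \<in> Rep g p. type_preserving g p \<phi> \<and> rel_euler_class g p \<phi> = n \<and> rep_sign g p \<phi> = s}"

definition num_pos :: "nat \<Rightarrow> (nat \<Rightarrow> int) \<Rightarrow> nat" where
  "num_pos p s = card {i. i < p \<and> s i = 1}"

definition num_neg :: "nat \<Rightarrow> (nat \<Rightarrow> int) \<Rightarrow> nat" where
  "num_neg p s = card {i. i < p \<and> s i = - 1}"


section \<open>Well-definedness of the groups and of the quotient topology\<close>

lemma word_equiv_words: "(u,v) \<in> word_equiv S R \<Longrightarrow> u \<in> words S \<and> v \<in> words S"
  by (induction rule: word_equiv.induct) (auto simp: words_def)

lemma equiv_word_equiv: "equiv (words S) (word_equiv S R)"
proof (rule equivI)
  show "word_equiv S R \<subseteq> words S \<times> words S" using word_equiv_words by fastforce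
  show "refl_on (words S) (word_equiv S R)" by (simp add: refl_on_def word_equiv.refl)
  show "sym (word_equiv S R)" by (meson symI word_equiv.sym)
  show "trans (word_equiv S R)" by (meson transI word_equiv.trans)
qed

lemma word_equiv_append:
  assumes "(u,u') \<in> word_equiv S R" "(v,v') \<in> word_equiv S R"
  shows "(u @ v, u' @ v') \<in> word_equiv S R"
proof -
  have l: "(w @ u, w @ u') \<in> word_equiv S R"
    if "(u,u') \<in> word_equiv S R" "w \<in> words S" for u u' w
    using that
  proof (induction rule: word_equiv.induct)
    case (cancel u v x b)
    then show ?case using word_equiv.cancel[of "w @ u" S v x b R] by (simp add: words_def)
  next
    case (relator u v r)
    then show ?case using word_equiv.relator[of "w @ u" S v r R] by (simp add: words_def)
  next
    case (refl w)
    then show ?case by (intro word_equiv.refl) (auto simp: words_def)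
  next
    case (sym v w)
    then show ?case by (simp add: word_equiv.sym)
  next
    case (trans u v w)
    then show ?case by (meson word_equiv.trans)
  qed
  have r: "(u @ w, u' @ w) \<in> word_equiv S R"
    if "(u,u') \<in> word_equiv S R" "w \<in> words S" for u u' w
    using that
  proof (induction rule: word_equiv.induct)
    case (cancel u v x b)
    then show ?case using word_equiv.cancel[of u S "v @ w" x b R] by (simp add: words_def)
  next
    case (relator u v r)
    then show ?case using word_equiv.relator[of u S "v @ w" r R] by (simp add: words_def)
  next
    case (refl w)
    then show ?case by (intro word_equiv.refl) (auto simp: words_def)
  next
    case (sym v w)
    then show ?case by (simp add: word_equiv.sym)
  next
    case (trans u v w)
    then show ?case by (meson word_equiv.trans)
  qed
  show ?thesis
    by (rule word_equiv.trans[OF r[OF assms(1)] l[OF assms(2)]])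
      (use word_equiv_words[OF assms(1)] word_equiv_words[OF assms(2)] in auto)
qed

lemma word_class_eq_iff:
  assumes "u \<in> words S" "v \<in> words S"
  shows "word_class S R u = word_class S R v \<longleftrightarrow> (u, v) \<in> word_equiv S R"
  unfolding word_class_def using assms by (simp add: eq_equiv_class_iff[OF equiv_word_equiv])

lemma carrier_presented_group: "carrier (presented_group S R) = word_class S R ` words S"
  by (auto simp: presented_group_def word_class_def quotient_def)

lemma mult_word_class:
  assumes "u \<in> words S" "v \<in> words S"
  shows "word_class S R u \<otimes>\<^bsub>presented_group S R\<^esub> word_class S R v = word_class S R (u @ v)"
proof -
  have "word_class S R (x @ y) = word_class S R (u @ v)"
    if "x \<in> word_class S R u" "y \<in> word_class S R v" for x y
    using that word_equiv_append[of u x S R v y] word_equiv_words[of u x S R] word_equiv_words[of v y S R]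
    by (subst word_class_eq_iff) (auto simp: word_class_def words_def intro!: word_equiv.sym[of "u @ v"])
  moreover have "u \<in> word_class S R u" "v \<in> word_class S R v"
    using assms by (auto simp: word_class_def intro: word_equiv.refl)
  ultimately have "(\<Union>x\<in>word_class S R u. \<Union>y\<in>word_class S R v. word_class S R (x @ y)) = word_class S R (u @ v)"
    by blast
  then show ?thesis by (simp add: presented_group_def)
qed

lemma one_presented_group: "\<one>\<^bsub>presented_group S R\<^esub> = word_class S R []"
  by (simp add: presented_group_def)

lemma word_inverse:
  assumes "w \<in> words S"
  shows "\<exists>w'\<in>words S. (w' @ w, []) \<in> word_equiv S R"
  using assms
proof (induction w rule: rev_induct)
  case Nil
  then show ?case by (intro bexI[of _ "[]"]) (auto simp: words_def intro: word_equiv.refl)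
next
  case (snoc a w)
  obtain x b where a: "a = (x, b)" by force
  obtain w' where w': "w' \<in> words S" "(w' @ w, []) \<in> word_equiv S R"
    using snoc by (auto simp: words_def)
  have x: "x \<in> S" using snoc.prems by (auto simp: words_def a)
  let ?i = "[(x, \<not> b)]" and ?a = "[(x, b)]"
  have 1: "?i \<in> words S" "?a \<in> words S" "[] \<in> words S" using x by (auto simp: words_def)
  have "(?i @ (w' @ w) @ ?a, ?i @ [] @ ?a) \<in> word_equiv S R"
    by (intro word_equiv_append w' word_equiv.refl 1)
  moreover have "(?i @ [] @ ?a, []) \<in> word_equiv S R"
    using word_equiv.cancel[of "[]" S "[]" x "\<not> b" R] x 1 by simp
  ultimately have "((?i @ w') @ (w @ [a]), []) \<in> word_equiv S R"
    using word_equiv.trans a by (metis append.assoc append.left_neutral)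
  moreover have "?i @ w' \<in> words S" using 1 w' by (auto simp: words_def)
  ultimately show ?case by blast
qed

lemma words_append: "u \<in> words S \<Longrightarrow> v \<in> words S \<Longrightarrow> u @ v \<in> words S"
  by (simp add: words_def)

lemma group_presented_group: "group (presented_group S R)"
proof (rule groupI)
  fix x y assume "x \<in> carrier (presented_group S R)" "y \<in> carrier (presented_group S R)"
  then show "x \<otimes>\<^bsub>presented_group S R\<^esub> y \<in> carrier (presented_group S R)"
    by (force simp: carrier_presented_group mult_word_class intro!: imageI simp: words_append)
next
  show "\<one>\<^bsub>presented_group S R\<^esub> \<in> carrier (presented_group S R)"
    by (auto simp: carrier_presented_group one_presented_group words_def)
next
  fix x y z assume "x \<in> carrier (presented_group S R)" "y \<in> carrier (presented_group S R)" "z \<in> carrier (presented_group S R)"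
  then obtain u v w where *: "x = word_class S R u" "y = word_class S R v" "z = word_class S R w"
    "u \<in> words S" "v \<in> words S" "w \<in> words S" by (auto simp: carrier_presented_group)
  then have "u @ v \<in> words S" "v @ w \<in> words S" by (auto simp: words_def)
  then show "x \<otimes>\<^bsub>presented_group S R\<^esub> y \<otimes>\<^bsub>presented_group S R\<^esub> z = x \<otimes>\<^bsub>presented_group S R\<^esub> (y \<otimes>\<^bsub>presented_group S R\<^esub> z)"
    using * by (simp add: mult_word_class)
next
  fix x assume "x \<in> carrier (presented_group S R)"
  then obtain u where u: "x = word_class S R u" "u \<in> words S" by (auto simp: carrier_presented_group)
  have n: "[] \<in> words S" by (simp add: words_def)
  show "\<one>\<^bsub>presented_group S R\<^esub> \<otimes>\<^bsub>presented_group S R\<^esub> x = x"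
    using u n by (simp add: one_presented_group mult_word_class)
  obtain w where w: "w \<in> words S" "(w @ u, []) \<in> word_equiv S R" using word_inverse[OF u(2)] by blast
  then have "word_class S R w \<otimes>\<^bsub>presented_group S R\<^esub> x = \<one>\<^bsub>presented_group S R\<^esub>"
    using u n word_equiv_words[OF w(2)] by (simp add: one_presented_group mult_word_class word_class_eq_iff)
  then show "\<exists>y\<in>carrier (presented_group S R). y \<otimes>\<^bsub>presented_group S R\<^esub> x = \<one>\<^bsub>presented_group S R\<^esub>"
    using w by (auto simp: carrier_presented_group)
qed

lemma group_SL2R: "group SL2R"
proof (rule groupI)
  fix x assume "x \<in> carrier SL2R"
  then have d: "det x = 1" by (simp add: SL2R_def)
  then have "invertible x" by (simp add: invertible_det_nz)
  then obtain y where i: "y ** x = mat 1" by (auto simp: invertible_def)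
  then have "det y = 1" using d det_mul[of y x] by simp
  with i show "\<exists>y\<in>carrier SL2R. y \<otimes>\<^bsub>SL2R\<^esub> x = \<one>\<^bsub>SL2R\<^esub>" by (auto simp: SL2R_def)
qed (auto simp: SL2R_def det_mul matrix_mul_assoc)

lemma mat2_neg: "det (- A) = det (A :: mat2)" "(- A) ** B = - (A ** B)" "B ** (- A) = - (B ** A)"
  for B :: mat2
  by (simp_all add: det_2 vec_eq_iff matrix_matrix_mult_def sum_negf)

lemma inv_minus_one: "inv\<^bsub>SL2R\<^esub> (- mat 1) = - mat 1"
proof -
  interpret group SL2R by (rule group_SL2R)
  show ?thesis by (rule inv_equality) (auto simp: SL2R_def mat2_neg)
qed

lemma normal_center: "{mat 1, - mat 1} \<lhd> SL2R"
proof -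
  interpret group SL2R by (rule group_SL2R)
  have s: "subgroup {mat 1, - mat 1} SL2R"
  proof (rule subgroupI)
    fix a assume "a \<in> {mat 1, - mat 1 :: mat2}"
    then show "inv\<^bsub>SL2R\<^esub> a \<in> {mat 1, - mat 1}"
      using inv_one inv_minus_one by (auto simp: SL2R_def)
  qed (auto simp: SL2R_def mat2_neg)
  show ?thesis
    by (rule normalI[OF s]) (auto simp: r_coset_def l_coset_def SL2R_def mat2_neg)
qed

lemma group_PSL2R: "group PSL2R"
  unfolding PSL2R_def by (rule normal.factorgroup_is_group[OF normal_center])

lemma to_PSL_eq: "to_PSL A = {A, - A}"
  by (auto simp: to_PSL_def r_coset_def SL2R_def mat2_neg)

lemma carrier_PSL2R: "carrier PSL2R = to_PSL ` carrier SL2R"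
  by (auto simp: PSL2R_def carrier_FactGroup to_PSL_def)

lemma openin_PSL2R_topology:
  "openin PSL2R_topology U \<longleftrightarrow> U \<subseteq> carrier PSL2R \<and>
     openin (top_of_set (carrier SL2R)) {A \<in> carrier SL2R. to_PSL A \<in> U}" (is "_ \<longleftrightarrow> ?P U")
proof -
  have "istopology ?P"
    unfolding istopology_def
  proof (intro conjI allI impI)
    fix S T assume "?P S" "?P T"
    moreover have "{A \<in> carrier SL2R. to_PSL A \<in> S \<inter> T}
      = {A \<in> carrier SL2R. to_PSL A \<in> S} \<inter> {A \<in> carrier SL2R. to_PSL A \<in> T}" by auto
    ultimately show "S \<inter> T \<subseteq> carrier PSL2R" "openin (top_of_set (carrier SL2R)) {A \<in> carrier SL2R. to_PSL A \<in> S \<inter> T}"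
      by (auto simp: openin_Int)
  next
    fix K assume K: "\<forall>k\<in>K. ?P k"
    then show "\<Union>K \<subseteq> carrier PSL2R" by blast
    have "{A \<in> carrier SL2R. to_PSL A \<in> \<Union>K} = (\<Union>k\<in>K. {A \<in> carrier SL2R. to_PSL A \<in> k})" by auto
    then show "openin (top_of_set (carrier SL2R)) {A \<in> carrier SL2R. to_PSL A \<in> \<Union>K}"
      using K by (auto intro!: openin_Union)
  qed
  then show ?thesis by (simp add: PSL2R_topology_def)
qed

lemma quotient_map_to_PSL: "quotient_map (top_of_set (carrier SL2R)) PSL2R_topology to_PSL"
proof -
  have "openin PSL2R_topology (carrier PSL2R)"
    unfolding openin_PSL2R_topology carrier_PSL2R
    by (auto intro!: exI[of _ UNIV] simp: openin_open)
  then have "topspace PSL2R_topology = carrier PSL2R"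
    by (meson openin_PSL2R_topology openin_subset openin_topspace subset_antisym)
  then show ?thesis
    by (auto simp: quotient_map_def openin_PSL2R_topology carrier_PSL2R)
qed

end

theory Submission
  imports Defs
begin

text \<open>A representation lifts to a solution of \<open>[A 1, B 1] \<cdots> [A g, B g] C 1 \<cdots> C p = z^n\<close> in the
  universal covering group, which acts on the line with \<open>z\<close> as the translation by \<open>\<pi>\<close>; here \<open>C i\<close> is
  parabolic with displacements in \<open>[0, \<pi>)\<close> or \<open>(- \<pi>, 0]\<close>, according to the sign \<open>s i\<close>.  A nontrivial
  element is a commutator iff its displacement is less than \<open>\<pi>\<close> somewhere and greater than \<open>- \<pi>\<close>
  somewhere.  Multiplying by a factor of one of these kinds widens such a displacement condition by
  a fixed amount, and conversely the factors that lead from a given element to a given condition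
  form a connected non-empty set.  Eliminating the factors one by one yields the inequalities and the
  connectedness of the set of all tuples of nontrivial commutators and parabolic elements with
  product \<open>z^n\<close>.

  The commutator map has local sections away from commuting pairs, and its fibre over a nontrivial
  element is connected up to the center: a twist \<open>(A, B) \<mapsto> (A, B Z)\<close> or \<open>(A, B) \<mapsto> (A Z, B)\<close> by a
  centralizing \<open>Z\<close> makes \<open>A\<close> hyperbolic, and the pairs with hyperbolic \<open>A\<close> are parametrized
  explicitly once the commutator is in normal form.  Hence a locally constant function of the lifted
  solutions that is invariant under the center descends to the tuples, so it is constant; solutions
  with a commuting pair are first deformed to solutions without one.\<close>

section \<open>Locally constant functions\<close>

definition loc_const :: "'a::topological_space set \<Rightarrow> ('a \<Rightarrow> 'b) \<Rightarrow> bool" where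
  "loc_const S \<kappa> \<longleftrightarrow> (\<forall>x\<in>S. \<forall>\<^sub>F y in at x within S. \<kappa> y = \<kappa> x)"

lemma loc_const_tendsto:
  assumes "loc_const T \<kappa>" "x \<in> T" "(\<gamma> \<longlongrightarrow> x) F" "\<forall>\<^sub>F t in F. \<gamma> t \<in> T"
  shows "\<forall>\<^sub>F t in F. \<kappa> (\<gamma> t) = \<kappa> x"
proof -
  have "\<forall>\<^sub>F y in at x within T. \<kappa> y = \<kappa> x" using assms by (auto simp: loc_const_def)
  then obtain U where U: "open U" "x \<in> U" "\<And>y. y \<in> U \<Longrightarrow> y \<noteq> x \<Longrightarrow> y \<in> T \<Longrightarrow> \<kappa> y = \<kappa> x"
    by (auto simp: eventually_at_topological)
  have "\<forall>\<^sub>F t in F. \<gamma> t \<in> U" using assms(3) U by (simp add: topological_tendstoD)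
  then show ?thesis using assms(4) by eventually_elim (use U in blast)
qed

lemma loc_const_compose:
  assumes "loc_const T \<kappa>" "continuous_on S \<gamma>" "\<And>x. x \<in> S \<Longrightarrow> \<gamma> x \<in> T"
  shows "loc_const S (\<lambda>x. \<kappa> (\<gamma> x))"
  unfolding loc_const_def
proof
  fix x assume x: "x \<in> S"
  show "\<forall>\<^sub>F y in at x within S. \<kappa> (\<gamma> y) = \<kappa> (\<gamma> x)"
  proof (rule loc_const_tendsto[OF assms(1)])
    show "(\<gamma> \<longlongrightarrow> \<gamma> x) (at x within S)" using assms(2) x by (simp add: continuous_on_def)
    show "\<forall>\<^sub>F t in at x within S. \<gamma> t \<in> T" using assms(3) by (auto simp: eventually_at_topological)
  qed (use assms x in auto)
qed

lemma loc_const_connected: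
  assumes "connected S" "loc_const S \<kappa>" "x \<in> S" "y \<in> S"
  shows "\<kappa> x = \<kappa> y"
proof (rule connected_local_const[OF assms(1) assms(3) assms(4)], intro ballI)
  fix a assume "a \<in> S"
  then have "\<forall>\<^sub>F b in at a within S. \<kappa> b = \<kappa> a" using assms(2) by (auto simp: loc_const_def)
  then show "\<forall>\<^sub>F b in at a within S. \<kappa> a = \<kappa> b" by eventually_elim simp
qed

lemma loc_const_path:
  assumes "loc_const T \<kappa>" "continuous_on S \<gamma>" "connected S" "\<And>x. x \<in> S \<Longrightarrow> \<gamma> x \<in> T" "x \<in> S" "y \<in> S"
  shows "\<kappa> (\<gamma> x) = \<kappa> (\<gamma> y)"
  by (rule loc_const_connected[OF assms(3) loc_const_compose[OF assms(1,2,4)] assms(5,6)])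

lemma loc_const_mono:
  assumes "loc_const T \<kappa>" "S \<subseteq> T" shows "loc_const S \<kappa>"
  using loc_const_compose[OF assms(1), of S "\<lambda>x. x"] assms(2) by auto

lemma connected_if_loc_const:
  assumes "\<And>\<kappa>::'a::topological_space \<Rightarrow> bool. loc_const S \<kappa> \<Longrightarrow> \<exists>c. \<forall>x\<in>S. \<kappa> x = c"
  shows "connected S"
proof (rule connectedI)
  fix U V :: "'a set" assume a: "open U" "open V" "U \<inter> S \<noteq> {}" "V \<inter> S \<noteq> {}" "U \<inter> V \<inter> S = {}" "S \<subseteq> U \<union> V"
  have "loc_const S (\<lambda>x. x \<in> U)"
    unfolding loc_const_def eventually_at_topological
  proof
    fix x assume x: "x \<in> S"
    show "\<exists>W. open W \<and> x \<in> W \<and> (\<forall>y\<in>W. y \<noteq> x \<longrightarrow> y \<in> S \<longrightarrow> (y \<in> U) = (x \<in> U))"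
      by (rule exI[of _ "if x \<in> U then U else V"]) (use a x in auto)
  qed
  from assms[OF this] obtain c where c: "\<And>x. x \<in> S \<Longrightarrow> (x \<in> U) = c" by blast
  obtain u where u: "u \<in> U" "u \<in> S" using a(3) by auto
  obtain v where v: "v \<in> V" "v \<in> S" using a(4) by auto
  have "v \<in> U" using c[OF u(2)] c[OF v(2)] u(1) by simp
  then have "v \<in> U \<inter> V \<inter> S" using v by simp
  with a(5) show False by simp
qed

lemma loc_const_fibre:
  assumes loc_const: "loc_const S \<kappa>"
    and fib: "\<And>s t. s \<in> S \<Longrightarrow> t \<in> S \<Longrightarrow> f s = f t \<Longrightarrow> \<kappa> s = \<kappa> t"
    and sec: "\<And>s. s \<in> S \<Longrightarrow> \<exists>\<sigma>. (\<sigma> \<longlongrightarrow> s) (at (f s) within W) \<and>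
               (\<forall>\<^sub>F w in at (f s) within W. \<sigma> w \<in> S \<and> f (\<sigma> w) = w)"
    and W: "W = f ` S"
  obtains \<kappa>' where "loc_const W \<kappa>'" "\<And>s. s \<in> S \<Longrightarrow> \<kappa> s = \<kappa>' (f s)"
proof -
  define \<kappa>' where "\<kappa>' w = \<kappa> (SOME s. s \<in> S \<and> f s = w)" for w
  have eq: "\<kappa> s = \<kappa>' (f s)" if "s \<in> S" for s
  proof -
    have "(SOME t. t \<in> S \<and> f t = f s) \<in> S \<and> f (SOME t. t \<in> S \<and> f t = f s) = f s"
      by (rule someI[of _ s]) (simp add: that)
    then show ?thesis unfolding \<kappa>'_def using fib[OF that] by metis
  qed
  have "loc_const W \<kappa>'"
    unfolding loc_const_def
  proof
    fix w assume "w \<in> W"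
    then obtain s where s: "s \<in> S" "w = f s" using W by blast
    obtain \<sigma> where \<sigma>: "(\<sigma> \<longlongrightarrow> s) (at w within W)" "\<forall>\<^sub>F w in at w within W. \<sigma> w \<in> S \<and> f (\<sigma> w) = w"
      using sec[OF s(1)] s(2) by blast
    have "\<forall>\<^sub>F w in at w within W. \<kappa> (\<sigma> w) = \<kappa> s"
      by (rule loc_const_tendsto[OF loc_const s(1) \<sigma>(1)]) (use \<sigma>(2) in \<open>auto elim: eventually_mono\<close>)
    then show "\<forall>\<^sub>F y in at w within W. \<kappa>' y = \<kappa>' w"
      using \<sigma>(2)
    proof eventually_elim
      case (elim w)
      then show ?case using eq[of "\<sigma> w"] eq[OF s(1)] s(2) by simp
    qed
  qed
  with eq show ?thesis by (rule that[rotated])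
qed

section \<open>Split quaternions\<close>

text \<open>The pair \<open>(a, b)\<close> stands for the real linear map \<open>v \<mapsto> a v + b cnj v\<close> of the plane, with \<open>htr\<close>
  half its trace.\<close>

type_synonym sq = "complex \<times> complex"

definition smul :: "sq \<Rightarrow> sq \<Rightarrow> sq" (infixl "\<star>" 70) where
  "s \<star> t = (fst s * fst t + snd s * cnj (snd t), fst s * snd t + snd s * cnj (fst t))"

definition sdet :: "sq \<Rightarrow> real" where
  "sdet s = (cmod (fst s))\<^sup>2 - (cmod (snd s))\<^sup>2"

definition sadj :: "sq \<Rightarrow> sq" where "sadj s = (cnj (fst s), - snd s)"

abbreviation sone :: sq where "sone \<equiv> (1, 0)"

abbreviation htr :: "sq \<Rightarrow> real" where "htr s \<equiv> Re (fst s)"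

lemma smul_assoc: "(s \<star> t) \<star> u = s \<star> (t \<star> u)"
  by (simp add: smul_def algebra_simps)

lemma smul_one [simp]: "sone \<star> s = s" "s \<star> sone = s"
  by (simp_all add: smul_def)

lemma sdet_complex: "complex_of_real (sdet s) = fst s * cnj (fst s) - snd s * cnj (snd s)"
  by (simp only: sdet_def of_real_diff complex_norm_square)

lemma sdet_mul: "sdet (s \<star> t) = sdet s * sdet t"
proof -
  have "complex_of_real (sdet (s \<star> t)) = complex_of_real (sdet s * sdet t)"
    unfolding of_real_mult sdet_complex by (simp add: smul_def algebra_simps)
  then show ?thesis by (simp only: of_real_eq_iff)
qed

lemma sdet_one [simp]: "sdet sone = 1" by (simp add: sdet_def)

lemma sdet_adj [simp]: "sdet (sadj s) = sdet s" by (simp add: sdet_def sadj_def)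

lemma sadj_mul: "sadj (s \<star> t) = sadj t \<star> sadj s"
  by (simp add: sadj_def smul_def algebra_simps)

lemma sadj_adj [simp]: "sadj (sadj s) = s" by (simp add: sadj_def)

lemma smul_scaleR: "(r *\<^sub>R s) \<star> t = r *\<^sub>R (s \<star> t)" "s \<star> (r *\<^sub>R t) = r *\<^sub>R (s \<star> t)"
  by (simp_all add: smul_def scaleR_conv_of_real algebra_simps)

lemma smul_add: "(s + u) \<star> t = s \<star> t + u \<star> t" "t \<star> (s + u) = t \<star> s + t \<star> u"
  by (simp_all add: smul_def algebra_simps)

lemma smul_diff: "(s - u) \<star> t = s \<star> t - u \<star> t" "t \<star> (s - u) = t \<star> s - t \<star> u"
  by (simp_all add: smul_def algebra_simps)

lemma smul_minus [simp]: "(- s) \<star> t = - (s \<star> t)" "s \<star> (- t) = - (s \<star> t)"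
  by (simp_all add: smul_def algebra_simps)

lemma smul_adj: "s \<star> sadj s = sdet s *\<^sub>R sone" "sadj s \<star> s = sdet s *\<^sub>R sone"
  using sdet_complex[of s] by (simp_all add: smul_def sadj_def scaleR_conv_of_real algebra_simps)

lemma sdet_scaleR: "sdet (r *\<^sub>R s) = r\<^sup>2 * sdet s"
  by (simp add: sdet_def power_mult_distrib algebra_simps)

lemma sdet_minus [simp]: "sdet (- s) = sdet s" by (simp add: sdet_def)

lemma sdet_Re_Im: "sdet s = (Re (fst s))\<^sup>2 + (Im (fst s))\<^sup>2 - (Re (snd s))\<^sup>2 - (Im (snd s))\<^sup>2"
  by (simp add: sdet_def cmod_power2)

lemma tendsto_smul [tendsto_intros]:
  assumes "(f \<longlongrightarrow> a) F" "(g \<longlongrightarrow> b) F"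
  shows "((\<lambda>x. f x \<star> g x) \<longlongrightarrow> a \<star> b) F"
  unfolding smul_def by (intro tendsto_intros assms)

lemma tendsto_sdet [tendsto_intros]:
  assumes "(f \<longlongrightarrow> a) F" shows "((\<lambda>x. sdet (f x)) \<longlongrightarrow> sdet a) F"
  unfolding sdet_def by (intro tendsto_intros assms)

lemma tendsto_sadj [tendsto_intros]:
  assumes "(f \<longlongrightarrow> a) F" shows "((\<lambda>x. sadj (f x)) \<longlongrightarrow> sadj a) F"
  unfolding sadj_def by (intro tendsto_intros assms)

section \<open>The universal covering group in coordinates\<close>

text \<open>The element \<open>(\<theta>, e)\<close> lies over the map \<open>v \<mapsto> cis \<theta> (c v + e cnj v)\<close> with \<open>c = \<surd>(1 + |e|\<^sup>2)\<close>.  All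
  values of \<open>\<theta>\<close> and \<open>e\<close> occur, and elements over the same class \<open>\<plusminus>A\<close> differ by a multiple of \<open>\<pi>\<close>
  in \<open>\<theta>\<close>.\<close>

type_synonym cov = "real \<times> complex"

definition cc :: "complex \<Rightarrow> real" where "cc e = sqrt (1 + (cmod e)\<^sup>2)"

lemma cc_pos [simp]: "cc e > 0" "cc e \<noteq> 0" "cc e \<ge> 0" "\<not> cc e < 0"
proof -
  have "1 + (cmod e)\<^sup>2 > 0" by (simp add: add_pos_nonneg)
  then have "cc e > 0" by (simp add: cc_def)
  then show "cc e > 0" "cc e \<noteq> 0" "cc e \<ge> 0" "\<not> cc e < 0" by linarith+
qed

lemma cc_sq: "(cc e)\<^sup>2 = 1 + (cmod e)\<^sup>2"
  by (simp add: cc_def)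

lemma cc_ge1: "cc e \<ge> 1" by (simp add: cc_def)

lemma cc_gt: "cmod e < cc e"
  by (rule power2_less_imp_less) (simp_all add: cc_sq)

lemma cc_eq1 [simp]: "cc e = 1 \<longleftrightarrow> e = 0"
  by (simp add: cc_def)

lemma cc_0 [simp]: "cc 0 = 1" by simp

lemma cc_cis [simp]: "cc (e * cis t) = cc e" "cc (- e) = cc e" "cc (cnj e) = cc e"
  by (simp_all add: cc_def norm_mult)

definition toS :: "cov \<Rightarrow> sq" where
  "toS x = (complex_of_real (cc (snd x)) * cis (fst x), snd x * cis (fst x))"

definition lift_near :: "real \<Rightarrow> sq \<Rightarrow> cov" where
  "lift_near t s = (t + Arg (fst s * cis (- t)), snd s * cis (- (t + Arg (fst s * cis (- t)))))"

lemma sdet_toS [simp]: "sdet (toS x) = 1"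
  by (simp add: sdet_def toS_def norm_mult power_mult_distrib cc_sq)

lemma sdet1_nz: assumes "sdet s = 1" shows "fst s \<noteq> 0"
proof
  assume "fst s = 0"
  with assms have "- (cmod (snd s))\<^sup>2 = 1" by (simp add: sdet_def)
  then show False using zero_le_power2[of "cmod (snd s)"] by linarith
qed

lemma cis_Arg_cmod: "complex_of_real (cmod z) * cis (Arg z) = z"
  by (metis rcis_cmod_Arg rcis_def)

lemma toS_lift_near: assumes "sdet s = 1" shows "toS (lift_near t s) = s"
proof -
  have "1 + (cmod (snd s))\<^sup>2 = (cmod (fst s))\<^sup>2" using assms by (simp add: sdet_def)
  then have 1: "cc (snd s) = cmod (fst s)" by (simp add: cc_def)
  have "complex_of_real (cmod (fst s)) * cis (Arg (fst s * cis (- t))) = fst s * cis (- t)"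
    using cis_Arg_cmod[of "fst s * cis (- t)"] by (simp add: norm_mult)
  then have "complex_of_real (cmod (fst s)) * cis (t + Arg (fst s * cis (- t))) = fst s"
    by (simp add: cis_mult[symmetric] algebra_simps) (simp add: cis_mult mult.assoc[symmetric])
  moreover have "snd s * cis (- (t + v)) * cis (t + v) = snd s" for v
    by (simp only: mult.assoc cis_mult) simp
  ultimately show ?thesis
    by (simp only: toS_def lift_near_def fst_conv snd_conv cc_cis 1 prod_eq_iff simp_thms)
qed

lemma lift_near_toS: assumes "- pi < fst x - t" "fst x - t \<le> pi" shows "lift_near t (toS x) = x"
proof -
  have "Arg (complex_of_real (cc (snd x)) * cis (fst x - t)) = fst x - t"
    using assms by (intro Arg_unique[of "cc (snd x)"]) (auto simp: cis_conv_exp)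
  then have a: "Arg (complex_of_real (cc (snd x)) * cis (fst x) * cis (- t)) = fst x - t"
    by (simp add: mult.assoc cis_mult)
  have "snd x * cis (fst x) * cis (- fst x) = snd x" by (simp add: mult.assoc cis_mult)
  with a show ?thesis by (simp add: lift_near_def toS_def prod_eq_iff)
qed

lemma toS_eq_iff: "toS x = toS y \<longleftrightarrow> snd x = snd y \<and> (\<exists>k::int. fst x = fst y + 2 * pi * k)"
proof
  assume a: "toS x = toS y"
  have "cmod (snd x) = cmod (snd y)"
    using arg_cong[OF a, of "\<lambda>s. cmod (snd s)"] by (simp add: toS_def norm_mult)
  then have c: "cc (snd x) = cc (snd y)" by (simp add: cc_def)
  then have ci: "cis (fst x) = cis (fst y)" using a by (simp add: toS_def)
  then have "snd x = snd y" using a by (simp add: toS_def)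
  moreover have "\<exists>k::int. fst x = fst y + 2 * pi * k"
    using ci sin_cos_eq_iff[of "fst x" "fst y"] by (simp add: complex_eq_iff)
  ultimately show "snd x = snd y \<and> (\<exists>k::int. fst x = fst y + 2 * pi * k)" by blast
next
  assume a: "snd x = snd y \<and> (\<exists>k::int. fst x = fst y + 2 * pi * k)"
  then obtain k :: int where k: "fst x = fst y + 2 * pi * k" by blast
  have "cis (fst x) = cis (fst y) * cis (2 * pi * k)" by (simp only: k cis_mult)
  then show "toS x = toS y" using a by (simp add: toS_def)
qed

lemma toS_inj: assumes "toS x = toS y" "\<bar>fst x - fst y\<bar> < 2 * pi" shows "x = y"
proof -
  obtain k :: int where k: "fst x = fst y + 2 * pi * k" "snd x = snd y" using assms toS_eq_iff by blast
  have "\<bar>real_of_int k\<bar> * (2 * pi) < 1 * (2 * pi)" using assms(2) k by (simp add: abs_mult mult.commute)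
  then have "\<bar>real_of_int k\<bar> < 1" by (subst (asm) mult_less_cancel_right_pos) auto
  then have "k = 0" by linarith
  then show ?thesis using k by (simp add: prod_eq_iff)
qed

definition cmul :: "cov \<Rightarrow> cov \<Rightarrow> cov" (infixl "\<odot>" 70) where
  "x \<odot> y = lift_near (fst x + fst y) (toS x \<star> toS y)"

abbreviation cid :: cov where "cid \<equiv> (0, 0)"

definition cinv :: "cov \<Rightarrow> cov" where
  "cinv x = (- fst x, - (snd x * cis (2 * fst x)))"

definition mul_factor :: "cov \<Rightarrow> cov \<Rightarrow> complex" where
  "mul_factor x y = complex_of_real (cc (snd x) * cc (snd y)) + snd x * cnj (snd y) * cis (- (2 * fst y))"

lemma mul_factor_eq: "fst (toS x \<star> toS y) * cis (- (fst x + fst y)) = mul_factor x y"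
proof -
  have a: "cis (fst x) * cis (fst y) * cis (- (fst x + fst y)) = 1" by (simp add: cis_mult)
  have b: "cis (fst x) * cnj (cis (fst y)) * cis (- (fst x + fst y)) = cis (- (2 * fst y))"
    by (simp add: cis_mult cis_cnj)
  have "fst (toS x \<star> toS y) * cis (- (fst x + fst y)) =
    complex_of_real (cc (snd x)) * complex_of_real (cc (snd y)) * (cis (fst x) * cis (fst y) * cis (- (fst x + fst y)))
    + snd x * cnj (snd y) * (cis (fst x) * cnj (cis (fst y)) * cis (- (fst x + fst y)))"
    by (simp add: toS_def smul_def algebra_simps)
  then show ?thesis unfolding a b by (simp add: mul_factor_def)
qed

lemma Re_mul_factor_pos: "Re (mul_factor x y) > 0"
proof -
  have "cmod (snd x * cnj (snd y) * cis (- (2 * fst y))) = cmod (snd x) * cmod (snd y)" by (simp add: norm_mult)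
  moreover have "cmod (snd x) * cmod (snd y) < cc (snd x) * cc (snd y)"
    by (intro mult_strict_mono cc_gt) auto
  moreover have "- cmod (snd x * cnj (snd y) * cis (- (2 * fst y))) \<le> Re (snd x * cnj (snd y) * cis (- (2 * fst y)))"
    using abs_Re_le_cmod[of "snd x * cnj (snd y) * cis (- (2 * fst y))"] by linarith
  ultimately show ?thesis by (simp add: mul_factor_def)
qed

lemma fst_cmul: "fst (x \<odot> y) = fst x + fst y + Arg (mul_factor x y)"
  by (simp only: cmul_def lift_near_def mul_factor_eq fst_conv)

lemma Arg_mul_factor_bound: "\<bar>Arg (mul_factor x y)\<bar> < pi / 2"
  using Re_mul_factor_pos[of x y] Arg_Re_pos[of "mul_factor x y"] by simp

lemma cmul_angle: "\<bar>fst (x \<odot> y) - fst x - fst y\<bar> < pi / 2"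
  using Arg_mul_factor_bound[of x y] by (simp add: fst_cmul)

lemma toS_mul: "toS (x \<odot> y) = toS x \<star> toS y"
  by (simp add: cmul_def toS_lift_near sdet_mul)

lemma toS_one [simp]: "toS cid = sone" by (simp add: toS_def)

lemma toS_inv: "toS (cinv x) = sadj (toS x)"
  by (simp add: toS_def cinv_def sadj_def cis_cnj mult.assoc cis_mult)

lemma cmul_assoc: "(x \<odot> y) \<odot> u = x \<odot> (y \<odot> u)"
proof (rule toS_inj)
  show "toS (x \<odot> y \<odot> u) = toS (x \<odot> (y \<odot> u))" by (simp add: toS_mul smul_assoc)
  show "\<bar>fst (x \<odot> y \<odot> u) - fst (x \<odot> (y \<odot> u))\<bar> < 2 * pi"
    using cmul_angle[of x y] cmul_angle[of "x \<odot> y" u] cmul_angle[of y u] cmul_angle[of x "y \<odot> u"] by linarith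
qed

lemma cmul_one [simp]: "cid \<odot> x = x" "x \<odot> cid = x"
proof -
  have "\<bar>fst (cid \<odot> x) - fst x\<bar> < 2 * pi" "\<bar>fst (x \<odot> cid) - fst x\<bar> < 2 * pi"
    using cmul_angle[of cid x] cmul_angle[of x cid] pi_gt_zero
    unfolding fst_conv by linarith+
  then show "cid \<odot> x = x" "x \<odot> cid = x" by (auto intro!: toS_inj simp: toS_mul)
qed

lemma cinv_left [simp]: "cinv x \<odot> x = cid" and cinv_right [simp]: "x \<odot> cinv x = cid"
proof -
  have "\<bar>fst (cinv x \<odot> x) - fst cid\<bar> < 2 * pi" "\<bar>fst (x \<odot> cinv x) - fst cid\<bar> < 2 * pi"
    using cmul_angle[of "cinv x" x] cmul_angle[of x "cinv x"] pi_gt_zero by (simp_all add: cinv_def)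
  then show "cinv x \<odot> x = cid" "x \<odot> cinv x = cid"
    by (auto intro!: toS_inj simp: toS_mul toS_inv smul_adj simp del: fst_conv)
qed

lemma cinv_cancel [simp]: "cinv x \<odot> (x \<odot> y) = y" "x \<odot> (cinv x \<odot> y) = y"
  by (simp_all add: cmul_assoc[symmetric])

lemma cmul_left_cancel [simp]: "x \<odot> y = x \<odot> u \<longleftrightarrow> y = u"
  by (metis cinv_cancel(1))

lemma cmul_right_cancel [simp]: "y \<odot> x = u \<odot> x \<longleftrightarrow> y = u"
  by (metis cinv_right cmul_assoc cmul_one(2))

lemma cinv_unique: "x \<odot> y = cid \<Longrightarrow> y = cinv x"
  by (metis cinv_cancel(1) cmul_one(2))

lemma cinv_mul [simp]: "cinv (x \<odot> y) = cinv y \<odot> cinv x"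
  by (rule cinv_unique[symmetric]) (simp add: cmul_assoc)

lemma cinv_inv [simp]: "cinv (cinv x) = x"
  by (rule cinv_unique[symmetric]) simp

definition ccomm :: "cov \<Rightarrow> cov \<Rightarrow> cov" where
  "ccomm x y = x \<odot> y \<odot> cinv x \<odot> cinv y"

lemma rot_left: "(s, 0) \<odot> x = (s + fst x, snd x)"
proof -
  have "mul_factor (s, 0) x = complex_of_real (cc (snd x))" by (simp add: mul_factor_def)
  then have "Arg (mul_factor (s, 0) x) = 0" by (simp add: Arg_of_real)
  then have f: "fst ((s, 0) \<odot> x) = s + fst x" by (simp add: fst_cmul)
  have "toS ((s, 0) \<odot> x) = toS (s + fst x, snd x)"
    by (simp add: toS_mul) (simp add: toS_def smul_def cis_mult[symmetric] algebra_simps)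
  then show ?thesis by (rule toS_inj) (simp add: f)
qed

lemma rot_right: "x \<odot> (s, 0) = (fst x + s, snd x * cis (- (2 * s)))"
proof -
  have "mul_factor x (s, 0) = complex_of_real (cc (snd x))" by (simp add: mul_factor_def)
  then have "Arg (mul_factor x (s, 0)) = 0" by (simp add: Arg_of_real)
  then have f: "fst (x \<odot> (s, 0)) = fst x + s" by (simp add: fst_cmul)
  have "cis (- (2 * s)) * cis (fst x + s) = cis (fst x) * cnj (cis s)"
    by (simp add: cis_mult cis_cnj)
  then have "toS (x \<odot> (s, 0)) = toS (fst x + s, snd x * cis (- (2 * s)))"
    by (simp add: toS_mul) (simp add: toS_def smul_def cis_mult[symmetric] algebra_simps)
  then show ?thesis by (rule toS_inj) (simp add: f)
qed

definition central :: "int \<Rightarrow> cov" where "central k = (pi * real_of_int k, 0)"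

lemma central_mul: "central k \<odot> x = (fst x + pi * k, snd x)" "x \<odot> central k = (fst x + pi * k, snd x)"
  using cis_multiple_2pi[of "- real_of_int k"]
  by (simp_all add: central_def rot_left rot_right algebra_simps)

lemma central_commute: "x \<odot> central k = central k \<odot> x" by (simp add: central_mul)

lemma central_left_commute: "x \<odot> (central k \<odot> y) = central k \<odot> (x \<odot> y)"
  by (metis cmul_assoc central_commute)

lemma central_0 [simp]: "central 0 = cid" by (simp add: central_def)

lemma central_add: "central k \<odot> central l = central (k + l)" by (simp add: central_mul) (simp add: central_def algebra_simps)

lemma central_add_left: "central k \<odot> (central l \<odot> x) = central (k + l) \<odot> x" by (simp add: cmul_assoc[symmetric] central_add)

lemma cinv_central [simp]: "cinv (central k) = central (- k)" by (simp add: cinv_def central_def)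

lemma central_inj [simp]: "central k = central l \<longleftrightarrow> k = l" by (simp add: central_def)

lemma ccomm_central [simp]: "ccomm (central k \<odot> x) y = ccomm x y" "ccomm x (central k \<odot> y) = ccomm x y"
proof -
  have 1: "cinv (central k \<odot> u) = central (- k) \<odot> cinv u" for u by (simp add: central_commute[of "cinv u"])
  show "ccomm (central k \<odot> x) y = ccomm x y"
    unfolding ccomm_def 1 cmul_assoc central_left_commute[of y] central_left_commute[of x] central_add_left by simp
  show "ccomm x (central k \<odot> y) = ccomm x y"
    unfolding ccomm_def 1 cmul_assoc central_left_commute[of "cinv x"] central_left_commute[of y] central_left_commute[of x] central_add_left by simp
qed

lemma toS_central: "toS (central k \<odot> x) = (if even k then toS x else - toS x)"
proof -
  have 1: "cis (2 * pi * of_int m) = 1" for m by (rule cis_multiple_2pi) simp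
  have "cis (fst x + pi * k) = cis (fst x) * cis (pi * k)" by (simp add: cis_mult)
  moreover have "cis (pi * k) = (if even k then 1 else - 1)"
  proof (cases "even k")
    case True
    then obtain m where "k = 2 * m" by auto
    then show ?thesis using 1[of m] by (simp add: algebra_simps)
  next
    case False
    then obtain m where "k = 2 * m + 1" by (metis oddE)
    then have "cis (pi * k) = cis (2 * pi * of_int m) * cis pi" unfolding cis_mult by (simp add: algebra_simps)
    then show ?thesis using 1[of m] False by simp
  qed
  ultimately show ?thesis by (auto simp: central_mul toS_def prod_eq_iff)
qed

lemma tendsto_lift_near:
  assumes "(f \<longlongrightarrow> s) F" "fst s * cis (- t) \<notin> \<real>\<^sub>\<le>\<^sub>0" "(g \<longlongrightarrow> t) F"
  shows "((\<lambda>x. lift_near (g x) (f x)) \<longlongrightarrow> lift_near t s) F"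
  unfolding lift_near_def by (intro tendsto_intros tendsto_Arg assms)

lemma tendsto_cc [tendsto_intros]: "(f \<longlongrightarrow> a) F \<Longrightarrow> ((\<lambda>x. cc (f x)) \<longlongrightarrow> cc a) F"
  unfolding cc_def by (intro tendsto_intros)

lemma tendsto_toS [tendsto_intros]: "(f \<longlongrightarrow> a) F \<Longrightarrow> ((\<lambda>x. toS (f x)) \<longlongrightarrow> toS a) F"
  unfolding toS_def by (intro tendsto_intros)

lemma continuous_on_toS [continuous_intros]: "continuous_on S f \<Longrightarrow> continuous_on S (\<lambda>x. toS (f x))"
  by (simp add: continuous_on_def tendsto_toS)

lemma Re_pos_not_nonpos: "Re z > 0 \<Longrightarrow> z \<notin> \<real>\<^sub>\<le>\<^sub>0"
  by (auto simp: complex_nonpos_Reals_iff)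

lemma tendsto_cmul [tendsto_intros]:
  assumes "(f \<longlongrightarrow> a) F" "(g \<longlongrightarrow> b) F"
  shows "((\<lambda>x. f x \<odot> g x) \<longlongrightarrow> a \<odot> b) F"
  unfolding cmul_def
  by (intro tendsto_lift_near tendsto_intros assms) (simp only: mul_factor_eq Re_pos_not_nonpos[OF Re_mul_factor_pos] not_False_eq_True)

lemma continuous_on_cmul [continuous_intros]:
  "continuous_on S f \<Longrightarrow> continuous_on S g \<Longrightarrow> continuous_on S (\<lambda>x. f x \<odot> g x)"
  by (simp add: continuous_on_def tendsto_cmul)

lemma tendsto_cinv [tendsto_intros]: "(f \<longlongrightarrow> a) F \<Longrightarrow> ((\<lambda>x. cinv (f x)) \<longlongrightarrow> cinv a) F"
  unfolding cinv_def by (intro tendsto_intros)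

lemma continuous_on_cinv [continuous_intros]: "continuous_on S f \<Longrightarrow> continuous_on S (\<lambda>x. cinv (f x))"
  by (simp add: continuous_on_def tendsto_cinv)

lemma tendsto_ccomm [tendsto_intros]:
  "(f \<longlongrightarrow> a) F \<Longrightarrow> (g \<longlongrightarrow> b) F \<Longrightarrow> ((\<lambda>x. ccomm (f x) (g x)) \<longlongrightarrow> ccomm a b) F"
  unfolding ccomm_def by (intro tendsto_intros)

section \<open>The action on the line\<close>

definition act_factor :: "cov \<Rightarrow> real \<Rightarrow> complex" where
  "act_factor x t = complex_of_real (cc (snd x)) + snd x * cis (- (2 * t))"

definition act :: "cov \<Rightarrow> real \<Rightarrow> real" where
  "act x t = fst x + t + Arg (act_factor x t)"

definition sact :: "sq \<Rightarrow> complex \<Rightarrow> complex" where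
  "sact s v = fst s * v + snd s * cnj v"

definition max_shift :: "cov \<Rightarrow> real" where "max_shift x = fst x + arctan (cmod (snd x))"
definition min_shift :: "cov \<Rightarrow> real" where "min_shift x = fst x - arctan (cmod (snd x))"

lemma Re_act_factor_pos: "Re (act_factor x t) > 0"
proof -
  have "- cmod (snd x * cis (- (2 * t))) \<le> Re (snd x * cis (- (2 * t)))"
    using abs_Re_le_cmod[of "snd x * cis (- (2 * t))"] by linarith
  then show ?thesis using cc_gt[of "snd x"] by (simp add: act_factor_def norm_mult)
qed

lemma sact_act: "sact (toS x) (cis t) = complex_of_real (cmod (act_factor x t)) * cis (act x t)"
proof -
  have "sact (toS x) (cis t) = cis (fst x + t) * act_factor x t"
  proof -
    have "cis (fst x + t) * cis (- (2 * t)) = cis (fst x) * cnj (cis t)" by (simp add: cis_mult cis_cnj)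
    then show ?thesis
      by (simp add: sact_def toS_def act_factor_def algebra_simps cis_mult[symmetric])
  qed
  also have "\<dots> = cis (fst x + t) * (complex_of_real (cmod (act_factor x t)) * cis (Arg (act_factor x t)))"
    by (simp only: cis_Arg_cmod)
  finally show ?thesis by (simp add: act_def cis_mult[symmetric] algebra_simps)
qed

lemma sact_mul: "sact (s \<star> u) v = sact s (sact u v)"
  by (simp add: sact_def smul_def algebra_simps)

lemma sact_scale: "sact s (complex_of_real r * v) = complex_of_real r * sact s v"
  by (simp add: sact_def algebra_simps)

lemma act_factor_nz: "act_factor x t \<noteq> 0" using Re_act_factor_pos[of x t] by auto

lemma act_approx: "\<bar>act x t - fst x - t\<bar> < pi / 2"
  using Arg_Re_pos[of "act_factor x t"] Re_act_factor_pos[of x t] by (simp add: act_def)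

lemma cis_pos_scale_eq:
  assumes "complex_of_real r * cis a = complex_of_real s * cis b" "r > 0" "s > 0"
  shows "cis a = cis b"
proof -
  have "r = s" using arg_cong[OF assms(1), of cmod] assms(2,3) by (simp add: norm_mult)
  then show ?thesis using assms by simp
qed

lemma cis_eq_close: assumes "cis a = cis b" "\<bar>a - b\<bar> < 2 * pi" shows "a = b"
  using toS_inj[of "(a, 0)" "(b, 0)"] assms by (simp add: toS_def)

lemma act_mul: "act (x \<odot> y) t = act x (act y t)"
proof (rule cis_eq_close)
  have "complex_of_real (cmod (act_factor (x \<odot> y) t)) * cis (act (x \<odot> y) t) = sact (toS x) (sact (toS y) (cis t))"
    by (simp add: sact_act[symmetric] toS_mul sact_mul)
  also have "\<dots> = complex_of_real (cmod (act_factor y t) * cmod (act_factor x (act y t))) * cis (act x (act y t))"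
    by (simp add: sact_act sact_scale)
  finally show "cis (act (x \<odot> y) t) = cis (act x (act y t))"
    by (rule cis_pos_scale_eq) (simp_all add: act_factor_nz)
  show "\<bar>act (x \<odot> y) t - act x (act y t)\<bar> < 2 * pi"
    using act_approx[of "x \<odot> y" t] act_approx[of y t] act_approx[of x "act y t"] cmul_angle[of x y]
    by linarith
qed

lemma act_one [simp]: "act cid t = t" by (simp add: act_def act_factor_def)

lemma act_cinv [simp]: "act (cinv x) (act x t) = t" "act x (act (cinv x) t) = t"
  by (simp_all add: act_mul[symmetric])

lemma act_central: "act (central k \<odot> x) t = act x t + pi * k"
  by (simp add: act_def central_mul act_factor_def)

lemma act_periodic: "act x (t + pi * of_int k) = act x t + pi * of_int k"
proof -
  have "act x (act (central k) t) = act (central k \<odot> x) t" by (simp add: act_mul[symmetric] central_commute)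
  moreover have "act (central k) t = t + pi * of_int k" using act_central[of k cid t] by simp
  ultimately show ?thesis by (simp add: act_central)
qed

lemma act_strict_mono: assumes "s < t" shows "act x s < act x t"
proof (cases "t - s < pi")
  case False
  then show ?thesis using act_approx[of x s] act_approx[of x t] by linarith
next
  case True
  let ?a = "fst (toS x)" and ?b = "snd (toS x)"
  let ?u = "act x t - act x s"
  have "Im (cnj (sact (toS x) (cis s)) * sact (toS x) (cis t)) = sdet (toS x) * sin (t - s)"
    unfolding sact_def sdet_Re_Im
    by (simp add: sin_diff power2_eq_square algebra_simps)
  moreover have "cnj (sact (toS x) (cis s)) * sact (toS x) (cis t) =
      complex_of_real (cmod (act_factor x s) * cmod (act_factor x t)) * cis ?u"
    by (simp add: sact_act cis_cnj cis_mult algebra_simps)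
  ultimately have "cmod (act_factor x s) * cmod (act_factor x t) * sin ?u = sin (t - s)" by simp
  moreover have "sin (t - s) > 0" using assms True by (intro sin_gt_zero) auto
  ultimately have pos: "sin ?u > 0" using act_factor_nz[of x s] act_factor_nz[of x t]
    by (metis mult_pos_pos zero_less_mult_pos zero_less_norm_iff)
  have "?u > - pi" using act_approx[of x s] act_approx[of x t] assms by linarith
  then have "?u > 0"
  proof (rule_tac ccontr)
    assume "?u > - pi" "\<not> ?u > 0"
    then have "sin (- ?u) \<ge> 0" by (intro sin_ge_zero) auto
    then show False using pos by (simp only: sin_minus)
  qed
  then show ?thesis by simp
qed

lemma act_mono: "s \<le> t \<Longrightarrow> act x s \<le> act x t"
  using act_strict_mono[of s t x] by (cases "s = t") auto

lemma act_less_iff [simp]: "act x s < act x t \<longleftrightarrow> s < t"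
  by (metis act_mono act_strict_mono not_less)

lemma act_le_iff [simp]: "act x s \<le> act x t \<longleftrightarrow> s \<le> t"
  by (metis act_less_iff not_less)

lemma act_bounds: "act x t - t \<le> max_shift x" "min_shift x \<le> act x t - t"
proof -
  define w where "w = snd x * cis (- (2 * t))"
  let ?e = "cmod (snd x)"
  have mul_factor: "cmod w = ?e" by (simp add: w_def norm_mult)
  have q: "act_factor x t = complex_of_real (cc (snd x)) + w" by (simp add: act_factor_def w_def)
  have re: "Re w + cc (snd x) > 0" using Re_act_factor_pos[of x t] by (simp add: q)
  have a: "Arg (act_factor x t) = arctan (Im w / (cc (snd x) + Re w))"
    using arg_conv_arctan[of "act_factor x t"] Re_act_factor_pos[of x t] by (simp add: q)
  have key: "\<bar>Im w\<bar> \<le> ?e * (cc (snd x) + Re w)"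
  proof -
    have "(\<bar>Im w\<bar> - ?e * Re w)\<^sup>2 \<le> (1 + ?e\<^sup>2) * ((Im w)\<^sup>2 + (Re w)\<^sup>2)"
    proof -
      have "(1 + ?e\<^sup>2) * ((Im w)\<^sup>2 + (Re w)\<^sup>2) - (\<bar>Im w\<bar> - ?e * Re w)\<^sup>2 = (?e * \<bar>Im w\<bar> + Re w)\<^sup>2"
        by (simp add: power2_eq_square algebra_simps)
      then show ?thesis by (metis diff_ge_0_iff_ge zero_le_power2)
    qed
    also have "\<dots> = (cc (snd x) * ?e)\<^sup>2"
      using mul_factor cmod_power2[of w] by (simp add: power_mult_distrib cc_sq)
    finally have "\<bar>Im w\<bar> - ?e * Re w \<le> cc (snd x) * ?e"
      by (rule power2_le_imp_le) simp
    then show ?thesis by (simp add: algebra_simps)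
  qed
  have "Im w / (cc (snd x) + Re w) \<le> ?e" "- ?e \<le> Im w / (cc (snd x) + Re w)"
    using key re by (simp_all add: field_simps abs_le_iff)
  then have "Arg (act_factor x t) \<le> arctan ?e" "- arctan ?e \<le> Arg (act_factor x t)"
    unfolding a by (simp_all add: arctan_le_iff arctan_minus[symmetric] del: arctan_minus)
  then show "act x t - t \<le> max_shift x" "min_shift x \<le> act x t - t"
    by (simp_all add: act_def max_shift_def min_shift_def)
qed

lemma act_attained: "\<exists>t. act x t = t + max_shift x" "\<exists>t. act x t = t + min_shift x"
proof -
  let ?e = "cmod (snd x)" and ?c = "cc (snd x)"
  have at: "\<exists>t. act_factor x t = Complex (1 / ?c) (r * ?e / ?c)" if r: "r = 1 \<or> r = - 1" for r :: real
  proof -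
    define z where "z = Complex (- (?e\<^sup>2 / ?c)) (r * ?e / ?c)"
    have "(cmod z)\<^sup>2 = ?e\<^sup>2 * (?e\<^sup>2 + 1) / ?c\<^sup>2"
    proof -
      have r2: "r\<^sup>2 = 1" using r by auto
      have "(cmod z)\<^sup>2 = (?e\<^sup>2)\<^sup>2 / ?c\<^sup>2 + r\<^sup>2 * ?e\<^sup>2 / ?c\<^sup>2"
        by (simp add: z_def cmod_power2 power_divide power_mult_distrib)
      also have "\<dots> = ?e\<^sup>2 * (?e\<^sup>2 + 1) / ?c\<^sup>2"
        unfolding r2 add_divide_distrib[symmetric] by (simp add: power2_eq_square algebra_simps)
      finally show ?thesis .
    qed
    also have "\<dots> = ?e\<^sup>2" unfolding cc_sq
      by (metis add.commute cc_pos(2) cc_sq power_not_zero nonzero_mult_div_cancel_right)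
    finally have cz: "cmod z = ?e" by simp
    have "\<exists>t. snd x * cis (- (2 * t)) = z"
    proof (cases "snd x = 0")
      case True
      then show ?thesis using cz by simp
    next
      case False
      have "cmod (z / snd x) = 1" using False cz by (simp add: norm_divide)
      then have "z / snd x = cis (Arg (z / snd x))" using cis_Arg_cmod[of "z / snd x"] by simp
      then have "snd x * cis (- (2 * (- Arg (z / snd x) / 2))) = z" using False
        by (simp add: field_simps)
      then show ?thesis by blast
    qed
    then obtain t where t: "snd x * cis (- (2 * t)) = z" by blast
    have "?c - ?e\<^sup>2 / ?c = 1 / ?c" using cc_sq[of "snd x"] by (simp add: field_simps power2_eq_square)
    then have "act_factor x t = Complex (1 / ?c) (r * ?e / ?c)"
      by (simp add: act_factor_def t z_def complex_eq_iff)
    then show ?thesis by blast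
  qed
  have ar: "Arg (Complex (1 / ?c) (r * ?e / ?c)) = arctan (r * ?e)" for r
    by (subst arg_conv_arctan) simp_all
  obtain t where "act_factor x t = Complex (1 / ?c) (1 * ?e / ?c)" using at[of 1] by auto
  then have "act x t = t + max_shift x" using ar[of 1] by (simp add: act_def max_shift_def)
  then show "\<exists>t. act x t = t + max_shift x" by blast
  obtain t where "act_factor x t = Complex (1 / ?c) (- 1 * ?e / ?c)" using at[of "- 1"] by auto
  then have "act x t = t + min_shift x" using ar[of "- 1"] by (simp add: act_def min_shift_def arctan_minus)
  then show "\<exists>t. act x t = t + min_shift x" by blast
qed

lemma min_shift_less_iff: "min_shift x < c \<longleftrightarrow> (\<exists>t. act x t < t + c)"
proof
  assume "min_shift x < c"
  moreover obtain t where "act x t = t + min_shift x" using act_attained by blast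
  ultimately show "\<exists>t. act x t < t + c" by (intro exI[of _ t]) simp
next
  assume "\<exists>t. act x t < t + c"
  then obtain t where "act x t < t + c" by blast
  then show "min_shift x < c" using act_bounds(2)[of x t] by linarith
qed

lemma min_shift_ge_iff: "min_shift x \<ge> c \<longleftrightarrow> (\<forall>t. act x t \<ge> t + c)"
  using min_shift_less_iff[where x=x and c=c] by (meson not_less)

lemma min_shift_le_max_shift: "min_shift x \<le> max_shift x" by (simp add: min_shift_def max_shift_def)

lemma max_shift_less_min_shift: "max_shift x < min_shift x + pi"
  using arctan_ubound[of "cmod (snd x)"] by (simp add: min_shift_def max_shift_def)

lemma arctan_norm_bounds: "0 \<le> arctan (cmod e)" "arctan (cmod e) < pi / 2" "arctan (cmod e) < pi"
proof -
  show "0 \<le> arctan (cmod e)" "arctan (cmod e) < pi / 2" using arctan_ubound by auto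
  then show "arctan (cmod e) < pi" using pi_gt_zero by linarith
qed

lemma max_shift_central: "max_shift (central k \<odot> x) = max_shift x + pi * k" "min_shift (central k \<odot> x) = min_shift x + pi * k"
  by (simp_all add: max_shift_def min_shift_def central_mul)

lemma max_shift_cinv: "max_shift (cinv x) = - min_shift x" "min_shift (cinv x) = - max_shift x"
  by (simp_all add: max_shift_def min_shift_def cinv_def norm_mult)

lemma max_shift_mul: "max_shift (x \<odot> y) \<le> max_shift x + max_shift y" "max_shift x + min_shift y \<le> max_shift (x \<odot> y)" "min_shift x + max_shift y \<le> max_shift (x \<odot> y)"
  "min_shift (x \<odot> y) \<ge> min_shift x + min_shift y" "min_shift (x \<odot> y) \<le> min_shift x + max_shift y" "min_shift (x \<odot> y) \<le> max_shift x + min_shift y"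
proof -
  note b = act_bounds[of "x \<odot> y"]
  obtain t where t: "act (x \<odot> y) t = t + max_shift (x \<odot> y)" using act_attained by blast
  show "max_shift (x \<odot> y) \<le> max_shift x + max_shift y"
    using t act_bounds[of x "act y t"] act_bounds[of y t] by (simp add: act_mul)
  obtain t where t: "act (x \<odot> y) t = t + min_shift (x \<odot> y)" using act_attained by blast
  show "min_shift (x \<odot> y) \<ge> min_shift x + min_shift y"
    using t act_bounds[of x "act y t"] act_bounds[of y t] by (simp add: act_mul)
  obtain t where t: "act y t = t + max_shift y" using act_attained by blast
  show "min_shift x + max_shift y \<le> max_shift (x \<odot> y)"
    using t b(1)[of t] act_bounds[of x "act y t"] by (simp add: act_mul)
  obtain t where t: "act y t = t + min_shift y" using act_attained by blast
  show "min_shift (x \<odot> y) \<le> max_shift x + min_shift y"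
    using t b(2)[of t] act_bounds[of x "act y t"] by (simp add: act_mul)
  obtain t where t: "act x t = t + max_shift x" using act_attained by blast
  show "max_shift x + min_shift y \<le> max_shift (x \<odot> y)"
    using t b(1)[of "act (cinv y) t"] act_bounds[of y "act (cinv y) t"] by (simp add: act_mul)
  obtain t where t: "act x t = t + min_shift x" using act_attained by blast
  show "min_shift (x \<odot> y) \<le> min_shift x + max_shift y"
    using t b(2)[of "act (cinv y) t"] act_bounds[of y "act (cinv y) t"] by (simp add: act_mul)
qed

lemma tendsto_max_shift [tendsto_intros]:
  "(f \<longlongrightarrow> a) F \<Longrightarrow> ((\<lambda>x. max_shift (f x)) \<longlongrightarrow> max_shift a) F" "(f \<longlongrightarrow> a) F \<Longrightarrow> ((\<lambda>x. min_shift (f x)) \<longlongrightarrow> min_shift a) F"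
  unfolding max_shift_def min_shift_def by (intro tendsto_intros; simp)+

lemma continuous_on_max_shift [continuous_intros]:
  "continuous_on S f \<Longrightarrow> continuous_on S (\<lambda>x. max_shift (f x))" "continuous_on S f \<Longrightarrow> continuous_on S (\<lambda>x. min_shift (f x))"
  by (simp_all add: continuous_on_def tendsto_max_shift)

lemma min_shift_conj: "min_shift (g \<odot> x \<odot> cinv g) < pi * of_int k \<longleftrightarrow> min_shift x < pi * of_int k"
proof -
  have *: "min_shift (g \<odot> x \<odot> cinv g) < pi * of_int k" if "min_shift x < pi * of_int k" for g x
  proof -
    obtain t where "act x t < t + pi * k" using \<open>min_shift x < pi * k\<close> min_shift_less_iff by blast
    then have "act g (act x t) < act g t + pi * k" by (metis act_less_iff act_periodic)
    then have "act (g \<odot> x \<odot> cinv g) (act g t) < act g t + pi * k" by (simp add: act_mul)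
    then show ?thesis using min_shift_less_iff by blast
  qed
  have "cinv g \<odot> (g \<odot> x \<odot> cinv g) \<odot> cinv (cinv g) = x" by (simp add: cmul_assoc)
  then show ?thesis using *[of x g] *[of "g \<odot> x \<odot> cinv g" "cinv g"] by auto
qed

lemma max_shift_conj: "max_shift (g \<odot> x \<odot> cinv g) > pi * of_int k \<longleftrightarrow> max_shift x > pi * of_int k"
  using min_shift_conj[of g "cinv x" "- k"] max_shift_cinv(2)[of x] max_shift_cinv(2)[of "g \<odot> x \<odot> cinv g"]
  by (simp add: cmul_assoc)

text \<open>The displacement at a point is not invariant under conjugation, but its comparison with
  integral multiples of \<open>\<pi>\<close> is; hence the integral bounds.\<close>

definition shift_range :: "int \<Rightarrow> int \<Rightarrow> cov set" where
  "shift_range a b = {x. min_shift x < pi * of_int a \<and> max_shift x > pi * of_int b}"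

lemma shift_range_central: "central k \<odot> x \<in> shift_range a b \<longleftrightarrow> x \<in> shift_range (a - k) (b - k)"
  by (simp add: shift_range_def max_shift_central algebra_simps)

lemma shift_range_cinv: "cinv x \<in> shift_range a b \<longleftrightarrow> x \<in> shift_range (- b) (- a)"
  by (auto simp: shift_range_def max_shift_cinv)

lemma shift_range_conj: "g \<odot> x \<odot> cinv g \<in> shift_range a b \<longleftrightarrow> x \<in> shift_range a b"
  by (simp add: shift_range_def min_shift_conj max_shift_conj)

lemma open_shift_range: "open (shift_range a b)"
proof -
  have "shift_range a b = {x. min_shift x < pi * of_int a} \<inter> {x. max_shift x > pi * of_int b}" by (auto simp: shift_range_def)
  moreover have "open {x. min_shift x < pi * of_int a}" "open {x. max_shift x > pi * of_int b}"
    by (intro open_Collect_less continuous_intros)+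
  ultimately show ?thesis by auto
qed

lemma ccomm_inv: "cinv (ccomm x y) = ccomm y x"
  by (simp add: ccomm_def cmul_assoc)

text \<open>A commutator is \<open>x\<close> times a conjugate of the inverse of \<open>x\<close>; displacements of at least
  \<open>\<pi>\<close> everywhere would make two conjugate elements differ by a translation.\<close>

lemma ccomm_min_shift: "min_shift (ccomm x y) < pi"
proof (rule ccontr)
  assume "\<not> min_shift (ccomm x y) < pi"
  then have ge: "act (ccomm x y) t \<ge> t + pi" for t using min_shift_ge_iff[where c=pi and x="ccomm x y"] by auto
  define g h where "g = cinv x" and "h = y \<odot> g \<odot> cinv y"
  have "act x (act h t) \<ge> t + pi" for t
    using ge[of t] by (simp add: act_mul[symmetric] ccomm_def h_def g_def cmul_assoc)
  then have "act g (act x (act h t)) \<ge> act g (t + pi)" for t by simp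
  then have hg: "act h t \<ge> act g t + pi" for t using act_periodic[of g t 1] unfolding g_def act_cinv by (metis of_int_1 mult_1_right)
  define k where "k = \<lfloor>min_shift g / pi\<rfloor> + 1"
  have k: "min_shift g < pi * of_int k" "min_shift g \<ge> pi * of_int (k - 1)"
  proof -
    define q where "q = min_shift g / pi"
    have "q < of_int k" "of_int (k - 1) \<le> q" unfolding k_def q_def by linarith+
    then have "pi * q < pi * of_int k" "pi * of_int (k - 1) \<le> pi * q" by simp_all
    then show "min_shift g < pi * of_int k" "min_shift g \<ge> pi * of_int (k - 1)" by (simp_all add: q_def)
  qed
  have "min_shift h < pi * of_int k" unfolding h_def min_shift_conj by (rule k)
  then obtain t where "act h t < t + pi * k" using min_shift_less_iff by blast
  then have "act g t < t + pi * of_int (k - 1)" using hg[of t] by (simp add: algebra_simps)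
  then have "min_shift g < pi * of_int (k - 1)" using min_shift_less_iff by blast
  with k show False by simp
qed

lemma ccomm_shift_range: "ccomm x y \<in> shift_range 1 (- 1)"
  using ccomm_min_shift[of x y] ccomm_min_shift[of y x] max_shift_cinv(2)[of "ccomm x y"] by (simp add: shift_range_def ccomm_inv)

lemma shift_range_mul_imp:
  assumes "x \<odot> y \<in> shift_range a b" "min_shift x \<ge> - (pi * of_int u)" "max_shift x < pi * of_int l"
  shows "y \<in> shift_range (a + u) (b - l)"
proof -
  have "min_shift x + min_shift y < pi * a" "pi * b < max_shift x + max_shift y"
    using assms(1) max_shift_mul[of x y] by (auto simp: shift_range_def)
  with assms(2,3) show ?thesis by (simp add: shift_range_def algebra_simps)
qed

lemma shift_range1_mul_imp:
  assumes "x \<odot> y \<in> shift_range a b" "x \<in> shift_range 1 (- 1)"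
  shows "y \<in> shift_range (a + 2) (b - 2)"
  by (rule shift_range_mul_imp[OF assms(1)]) (use assms(2) max_shift_less_min_shift[of x] in \<open>auto simp: shift_range_def\<close>)

section \<open>Reflection\<close>

definition crefl :: "cov \<Rightarrow> cov" where "crefl x = (- fst x, cnj (snd x))"
definition srefl :: "sq \<Rightarrow> sq" where "srefl s = (cnj (fst s), cnj (snd s))"

lemma toS_refl: "toS (crefl x) = srefl (toS x)"
  by (simp add: toS_def crefl_def srefl_def cis_cnj)

lemma srefl_mul: "srefl (s \<star> t) = srefl s \<star> srefl t"
  by (simp add: srefl_def smul_def)

lemma crefl_crefl [simp]: "crefl (crefl x) = x" by (simp add: crefl_def)

lemma crefl_mul: "crefl (x \<odot> y) = crefl x \<odot> crefl y"
proof (rule toS_inj)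
  show "toS (crefl (x \<odot> y)) = toS (crefl x \<odot> crefl y)" by (simp add: toS_refl toS_mul srefl_mul)
  show "\<bar>fst (crefl (x \<odot> y)) - fst (crefl x \<odot> crefl y)\<bar> < 2 * pi"
    using cmul_angle[of x y] cmul_angle[of "crefl x" "crefl y"] unfolding crefl_def fst_conv snd_conv by linarith
qed

lemma crefl_one [simp]: "crefl cid = cid" by (simp add: crefl_def)

lemma crefl_cinv: "crefl (cinv x) = cinv (crefl x)"
  by (rule cinv_unique) (simp add: crefl_mul[symmetric])

lemma crefl_ccomm: "crefl (ccomm x y) = ccomm (crefl x) (crefl y)"
  by (simp add: ccomm_def crefl_mul crefl_cinv)

lemma max_shift_refl: "max_shift (crefl x) = - min_shift x" "min_shift (crefl x) = - max_shift x"
  by (simp_all add: max_shift_def min_shift_def crefl_def)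

lemma shift_range_refl: "crefl x \<in> shift_range a b \<longleftrightarrow> x \<in> shift_range (- b) (- a)"
  by (auto simp: shift_range_def max_shift_refl)

lemma crefl_inj [simp]: "crefl x = crefl y \<longleftrightarrow> x = y" by (metis crefl_crefl)

lemma continuous_on_refl [continuous_intros]: "continuous_on S f \<Longrightarrow> continuous_on S (\<lambda>x. crefl (f x))"
  unfolding crefl_def by (intro continuous_intros)

section \<open>Traces\<close>

lemma htr_toS: "htr (toS x) = cc (snd x) * cos (fst x)" by (simp add: toS_def)

lemma Im_toS: "Im (fst (toS x)) = cc (snd x) * sin (fst x)" by (simp add: toS_def)

lemma cos_arctan_cc: "cos (arctan (cmod e)) = 1 / cc e" by (simp add: cos_arctan cc_def)

lemma htr_gt1_iff:
  assumes "\<bar>fst x\<bar> \<le> pi"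
  shows "htr (toS x) > 1 \<longleftrightarrow> \<bar>fst x\<bar> < arctan (cmod (snd x))"
    "htr (toS x) = 1 \<longleftrightarrow> \<bar>fst x\<bar> = arctan (cmod (snd x))"
proof -
  let ?r = "arctan (cmod (snd x))"
  have r: "0 \<le> ?r" "?r \<le> pi" using arctan_norm_bounds[of "snd x"] by linarith+
  have c: "cos (fst x) = cos \<bar>fst x\<bar>" by simp
  have "htr (toS x) > 1 \<longleftrightarrow> cos ?r < cos \<bar>fst x\<bar>"
    unfolding htr_toS cos_arctan_cc c by (simp add: field_simps)
  also have "\<dots> \<longleftrightarrow> \<bar>fst x\<bar> < ?r" using r assms by (intro cos_mono_less_eq) auto
  finally show "htr (toS x) > 1 \<longleftrightarrow> \<bar>fst x\<bar> < ?r" .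
  have "htr (toS x) = 1 \<longleftrightarrow> cos ?r = cos \<bar>fst x\<bar>"
    unfolding htr_toS cos_arctan_cc c by (auto simp: field_simps)
  also have "\<dots> \<longleftrightarrow> \<bar>fst x\<bar> = ?r" using r assms cos_inj_pi[of "\<bar>fst x\<bar>" ?r] c by fastforce
  finally show "htr (toS x) = 1 \<longleftrightarrow> \<bar>fst x\<bar> = ?r" .
qed

lemma cos_pos_abs: assumes "cos a > 0" "- (3 * pi / 2) \<le> a" "a \<le> 3 * pi / 2" shows "\<bar>a\<bar> < pi / 2"
proof (rule ccontr)
  assume "\<not> \<bar>a\<bar> < pi / 2"
  then have "cos (pi - \<bar>a\<bar>) \<ge> 0" using assms by (intro cos_ge_zero) auto
  then have "cos \<bar>a\<bar> \<le> 0" by (simp add: cos_diff)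
  then show False using assms(1) by simp
qed

text \<open>For \<open>s = \<plusminus>1\<close>, \<open>Parabolics s\<close> consists of the lifts, in the image of the exponential map, of the
  parabolic elements of sign \<open>s\<close>.\<close>

definition parab :: "int \<Rightarrow> complex \<Rightarrow> cov" where
  "parab s e = (of_int s * arctan (cmod e), e)"

definition Parabolics :: "int \<Rightarrow> cov set" where "Parabolics s = parab s ` (- {0})"

lemma parab_one_bounds: "min_shift (parab 1 e) = 0" "max_shift (parab 1 e) < pi" "max_shift (parab 1 e) \<ge> 0"
  "max_shift (parab (- 1) e) = 0" "min_shift (parab (- 1) e) > - pi" "min_shift (parab (- 1) e) \<le> 0"
  using arctan_norm_bounds[of e] by (simp_all add: parab_def min_shift_def max_shift_def)

lemma crefl_parab: "crefl (parab s e) = parab (- s) (cnj e)" by (simp add: crefl_def parab_def)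

lemma toS_parab: assumes "s = 1 \<or> s = -1"
  shows "fst (toS (parab s e)) = Complex 1 (of_int s * cmod e)"
  using assms cos_arctan_cc[of e] sin_arctan[of "cmod e"]
  by (auto simp: toS_def parab_def complex_eq_iff cc_def)

lemma Parabolics_iff: "x \<in> Parabolics s \<longleftrightarrow> snd x \<noteq> 0 \<and> fst x = of_int s * arctan (cmod (snd x))"
  by (auto simp: Parabolics_def parab_def image_iff prod_eq_iff)

lemma Parabolics_iff_htr: assumes "s = 1 \<or> s = - 1"
  shows "x \<in> Parabolics s \<longleftrightarrow> \<bar>fst x\<bar> < pi \<and> htr (toS x) = 1 \<and> of_int s * Im (fst (toS x)) > 0"
proof
  assume x: "x \<in> Parabolics s"
  then have "x = parab s (snd x)" "snd x \<noteq> 0" by (auto simp: Parabolics_def parab_def)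
  with toS_parab[OF assms, of "snd x"] show "\<bar>fst x\<bar> < pi \<and> htr (toS x) = 1 \<and> of_int s * Im (fst (toS x)) > 0"
    using assms arctan_norm_bounds(3)[of "snd x"] x by (auto simp: Parabolics_iff abs_mult)
next
  assume a: "\<bar>fst x\<bar> < pi \<and> htr (toS x) = 1 \<and> of_int s * Im (fst (toS x)) > 0"
  then have e: "\<bar>fst x\<bar> = arctan (cmod (snd x))" using htr_gt1_iff(2)[of x] by simp
  have sn: "of_int s * sin (fst x) > 0" using a
    by (simp add: Im_toS mult.left_commute[of _ "cc (snd x)"] zero_less_mult_iff)
  have "snd x \<noteq> 0"
    using e sn by auto
  moreover have "fst x = of_int s * arctan (cmod (snd x))"
  proof (cases "s = 1")
    case True
    have "fst x \<ge> 0"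
    proof (rule ccontr)
      assume "\<not> fst x \<ge> 0"
      then have "sin (- fst x) \<ge> 0" using a by (intro sin_ge_zero) auto
      then show False using sn True by simp
    qed
    then show ?thesis using e True by simp
  next
    case False
    then have s: "s = - 1" using assms by simp
    have "fst x \<le> 0"
    proof (rule ccontr)
      assume "\<not> fst x \<le> 0"
      then have "sin (fst x) \<ge> 0" using a by (intro sin_ge_zero) auto
      then show False using sn s by simp
    qed
    then show ?thesis using e s by simp
  qed
  ultimately show "x \<in> Parabolics s" by (simp add: Parabolics_iff)
qed

section \<open>Multiplying by a parabolic element\<close>

definition ray :: "real \<Rightarrow> real \<Rightarrow> cov" where
  "ray \<tau> \<phi> = (arctan \<tau>, complex_of_real \<tau> * cis (\<phi> - arctan \<tau>))"

lemma cc_ray: "cc (complex_of_real \<tau> * cis t) = sqrt (1 + \<tau>\<^sup>2)"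
  by (simp add: cc_def norm_mult)

lemma toS_ray: "toS (ray \<tau> \<phi>) = (Complex 1 \<tau>, complex_of_real \<tau> * cis \<phi>)"
proof -
  have p: "1 + \<tau>\<^sup>2 > 0" by (simp add: add_pos_nonneg)
  have "complex_of_real (sqrt (1 + \<tau>\<^sup>2)) * cis (arctan \<tau>) = Complex 1 \<tau>"
    using p by (simp add: complex_eq_iff cos_arctan sin_arctan)
  moreover have "cis (\<phi> - arctan \<tau>) * cis (arctan \<tau>) = cis \<phi>" by (simp add: cis_mult)
  ultimately show ?thesis by (simp only: toS_def ray_def fst_conv snd_conv cc_ray mult.assoc)
qed

lemma ray_add: "ray \<sigma> \<phi> \<odot> ray \<tau> \<phi> = ray (\<sigma> + \<tau>) \<phi>"
proof (rule toS_inj)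
  have "cis \<phi> * cnj (cis \<phi>) = 1" by (simp add: cis_cnj cis_mult)
  then have e: "complex_of_real \<sigma> * cis \<phi> * cnj (complex_of_real \<tau> * cis \<phi>) = complex_of_real (\<sigma> * \<tau>)"
    by (simp add: algebra_simps)
  show "toS (ray \<sigma> \<phi> \<odot> ray \<tau> \<phi>) = toS (ray (\<sigma> + \<tau>) \<phi>)"
    unfolding toS_mul toS_ray smul_def fst_conv snd_conv e
    by (simp add: complex_eq_iff algebra_simps)
  show "\<bar>fst (ray \<sigma> \<phi> \<odot> ray \<tau> \<phi>) - fst (ray (\<sigma> + \<tau>) \<phi>)\<bar> < 2 * pi"
    using cmul_angle[of "ray \<sigma> \<phi>" "ray \<tau> \<phi>"] arctan_bounded[of \<sigma>] arctan_bounded[of \<tau>] arctan_bounded[of "\<sigma> + \<tau>"]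
    unfolding ray_def fst_conv by linarith
qed

lemma ray_0 [simp]: "ray 0 \<phi> = cid" by (simp add: ray_def)

lemma ray_parab: "\<tau> \<ge> 0 \<Longrightarrow> ray \<tau> \<phi> = parab 1 (snd (ray \<tau> \<phi>))"
  by (simp add: ray_def parab_def norm_mult)

lemma ray_in_Parabolics: "\<tau> > 0 \<Longrightarrow> ray \<tau> \<phi> \<in> Parabolics 1"
  by (simp add: Parabolics_iff ray_def norm_mult)

lemma parab_eq_ray: "parab 1 e = ray (cmod e) (Arg e + arctan (cmod e))"
  by (simp add: parab_def ray_def cis_Arg_cmod)

lemma ray_periodic: "ray \<tau> (\<phi> + 2 * pi * of_int k) = ray \<tau> \<phi>"
proof -
  have "cis (\<phi> + 2 * pi * of_int k - arctan \<tau>) = cis (\<phi> - arctan \<tau>) * cis (2 * pi * of_int k)"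
    by (simp only: cis_mult) (simp add: algebra_simps)
  then show ?thesis by (simp add: ray_def)
qed

lemma tendsto_ray [tendsto_intros]:
  "(f \<longlongrightarrow> a) F \<Longrightarrow> (g \<longlongrightarrow> b) F \<Longrightarrow> ((\<lambda>x. ray (f x) (g x)) \<longlongrightarrow> ray a b) F"
  unfolding ray_def by (intro tendsto_intros)

lemma continuous_on_ray [continuous_intros]:
  "continuous_on S f \<Longrightarrow> continuous_on S g \<Longrightarrow> continuous_on S (\<lambda>x. ray (f x) (g x))"
  by (simp add: continuous_on_def tendsto_ray)

lemma ray_bounds:
  assumes "\<tau> \<ge> 0" shows "min_shift (ray \<tau> \<phi>) = 0" "max_shift (ray \<tau> \<phi>) < pi"
  by (subst ray_parab[OF assms], rule parab_one_bounds)+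

lemma ray_mono:
  assumes "\<sigma> \<le> \<tau>"
  shows "max_shift (ray \<sigma> \<phi> \<odot> y) \<le> max_shift (ray \<tau> \<phi> \<odot> y)" "min_shift (ray \<sigma> \<phi> \<odot> y) \<le> min_shift (ray \<tau> \<phi> \<odot> y)"
proof -
  have e: "ray \<tau> \<phi> \<odot> y = ray (\<tau> - \<sigma>) \<phi> \<odot> (ray \<sigma> \<phi> \<odot> y)"
    by (simp add: cmul_assoc[symmetric] ray_add)
  have "min_shift (ray (\<tau> - \<sigma>) \<phi>) = 0" using assms by (intro ray_bounds) simp
  then show "max_shift (ray \<sigma> \<phi> \<odot> y) \<le> max_shift (ray \<tau> \<phi> \<odot> y)" "min_shift (ray \<sigma> \<phi> \<odot> y) \<le> min_shift (ray \<tau> \<phi> \<odot> y)"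
    unfolding e using max_shift_mul(3,4)[of "ray (\<tau> - \<sigma>) \<phi>" "ray \<sigma> \<phi> \<odot> y"] by simp_all
qed

definition rslope :: "real \<Rightarrow> cov \<Rightarrow> real" where
  "rslope \<phi> y = Re (cis \<phi> * cnj (snd (toS y))) - Im (fst (toS y))"

lemma ray_htr: "htr (toS (ray \<tau> \<phi> \<odot> y)) = htr (toS y) + \<tau> * rslope \<phi> y"
  by (simp add: toS_mul toS_ray smul_def rslope_def algebra_simps)

lemma cmod_snd_toS: "cmod (snd (toS y)) = cmod (snd y)" by (simp add: toS_def norm_mult)

lemma ray_angle:
  assumes "- pi < max_shift y" "max_shift y \<le> 0" "\<tau> \<ge> 0" "htr (toS (ray \<tau> \<phi> \<odot> y)) > 0"
  shows "\<bar>fst (ray \<tau> \<phi> \<odot> y)\<bar> < pi / 2"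
proof (rule cos_pos_abs)
  let ?u = "ray \<tau> \<phi> \<odot> y"
  show "cos (fst ?u) > 0" using assms(4) unfolding htr_toS by (simp add: zero_less_mult_iff)
  have "max_shift ?u > - pi" using ray_mono(1)[OF assms(3), of \<phi> y] assms(1) by simp
  moreover have "max_shift ?u < pi" using max_shift_mul(1)[of "ray \<tau> \<phi>" y] ray_bounds(2)[OF assms(3), of \<phi>] assms(2) by simp
  ultimately show "- (3 * pi / 2) \<le> fst ?u" "fst ?u \<le> 3 * pi / 2"
    using arctan_norm_bounds[of "snd ?u"] unfolding max_shift_def by linarith+
qed

lemma ray_max_shift_pos:
  assumes "- pi < max_shift y" "max_shift y \<le> 0" "\<tau> \<ge> 0" "htr (toS (ray \<tau> \<phi> \<odot> y)) > 1"
  shows "max_shift (ray \<tau> \<phi> \<odot> y) > 0"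
proof -
  have "\<bar>fst (ray \<tau> \<phi> \<odot> y)\<bar> < pi / 2" by (rule ray_angle) (use assms in auto)
  then have "\<bar>fst (ray \<tau> \<phi> \<odot> y)\<bar> \<le> pi" using pi_gt_zero by linarith
  from htr_gt1_iff(1)[OF this] assms(4) have "\<bar>fst (ray \<tau> \<phi> \<odot> y)\<bar> < arctan (cmod (snd (ray \<tau> \<phi> \<odot> y)))"
    by blast
  then show ?thesis unfolding max_shift_def by linarith
qed

text \<open>The trace is affine along a ray, so the ray enters the region \<open>max_shift > 0\<close> iff the slope is
  positive; elements with \<open>max_shift = 0\<close> have trace \<open>2\<close>.\<close>

lemma ray_reach:
  assumes M: "- pi < max_shift y" "max_shift y \<le> 0"
  shows "(\<exists>\<tau>>0. max_shift (ray \<tau> \<phi> \<odot> y) > 0) \<longleftrightarrow> rslope \<phi> y > 0 \<or> max_shift y = 0"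
proof
  assume ex: "\<exists>\<tau>>0. max_shift (ray \<tau> \<phi> \<odot> y) > 0"
  show "rslope \<phi> y > 0 \<or> max_shift y = 0"
  proof (rule ccontr)
    assume "\<not> ?thesis"
    then have L: "rslope \<phi> y \<le> 0" and M0: "max_shift y < 0" using M by auto
    have th: "- (3 * pi / 2) \<le> fst y" "fst y \<le> 0"
      using M arctan_norm_bounds[of "snd y"] unfolding max_shift_def by linarith+
    have h1: "htr (toS y) < 1"
    proof (rule ccontr)
      assume h: "\<not> htr (toS y) < 1"
      then have "cc (snd y) * cos (fst y) > 0" unfolding htr_toS by linarith
      then have "cos (fst y) > 0" by (simp add: zero_less_mult_iff)
      then have "\<bar>fst y\<bar> < pi / 2" using th pi_gt_zero by (intro cos_pos_abs) linarith+
      then have "\<bar>fst y\<bar> \<le> pi" using pi_gt_zero by linarith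
      from htr_gt1_iff[OF this] h have "\<bar>fst y\<bar> \<le> arctan (cmod (snd y))" by linarith
      then show False using M0 unfolding max_shift_def by linarith
    qed
    obtain \<tau> where \<tau>: "\<tau> > 0" "max_shift (ray \<tau> \<phi> \<odot> y) > 0" using ex by blast
    have "\<exists>x\<ge>0. x \<le> \<tau> \<and> max_shift (ray x \<phi> \<odot> y) = 0"
      by (rule IVT') (use \<tau> M0 in \<open>auto intro!: continuous_intros\<close>)
    then obtain \<sigma> where s: "\<sigma> \<ge> 0" "max_shift (ray \<sigma> \<phi> \<odot> y) = 0" by blast
    let ?u = "ray \<sigma> \<phi> \<odot> y"
    have ab: "\<bar>fst ?u\<bar> = arctan (cmod (snd ?u))" using s(2) arctan_norm_bounds(1)[of "snd ?u"] unfolding max_shift_def by linarith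
    then have "\<bar>fst ?u\<bar> \<le> pi" using arctan_norm_bounds(3)[of "snd ?u"] by linarith
    then have "htr (toS ?u) = 1" using htr_gt1_iff(2) ab by blast
    then have "htr (toS y) + \<sigma> * rslope \<phi> y = 1" by (simp add: ray_htr)
    moreover have "\<sigma> * rslope \<phi> y \<le> 0" using s(1) L by (simp add: mult_nonneg_nonpos)
    ultimately show False using h1 by linarith
  qed
next
  assume a: "rslope \<phi> y > 0 \<or> max_shift y = 0"
  have pos: "\<exists>\<tau>>0. max_shift (ray \<tau> \<phi> \<odot> y) > 0" if L: "rslope \<phi> y > 0"
  proof (intro exI conjI)
    let ?t = "(\<bar>htr (toS y)\<bar> + 2) / rslope \<phi> y"
    show t: "?t > 0" using L by (simp add: add_nonneg_pos)
    have "htr (toS (ray ?t \<phi> \<odot> y)) > 1" unfolding ray_htr using L by simp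
    then show "max_shift (ray ?t \<phi> \<odot> y) > 0" using M t by (intro ray_max_shift_pos) auto
  qed
  show "\<exists>\<tau>>0. max_shift (ray \<tau> \<phi> \<odot> y) > 0"
  proof (cases "rslope \<phi> y > 0")
    case True then show ?thesis by (rule pos)
  next
    case False
    then have M0: "max_shift y = 0" using a by blast
    let ?e = "cmod (snd y)"
    have y: "y = parab (- 1) (snd y)" using M0 by (simp add: max_shift_def parab_def prod_eq_iff)
    have al: "fst (toS y) = Complex 1 (- ?e)" using toS_parab[of "- 1" "snd y"] y by simp
    define w where "w = cis \<phi> * cnj (snd (toS y))"
    have mul_factor: "cmod w = ?e" by (simp add: w_def norm_mult cmod_snd_toS)
    have "Re w \<le> - ?e" using False by (simp add: rslope_def al w_def)
    moreover have "\<bar>Re w\<bar> \<le> ?e" using abs_Re_le_cmod[of w] mul_factor by simp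
    ultimately have re: "Re w = - ?e" by linarith
    then have "(Im w)\<^sup>2 = 0" using cmod_power2[of w] mul_factor by simp
    then have of_mat: "Im w = 0" by simp
    have L0: "rslope \<phi> y = 0" using re by (simp add: rslope_def al w_def)
    let ?u = "ray (?e + 1) \<phi> \<odot> y"
    have h: "htr (toS ?u) = 1" unfolding ray_htr L0 by (simp add: al)
    have "Im (fst (toS ?u)) = - ?e + (?e + 1) + (?e + 1) * Im w"
      by (simp add: toS_mul toS_ray smul_def al w_def algebra_simps)
    then have I: "Im (fst (toS ?u)) > 0" by (simp add: of_mat)
    have "\<bar>fst ?u\<bar> < pi / 2" by (rule ray_angle) (use M h in auto)
    then have "\<bar>fst ?u\<bar> < pi" using pi_gt_zero by linarith
    then have "?u \<in> Parabolics 1" using Parabolics_iff_htr[of 1 ?u] h I by simp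
    then have "max_shift ?u > 0" by (simp add: Parabolics_iff max_shift_def)
    then show ?thesis by (intro exI[of _ "?e + 1"]) (simp add: add_nonneg_pos)
  qed
qed

lemma ray_region:
  assumes J: "connected J" "J \<noteq> {}" and ba: "b < a" and y: "min_shift y < pi * of_int a"
    and reach: "\<And>\<phi>. \<phi> \<in> J \<Longrightarrow> \<exists>\<tau>>0. max_shift (ray \<tau> \<phi> \<odot> y) > pi * of_int b"
  shows "connected {(\<tau>, \<phi>). \<tau> > 0 \<and> \<phi> \<in> J \<and> ray \<tau> \<phi> \<odot> y \<in> shift_range a b}" (is "connected ?P")
    and "{(\<tau>, \<phi>). \<tau> > 0 \<and> \<phi> \<in> J \<and> ray \<tau> \<phi> \<odot> y \<in> shift_range a b} \<noteq> {}"
proof -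
  have ex: "\<exists>\<tau>. (\<tau>, \<phi>) \<in> ?P" if phi: "\<phi> \<in> J" for \<phi>
  proof (rule ccontr)
    assume no: "\<nexists>\<tau>. (\<tau>, \<phi>) \<in> ?P"
    define A where "A = {\<tau>::real. max_shift (ray \<tau> \<phi> \<odot> y) > pi * of_int b}"
    define B where "B = {\<tau>::real. min_shift (ray \<tau> \<phi> \<odot> y) < pi * of_int a}"
    have op: "open A" "open B" unfolding A_def B_def by (intro open_Collect_less continuous_intros)+
    have "A \<inter> B \<inter> {0<..} = {}" using no phi by (auto simp: A_def B_def shift_range_def)
    moreover have "{0<..} \<subseteq> A \<union> B"
    proof
      fix \<tau> :: real
      have "min_shift (ray \<tau> \<phi> \<odot> y) \<le> max_shift (ray \<tau> \<phi> \<odot> y)" by (rule min_shift_le_max_shift)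
      moreover have "pi * of_int b < pi * of_int a" using ba by simp
      ultimately have "max_shift (ray \<tau> \<phi> \<odot> y) > pi * of_int b \<or> min_shift (ray \<tau> \<phi> \<odot> y) < pi * of_int a" by linarith
      then show "\<tau> \<in> A \<union> B" by (simp add: A_def B_def)
    qed
    moreover have "A \<inter> {0<..} \<noteq> {}" using reach[OF phi] by (auto simp: A_def)
    moreover have "B \<inter> {0<..} \<noteq> {}"
    proof -
      have "((\<lambda>\<tau>. min_shift (ray \<tau> \<phi> \<odot> y)) \<longlongrightarrow> min_shift (ray 0 \<phi> \<odot> y)) (at_right 0)"
        by (intro tendsto_intros)
      then have "\<forall>\<^sub>F \<tau> in at_right 0. min_shift (ray \<tau> \<phi> \<odot> y) < pi * of_int a"
        by (rule order_tendstoD) (simp add: y)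
      moreover have "\<forall>\<^sub>F \<tau>::real in at_right 0. \<tau> > 0" by (simp add: eventually_at_right_less)
      ultimately have "\<forall>\<^sub>F \<tau>::real in at_right 0. \<tau> \<in> B \<inter> {0<..}"
        by eventually_elim (simp add: B_def)
      then show ?thesis using eventually_happens'[OF trivial_limit_at_right_real] by fastforce
    qed
    moreover have "connected {0::real<..}" by (simp add: connected_Ioi)
    ultimately show False using op unfolding connected_def by blast
  qed
  then have img: "J = snd ` ?P" by force
  show "?P \<noteq> {}" using ex J(2) by blast
  show "connected ?P"
  proof (rule connected_if_loc_const)
    fix \<kappa> :: "real \<times> real \<Rightarrow> bool" assume loc_const: "loc_const ?P \<kappa>"
    have fib: "\<kappa> s = \<kappa> t" if st: "s \<in> ?P" "t \<in> ?P" "snd s = snd t" for s t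
    proof -
      obtain \<tau>1 \<tau>2 \<phi> where e: "s = (\<tau>1, \<phi>)" "t = (\<tau>2, \<phi>)" using st(3) by (metis prod.collapse)
      have "\<kappa> (\<tau>1, \<phi>) = \<kappa> (\<tau>2, \<phi>)"
      proof (rule loc_const_path[OF loc_const, where \<gamma> = "\<lambda>\<tau>. (\<tau>, \<phi>)" and S = "{min \<tau>1 \<tau>2..max \<tau>1 \<tau>2}"])
        show "continuous_on {min \<tau>1 \<tau>2..max \<tau>1 \<tau>2} (\<lambda>\<tau>. (\<tau>, \<phi>))" by (intro continuous_intros)
        fix \<tau> assume t: "\<tau> \<in> {min \<tau>1 \<tau>2..max \<tau>1 \<tau>2}"
        have "ray (min \<tau>1 \<tau>2) \<phi> \<odot> y \<in> shift_range a b" "ray (max \<tau>1 \<tau>2) \<phi> \<odot> y \<in> shift_range a b" "min \<tau>1 \<tau>2 > 0" "\<phi> \<in> J"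
          using st e by (auto simp: min_def max_def)
        then show "(\<tau>, \<phi>) \<in> ?P"
          using t ray_mono[of "min \<tau>1 \<tau>2" \<tau> \<phi> y] ray_mono[of \<tau> "max \<tau>1 \<tau>2" \<phi> y] by (auto simp: shift_range_def)
      qed auto
      then show ?thesis by (simp add: e)
    qed
    have sec: "\<exists>\<sigma>. (\<sigma> \<longlongrightarrow> s) (at (snd s) within J) \<and> (\<forall>\<^sub>F w in at (snd s) within J. \<sigma> w \<in> ?P \<and> snd (\<sigma> w) = w)"
      if s: "s \<in> ?P" for s
    proof -
      have l: "((\<lambda>w. (fst s, w)) \<longlongrightarrow> (fst s, snd s)) (at (snd s) within J)" by (intro tendsto_intros)
      have "((\<lambda>w. ray (fst s) w \<odot> y) \<longlongrightarrow> ray (fst s) (snd s) \<odot> y) (at (snd s) within J)" by (intro tendsto_intros)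
      then have "\<forall>\<^sub>F w in at (snd s) within J. ray (fst s) w \<odot> y \<in> shift_range a b"
        by (rule topological_tendstoD[OF _ open_shift_range]) (use s in auto)
      moreover have "\<forall>\<^sub>F w in at (snd s) within J. w \<in> J" by (auto simp: eventually_at_topological)
      ultimately have "\<forall>\<^sub>F w in at (snd s) within J. (fst s, w) \<in> ?P \<and> snd (fst s, w) = w"
        by eventually_elim (use s in auto)
      with l show ?thesis by (intro exI[of _ "\<lambda>w. (fst s, w)"]) simp
    qed
    obtain \<kappa>' where k: "loc_const J \<kappa>'" "\<And>s. s \<in> ?P \<Longrightarrow> \<kappa> s = \<kappa>' (snd s)"
      using loc_const_fibre[OF loc_const fib sec img] by blast
    obtain j where "j \<in> J" using J(2) by blast
    have "\<kappa> s = \<kappa>' j" if s: "s \<in> ?P" for s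
    proof -
      have "snd s \<in> J" using s by auto
      then show ?thesis using k(2)[OF s] loc_const_connected[OF J(1) k(1) _ \<open>j \<in> J\<close>] by simp
    qed
    then show "\<exists>c. \<forall>s\<in>?P. \<kappa> s = c" by blast
  qed
qed

lemma rslope_max:
  assumes "- pi < max_shift y" "max_shift y < 0" shows "cmod (snd y) - Im (fst (toS y)) > 0"
proof -
  let ?e = "cmod (snd y)" and ?t = "fst y"
  have b: "0 \<le> arctan ?e" "arctan ?e < pi / 2" by (rule arctan_norm_bounds)+
  have se: "sin (arctan ?e) = ?e / cc (snd y)" by (simp add: sin_arctan cc_def)
  have "sin ?t < ?e / cc (snd y)"
  proof (cases "?t > - pi")
    case True
    have "?t < 0 \<or> ?t = 0" using assms b unfolding max_shift_def by linarith
    then show ?thesis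
    proof
      assume "?t < 0"
      then have "sin (- ?t) > 0" using True by (intro sin_gt_zero) auto
      then have "sin ?t < 0" by simp
      then show ?thesis by (rule less_le_trans) simp
    next
      assume t0: "?t = 0"
      then have "?e \<noteq> 0" using assms b unfolding max_shift_def by linarith
      then show ?thesis using t0 by simp
    qed
  next
    case False
    have "sin (- pi - ?t) < sin (arctan ?e)"
      using False assms b unfolding max_shift_def by (intro sin_monotone_2pi) linarith+
    moreover have "sin (- pi - ?t) = sin ?t" by (simp add: sin_diff)
    ultimately show ?thesis using se by simp
  qed
  then show ?thesis unfolding Im_toS by (simp add: field_simps)
qed

lemma Parabolics_fibre_connected:
  assumes ba: "b < a" and y: "y \<in> shift_range a (b - 1)"
  shows "connected {x \<in> Parabolics 1. x \<odot> y \<in> shift_range a b}" "{x \<in> Parabolics 1. x \<odot> y \<in> shift_range a b} \<noteq> {}"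
proof -
  define y' where "y' = central (- b) \<odot> y"
  have y': "y' \<in> shift_range (a - b) (- 1)" using y by (simp add: y'_def shift_range_central)
  have xy': "x \<odot> y' \<in> shift_range (a - b) 0 \<longleftrightarrow> x \<odot> y \<in> shift_range a b" for x
    by (simp add: y'_def central_left_commute shift_range_central)
  have "\<exists>J. connected J \<and> J \<noteq> {} \<and> (\<forall>\<phi>\<in>J. \<exists>\<tau>>0. max_shift (ray \<tau> \<phi> \<odot> y') > 0) \<and>
    (\<forall>\<phi>. (\<exists>\<tau>>0. max_shift (ray \<tau> \<phi> \<odot> y') > 0) \<longrightarrow> (\<exists>k::int. \<phi> + 2 * pi * k \<in> J))"
  proof (cases "max_shift y' \<ge> 0")
    case True
    have "\<exists>\<tau>>0. max_shift (ray \<tau> \<phi> \<odot> y') > 0" for \<phi>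
    proof (cases "max_shift y' = 0")
      case True
      then show ?thesis using ray_reach[of y' \<phi>] pi_gt_zero by simp
    next
      case False
      then have "max_shift y' > 0" using True by simp
      then show ?thesis using ray_mono(1)[of 0 1 \<phi> y'] by (intro exI[of _ 1]) simp
    qed
    then show ?thesis by (intro exI[of _ UNIV]) auto
  next
    case False
    then have M: "- pi < max_shift y'" "max_shift y' < 0" using y' by (auto simp: shift_range_def)
    define p where "p = Arg (snd (toS y'))"
    define J where "J = {\<phi>. \<bar>\<phi> - p\<bar> \<le> pi \<and> rslope \<phi> y' > 0}"
    have rs: "rslope \<phi> y' = cmod (snd y') * cos (\<phi> - p) - Im (fst (toS y'))" for \<phi>
    proof -
      have "cnj (snd (toS y')) = complex_of_real (cmod (snd y')) * cis (- p)"
        using arg_cong[OF cis_Arg_cmod[of "snd (toS y')"], of cnj] by (simp add: cmod_snd_toS p_def cis_cnj)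
      then have "cis \<phi> * cnj (snd (toS y')) = complex_of_real (cmod (snd y')) * (cis \<phi> * cis (- p))"
        by (simp only: mult.left_commute)
      also have "\<dots> = complex_of_real (cmod (snd y')) * cis (\<phi> - p)" by (simp only: cis_mult) simp
      finally show ?thesis by (simp add: rslope_def)
    qed
    have "p \<in> J" using rslope_max[OF M] by (simp add: J_def rs)
    moreover have "connected J"
    proof -
      have "is_interval J"
        unfolding is_interval_1
      proof (intro ballI allI impI)
        fix u v w assume u: "u \<in> J" and v: "v \<in> J" and w: "u \<le> w \<and> w \<le> v"
        have "\<exists>q\<in>{u, v}. \<bar>w - p\<bar> \<le> \<bar>q - p\<bar>" using w by auto
        then obtain q where q: "q \<in> J" "\<bar>w - p\<bar> \<le> \<bar>q - p\<bar>" using u v by auto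
        then have "cos \<bar>q - p\<bar> \<le> cos \<bar>w - p\<bar>" by (intro cos_monotone_0_pi_le) (auto simp: J_def)
        then have "rslope q y' \<le> rslope w y'" by (simp add: rs mult_left_mono)
        then show "w \<in> J" using q by (auto simp: J_def)
      qed
      then show ?thesis by (simp add: is_interval_connected_1)
    qed
    moreover have "\<forall>\<phi>\<in>J. \<exists>\<tau>>0. max_shift (ray \<tau> \<phi> \<odot> y') > 0"
      using ray_reach[of y'] M by (auto simp: J_def)
    moreover have "\<exists>k::int. \<phi> + 2 * pi * k \<in> J" if ex: "\<exists>\<tau>>0. max_shift (ray \<tau> \<phi> \<odot> y') > 0" for \<phi>
    proof -
      define k where "k = - \<lfloor>(\<phi> - p + pi) / (2 * pi)\<rfloor>"
      define q where "q = (\<phi> - p + pi) / (2 * pi)"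
      have q: "\<phi> - p + pi = q * (2 * pi)" by (simp add: q_def)
      have "q + of_int k \<ge> 0" "q + of_int k \<le> 1" unfolding k_def q_def[symmetric] by linarith+
      then have "(q + of_int k) * (2 * pi) \<ge> 0" "(q + of_int k) * (2 * pi) \<le> 1 * (2 * pi)"
        by (intro mult_nonneg_nonneg mult_right_mono; simp)+
      then have "\<bar>\<phi> + 2 * pi * k - p\<bar> \<le> pi" using q by (simp add: algebra_simps abs_le_iff)
      moreover have "\<exists>\<tau>>0. max_shift (ray \<tau> (\<phi> + 2 * pi * k) \<odot> y') > 0" using ex by (simp only: ray_periodic)
      then have "rslope (\<phi> + 2 * pi * k) y' > 0" using ray_reach[of y' "\<phi> + 2 * pi * k"] M by auto
      ultimately show ?thesis by (auto simp: J_def)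
    qed
    ultimately show ?thesis by (intro exI[of _ J]) blast
  qed
  then obtain J where J: "connected J" "J \<noteq> {}" "\<And>\<phi>. \<phi> \<in> J \<Longrightarrow> \<exists>\<tau>>0. max_shift (ray \<tau> \<phi> \<odot> y') > pi * of_int 0"
    "\<And>\<phi>. \<exists>\<tau>>0. max_shift (ray \<tau> \<phi> \<odot> y') > 0 \<Longrightarrow> \<exists>k::int. \<phi> + 2 * pi * k \<in> J" by auto
  let ?P = "{(\<tau>, \<phi>). \<tau> > 0 \<and> \<phi> \<in> J \<and> ray \<tau> \<phi> \<odot> y' \<in> shift_range (a - b) 0}"
  have my: "min_shift y' < pi * of_int (a - b)" using y' by (simp add: shift_range_def)
  note P = ray_region[OF J(1,2) _ my J(3)]
  have img: "{x \<in> Parabolics 1. x \<odot> y \<in> shift_range a b} = (\<lambda>(\<tau>, \<phi>). ray \<tau> \<phi>) ` ?P"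
  proof (intro equalityI subsetI)
    fix x assume x: "x \<in> {x \<in> Parabolics 1. x \<odot> y \<in> shift_range a b}"
    define \<tau> \<phi> where "\<tau> = cmod (snd x)" and "\<phi> = Arg (snd x) + arctan (cmod (snd x))"
    have "x = parab 1 (snd x)" using x by (auto simp: Parabolics_def parab_def)
    then have xr: "x = ray \<tau> \<phi>" unfolding \<tau>_def \<phi>_def by (simp only: parab_eq_ray[symmetric])
    have t: "\<tau> > 0" using x by (auto simp: Parabolics_iff \<tau>_def)
    have D: "ray \<tau> \<phi> \<odot> y' \<in> shift_range (a - b) 0" using x xy'[of x] by (simp add: xr)
    then have "max_shift (ray \<tau> \<phi> \<odot> y') > 0" by (simp add: shift_range_def)
    then obtain k :: int where k: "\<phi> + 2 * pi * k \<in> J" using J(4) t by blast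
    then have "(\<tau>, \<phi> + 2 * pi * k) \<in> ?P" using D t by (simp add: ray_periodic)
    then show "x \<in> (\<lambda>(\<tau>, \<phi>). ray \<tau> \<phi>) ` ?P" using xr by (force simp: ray_periodic intro: rev_image_eqI)
  next
    fix x assume "x \<in> (\<lambda>(\<tau>, \<phi>). ray \<tau> \<phi>) ` ?P"
    then show "x \<in> {x \<in> Parabolics 1. x \<odot> y \<in> shift_range a b}" using xy' by (auto simp: ray_in_Parabolics)
  qed
  show "connected {x \<in> Parabolics 1. x \<odot> y \<in> shift_range a b}"
    unfolding img by (rule connected_continuous_image)
      (use P(1) ba in \<open>auto simp: case_prod_beta intro!: continuous_intros\<close>)
  show "{x \<in> Parabolics 1. x \<odot> y \<in> shift_range a b} \<noteq> {}"
    unfolding img using P(2) ba by simp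
qed


lemma open_connected_delete:
  fixes S :: "'a::euclidean_space set"
  assumes "open S" "connected S" "S \<noteq> {}" "2 \<le> DIM('a)"
  shows "open (S - {a})" "connected (S - {a})" "S - {a} \<noteq> {}"
proof -
  show "open (S - {a})" using assms(1) by (rule open_delete)
  show "connected (S - {a})" using connected_open_delete assms by blast
  show "S - {a} \<noteq> {}"
  proof
    assume "S - {a} = {}"
    then have "S = {a}" using assms(3) by blast
    then show False using assms(1) by (simp add: not_open_singleton)
  qed
qed

definition peel :: "cov set \<Rightarrow> int \<Rightarrow> int \<Rightarrow> bool" where
  "peel S u l \<longleftrightarrow>
    (\<forall>a b x y. x \<in> S \<longrightarrow> x \<odot> y \<in> shift_range a b \<longrightarrow> y \<in> shift_range (a + u) (b - l)) \<and>
    (\<forall>a b y e. b < a \<longrightarrow> y \<in> shift_range (a + u) (b - l) \<longrightarrow>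
       connected {x \<in> S. x \<odot> y \<in> shift_range a b \<and> x \<odot> y \<noteq> e} \<and> {x \<in> S. x \<odot> y \<in> shift_range a b \<and> x \<odot> y \<noteq> e} \<noteq> {})"

lemma continuous_on_parab1 [continuous_intros]: "continuous_on S (parab s)"
  unfolding parab_def by (intro continuous_intros)

lemma eq_cmul_cinv: "x \<odot> y = e \<longleftrightarrow> x = e \<odot> cinv y"
  by (metis cinv_left cmul_assoc cmul_one(2) cinv_right)

lemma peel_Parabolics1: "peel (Parabolics 1) 0 1"
  unfolding peel_def
proof (intro conjI allI impI)
  fix a b x y assume x: "x \<in> Parabolics 1" and xy: "x \<odot> y \<in> shift_range a b"
  have "x = parab 1 (snd x)" using x by (auto simp: Parabolics_def parab_def)
  then have "min_shift x \<ge> - (pi * of_int 0)" "max_shift x < pi * of_int 1"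
    using parab_one_bounds(1,2)[of "snd x"] by simp_all
  from shift_range_mul_imp[OF xy this] show "y \<in> shift_range (a + 0) (b - 1)" .
next
  fix a b :: int and y e :: cov assume ba: "b < a" and y: "y \<in> shift_range (a + 0) (b - 1)"
  define F where "F = {x \<in> Parabolics 1. x \<odot> y \<in> shift_range a b}"
  have F: "connected F" "F \<noteq> {}" using Parabolics_fibre_connected[OF ba] y by (auto simp: F_def)
  define V where "V = {\<eta>. \<eta> \<noteq> 0 \<and> parab 1 \<eta> \<odot> y \<in> shift_range a b}"
  have VF: "V = snd ` F" by (force simp: V_def F_def Parabolics_def parab_def image_iff)
  have FV: "F = parab 1 ` V" by (auto simp: V_def F_def Parabolics_def)
  have V: "connected V" "V \<noteq> {}" unfolding VF using F by (auto intro!: connected_continuous_image continuous_intros)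
  have "V = - {0} \<inter> {\<eta>. parab 1 \<eta> \<odot> y \<in> shift_range a b}" by (auto simp: V_def)
  moreover have "open ((\<lambda>\<eta>. parab 1 \<eta> \<odot> y) -` shift_range a b)"
    by (intro open_vimage[OF open_shift_range] continuous_intros)
  ultimately have oV: "open V" by (auto simp: vimage_def intro!: open_Int)
  define x0 where "x0 = e \<odot> cinv y"
  have G: "{x \<in> Parabolics 1. x \<odot> y \<in> shift_range a b \<and> x \<odot> y \<noteq> e} = F - {x0}"
    by (auto simp: F_def x0_def eq_cmul_cinv)
  have "connected (F - {x0}) \<and> F - {x0} \<noteq> {}"
  proof (cases "x0 \<in> F")
    case False
    then show ?thesis using F by simp
  next
    case True
    then have x0: "x0 = parab 1 (snd x0)" unfolding FV by (auto simp: parab_def)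
    have "inj_on (parab 1) UNIV" by (simp add: inj_on_def parab_def)
    then have "F - {x0} = parab 1 ` (V - {snd x0})"
      unfolding FV by (subst x0) (simp add: image_set_diff)
    moreover have "connected (V - {snd x0})" "V - {snd x0} \<noteq> {}"
      using open_connected_delete[OF oV V] by auto
    ultimately show ?thesis by (auto intro!: connected_continuous_image continuous_intros)
  qed
  then show "connected {x \<in> Parabolics 1. x \<odot> y \<in> shift_range a b \<and> x \<odot> y \<noteq> e}" "{x \<in> Parabolics 1. x \<odot> y \<in> shift_range a b \<and> x \<odot> y \<noteq> e} \<noteq> {}"
    unfolding G by auto
qed

lemma crefl_Parabolics: "crefl x \<in> Parabolics s \<longleftrightarrow> x \<in> Parabolics (- s)"
  by (auto simp: Parabolics_iff crefl_def)

lemma peel_refl: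
  assumes "peel S u l" shows "peel (crefl ` S) l u"
  unfolding peel_def
proof (intro conjI allI impI)
  fix a b x y assume x: "x \<in> crefl ` S" and xy: "x \<odot> y \<in> shift_range a b"
  then have "crefl x \<in> S" by auto
  moreover have "crefl x \<odot> crefl y \<in> shift_range (- b) (- a)" using xy by (simp add: crefl_mul[symmetric] shift_range_refl)
  ultimately have "crefl y \<in> shift_range (- b + u) (- a - l)" using assms unfolding peel_def by blast
  then have "y \<in> shift_range (- (- a - l)) (- (- b + u))" by (simp only: shift_range_refl)
  then show "y \<in> shift_range (a + l) (b - u)" by (simp add: algebra_simps)
next
  fix a b :: int and y e :: cov assume ba: "b < a" and y: "y \<in> shift_range (a + l) (b - u)"
  have "crefl y \<in> shift_range (- b + u) (- a - l)" unfolding shift_range_refl using y by (simp add: algebra_simps)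
  moreover have "- a < - b" using ba by simp
  ultimately have c: "connected {x \<in> S. x \<odot> crefl y \<in> shift_range (- b) (- a) \<and> x \<odot> crefl y \<noteq> crefl e}"
    "{x \<in> S. x \<odot> crefl y \<in> shift_range (- b) (- a) \<and> x \<odot> crefl y \<noteq> crefl e} \<noteq> {}"
    using assms unfolding peel_def by blast+
  have e: "{x \<in> crefl ` S. x \<odot> y \<in> shift_range a b \<and> x \<odot> y \<noteq> e} =
    crefl ` {x \<in> S. x \<odot> crefl y \<in> shift_range (- b) (- a) \<and> x \<odot> crefl y \<noteq> crefl e}"
  proof (intro equalityI subsetI)
    fix x assume "x \<in> {x \<in> crefl ` S. x \<odot> y \<in> shift_range a b \<and> x \<odot> y \<noteq> e}"
    then have x: "x \<in> crefl ` S" "x \<odot> y \<in> shift_range a b" "x \<odot> y \<noteq> e" by auto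
    have "crefl x \<odot> crefl y = crefl (x \<odot> y)" by (simp add: crefl_mul)
    then have "crefl x \<in> {x \<in> S. x \<odot> crefl y \<in> shift_range (- b) (- a) \<and> x \<odot> crefl y \<noteq> crefl e}"
      using x by (auto simp: shift_range_refl)
    then show "x \<in> crefl ` {x \<in> S. x \<odot> crefl y \<in> shift_range (- b) (- a) \<and> x \<odot> crefl y \<noteq> crefl e}"
      by (rule image_eqI[rotated]) simp
  next
    fix x assume "x \<in> crefl ` {x \<in> S. x \<odot> crefl y \<in> shift_range (- b) (- a) \<and> x \<odot> crefl y \<noteq> crefl e}"
    then obtain v where v: "x = crefl v" "v \<in> S" "v \<odot> crefl y \<in> shift_range (- b) (- a)" "v \<odot> crefl y \<noteq> crefl e" by auto
    have "x \<odot> y = crefl (v \<odot> crefl y)" by (simp add: v crefl_mul)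
    then have "x \<odot> y \<in> shift_range a b" "x \<odot> y \<noteq> e" using v by (auto simp: shift_range_refl)
    then show "x \<in> {x \<in> crefl ` S. x \<odot> y \<in> shift_range a b \<and> x \<odot> y \<noteq> e}" using v by auto
  qed
  show "connected {x \<in> crefl ` S. x \<odot> y \<in> shift_range a b \<and> x \<odot> y \<noteq> e}" "{x \<in> crefl ` S. x \<odot> y \<in> shift_range a b \<and> x \<odot> y \<noteq> e} \<noteq> {}"
    unfolding e using c by (auto intro!: connected_continuous_image continuous_intros)
qed

lemma peel_Parabolics: assumes "s = 1 \<or> s = - 1" shows "peel (Parabolics s) (if s = 1 then 0 else 1) (if s = 1 then 1 else 0)"
proof -
  have "crefl ` Parabolics 1 = Parabolics (- 1)"
  proof (intro equalityI subsetI)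
    fix x assume "x \<in> Parabolics (- 1)"
    then have "crefl x \<in> Parabolics 1" by (simp add: crefl_Parabolics)
    then show "x \<in> crefl ` Parabolics 1" by (rule image_eqI[rotated]) simp
  qed (auto simp: crefl_Parabolics)
  then show ?thesis using peel_Parabolics1 peel_refl[OF peel_Parabolics1] assms by auto
qed

section \<open>Multiplying by a commutator\<close>

lemma rot_split: "x = (fst x, 0) \<odot> (0, snd x)" by (simp add: rot_left)

text \<open>The condition on \<open>\<eta>\<close> below is that a fixed-point free range of rotations
  remains; it only involves the parabolic elements with the same \<open>\<eta>\<close>.\<close>

lemma shift_range1_base:
  assumes ba: "b < a" and y: "y \<in> shift_range (a + 2) (b - 2)"
  defines "V \<equiv> {\<eta>. max_shift (parab 1 \<eta> \<odot> y) > pi * of_int (b - 1) \<and> min_shift (parab (- 1) \<eta> \<odot> y) < pi * of_int (a + 1)}"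
  shows "connected V \<and> V \<noteq> {}"
proof -
  have up: "max_shift (parab 1 \<eta> \<odot> y) \<ge> max_shift y" and dn: "min_shift (parab (- 1) \<eta> \<odot> y) \<le> min_shift y" for \<eta>
    using max_shift_mul(3)[of "parab 1 \<eta>" y] max_shift_mul(6)[of "parab (- 1) \<eta>" y] parab_one_bounds[of \<eta>] by linarith+
  have mM: "min_shift y \<le> max_shift y" by (rule min_shift_le_max_shift)
  have ineq: "pi * of_int (b - 1) < pi * of_int (a + 1)" using ba by simp
  consider "max_shift y > pi * of_int (b - 1)" "min_shift y < pi * of_int (a + 1)"
    | "max_shift y \<le> pi * of_int (b - 1)" | "min_shift y \<ge> pi * of_int (a + 1)" by linarith
  then show ?thesis
  proof cases
    case 1
    then have "V = UNIV" using up dn unfolding V_def by (auto intro: less_le_trans le_less_trans)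
    then show ?thesis by (simp add: convex_connected)
  next
    case 2
    have key: "V = {\<eta>. max_shift (parab 1 \<eta> \<odot> y) > pi * of_int (b - 1)}"
    proof -
      have "min_shift (parab (- 1) \<eta> \<odot> y) < pi * of_int (a + 1)" for \<eta> using 2 dn[of \<eta>] mM ineq by linarith
      then show ?thesis by (auto simp: V_def)
    qed
    have big: "min_shift (parab 1 \<eta> \<odot> y) < pi * of_int (b + 3)" for \<eta>
    proof -
      have "min_shift (parab 1 \<eta> \<odot> y) \<le> max_shift (parab 1 \<eta>) + min_shift y" by (rule max_shift_mul(6))
      also have "\<dots> < pi + pi * of_int (b - 1)" using parab_one_bounds(2)[of \<eta>] 2 mM by linarith
      also have "\<dots> \<le> pi * of_int (b + 3)" by (simp add: algebra_simps)
      finally show ?thesis .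
    qed
    have z: "\<eta> \<noteq> 0" if "\<eta> \<in> V" for \<eta> using that 2 by (auto simp: key parab_def)
    have yD: "y \<in> shift_range (b + 3) (b - 1 - 1)"
    proof -
      have "pi * of_int (b - 1) < pi * of_int (b + 3)" by simp
      then have "min_shift y < pi * of_int (b + 3)" using 2 mM by linarith
      then show ?thesis using y by (simp add: shift_range_def)
    qed
    have "V = snd ` {x \<in> Parabolics 1. x \<odot> y \<in> shift_range (b + 3) (b - 1)}"
      using z big by (force simp: key shift_range_def Parabolics_def image_iff parab_def)
    moreover have "connected {x \<in> Parabolics 1. x \<odot> y \<in> shift_range (b + 3) (b - 1)}" "{x \<in> Parabolics 1. x \<odot> y \<in> shift_range (b + 3) (b - 1)} \<noteq> {}"
      by (rule Parabolics_fibre_connected; use yD in simp)+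
    ultimately show ?thesis by (auto intro!: connected_continuous_image continuous_intros)
  next
    case 3
    let ?y = "crefl y"
    have key: "V = {\<eta>. min_shift (parab (- 1) \<eta> \<odot> y) < pi * of_int (a + 1)}"
    proof -
      have "max_shift (parab 1 \<eta> \<odot> y) > pi * of_int (b - 1)" for \<eta> using 3 up[of \<eta>] mM ineq by linarith
      then show ?thesis by (auto simp: V_def)
    qed
    have rr: "min_shift (parab (- 1) \<eta> \<odot> y) = - max_shift (parab 1 (cnj \<eta>) \<odot> ?y)" for \<eta>
      using max_shift_refl(1)[of "parab (- 1) \<eta> \<odot> y"] by (simp add: crefl_mul crefl_parab)
    have key2: "V = {\<eta>. max_shift (parab 1 (cnj \<eta>) \<odot> ?y) > pi * of_int (- a - 1)}"
      unfolding key rr by (auto simp: algebra_simps)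
    have M: "max_shift ?y \<le> pi * of_int (- a - 1)" using 3 by (simp add: max_shift_refl algebra_simps)
    have big: "min_shift (parab 1 \<eta> \<odot> ?y) < pi * of_int (- a + 3)" for \<eta>
    proof -
      have "min_shift (parab 1 \<eta> \<odot> ?y) \<le> max_shift (parab 1 \<eta>) + min_shift ?y" by (rule max_shift_mul(6))
      also have "\<dots> < pi + pi * of_int (- a - 1)" using parab_one_bounds(2)[of \<eta>] M min_shift_le_max_shift[of ?y] by linarith
      also have "\<dots> \<le> pi * of_int (- a + 3)" by (simp add: algebra_simps)
      finally show ?thesis .
    qed
    have z: "\<eta> \<noteq> 0" if "\<eta> \<in> V" for \<eta> using that M by (auto simp: key2 parab_def)
    have yD: "?y \<in> shift_range (- a + 3) (- a - 1 - 1)"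
    proof -
      have "pi * of_int (- a - 1) < pi * of_int (- a + 3)" by simp
      then have "min_shift ?y < pi * of_int (- a + 3)" using M min_shift_le_max_shift[of ?y] by linarith
      moreover have "max_shift ?y > pi * of_int (- a - 1 - 1)" using y by (simp add: shift_range_def max_shift_refl algebra_simps)
      ultimately show ?thesis by (simp add: shift_range_def)
    qed
    let ?F = "{x \<in> Parabolics 1. x \<odot> ?y \<in> shift_range (- a + 3) (- a - 1)}"
    have "V = (\<lambda>x. cnj (snd x)) ` ?F"
    proof (intro equalityI subsetI)
      fix \<eta> assume e: "\<eta> \<in> V"
      then have "parab 1 (cnj \<eta>) \<in> ?F" using z[OF e] big[of "cnj \<eta>"] by (auto simp: key2 shift_range_def Parabolics_def)
      then show "\<eta> \<in> (\<lambda>x. cnj (snd x)) ` ?F" by (force simp: parab_def intro: rev_image_eqI)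
    next
      fix \<eta> assume "\<eta> \<in> (\<lambda>x. cnj (snd x)) ` ?F"
      then show "\<eta> \<in> V" by (auto simp: key2 shift_range_def Parabolics_def parab_def)
    qed
    moreover have "connected ?F" "?F \<noteq> {}"
      by (rule Parabolics_fibre_connected; use yD in simp)+
    ultimately show ?thesis by (auto intro!: connected_continuous_image continuous_intros)
  qed
qed

lemma shift_range1_fibre_connected:
  assumes ba: "b < a" and y: "y \<in> shift_range (a + 2) (b - 2)"
  defines "F \<equiv> {x \<in> shift_range 1 (- 1). x \<odot> y \<in> shift_range a b}"
  shows "connected F \<and> F \<noteq> {} \<and> open F"
proof -
  define V where "V = {\<eta>. max_shift (parab 1 \<eta> \<odot> y) > pi * of_int (b - 1) \<and> min_shift (parab (- 1) \<eta> \<odot> y) < pi * of_int (a + 1)}"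
  have V: "connected V" "V \<noteq> {}" using shift_range1_base[OF ba y] by (auto simp: V_def)
  define u where "u \<eta> = (0::real, \<eta>::complex) \<odot> y" for \<eta>
  have xy: "x \<odot> y = (fst x + fst (u (snd x)), snd (u (snd x)))" for x
  proof -
    have "x \<odot> y = (fst x, 0) \<odot> u (snd x)" unfolding u_def by (subst rot_split) (simp only: cmul_assoc)
    then show ?thesis by (simp add: rot_left)
  qed
  have pu: "parab s \<eta> \<odot> y = (of_int s * arctan (cmod \<eta>) + fst (u \<eta>), snd (u \<eta>))" for s \<eta>
    using xy[of "parab s \<eta>"] by (simp add: parab_def)
  define lo where "lo \<eta> = max (- pi - arctan (cmod \<eta>)) (pi * of_int b - max_shift (u \<eta>))" for \<eta>
  define hi where "hi \<eta> = min (pi + arctan (cmod \<eta>)) (pi * of_int a - min_shift (u \<eta>))" for \<eta>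
  have F: "x \<in> F \<longleftrightarrow> lo (snd x) < fst x \<and> fst x < hi (snd x)" for x
    unfolding F_def mem_Collect_eq xy by (auto simp: shift_range_def min_shift_def max_shift_def lo_def hi_def)
  have VF: "\<eta> \<in> V \<longleftrightarrow> lo \<eta> < hi \<eta>" for \<eta>
  proof -
    have "pi * of_int b < pi * of_int a" using ba by simp
    have e1: "max_shift (parab 1 \<eta> \<odot> y) = arctan (cmod \<eta>) + max_shift (u \<eta>)" "min_shift (parab (- 1) \<eta> \<odot> y) = min_shift (u \<eta>) - arctan (cmod \<eta>)"
      by (simp_all add: pu max_shift_def min_shift_def)
    have e2: "pi * of_int (b - 1) = pi * of_int b - pi" "pi * of_int (a + 1) = pi * of_int a + pi"
      by (simp_all add: algebra_simps)
    show ?thesis using \<open>pi * of_int b < pi * of_int a\<close> min_shift_le_max_shift[of "u \<eta>"] arctan_norm_bounds(1)[of \<eta>] pi_gt_zero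
      unfolding V_def mem_Collect_eq e1 e2 lo_def hi_def max_less_iff_conj min_less_iff_conj by linarith
  qed
  have img: "V = snd ` F"
  proof (intro equalityI subsetI)
    fix \<eta> assume "\<eta> \<in> V"
    then obtain t where "lo \<eta> < t" "t < hi \<eta>" using VF dense by blast
    then have "(t, \<eta>) \<in> F" by (simp add: F)
    then show "\<eta> \<in> snd ` F" by force
  next
    fix \<eta> assume "\<eta> \<in> snd ` F"
    then show "\<eta> \<in> V" by (auto simp: F VF)
  qed
  have "F = shift_range 1 (- 1) \<inter> (\<lambda>x. x \<odot> y) -` shift_range a b" by (auto simp: F_def)
  moreover have "open ((\<lambda>x. x \<odot> y) -` shift_range a b)" by (intro open_vimage[OF open_shift_range] continuous_intros)
  ultimately have oF: "open F" by (auto intro: open_Int open_shift_range)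
  have "connected F"
  proof (rule connected_if_loc_const)
    fix \<kappa> :: "cov \<Rightarrow> bool" assume loc_const: "loc_const F \<kappa>"
    have fib: "\<kappa> s = \<kappa> t" if st: "s \<in> F" "t \<in> F" "snd s = snd t" for s t
    proof -
      obtain t1 t2 \<eta> where e: "s = (t1, \<eta>)" "t = (t2, \<eta>)" using st(3) by (metis prod.collapse)
      have "\<kappa> (t1, \<eta>) = \<kappa> (t2, \<eta>)"
        by (rule loc_const_path[OF loc_const, where \<gamma> = "\<lambda>t. (t, \<eta>)" and S = "{lo \<eta><..<hi \<eta>}"])
          (use st e F in \<open>auto intro!: continuous_intros\<close>)
      then show ?thesis by (simp add: e)
    qed
    have sec: "\<exists>\<sigma>. (\<sigma> \<longlongrightarrow> s) (at (snd s) within V) \<and> (\<forall>\<^sub>F w in at (snd s) within V. \<sigma> w \<in> F \<and> snd (\<sigma> w) = w)"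
      if s: "s \<in> F" for s
    proof -
      have l: "((\<lambda>w. (fst s, w)) \<longlongrightarrow> (fst s, snd s)) (at (snd s) within V)" by (intro tendsto_intros)
      have "\<forall>\<^sub>F w in at (snd s) within V. (fst s, w) \<in> F"
        by (rule topological_tendstoD[OF l oF]) (use s in auto)
      with l show ?thesis by (intro exI[of _ "\<lambda>w. (fst s, w)"]) simp
    qed
    obtain \<kappa>' where k: "loc_const V \<kappa>'" "\<And>s. s \<in> F \<Longrightarrow> \<kappa> s = \<kappa>' (snd s)"
      using loc_const_fibre[OF loc_const fib sec img] by blast
    obtain j where "j \<in> V" using V(2) by blast
    have "\<kappa> s = \<kappa>' j" if s: "s \<in> F" for s
    proof -
      have "snd s \<in> V" using s img by auto
      then show ?thesis using k(2)[OF s] loc_const_connected[OF V(1) k(1) _ \<open>j \<in> V\<close>] by simp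
    qed
    then show "\<exists>c. \<forall>s\<in>F. \<kappa> s = c" by blast
  qed
  then show ?thesis using oF img V(2) by auto
qed

lemma peel_shift_range1: "peel (shift_range 1 (- 1) - {cid}) 2 2"
  unfolding peel_def
proof (intro conjI allI impI)
  fix a b x y assume "x \<in> shift_range 1 (- 1) - {cid}" "x \<odot> y \<in> shift_range a b"
  then show "y \<in> shift_range (a + 2) (b - 2)" using shift_range1_mul_imp by blast
next
  fix a b :: int and y e :: cov assume ba: "b < a" and y: "y \<in> shift_range (a + 2) (b - 2)"
  define F where "F = {x \<in> shift_range 1 (- 1). x \<odot> y \<in> shift_range a b}"
  have F: "open F" "connected F" "F \<noteq> {}" using shift_range1_fibre_connected[OF ba y] by (auto simp: F_def)
  have dim: "2 \<le> DIM(cov)" by simp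
  note F1 = open_connected_delete[OF F dim, of cid]
  note F2 = open_connected_delete[OF F1 dim, of "e \<odot> cinv y"]
  have "{x \<in> shift_range 1 (- 1) - {cid}. x \<odot> y \<in> shift_range a b \<and> x \<odot> y \<noteq> e} = F - {cid} - {e \<odot> cinv y}"
    by (auto simp: F_def eq_cmul_cinv)
  then show "connected {x \<in> shift_range 1 (- 1) - {cid}. x \<odot> y \<in> shift_range a b \<and> x \<odot> y \<noteq> e}"
    "{x \<in> shift_range 1 (- 1) - {cid}. x \<odot> y \<in> shift_range a b \<and> x \<odot> y \<noteq> e} \<noteq> {}" using F2 by auto
qed

section \<open>Words with a prescribed product\<close>

lemma tendsto_coord: "(f \<longlongrightarrow> l) F \<Longrightarrow> ((\<lambda>t. f t k) \<longlongrightarrow> l k) F"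
  for f :: "'c \<Rightarrow> 'a \<Rightarrow> 'b::topological_space"
  using continuous_on_tendsto_compose[OF continuous_on_product_coordinates[of k], of f l F]
  by (simp add: eventually_True)

lemma tendsto_from_coords:
  fixes f :: "'c \<Rightarrow> 'a \<Rightarrow> 'b::topological_space"
  assumes "\<And>k. ((\<lambda>t. f t k) \<longlongrightarrow> l k) F"
  shows "(f \<longlongrightarrow> l) F"
proof -
  have "limitin (product_topology (\<lambda>_. euclidean) UNIV) f l F"
    using assms by (simp add: limitin_componentwise)
  then show ?thesis by (simp add: euclidean_product_topology)
qed

lemma tendsto_fun_upd:
  fixes f :: "'c \<Rightarrow> 'a \<Rightarrow> 'b::topological_space"
  assumes "(f \<longlongrightarrow> l) F" "(g \<longlongrightarrow> c) F"
  shows "((\<lambda>t. (f t)(k := g t)) \<longlongrightarrow> l(k := c)) F"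
  by (rule tendsto_from_coords) (use assms tendsto_coord in auto)

lemma continuous_on_fun_upd [continuous_intros]:
  fixes f :: "'c::topological_space \<Rightarrow> 'a \<Rightarrow> 'b::topological_space"
  shows "continuous_on S f \<Longrightarrow> continuous_on S g \<Longrightarrow> continuous_on S (\<lambda>t. (f t)(k := g t))"
  by (simp add: continuous_on_def tendsto_fun_upd)

lemma continuous_on_coord:
  fixes f :: "'c::topological_space \<Rightarrow> 'a \<Rightarrow> 'b::topological_space"
  shows "continuous_on S f \<Longrightarrow> continuous_on S (\<lambda>t. f t k)"
  by (simp add: continuous_on_def tendsto_coord)

definition wlist :: "cov list \<Rightarrow> cov" where "wlist xs = foldr (\<odot>) xs cid"

lemma wlist_simps [simp]: "wlist [] = cid" "wlist (x # xs) = x \<odot> wlist xs"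
  by (simp_all add: wlist_def)

lemma wlist_append: "wlist (xs @ ys) = wlist xs \<odot> wlist ys"
  by (induction xs) (simp_all add: cmul_assoc)

definition wprod :: "(nat \<Rightarrow> cov) \<Rightarrow> nat \<Rightarrow> nat \<Rightarrow> cov" where
  "wprod y i m = wlist (map y [i..<m])"

lemma wprod_rec: "i < m \<Longrightarrow> wprod y i m = y i \<odot> wprod y (Suc i) m"
  by (simp add: wprod_def upt_conv_Cons)

lemma wprod_empty [simp]: "m \<le> i \<Longrightarrow> wprod y i m = cid" by (simp add: wprod_def)

lemma wprod_cong: "(\<And>k. i \<le> k \<Longrightarrow> k < m \<Longrightarrow> y k = y' k) \<Longrightarrow> wprod y i m = wprod y' i m"
  unfolding wprod_def by (rule arg_cong[of _ _ wlist]) simp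

lemma tendsto_wlist: "(\<And>k. k \<in> set ks \<Longrightarrow> ((\<lambda>t. y t k) \<longlongrightarrow> l k) F) \<Longrightarrow> ((\<lambda>t. wlist (map (y t) ks)) \<longlongrightarrow> wlist (map l ks)) F"
  by (induction ks) (auto intro!: tendsto_intros)

lemma tendsto_wprod [tendsto_intros]: "(y \<longlongrightarrow> l) F \<Longrightarrow> ((\<lambda>t. wprod (y t) i m) \<longlongrightarrow> wprod l i m) F"
  unfolding wprod_def by (rule tendsto_wlist) (rule tendsto_coord)

lemma continuous_on_wprod [continuous_intros]: "continuous_on S y \<Longrightarrow> continuous_on S (\<lambda>t. wprod (y t) i m)"
  by (simp add: continuous_on_def tendsto_wprod)

lemma cid_shift_range: "cid \<in> shift_range a b \<longleftrightarrow> a > 0 \<and> b < 0"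
  by (simp add: shift_range_def min_shift_def max_shift_def zero_less_mult_iff mult_less_0_iff)

lemma central_not_shift_range: "central a \<notin> shift_range a b"
  by (simp add: shift_range_def central_def min_shift_def)

locale peeling =
  fixes S :: "nat \<Rightarrow> cov set" and U L :: "nat \<Rightarrow> int" and m :: nat
  assumes peel: "\<And>k. k < m \<Longrightarrow> peel (S k) (U k) (L k)"
    and nonneg: "\<And>k. U k \<ge> 0" "\<And>k. L k \<ge> 0"
begin

definition tails :: "nat \<Rightarrow> int \<Rightarrow> int \<Rightarrow> cov \<Rightarrow> (nat \<Rightarrow> cov) set" where
  "tails i a b e = {y. (\<forall>k. y k \<in> (if i \<le> k \<and> k < m then S k else {cid})) \<and> wprod y i m \<in> shift_range a b \<and> wprod y i m \<noteq> e}"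

lemma necessary:
  assumes "i \<le> m" "\<And>k. i \<le> k \<Longrightarrow> k < m \<Longrightarrow> y k \<in> S k" "wprod y i m \<in> shift_range a b"
  shows "cid \<in> shift_range (a + sum U {i..<m}) (b - sum L {i..<m})"
  using assms
proof (induction arbitrary: a b rule: inc_induct)
  case base
  then show ?case by simp
next
  case (step i)
  have "y i \<odot> wprod y (Suc i) m \<in> shift_range a b" using step.prems(2) step.hyps by (simp add: wprod_rec)
  moreover have "y i \<in> S i" using step by simp
  ultimately have "wprod y (Suc i) m \<in> shift_range (a + U i) (b - L i)" using peel[OF step.hyps(2)] unfolding peel_def by blast
  then have "cid \<in> shift_range (a + U i + sum U {Suc i..<m}) (b - L i - sum L {Suc i..<m})"
    using step.IH step.prems(1) by simp
  then show ?case using step.hyps by (simp add: sum.atLeast_Suc_lessThan algebra_simps)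
qed

lemma tails_connected:
  assumes "i \<le> m" "b < a" "cid \<in> shift_range (a + sum U {i..<m}) (b - sum L {i..<m})" "i < m \<or> e \<noteq> cid"
  shows "connected (tails i a b e) \<and> tails i a b e \<noteq> {}"
  using assms
proof (induction arbitrary: a b e rule: inc_induct)
  case base
  then have "tails m a b e = {\<lambda>_. cid}" by (auto simp: tails_def fun_eq_iff)
  then show ?case by simp
next
  case (step i)
  define e' where "e' = central (a + U i)"
  define tails' where "tails' = tails (Suc i) (a + U i) (b - L i) e'"
  have D': "cid \<in> shift_range (a + U i + sum U {Suc i..<m}) (b - L i - sum L {Suc i..<m})"
    using step.prems(2) step.hyps by (simp add: sum.atLeast_Suc_lessThan algebra_simps)
  have "Suc i < m \<or> e' \<noteq> cid"
  proof (rule disjCI)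
    assume "\<not> e' \<noteq> cid"
    then have "a + U i = 0" unfolding e'_def using central_inj[of "a + U i" 0] by simp
    then have "cid \<notin> shift_range (a + U i) (b - L i)" by (simp add: cid_shift_range)
    then have "{Suc i..<m} \<noteq> {}" using D' by (metis add.right_neutral diff_zero sum.empty)
    then show "Suc i < m" by simp
  qed
  moreover have "b - L i < a + U i" using step.prems(1) nonneg(1)[of i] nonneg(2)[of i] by linarith
  ultimately have tails': "connected tails'" "tails' \<noteq> {}" using step.IH D' by (auto simp: tails'_def)
  define F where "F w = {x \<in> S i. x \<odot> w \<in> shift_range a b \<and> x \<odot> w \<noteq> e}" for w
  have F: "connected (F w)" "F w \<noteq> {}" if "w \<in> shift_range (a + U i) (b - L i)" for w
    using peel[OF step.hyps(2)] that step.prems(1) unfolding peel_def F_def by blast+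
  have wu: "wprod (y(i := x)) (Suc i) m = wprod y (Suc i) m" for y x by (rule wprod_cong) auto
  have YD: "wprod y (Suc i) m \<in> shift_range (a + U i) (b - L i)" if "y \<in> tails'" for y
    using that by (auto simp: tails'_def tails_def)
  have in1: "y(i := x) \<in> tails i a b e" if y: "y \<in> tails'" and x: "x \<in> F (wprod y (Suc i) m)" for y x
  proof -
    have "(y(i := x)) k \<in> (if i \<le> k \<and> k < m then S k else {cid})" for k
    proof -
      have "y k \<in> (if Suc i \<le> k \<and> k < m then S k else {cid})" using y by (simp add: tails'_def tails_def)
      then show ?thesis using x step.hyps by (auto simp: F_def split: if_splits)
    qed
    moreover have "wprod (y(i := x)) i m = x \<odot> wprod y (Suc i) m" using step.hyps by (simp add: wprod_rec[of i] wu)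
    ultimately show ?thesis using x by (simp add: tails_def F_def)
  qed
  have in2: "y(i := cid) \<in> tails'" "y i \<in> F (wprod (y(i := cid)) (Suc i) m)" if y: "y \<in> tails i a b e" for y
  proof -
    have yi: "y i \<in> S i" using y step.hyps by (auto simp: tails_def dest: spec[of _ i])
    have D: "y i \<odot> wprod y (Suc i) m \<in> shift_range a b" "y i \<odot> wprod y (Suc i) m \<noteq> e"
      using y step.hyps by (auto simp: tails_def wprod_rec)
    then have w: "wprod y (Suc i) m \<in> shift_range (a + U i) (b - L i)" using peel[OF step.hyps(2)] yi unfolding peel_def by blast
    then have "wprod y (Suc i) m \<noteq> e'" using central_not_shift_range by (auto simp: e'_def)
    moreover have "\<forall>k. (y(i := cid)) k \<in> (if Suc i \<le> k \<and> k < m then S k else {cid})"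
    proof
      fix k
      have "y k \<in> (if i \<le> k \<and> k < m then S k else {cid})" using y by (simp add: tails_def)
      then show "(y(i := cid)) k \<in> (if Suc i \<le> k \<and> k < m then S k else {cid})"
        by (auto split: if_splits)
    qed
    ultimately show "y(i := cid) \<in> tails'" using w unfolding tails'_def tails_def by (simp add: wu)
    show "y i \<in> F (wprod (y(i := cid)) (Suc i) m)" using yi D by (simp add: F_def wu)
  qed
  have tails'i: "y i = cid" if "y \<in> tails'" for y using that by (auto simp: tails'_def tails_def dest: spec[of _ i])
  define f where "f y = y(i := cid)" for y :: "nat \<Rightarrow> cov"
  have img: "tails' = f ` tails i a b e"
  proof (intro equalityI subsetI)
    fix y assume y: "y \<in> tails'"
    then obtain x where "x \<in> F (wprod y (Suc i) m)" using F(2)[OF YD[OF y]] by blast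
    then have "y(i := x) \<in> tails i a b e" by (rule in1[OF y])
    moreover have "y = f (y(i := x))" using tails'i[OF y] by (auto simp: f_def)
    ultimately show "y \<in> f ` tails i a b e" by blast
  next
    fix y assume "y \<in> f ` tails i a b e"
    then show "y \<in> tails'" using in2 by (auto simp: f_def)
  qed
  have "connected (tails i a b e)"
  proof (rule connected_if_loc_const)
    fix \<kappa> :: "(nat \<Rightarrow> cov) \<Rightarrow> bool" assume loc_const: "loc_const (tails i a b e) \<kappa>"
    have fib: "\<kappa> s = \<kappa> t" if st: "s \<in> tails i a b e" "t \<in> tails i a b e" "f s = f t" for s t
    proof -
      let ?F = "F (wprod (f s) (Suc i) m)"
      have "\<kappa> ((f s)(i := s i)) = \<kappa> ((f s)(i := t i))"
      proof (rule loc_const_path[OF loc_const, where \<gamma> = "\<lambda>x. (f s)(i := x)" and S = ?F])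
        have fs: "f s \<in> tails'" using in2(1)[OF st(1)] by (simp add: f_def)
        show "connected ?F" by (rule F(1)[OF YD[OF fs]])
        show "continuous_on ?F (\<lambda>x. (f s)(i := x))" by (intro continuous_intros)
        show "(f s)(i := x) \<in> tails i a b e" if "x \<in> ?F" for x by (rule in1[OF fs that])
        show "s i \<in> ?F" using in2(2)[OF st(1)] by (simp add: f_def)
        show "t i \<in> ?F" unfolding st(3) using in2(2)[OF st(2)] by (simp add: f_def)
      qed
      moreover have "(f s)(i := s i) = s" "(f s)(i := t i) = t" unfolding f_def
        using st(3) by (auto simp: f_def fun_eq_iff split: if_splits)
      ultimately show ?thesis by simp
    qed
    have sec: "\<exists>\<sigma>. (\<sigma> \<longlongrightarrow> s) (at (f s) within tails') \<and> (\<forall>\<^sub>F w in at (f s) within tails'. \<sigma> w \<in> tails i a b e \<and> f (\<sigma> w) = w)"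
      if s: "s \<in> tails i a b e" for s
    proof -
      let ?F = "at (f s) within tails'"
      have "((\<lambda>w. w(i := s i)) \<longlongrightarrow> (f s)(i := s i)) ?F" by (intro tendsto_fun_upd tendsto_intros)
      moreover have "(f s)(i := s i) = s" by (auto simp: f_def)
      ultimately have l: "((\<lambda>w. w(i := s i)) \<longlongrightarrow> s) ?F" by simp
      have lw: "((\<lambda>w. s i \<odot> wprod w (Suc i) m) \<longlongrightarrow> s i \<odot> wprod (f s) (Suc i) m) ?F" by (intro tendsto_intros)
      have si: "s i \<in> F (wprod (f s) (Suc i) m)" using in2(2)[OF s] by (simp add: f_def)
      have op: "open (shift_range a b - {e})" by (intro open_delete open_shift_range)
      have "\<forall>\<^sub>F w in ?F. s i \<odot> wprod w (Suc i) m \<in> shift_range a b - {e}"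
        by (rule topological_tendstoD[OF lw op]) (use si in \<open>auto simp: F_def\<close>)
      moreover have "\<forall>\<^sub>F w in ?F. w \<in> tails'" by (auto simp: eventually_at_topological)
      ultimately have "\<forall>\<^sub>F w in ?F. w(i := s i) \<in> tails i a b e \<and> f (w(i := s i)) = w"
      proof eventually_elim
        case (elim w)
        then have "s i \<in> F (wprod w (Suc i) m)" using si by (simp add: F_def)
        then have "w(i := s i) \<in> tails i a b e" using elim by (intro in1) auto
        moreover have "f (w(i := s i)) = w" using tails'i[OF elim(2)] by (auto simp: f_def)
        ultimately show ?case by blast
      qed
      with l show ?thesis by blast
    qed
    obtain \<kappa>' where k: "loc_const tails' \<kappa>'" "\<And>s. s \<in> tails i a b e \<Longrightarrow> \<kappa> s = \<kappa>' (f s)"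
      using loc_const_fibre[OF loc_const fib sec img] by blast
    obtain j where j: "j \<in> tails'" using tails'(2) by blast
    have "\<kappa> s = \<kappa>' j" if s: "s \<in> tails i a b e" for s
      using k(2)[OF s] loc_const_connected[OF tails'(1) k(1) _ j, of "f s"] img s by simp
    then show "\<exists>c. \<forall>s\<in>tails i a b e. \<kappa> s = c" by blast
  qed
  moreover have "tails i a b e \<noteq> {}" using img tails'(2) by auto
  ultimately show ?case by blast
qed

definition tuples :: "int \<Rightarrow> (nat \<Rightarrow> cov) set" where
  "tuples n = {y. (\<forall>k. y k \<in> (if k < m then S k else {cid})) \<and> wprod y 0 m = central n}"

lemma tuples_connected:
  assumes m: "1 < m" and S0: "S 0 = shift_range 1 (- 1) - {cid}"
  shows "connected (tuples n)"
    and "0 < n + 1 + sum U {1..<m} \<Longrightarrow> n - 1 - sum L {1..<m} < 0 \<Longrightarrow> tuples n \<noteq> {}"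
proof -
  define e where "e = central n"
  define h where "h y = y(0 := central n \<odot> cinv (wprod y 1 m))" for y :: "nat \<Rightarrow> cov"
  let ?tails = "tails 1 (n + 1) (n - 1) e"
  have wu: "wprod (y(0 := x)) (Suc 0) m = wprod y (Suc 0) m" for y x by (rule wprod_cong) auto
  have mem: "central n \<odot> cinv w \<in> shift_range 1 (- 1) - {cid} \<longleftrightarrow> w \<in> shift_range (n + 1) (n - 1) \<and> w \<noteq> e" for w
  proof -
    have "central n \<odot> cinv w = cid \<longleftrightarrow> w = e" unfolding e_def by (metis cinv_inv cinv_right cinv_unique)
    then show ?thesis by (auto simp: shift_range_central shift_range_cinv algebra_simps)
  qed
  have WY: "tuples n = h ` ?tails"
  proof (intro equalityI subsetI)
    fix y assume y: "y \<in> tuples n"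
    have w0: "y 0 \<odot> wprod y 1 m = central n" using y m by (simp add: tuples_def wprod_rec)
    then have y0: "y 0 = central n \<odot> cinv (wprod y 1 m)" by (simp add: eq_cmul_cinv)
    have "y 0 \<in> S 0" using y m by (auto simp: tuples_def dest: spec[of _ 0])
    then have D: "wprod y 1 m \<in> shift_range (n + 1) (n - 1) \<and> wprod y 1 m \<noteq> e" using mem[of "wprod y 1 m"] y0 S0 by simp
    have "(y(0 := cid)) k \<in> (if 1 \<le> k \<and> k < m then S k else {cid})" for k
    proof -
      have "y k \<in> (if k < m then S k else {cid})" using y by (simp add: tuples_def)
      then show ?thesis by (auto split: if_splits)
    qed
    then have "y(0 := cid) \<in> ?tails" using D by (simp add: tails_def wu)
    moreover have "h (y(0 := cid)) = y" using y0 by (simp add: h_def wu fun_upd_idem)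
    ultimately show "y \<in> h ` ?tails" by (metis image_eqI)
  next
    fix y assume "y \<in> h ` ?tails"
    then obtain v where v: "v \<in> ?tails" "y = h v" by blast
    have "y k \<in> (if k < m then S k else {cid})" for k
    proof -
      have "v k \<in> (if 1 \<le> k \<and> k < m then S k else {cid})" using v(1) by (simp add: tails_def)
      moreover have "central n \<odot> cinv (wprod v 1 m) \<in> S 0" using v(1) mem S0 by (simp add: tails_def)
      ultimately show ?thesis using m by (auto simp: v(2) h_def)
    qed
    moreover have "wprod y 0 m = central n" using m by (simp add: wprod_rec v(2) h_def wu cmul_assoc)
    ultimately show "y \<in> tuples n" by (simp add: tuples_def)
  qed
  have conth: "continuous_on ?tails h" unfolding h_def by (intro continuous_intros)
  have nec: "cid \<in> shift_range (n + 1 + sum U {1..<m}) (n - 1 - sum L {1..<m})" if "y \<in> ?tails" for y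
    by (rule necessary[of 1 y]) (use that m in \<open>auto simp: tails_def split: if_splits dest!: spec\<close>)
  show "connected (tuples n)"
  proof (cases "?tails = {}")
    case True
    then show ?thesis by (simp add: WY)
  next
    case False
    then have "connected ?tails" using tails_connected[of 1 "n - 1" "n + 1" e] nec m by auto
    then show ?thesis unfolding WY using conth by (intro connected_continuous_image)
  qed
  show "tuples n \<noteq> {}" if "0 < n + 1 + sum U {1..<m}" "n - 1 - sum L {1..<m} < 0"
    using tails_connected[of 1 "n - 1" "n + 1" e] m that WY by (simp add: cid_shift_range)
qed

end

section \<open>Local sections of the commutator map\<close>

definition snorm :: "sq \<Rightarrow> sq" where "snorm s = (1 / sqrt (sdet s)) *\<^sub>R s"

lemma sdet_snorm: "sdet s > 0 \<Longrightarrow> sdet (snorm s) = 1"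
  by (simp add: snorm_def sdet_scaleR power_divide)

lemma snorm_eq [simp]: "sdet s = 1 \<Longrightarrow> snorm s = s" by (simp add: snorm_def)

lemma tendsto_snorm: "(f \<longlongrightarrow> a) F \<Longrightarrow> sdet a > 0 \<Longrightarrow> ((\<lambda>x. snorm (f x)) \<longlongrightarrow> snorm a) F"
  unfolding snorm_def by (intro tendsto_intros) auto

lemma htr_eq_sadj: "s + sadj s = (2 * htr s) *\<^sub>R sone"
  by (simp add: sadj_def scaleR_conv_of_real prod_eq_iff complex_eq_iff)

lemma smul_sone_scale: "s \<star> (r *\<^sub>R sone) = r *\<^sub>R s" "(r *\<^sub>R sone) \<star> s = r *\<^sub>R s"
  by (simp_all only: smul_scaleR smul_one)

lemma smul_minus_one [simp]: "s \<star> (- 1, 0) = - s" "(- 1, 0) \<star> s = - s"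
  by (simp_all add: smul_def prod_eq_iff)

lemma htr_mul_commute: "htr (s \<star> t) = htr (t \<star> s)"
  by (simp add: smul_def algebra_simps)

lemma sadj_cancel: "sdet s = 1 \<Longrightarrow> s \<star> (sadj s \<star> t) = t" "sdet s = 1 \<Longrightarrow> sadj s \<star> (s \<star> t) = t"
  by (simp_all add: smul_assoc[symmetric] smul_adj)

lemma sadj_id: "sdet s = 1 \<Longrightarrow> s \<star> sadj s = sone" "sdet s = 1 \<Longrightarrow> sadj s \<star> s = sone"
  by (simp_all add: smul_adj)

lemma smul_left_cancel: "sdet s = 1 \<Longrightarrow> s \<star> t = s \<star> u \<longleftrightarrow> t = u"
  by (metis sadj_cancel(2))

text \<open>For \<open>S\<close>, \<open>T\<close> of determinant 1 and equal trace, \<open>T M - M S\<inverse>\<close> intertwines \<open>S\<close> and \<open>T\<close>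
  for every \<open>M\<close> (Cayley-Hamilton).\<close>

lemma intertwiner:
  assumes "sdet S = 1" "sdet T = 1" "htr S = htr T"
  shows "(T \<star> M - M \<star> sadj S) \<star> S = T \<star> (T \<star> M - M \<star> sadj S)"
proof -
  let ?h = "(2 * htr S) *\<^sub>R sone"
  have S: "S = ?h - sadj S" using htr_eq_sadj[of S] by (simp add: algebra_simps)
  have T: "sadj T = ?h - T" using htr_eq_sadj[of T] assms(3) by (simp add: algebra_simps)
  have "T \<star> M \<star> S = T \<star> M \<star> (?h - sadj S)" using S by simp
  also have "\<dots> = (2 * htr S) *\<^sub>R (T \<star> M) - T \<star> M \<star> sadj S" by (simp only: smul_diff smul_sone_scale)
  finally have 1: "T \<star> M \<star> S = (2 * htr S) *\<^sub>R (T \<star> M) - T \<star> M \<star> sadj S" .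
  have "sone = T \<star> (?h - T)" using sadj_id(1)[OF assms(2)] T by simp
  then have "M = T \<star> (?h - T) \<star> M" by (metis smul_one(1))
  also have "\<dots> = (2 * htr S) *\<^sub>R (T \<star> M) - T \<star> (T \<star> M)" by (simp only: smul_diff smul_sone_scale smul_scaleR smul_assoc smul_one)
  finally have 2: "M = (2 * htr S) *\<^sub>R (T \<star> M) - T \<star> (T \<star> M)" .
  have "(T \<star> M - M \<star> sadj S) \<star> S = T \<star> M \<star> S - M"
    by (simp add: smul_diff smul_assoc sadj_id(2)[OF assms(1)])
  also have "\<dots> = T \<star> (T \<star> M) - T \<star> M \<star> sadj S" using 1 2 by (metis (no_types, lifting) add_diff_cancel_left' diff_diff_eq2 diff_add_cancel add_diff_eq)
  finally show ?thesis by (simp add: smul_diff smul_assoc)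
qed

lemma nonscalar_solve:
  assumes "sdet S = 1" "S \<noteq> sone" "S \<noteq> - sone"
  obtains m where "S \<star> m - m \<star> sadj S = sone"
proof -
  let ?y = "Im (fst S)" and ?b = "snd S"
  define q where "q = ?y\<^sup>2 + (cmod ?b)\<^sup>2"
  have "q \<noteq> 0"
  proof
    assume "q = 0"
    then have z: "?y = 0" "?b = 0" by (simp_all add: q_def sum_power2_eq_zero_iff)
    then have "(Re (fst S))\<^sup>2 = 1" using assms(1) by (simp add: sdet_Re_Im)
    then have "Re (fst S) = 1 \<or> Re (fst S) = - 1" by (simp add: power2_eq_1_iff)
    then show False using z assms(2,3) by (auto simp: prod_eq_iff complex_eq_iff)
  qed
  define c where "c = 1 / (2 * q)"
  define m where "m = (- \<i> * complex_of_real ?y * complex_of_real c, ?b * complex_of_real c)"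
  have bb: "?b * cnj ?b = complex_of_real ((cmod ?b)\<^sup>2)" by (rule complex_norm_square[symmetric])
  have 1: "fst (S \<star> m - m \<star> sadj S) = - \<i> * complex_of_real ?y * complex_of_real c * (fst S - cnj (fst S)) + 2 * (?b * cnj ?b) * complex_of_real c"
    by (simp add: smul_def sadj_def m_def algebra_simps)
  have 2: "fst S - cnj (fst S) = 2 * \<i> * complex_of_real ?y" by (simp add: complex_eq_iff)
  have "fst (S \<star> m - m \<star> sadj S) = complex_of_real (2 * c * (?y\<^sup>2 + (cmod ?b)\<^sup>2))"
    unfolding 1 2 bb by (simp add: complex_eq_iff power2_eq_square algebra_simps)
  also have "2 * c * (?y\<^sup>2 + (cmod ?b)\<^sup>2) = 1" using \<open>q \<noteq> 0\<close> by (simp add: q_def[symmetric] c_def)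
  finally have f: "fst (S \<star> m - m \<star> sadj S) = 1" by simp
  have "snd (S \<star> m - m \<star> sadj S) = 0"
    by (simp add: smul_def sadj_def m_def algebra_simps)
  with f show ?thesis by (intro that[of m]) (simp add: prod_eq_iff)
qed

lemma sq_conj_section:
  assumes S: "sdet S = 1" "S \<noteq> sone" "S \<noteq> - sone" and B: "sdet B = 1" "B \<star> S = T \<star> B"
    and lim: "(S' \<longlongrightarrow> S) F" "(T' \<longlongrightarrow> T) F"
    and ev: "\<forall>\<^sub>F x in F. sdet (S' x) = 1 \<and> sdet (T' x) = 1 \<and> htr (S' x) = htr (T' x)"
  obtains B' where "(B' \<longlongrightarrow> B) F" "\<forall>\<^sub>F x in F. sdet (B' x) = 1 \<and> B' x \<star> S' x = T' x \<star> B' x"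
proof -
  obtain m where m: "S \<star> m - m \<star> sadj S = sone" by (rule nonscalar_solve[OF S])
  define X where "X x = T' x \<star> (B \<star> m) - (B \<star> m) \<star> sadj (S' x)" for x
  have "(X \<longlongrightarrow> T \<star> (B \<star> m) - (B \<star> m) \<star> sadj S) F"
    unfolding X_def by (intro tendsto_intros lim)
  moreover have "T \<star> (B \<star> m) - (B \<star> m) \<star> sadj S = B \<star> (S \<star> m - m \<star> sadj S)"
    using B(2) by (simp add: smul_diff smul_assoc[symmetric])
  ultimately have X: "(X \<longlongrightarrow> B) F" using m by simp
  have "((\<lambda>x. sdet (X x)) \<longlongrightarrow> sdet B) F" by (intro tendsto_intros X)
  then have pos: "\<forall>\<^sub>F x in F. sdet (X x) > 0" using B(1) by (intro order_tendstoD(1)[of _ "sdet B"]) auto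
  have "((\<lambda>x. snorm (X x)) \<longlongrightarrow> snorm B) F" using X B(1) by (intro tendsto_snorm) auto
  then have l: "((\<lambda>x. snorm (X x)) \<longlongrightarrow> B) F" using B(1) by simp
  have "\<forall>\<^sub>F x in F. sdet (snorm (X x)) = 1 \<and> snorm (X x) \<star> S' x = T' x \<star> snorm (X x)"
    using pos ev
  proof eventually_elim
    case (elim x)
    have "X x \<star> S' x = T' x \<star> X x" unfolding X_def by (rule intertwiner) (use elim in auto)
    then show ?case using elim(1) by (simp add: sdet_snorm) (simp add: snorm_def smul_scaleR)
  qed
  with l show ?thesis by (rule that)
qed

lemma toS_pm: assumes "toS x = toS y \<or> toS x = - toS y" shows "\<exists>k. x = central k \<odot> y"
  using assms
proof
  assume "toS x = toS y"
  then obtain k :: int where "snd x = snd y" "fst x = fst y + 2 * pi * k" using toS_eq_iff by blast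
  then show ?thesis by (intro exI[of _ "2 * k"]) (simp add: central_mul prod_eq_iff)
next
  assume "toS x = - toS y"
  then have "toS x = toS (central 1 \<odot> y)" by (simp add: toS_central)
  then obtain k :: int where "snd x = snd (central 1 \<odot> y)" "fst x = fst (central 1 \<odot> y) + 2 * pi * k" using toS_eq_iff by blast
  then show ?thesis by (intro exI[of _ "1 + 2 * k"]) (simp add: central_mul prod_eq_iff algebra_simps)
qed

lemma toS_sone_imp: "toS x = sone \<or> toS x = - sone \<Longrightarrow> \<exists>k. x = central k"
  using toS_pm[of x cid] by simp

lemma central_shift_range1: "central k \<in> shift_range 1 (- 1) \<longleftrightarrow> k = 0"
proof -
  have "central k \<in> shift_range 1 (- 1) \<longleftrightarrow> cid \<in> shift_range (1 - k) (- 1 - k)" using shift_range_central[of k cid 1 "- 1"] by simp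
  then show ?thesis by (auto simp: cid_shift_range)
qed

lemma lift_near_tendsto_self:
  assumes "(f \<longlongrightarrow> toS x) F" shows "((\<lambda>t. lift_near (fst x) (f t)) \<longlongrightarrow> x) F"
proof -
  have "((\<lambda>t. lift_near (fst x) (f t)) \<longlongrightarrow> lift_near (fst x) (toS x)) F"
  proof (rule tendsto_lift_near[OF assms _ tendsto_const])
    have "fst (toS x) * cis (- fst x) = complex_of_real (cc (snd x))"
      by (simp add: toS_def mult.assoc cis_mult)
    then show "fst (toS x) * cis (- fst x) \<notin> \<real>\<^sub>\<le>\<^sub>0" by (simp add: not_le)
  qed
  then show ?thesis by (simp add: lift_near_toS)
qed

lemma eventually_eq_of_toS:
  assumes "(f \<longlongrightarrow> a) F" "(g \<longlongrightarrow> a) F" "\<forall>\<^sub>F x in F. toS (f x) = toS (g x)"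
  shows "\<forall>\<^sub>F x in F. f x = g x"
proof -
  have "((\<lambda>x. \<bar>fst (f x) - fst (g x)\<bar>) \<longlongrightarrow> \<bar>fst a - fst a\<bar>) F" by (intro tendsto_intros assms)
  then have "\<forall>\<^sub>F x in F. \<bar>fst (f x) - fst (g x)\<bar> < 2 * pi" by (rule order_tendstoD(2)) simp
  with assms(3) show ?thesis by eventually_elim (rule toS_inj)
qed

lemma toS_ccomm: "toS (ccomm A B) = toS A \<star> toS B \<star> sadj (toS A) \<star> sadj (toS B)"
  by (simp add: ccomm_def toS_mul toS_inv)

lemma toS_ccomm_iff:
  assumes "sdet K = 1"
  shows "toS (ccomm A B) = sadj K \<longleftrightarrow> toS B \<star> toS A = K \<star> toS A \<star> toS B"
proof -
  let ?A = "toS A" and ?B = "toS B"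
  have "?B \<star> ?A = K \<star> ?A \<star> ?B \<longleftrightarrow> sadj K \<star> (?B \<star> ?A) = ?A \<star> ?B"
    using smul_left_cancel[of "sadj K" "?B \<star> ?A" "K \<star> ?A \<star> ?B"] assms by (simp add: smul_assoc sadj_cancel)
  also have "\<dots> \<longleftrightarrow> ?A \<star> ?B \<star> sadj ?A \<star> sadj ?B = sadj K"
  proof
    assume e: "sadj K \<star> (?B \<star> ?A) = ?A \<star> ?B"
    have "?A \<star> ?B \<star> sadj ?A \<star> sadj ?B = sadj K \<star> (?B \<star> (?A \<star> (sadj ?A \<star> sadj ?B)))"
      unfolding e[symmetric] by (simp add: smul_assoc)
    then show "?A \<star> ?B \<star> sadj ?A \<star> sadj ?B = sadj K" by (simp add: sadj_cancel sadj_id)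
  next
    assume e: "?A \<star> ?B \<star> sadj ?A \<star> sadj ?B = sadj K"
    show "sadj K \<star> (?B \<star> ?A) = ?A \<star> ?B"
      unfolding e[symmetric] by (simp add: smul_assoc sadj_cancel sadj_id)
  qed
  finally show ?thesis by (simp add: toS_ccomm)
qed

lemma ccomm_eq_cid_iff: "ccomm A B = cid \<longleftrightarrow> A \<odot> B = B \<odot> A"
proof
  assume "ccomm A B = cid"
  then have "ccomm A B \<odot> (B \<odot> A) = B \<odot> A" by simp
  then show "A \<odot> B = B \<odot> A" by (simp add: ccomm_def cmul_assoc)
next
  assume "A \<odot> B = B \<odot> A"
  then have "ccomm A B = B \<odot> A \<odot> cinv A \<odot> cinv B" by (simp add: ccomm_def)
  then show "ccomm A B = cid" by (simp add: cmul_assoc)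
qed

lemma toS_commute_iff: "toS A \<star> toS B = toS B \<star> toS A \<longleftrightarrow> A \<odot> B = B \<odot> A"
proof
  assume "toS A \<star> toS B = toS B \<star> toS A"
  then have "toS (A \<odot> B) = toS (B \<odot> A)" by (simp add: toS_mul)
  then show "A \<odot> B = B \<odot> A"
    by (rule toS_inj) (use cmul_angle[of A B] cmul_angle[of B A] pi_gt_zero in linarith)
next
  assume "A \<odot> B = B \<odot> A"
  then show "toS A \<star> toS B = toS B \<star> toS A" by (metis toS_mul)
qed

lemma ccomm_section:
  assumes ne: "ccomm A B \<noteq> cid"
  obtains \<sigma> where "(\<sigma> \<longlongrightarrow> (A, B)) (nhds (ccomm A B))"
    "\<forall>\<^sub>F h in nhds (ccomm A B). ccomm (fst (\<sigma> h)) (snd (\<sigma> h)) = h"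
proof -
  define h0 where "h0 = ccomm A B"
  define K where "K h = sadj (toS h)" for h
  let ?F = "nhds h0"
  let ?A = "toS A" and ?B = "toS B"
  have dK: "sdet (K h) = 1" for h by (simp add: K_def)
  have K1: "K h0 \<noteq> sone"
  proof
    assume "K h0 = sone"
    then have "sadj (K h0) = sone" by (simp add: sadj_def)
    then have "toS h0 = sone" by (simp add: K_def)
    then obtain k where "h0 = central k" using toS_sone_imp by blast
    then show False using ccomm_shift_range[of A B] central_shift_range1 ne by (simp add: h0_def)
  qed
  have AB: "?B \<star> ?A = K h0 \<star> ?A \<star> ?B"
    using toS_ccomm_iff[OF dK, of A B h0] by (simp add: h0_def[symmetric]) (simp add: K_def)
  have nonsc: "?A \<noteq> sone" "?A \<noteq> - sone"
    using ne unfolding ccomm_eq_cid_iff toS_commute_iff[symmetric] by auto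
  define w where "w = K h0 - sone"
  define u where "u = (cnj (fst w), snd w)"
  have wu: "htr (w \<star> u) > 0"
  proof -
    have "w \<noteq> 0" using K1 by (simp add: w_def)
    then have "cmod (fst w) \<noteq> 0 \<or> cmod (snd w) \<noteq> 0" by (auto simp: prod_eq_iff)
    then have "(cmod (fst w))\<^sup>2 + (cmod (snd w))\<^sup>2 > 0"
      by (metis not_sum_power2_lt_zero sum_power2_eq_zero_iff linorder_neqE_linordered_idom)
    moreover have "w \<star> u = (complex_of_real ((cmod (fst w))\<^sup>2) + complex_of_real ((cmod (snd w))\<^sup>2), snd (w \<star> u))"
      by (simp only: smul_def u_def fst_conv snd_conv complex_norm_square complex_cnj_cnj)
    ultimately show ?thesis by (metis fst_conv Re_complex_of_real of_real_add)
  qed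
  define den where "den h = htr (K h \<star> u) - htr u" for h
  define lam where "lam h = (htr (K h \<star> ?A) - htr ?A) / den h" for h
  define X where "X h = ?A - lam h *\<^sub>R u" for h
  have limK: "(K \<longlongrightarrow> K h0) ?F" unfolding K_def by (intro tendsto_intros) (simp add: tendsto_ident_at[of h0 UNIV] filterlim_ident)
  have den0: "den h0 > 0" using wu by (simp add: den_def w_def smul_diff)
  have lam0: "lam h0 = 0"
  proof -
    have "K h0 \<star> ?A = ?B \<star> ?A \<star> sadj ?B" unfolding AB by (simp add: smul_assoc sadj_id)
    then have "htr (K h0 \<star> ?A) = htr (sadj ?B \<star> (?B \<star> ?A))" by (simp only: htr_mul_commute)
    then show ?thesis by (simp add: lam_def sadj_cancel)
  qed
  have limd: "(den \<longlongrightarrow> den h0) ?F" unfolding den_def by (intro tendsto_intros limK)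
  have "(lam \<longlongrightarrow> lam h0) ?F" unfolding lam_def
    by (intro tendsto_intros limK limd) (use den0 in auto)
  then have "(X \<longlongrightarrow> ?A - lam h0 *\<^sub>R u) ?F" unfolding X_def by (intro tendsto_intros)
  then have limX: "(X \<longlongrightarrow> ?A) ?F" by (simp add: lam0)
  have "((\<lambda>h. sdet (X h)) \<longlongrightarrow> sdet ?A) ?F" by (intro tendsto_intros limX)
  then have pos: "\<forall>\<^sub>F h in ?F. sdet (X h) > 0" by (intro order_tendstoD(1)[of _ "sdet ?A"]) auto
  have dpos: "\<forall>\<^sub>F h in ?F. den h > 0" by (rule order_tendstoD(1)[OF limd den0])
  define A' where "A' h = snorm (X h)" for h
  have "(A' \<longlongrightarrow> snorm ?A) ?F" unfolding A'_def by (intro tendsto_snorm limX) simp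
  then have limA: "(A' \<longlongrightarrow> ?A) ?F" by simp
  have evA: "\<forall>\<^sub>F h in ?F. sdet (A' h) = 1 \<and> sdet (K h \<star> A' h) = 1 \<and> htr (A' h) = htr (K h \<star> A' h)"
    using pos dpos
  proof eventually_elim
    case (elim h)
    have "htr (K h \<star> X h) - htr (X h) = htr (K h \<star> ?A) - htr ?A - lam h * den h"
      by (simp add: X_def smul_diff smul_scaleR den_def algebra_simps)
    also have "\<dots> = 0" using elim(2) by (simp add: lam_def)
    finally have "htr (A' h) = htr (K h \<star> A' h)" by (simp add: A'_def snorm_def smul_scaleR)
    then show ?case using elim(1) by (simp add: A'_def sdet_snorm sdet_mul dK)
  qed
  obtain B' where B': "(B' \<longlongrightarrow> ?B) ?F" "\<forall>\<^sub>F h in ?F. sdet (B' h) = 1 \<and> B' h \<star> A' h = (K h \<star> A' h) \<star> B' h"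
  proof (rule sq_conj_section[OF sdet_toS nonsc sdet_toS AB limA _ evA])
    show "((\<lambda>h. K h \<star> A' h) \<longlongrightarrow> K h0 \<star> ?A) ?F" by (intro tendsto_intros limK limA)
  qed
  define \<sigma> where "\<sigma> h = (lift_near (fst A) (A' h), lift_near (fst B) (B' h))" for h
  have l1: "((\<lambda>h. lift_near (fst A) (A' h)) \<longlongrightarrow> A) ?F" "((\<lambda>h. lift_near (fst B) (B' h)) \<longlongrightarrow> B) ?F"
    using limA B'(1) by (auto intro: lift_near_tendsto_self)
  then have lim: "(\<sigma> \<longlongrightarrow> (A, B)) ?F" unfolding \<sigma>_def by (intro tendsto_Pair)
  have "\<forall>\<^sub>F h in ?F. toS (ccomm (lift_near (fst A) (A' h)) (lift_near (fst B) (B' h))) = toS h"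
    using evA B'(2)
  proof eventually_elim
    case (elim h)
    then have "toS (ccomm (lift_near (fst A) (A' h)) (lift_near (fst B) (B' h))) = sadj (K h)"
      by (subst toS_ccomm_iff[OF dK]) (simp add: toS_lift_near)
    then show ?case by (simp add: K_def)
  qed
  moreover have "((\<lambda>h. ccomm (lift_near (fst A) (A' h)) (lift_near (fst B) (B' h))) \<longlongrightarrow> ccomm A B) ?F"
    by (intro tendsto_intros l1)
  moreover have "((\<lambda>h. h) \<longlongrightarrow> ccomm A B) ?F" unfolding h0_def by (simp add: filterlim_ident)
  ultimately have "\<forall>\<^sub>F h in ?F. ccomm (lift_near (fst A) (A' h)) (lift_near (fst B) (B' h)) = h"
    by (intro eventually_eq_of_toS)
  then have "\<forall>\<^sub>F h in ?F. ccomm (fst (\<sigma> h)) (snd (\<sigma> h)) = h" by (simp add: \<sigma>_def)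
  with lim show ?thesis unfolding h0_def by (rule that)
qed

section \<open>Twists\<close>

definition comm_fibre :: "cov \<Rightarrow> (cov \<times> cov) set" where
  "comm_fibre h = {(A, B). ccomm A B = h}"

definition center_inv :: "(cov \<times> cov) set \<Rightarrow> (cov \<times> cov \<Rightarrow> bool) \<Rightarrow> bool" where
  "center_inv F \<kappa> \<longleftrightarrow> (\<forall>A B. (A, B) \<in> F \<longrightarrow> \<kappa> (central 1 \<odot> A, B) = \<kappa> (A, B) \<and> \<kappa> (A, central 1 \<odot> B) = \<kappa> (A, B))"

definition conn_mod_center :: "(cov \<times> cov) set \<Rightarrow> bool" where
  "conn_mod_center F \<longleftrightarrow> (\<forall>\<kappa>. loc_const F \<kappa> \<longrightarrow> center_inv F \<kappa> \<longrightarrow> (\<exists>c. \<forall>x\<in>F. \<kappa> x = c))"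

lemma zshift_induct:
  fixes f :: "cov \<Rightarrow> bool"
  assumes "\<And>j. f (central 1 \<odot> (central j \<odot> x)) = f (central j \<odot> x)"
  shows "f (central k \<odot> x) = f x"
proof -
  have st: "f (central (j + 1) \<odot> x) = f (central j \<odot> x)" for j
    using assms[of j] by (simp add: central_add_left add.commute)
  show ?thesis
  proof (induction k rule: int_induct[where k = 0])
    case base then show ?case by simp
  next
    case (step1 i) then show ?case using st[of i] by simp
  next
    case (step2 i) then show ?case using st[of "i - 1"] by simp
  qed
qed

lemma center_inv_shift:
  assumes "center_inv (comm_fibre h) \<kappa>" "(A, B) \<in> comm_fibre h"
  shows "(central j \<odot> A, central k \<odot> B) \<in> comm_fibre h" "\<kappa> (central j \<odot> A, central k \<odot> B) = \<kappa> (A, B)"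
proof -
  have F: "(central j \<odot> A, central k \<odot> B) \<in> comm_fibre h" for j k using assms(2) by (simp add: comm_fibre_def)
  then show "(central j \<odot> A, central k \<odot> B) \<in> comm_fibre h" .
  have 1: "\<kappa> (central 1 \<odot> (central j \<odot> A), central k \<odot> B) = \<kappa> (central j \<odot> A, central k \<odot> B)" for j k
    using assms(1) F[of j k] unfolding center_inv_def by blast
  have 2: "\<kappa> (A, central 1 \<odot> (central k \<odot> B)) = \<kappa> (A, central k \<odot> B)" for k
    proof -
    have "(A, central k \<odot> B) \<in> comm_fibre h" using F[of 0 k] by simp
    then show ?thesis using assms(1) unfolding center_inv_def by blast
  qed
  have "\<kappa> (central j \<odot> A, central k \<odot> B) = \<kappa> (A, central k \<odot> B)"
    by (rule zshift_induct[of "\<lambda>x. \<kappa> (x, central k \<odot> B)"]) (rule 1)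
  also have "\<dots> = \<kappa> (A, B)"
    by (rule zshift_induct[of "\<lambda>x. \<kappa> (A, x)"]) (rule 2)
  finally show "\<kappa> (central j \<odot> A, central k \<odot> B) = \<kappa> (A, B)" .
qed

text \<open>The path is the normalized segment from the identity to the matrix of \<open>Z\<close> or to its negative.\<close>

lemma centralizer_path:
  "\<exists>Z' k. continuous_on {0..1} Z' \<and> Z' (0::real) = cid \<and> Z' 1 = central k \<odot> Z \<and>
    (\<forall>s\<in>{0..1}. \<forall>A. A \<odot> Z = Z \<odot> A \<longrightarrow> A \<odot> Z' s = Z' s \<odot> A)"
proof -
  define E where "E = (if htr (toS Z) \<ge> 0 then toS Z else - toS Z)"
  have E: "htr E \<ge> 0" "sdet E = 1" "E = toS Z \<or> E = - toS Z" by (auto simp: E_def)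
  define X where "X s = (1 - s) *\<^sub>R sone + s *\<^sub>R E" for s :: real
  have dX: "sdet (X s) = (1 - s)\<^sup>2 + 2 * s * (1 - s) * htr E + s\<^sup>2" for s
  proof -
    have "sdet (X s) = (1 - s + s * Re (fst E))\<^sup>2 + (s * Im (fst E))\<^sup>2 - (s * Re (snd E))\<^sup>2 - (s * Im (snd E))\<^sup>2"
      by (simp add: X_def sdet_Re_Im)
    also have "\<dots> = (1 - s)\<^sup>2 + 2 * s * (1 - s) * Re (fst E) + s\<^sup>2 * sdet E"
      by (simp add: sdet_Re_Im power2_eq_square algebra_simps)
    finally show ?thesis by (simp add: E(2))
  qed
  have pos: "sdet (X s) > 0" if "s \<in> {0..1}" for s
  proof -
    have "2 * s * (1 - s) * htr E \<ge> 0" using that E(1) by (intro mult_nonneg_nonneg) auto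
    moreover have "(1 - s)\<^sup>2 + s\<^sup>2 > 0" by (cases "s = 0") (auto simp: add_nonneg_pos)
    ultimately show ?thesis unfolding dX by linarith
  qed
  define Z' where "Z' s = lift_near 0 (snorm (X s))" for s
  have htrX: "Re (fst (snorm (X s))) \<ge> 0" if "s \<in> {0..1}" for s
    using that E(1) pos[OF that] by (simp add: snorm_def X_def)
  have nz: "fst (snorm (X s)) \<notin> \<real>\<^sub>\<le>\<^sub>0" if "s \<in> {0..1}" for s
    using htrX[OF that] sdet1_nz[OF sdet_snorm[OF pos[OF that]]] by (auto simp: complex_nonpos_Reals_iff complex_eq_iff)
  have cX: "continuous_on {0..1} X" unfolding X_def by (intro continuous_intros)
  have cont: "continuous_on {0..1} Z'"
    unfolding continuous_on_def
  proof
    fix s :: real assume s: "s \<in> {0..1}"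
    have "(X \<longlongrightarrow> X s) (at s within {0..1})" using cX s by (simp add: continuous_on_def)
    then have "((\<lambda>t. snorm (X t)) \<longlongrightarrow> snorm (X s)) (at s within {0..1})" by (rule tendsto_snorm) (rule pos[OF s])
    then show "(Z' \<longlongrightarrow> Z' s) (at s within {0..1})" unfolding Z'_def
      by (rule tendsto_lift_near) (use nz[OF s] in auto)
  qed
  have t: "toS (Z' s) = snorm (X s)" if "s \<in> {0..1}" for s
    unfolding Z'_def by (rule toS_lift_near) (rule sdet_snorm[OF pos[OF that]])
  have "X 0 = sone" "X 1 = E" by (simp_all add: X_def prod_eq_iff)
  have Z0: "Z' 0 = cid" using \<open>X 0 = sone\<close> by (simp add: Z'_def lift_near_def)
  have "toS (Z' 1) = E" using t[of 1] E(2) \<open>X 1 = E\<close> by simp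
  then obtain k where Z1: "Z' 1 = central k \<odot> Z" using toS_pm[of "Z' 1" Z] E(3) by metis
  have comm: "A \<odot> Z' s = Z' s \<odot> A" if s: "s \<in> {0..1}" and AZ: "A \<odot> Z = Z \<odot> A" for s A
  proof -
    have "toS A \<star> E = E \<star> toS A" using E(3) AZ toS_commute_iff[of A Z] by auto
    then have "toS A \<star> X s = X s \<star> toS A" by (simp only: X_def smul_add smul_sone_scale smul_scaleR smul_one)
    then have "toS A \<star> toS (Z' s) = toS (Z' s) \<star> toS A" by (simp add: t[OF s] snorm_def smul_scaleR)
    then show ?thesis by (simp add: toS_commute_iff)
  qed
  show ?thesis using cont Z0 Z1 comm by blast
qed

lemma ccomm_twist: "A \<odot> Z = Z \<odot> A \<Longrightarrow> ccomm A (B \<odot> Z) = ccomm A B"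
  "B \<odot> W = W \<odot> B \<Longrightarrow> ccomm (A \<odot> W) B = ccomm A B"
proof -
  assume a: "A \<odot> Z = Z \<odot> A"
  have "Z \<odot> (cinv A \<odot> (cinv Z \<odot> cinv B)) = cinv A \<odot> cinv B"
  proof -
    have "Z \<odot> cinv A = cinv A \<odot> Z"
      using arg_cong[OF a, of "\<lambda>x. cinv A \<odot> (x \<odot> cinv A)"] by (simp add: cmul_assoc)
    then have "Z \<odot> (cinv A \<odot> (cinv Z \<odot> cinv B)) = cinv A \<odot> Z \<odot> (cinv Z \<odot> cinv B)" by (simp add: cmul_assoc[symmetric])
    then show ?thesis by (simp add: cmul_assoc)
  qed
  then show "ccomm A (B \<odot> Z) = ccomm A B" by (simp add: ccomm_def cmul_assoc)
next
  assume a: "B \<odot> W = W \<odot> B"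
  have "W \<odot> (B \<odot> (cinv W \<odot> (cinv A \<odot> cinv B))) = B \<odot> (cinv A \<odot> cinv B)"
    using a by (metis cmul_assoc cinv_cancel(2))
  then show "ccomm (A \<odot> W) B = ccomm A B" by (simp add: ccomm_def cmul_assoc)
qed

lemma twist_right:
  assumes loc_const: "loc_const (comm_fibre h) \<kappa>" "center_inv (comm_fibre h) \<kappa>" and AB: "(A, B) \<in> comm_fibre h" and Z: "A \<odot> Z = Z \<odot> A"
  shows "(A, B \<odot> Z) \<in> comm_fibre h" "\<kappa> (A, B \<odot> Z) = \<kappa> (A, B)"
proof -
  show F: "(A, B \<odot> Z) \<in> comm_fibre h" using AB ccomm_twist(1)[OF Z] by (simp add: comm_fibre_def)
  obtain Z' :: "real \<Rightarrow> cov" and k where Z': "continuous_on {0..1} Z'" "Z' 0 = cid" "Z' 1 = central k \<odot> Z"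
    "\<And>s A. s \<in> {0..1} \<Longrightarrow> A \<odot> Z = Z \<odot> A \<Longrightarrow> A \<odot> Z' s = Z' s \<odot> A"
    using centralizer_path[of Z] by blast
  have "\<kappa> (A, B \<odot> Z' 0) = \<kappa> (A, B \<odot> Z' 1)"
  proof (rule loc_const_path[OF loc_const(1), where \<gamma> = "\<lambda>s. (A, B \<odot> Z' s)" and S = "{0..1::real}"])
    show "continuous_on {0..1} (\<lambda>s. (A, B \<odot> Z' s))" by (intro continuous_intros Z'(1))
    show "(A, B \<odot> Z' s) \<in> comm_fibre h" if "s \<in> {0..1}" for s
      using AB ccomm_twist(1)[OF Z'(4)[OF that Z]] by (simp add: comm_fibre_def)
  qed auto
  then show "\<kappa> (A, B \<odot> Z) = \<kappa> (A, B)"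
    using center_inv_shift(2)[OF loc_const(2) F, of 0 k] by (simp add: Z' central_left_commute)
qed

lemma twist_left:
  assumes loc_const: "loc_const (comm_fibre h) \<kappa>" "center_inv (comm_fibre h) \<kappa>" and AB: "(A, B) \<in> comm_fibre h" and Z: "B \<odot> Z = Z \<odot> B"
  shows "(A \<odot> Z, B) \<in> comm_fibre h" "\<kappa> (A \<odot> Z, B) = \<kappa> (A, B)"
proof -
  show F: "(A \<odot> Z, B) \<in> comm_fibre h" using AB ccomm_twist(2)[OF Z] by (simp add: comm_fibre_def)
  obtain Z' :: "real \<Rightarrow> cov" and k where Z': "continuous_on {0..1} Z'" "Z' 0 = cid" "Z' 1 = central k \<odot> Z"
    "\<And>s A. s \<in> {0..1} \<Longrightarrow> A \<odot> Z = Z \<odot> A \<Longrightarrow> A \<odot> Z' s = Z' s \<odot> A"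
    using centralizer_path[of Z] by blast
  have "\<kappa> (A \<odot> Z' 0, B) = \<kappa> (A \<odot> Z' 1, B)"
  proof (rule loc_const_path[OF loc_const(1), where \<gamma> = "\<lambda>s. (A \<odot> Z' s, B)" and S = "{0..1::real}"])
    show "continuous_on {0..1} (\<lambda>s. (A \<odot> Z' s, B))" by (intro continuous_intros Z'(1))
    show "(A \<odot> Z' s, B) \<in> comm_fibre h" if "s \<in> {0..1}" for s
      using AB ccomm_twist(2)[OF Z'(4)[OF that Z]] by (simp add: comm_fibre_def)
  qed auto
  then show "\<kappa> (A \<odot> Z, B) = \<kappa> (A, B)"
    using center_inv_shift(2)[OF loc_const(2) F, of k 0] by (simp add: Z' central_left_commute)
qed

section \<open>Conjugation to normal forms\<close>

lemma rotate_conj: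
  assumes "cmod b' = cmod b"
  shows "\<exists>g::cov. toS g \<star> (a, b) = (a, b') \<star> toS g"
proof (cases "b = 0")
  case True
  then show ?thesis using assms by (intro exI[of _ cid]) simp
next
  case False
  define t where "t = Arg (b' / b) / 2"
  have "cmod (b' / b) = 1" using assms False by (simp add: norm_divide)
  then have "b' / b = cis (2 * t)" using cis_Arg_cmod[of "b' / b"] by (simp add: t_def)
  then have b': "b' = b * (cis t * cis t)" using False by (simp add: field_simps cis_mult)
  have c: "cis t * cnj (cis t) = 1" by (simp add: cis_cnj cis_mult)
  have "toS (t, 0) \<star> (a, b) = (a, b') \<star> toS (t, 0)"
    using c by (simp add: toS_def smul_def b' mult.assoc)
  then show ?thesis by blast
qed

lemma half_boost:
  fixes C S :: real
  assumes "C\<^sup>2 - S\<^sup>2 = 1" "C \<ge> 1"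
  obtains p q where "p\<^sup>2 - q\<^sup>2 = 1" "p > 0" "p\<^sup>2 + q\<^sup>2 = C" "2 * p * q = S"
proof -
  define p where "p = sqrt ((C + 1) / 2)"
  define q where "q = S / (2 * p)"
  have p: "p > 0" "p\<^sup>2 = (C + 1) / 2" using assms(2) by (simp_all add: p_def)
  have "q\<^sup>2 = S\<^sup>2 / (4 * p\<^sup>2)" by (simp add: q_def power_divide power_mult_distrib)
  also have "\<dots> = (C\<^sup>2 - 1) / (2 * (C + 1))" using assms(1) p(2) by (simp add: algebra_simps)
  also have "\<dots> = (C - 1) / 2" using assms(2) by (simp add: power2_eq_square field_simps)
  finally have q: "q\<^sup>2 = (C - 1) / 2" .
  show ?thesis
  proof (rule that[of p q])
    show "p\<^sup>2 - q\<^sup>2 = 1" "p\<^sup>2 + q\<^sup>2 = C" unfolding p(2) q by (simp_all add: field_simps)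
    show "2 * p * q = S" using p(1) by (simp add: q_def)
  qed (rule p)
qed

lemma toS_boost: "p > 0 \<Longrightarrow> p\<^sup>2 - q\<^sup>2 = 1 \<Longrightarrow> toS (0, \<i> * complex_of_real q) = (complex_of_real p, \<i> * complex_of_real q)"
proof -
  assume p: "p > 0" "p\<^sup>2 - q\<^sup>2 = 1"
  then have "1 + q\<^sup>2 = p\<^sup>2" by simp
  then have "cc (\<i> * complex_of_real q) = p" using p(1) by (simp add: cc_def norm_mult)
  then show ?thesis by (simp add: toS_def)
qed

lemma boost_conj:
  assumes "C\<^sup>2 - S\<^sup>2 = 1" "C \<ge> 1"
  shows "\<exists>g::cov. toS g \<star> (Complex X Y, complex_of_real P) =
    (Complex X (Y * C + P * S), complex_of_real (Y * S + P * C)) \<star> toS g"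
proof -
  obtain p q where pq: "p\<^sup>2 - q\<^sup>2 = 1" "p > 0" "p\<^sup>2 + q\<^sup>2 = C" "2 * p * q = S" by (rule half_boost[OF assms])
  have 1: "p * (p\<^sup>2 + q\<^sup>2) - q * (2 * p * q) = p" "p * (2 * p * q) - q * (p\<^sup>2 + q\<^sup>2) = q"
  proof -
    have "p * (p\<^sup>2 + q\<^sup>2) - q * (2 * p * q) = p * (p\<^sup>2 - q\<^sup>2)" "p * (2 * p * q) - q * (p\<^sup>2 + q\<^sup>2) = q * (p\<^sup>2 - q\<^sup>2)"
      by (simp_all add: power2_eq_square algebra_simps)
    then show "p * (p\<^sup>2 + q\<^sup>2) - q * (2 * p * q) = p" "p * (2 * p * q) - q * (p\<^sup>2 + q\<^sup>2) = q" using pq(1) by simp_all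
  qed
  have 2: "p * (Y * C + P * S) - q * (Y * S + P * C) = p * Y + q * P"
    "p * (Y * S + P * C) - q * (Y * C + P * S) = p * P + q * Y"
  proof -
    have "p * (Y * C + P * S) - q * (Y * S + P * C) = Y * (p * C - q * S) + P * (p * S - q * C)"
      "p * (Y * S + P * C) - q * (Y * C + P * S) = P * (p * C - q * S) + Y * (p * S - q * C)"
      by (simp_all add: algebra_simps)
    then show "p * (Y * C + P * S) - q * (Y * S + P * C) = p * Y + q * P"
      "p * (Y * S + P * C) - q * (Y * C + P * S) = p * P + q * Y"
      using 1 unfolding pq(3) pq(4) by (simp_all only: mult.commute)
  qed
  have "toS (0, \<i> * complex_of_real q) \<star> (Complex X Y, complex_of_real P) =
    (Complex X (Y * C + P * S), complex_of_real (Y * S + P * C)) \<star> toS (0, \<i> * complex_of_real q)"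
    unfolding toS_boost[OF pq(2,1)] using 2
    by (simp add: smul_def complex_eq_iff algebra_simps)
  then show ?thesis by blast
qed

lemma conj_trans:
  assumes "toS g \<star> K = K1 \<star> toS g" "toS g' \<star> K1 = K2 \<star> toS g'"
  shows "toS (g' \<odot> g) \<star> K = K2 \<star> toS (g' \<odot> g)"
  unfolding toS_mul smul_assoc assms(1) unfolding smul_assoc[symmetric] assms(2) ..

definition hypN :: "real \<Rightarrow> real \<Rightarrow> sq" where "hypN c s = (complex_of_real c, complex_of_real s)"
definition parN :: "real \<Rightarrow> sq" where "parN t = (Complex 1 t, complex_of_real t)"

lemma normal_form:
  assumes K: "sdet K = 1" "K \<noteq> sone" "K \<noteq> - sone"
  obtains g N where "toS g \<star> K = N \<star> toS g"
    "(\<exists>c s. c > 1 \<and> s \<noteq> 0 \<and> c\<^sup>2 - s\<^sup>2 = 1 \<and> (N = hypN c s \<or> N = - hypN c s)) \<or>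
     (\<exists>\<theta>. sin \<theta> \<noteq> 0 \<and> N = (cis \<theta>, 0)) \<or> (\<exists>t. t \<noteq> 0 \<and> (N = parN t \<or> N = - parN t))"
proof -
  define X Y P where "X = Re (fst K)" and "Y = Im (fst K)" and "P = cmod (snd K)"
  have det: "X\<^sup>2 + Y\<^sup>2 - P\<^sup>2 = 1" using K(1) unfolding sdet_def cmod_power2[of "fst K"] by (simp add: X_def Y_def P_def)
  have KK: "K = (Complex X Y, snd K)" by (simp add: X_def Y_def)
  obtain g where g: "toS g \<star> K = (Complex X Y, complex_of_real P) \<star> toS g"
    using rotate_conj[of "complex_of_real P" "snd K" "Complex X Y"] KK by (auto simp: P_def)
  have P0: "P \<ge> 0" by (simp add: P_def)
  consider "P\<^sup>2 > Y\<^sup>2" | "P\<^sup>2 < Y\<^sup>2" | "P\<^sup>2 = Y\<^sup>2" by linarith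
  then show ?thesis
  proof cases
    case 1
    define r where "r = sqrt (P\<^sup>2 - Y\<^sup>2)"
    have r: "r > 0" "r\<^sup>2 = P\<^sup>2 - Y\<^sup>2" using 1 by (simp_all add: r_def)
    have Pr: "P \<ge> r" by (rule power2_le_imp_le) (use r P0 in simp_all)
    have CS: "(P / r)\<^sup>2 - (- Y / r)\<^sup>2 = 1"
    proof -
      have "(P / r)\<^sup>2 - (- Y / r)\<^sup>2 = (P\<^sup>2 - Y\<^sup>2) / r\<^sup>2" by (simp add: power_divide diff_divide_distrib)
      then show ?thesis using r 1 by simp
    qed
    have "P / r \<ge> 1" using Pr r by simp
    then obtain g' where g': "toS g' \<star> (Complex X Y, complex_of_real P) =
      (Complex X (Y * (P / r) + P * (- Y / r)), complex_of_real (Y * (- Y / r) + P * (P / r))) \<star> toS g'"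
      using boost_conj[OF CS] by blast
    have "Y * (- Y / r) + P * (P / r) = (P\<^sup>2 - Y\<^sup>2) / r" by (simp add: power2_eq_square diff_divide_distrib)
    also have "\<dots> = r" using r by (simp add: power2_eq_square field_simps)
    finally have e: "Y * (- Y / r) + P * (P / r) = r" .
    have "Y * (P / r) + P * (- Y / r) = 0" by simp
    then have g2: "toS g' \<star> (Complex X Y, complex_of_real P) = hypN X r \<star> toS g'"
      using g' unfolding e by (simp add: hypN_def complex_of_real_def)
    have X: "X\<^sup>2 - r\<^sup>2 = 1" using det r by simp
    have "X\<^sup>2 > 1" using X r by (metis add.commute diff_eq_eq less_add_same_cancel1 zero_less_power)
    then have "X > 1 \<or> X < - 1" using abs_square_less_1[of X] abs_square_eq_1[of X] by (smt (verit) power2_le_iff_abs_le abs_le_square_iff one_power2)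
    then show ?thesis
    proof
      assume "X > 1"
      then have "\<exists>c s. c > 1 \<and> s \<noteq> 0 \<and> c\<^sup>2 - s\<^sup>2 = 1 \<and> (hypN X r = hypN c s \<or> hypN X r = - hypN c s)"
        using r X by (intro exI[of _ X] exI[of _ r]) auto
      then show ?thesis by (intro that[OF conj_trans[OF g g2]] disjI1)
    next
      assume "X < - 1"
      moreover have "hypN X r = - hypN (- X) (- r)" by (simp add: hypN_def)
      ultimately show ?thesis using r X
        by (intro that[OF conj_trans[OF g g2]] disjI1 exI[of _ "- X"] exI[of _ "- r"]) auto
    qed
  next
    case 2
    define r where "r = sqrt (Y\<^sup>2 - P\<^sup>2)"
    have r: "r > 0" "r\<^sup>2 = Y\<^sup>2 - P\<^sup>2" using 2 by (simp_all add: r_def)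
    have Yr: "\<bar>Y\<bar> \<ge> r" by (rule power2_le_imp_le) (use r in simp_all)
    have CS: "(\<bar>Y\<bar> / r)\<^sup>2 - (- P * sgn Y / r)\<^sup>2 = 1"
    proof -
      have "Y \<noteq> 0" using 2 by auto
      then have "(- P * sgn Y)\<^sup>2 = P\<^sup>2" by (simp add: power_mult_distrib sgn_if)
      then have "(\<bar>Y\<bar> / r)\<^sup>2 - (- P * sgn Y / r)\<^sup>2 = (Y\<^sup>2 - P\<^sup>2) / r\<^sup>2"
        by (simp only: power_divide diff_divide_distrib power2_abs)
      then show ?thesis using r 2 by simp
    qed
    have "\<bar>Y\<bar> / r \<ge> 1" using Yr r by simp
    then obtain g' where g': "toS g' \<star> (Complex X Y, complex_of_real P) =
      (Complex X (Y * (\<bar>Y\<bar> / r) + P * (- P * sgn Y / r)), complex_of_real (Y * (- P * sgn Y / r) + P * (\<bar>Y\<bar> / r))) \<star> toS g'"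
      using boost_conj[OF CS] by blast
    define Y' where "Y' = Y * (\<bar>Y\<bar> / r) + P * (- P * sgn Y / r)"
    have "Y' = sgn Y * ((Y\<^sup>2 - P\<^sup>2) / r)"
      unfolding Y'_def by (cases "Y > 0") (auto simp: sgn_if power2_eq_square diff_divide_distrib field_simps)
    then have "Y' = sgn Y * (r\<^sup>2 / r)" by (simp only: r(2))
    then have Y': "Y' = sgn Y * r" using r(1) by (simp add: power2_eq_square)
    have e: "Y * (- P * sgn Y / r) + P * (\<bar>Y\<bar> / r) = 0" by (cases "Y > 0") (auto simp: sgn_if)
    have Yn: "Y \<noteq> 0" using 2 by auto
    then have "Y'\<^sup>2 = r\<^sup>2" unfolding Y' by (simp add: power_mult_distrib sgn_if)
    then have "X\<^sup>2 + Y'\<^sup>2 = 1" using det r by simp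
    then obtain \<theta> where t: "X = cos \<theta>" "Y' = sin \<theta>" using sincos_total_2pi by metis
    have "toS g' \<star> (Complex X Y, complex_of_real P) = (cis \<theta>, 0) \<star> toS g'"
      using g' unfolding e Y'_def[symmetric] by (simp add: t cis.ctr)
    moreover have "sin \<theta> \<noteq> 0" using t Y' r Yn by (simp add: sgn_if split: if_splits)
    ultimately show ?thesis by (intro that[OF conj_trans[OF g]]) auto
  next
    case 3
    then have X: "X = 1 \<or> X = - 1" using det by (simp add: power2_eq_1_iff)
    have "\<bar>Y\<bar> = P" using 3 P0 by (metis abs_of_nonneg power2_eq_iff_nonneg abs_ge_zero power2_abs)
    then have "cmod (complex_of_real Y) = cmod (snd K)" by (simp add: P_def)
    then obtain g1 where g1: "toS g1 \<star> K = (Complex X Y, complex_of_real Y) \<star> toS g1"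
      using rotate_conj[of "complex_of_real Y" "snd K" "Complex X Y"] KK by auto
    have Y0: "Y \<noteq> 0"
    proof
      assume "Y = 0"
      then have "snd K = 0" using \<open>\<bar>Y\<bar> = P\<close> by (simp add: P_def)
      then have "K = (Complex X 0, 0)" using KK \<open>Y = 0\<close> by simp
      then show False using X K(2,3) by (auto simp: complex_eq_iff prod_eq_iff)
    qed
    from X show ?thesis
    proof
      assume "X = 1"
      then have "toS g1 \<star> K = parN Y \<star> toS g1" using g1 by (simp add: parN_def)
      then show ?thesis using Y0 by (intro that) auto
    next
      assume "X = - 1"
      moreover have "- parN (- Y) = (Complex (- 1) Y, complex_of_real Y)" by (simp add: parN_def complex_eq_iff)
      ultimately have "toS g1 \<star> K = - parN (- Y) \<star> toS g1" using g1 by simp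
      then show ?thesis using Y0 by (intro that[of g1 "- parN (- Y)"] disjI2 exI[of _ "- Y"]) auto
    qed
  qed
qed

lemma htr_conj: assumes "toS g \<star> K = N \<star> toS g" shows "htr N = htr K" "sdet N = sdet K"
proof -
  have "N = toS g \<star> K \<star> sadj (toS g)" unfolding assms by (simp add: smul_assoc sadj_id)
  then have "htr N = htr (sadj (toS g) \<star> (toS g \<star> K))" by (simp only: htr_mul_commute)
  then show "htr N = htr K" by (simp add: sadj_cancel)
  show "sdet N = sdet K" using arg_cong[OF assms, of sdet] by (simp add: sdet_mul)
qed

lemma hyp_conj:
  assumes "sdet a = 1" "htr a > 1"
  obtains g where "toS g \<star> a = hypN (htr a) (sqrt ((htr a)\<^sup>2 - 1)) \<star> toS g"
proof -
  have ne: "a \<noteq> sone" "a \<noteq> - sone" using assms(2) by auto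
  obtain g N where g: "toS g \<star> a = N \<star> toS g" and
    N: "(\<exists>c s. c > 1 \<and> s \<noteq> 0 \<and> c\<^sup>2 - s\<^sup>2 = 1 \<and> (N = hypN c s \<or> N = - hypN c s)) \<or>
     (\<exists>\<theta>. sin \<theta> \<noteq> 0 \<and> N = (cis \<theta>, 0)) \<or> (\<exists>t. t \<noteq> 0 \<and> (N = parN t \<or> N = - parN t))"
    by (rule normal_form[OF assms(1) ne])
  have h: "htr N > 1" using htr_conj(1)[OF g] assms(2) by simp
  have "\<exists>s. (htr a)\<^sup>2 - s\<^sup>2 = 1 \<and> N = hypN (htr a) s"
  proof -
    have "\<not> (\<exists>\<theta>. sin \<theta> \<noteq> 0 \<and> N = (cis \<theta>, 0))" using h cos_le_one by (auto simp: not_less[symmetric])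
    moreover have "\<not> (\<exists>t. t \<noteq> 0 \<and> (N = parN t \<or> N = - parN t))" using h by (auto simp: parN_def)
    moreover have "N \<noteq> - hypN c s" if "c > 1" for c s using h that by (auto simp: hypN_def)
    ultimately obtain c s where "c\<^sup>2 - s\<^sup>2 = 1" "N = hypN c s" using N by blast
    moreover have "c = htr a" using htr_conj(1)[OF g] \<open>N = hypN c s\<close> by (simp add: hypN_def)
    ultimately show ?thesis by blast
  qed
  then obtain s where s: "(htr a)\<^sup>2 - s\<^sup>2 = 1" "N = hypN (htr a) s" by blast
  have s': "\<bar>s\<bar> = sqrt ((htr a)\<^sup>2 - 1)" using s(1) by (metis add_diff_cancel_left' diff_add_cancel real_sqrt_abs)
  have "cmod (complex_of_real (sqrt ((htr a)\<^sup>2 - 1))) = cmod (complex_of_real s)" unfolding s'[symmetric] by simp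
  then obtain g' where g': "toS g' \<star> N = hypN (htr a) (sqrt ((htr a)\<^sup>2 - 1)) \<star> toS g'"
    using rotate_conj[of "complex_of_real (sqrt ((htr a)\<^sup>2 - 1))" "complex_of_real s" "complex_of_real (htr a)"] s(2)
    by (auto simp: hypN_def)
  show ?thesis by (rule that[OF conj_trans[OF g g']])
qed

lemma hyp_intertwine:
  assumes "sdet a = 1" "sdet b = 1" "htr a > 1" "htr a = htr b"
  shows "\<exists>B::cov. toS B \<star> a = b \<star> toS B"
proof -
  let ?N = "hypN (htr a) (sqrt ((htr a)\<^sup>2 - 1))"
  obtain g where g: "toS g \<star> a = ?N \<star> toS g" by (rule hyp_conj[OF assms(1,3)])
  obtain g' where g': "toS g' \<star> b = ?N \<star> toS g'" using hyp_conj[OF assms(2)] assms(3,4) by metis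
  have "toS (cinv g') \<star> ?N = b \<star> toS (cinv g')"
  proof -
    have "sadj (toS g') \<star> (toS g' \<star> b) \<star> sadj (toS g') = sadj (toS g') \<star> ?N \<star> toS g' \<star> sadj (toS g')"
      unfolding g' by (simp add: smul_assoc)
    then show ?thesis by (simp add: toS_inv smul_assoc sadj_cancel sadj_id)
  qed
  from conj_trans[OF g this] show ?thesis by blast
qed

section \<open>The hyperbolic part of a fibre\<close>

text \<open>The pairs with commutator \<open>h\<close> satisfy \<open>B A = K A B\<close> for \<open>K\<close> the inverse of \<open>h\<close>, so \<open>K A\<close> is
  conjugate to \<open>A\<close>; the first components with trace above \<open>2\<close> are determined by this condition.\<close>

definition hyp_base :: "sq \<Rightarrow> sq set" where
  "hyp_base K = {a. sdet a = 1 \<and> htr a > 1 \<and> htr (K \<star> a) = htr a}"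

definition hyp_pairs :: "sq \<Rightarrow> sq set \<Rightarrow> (cov \<times> cov) set" where
  "hyp_pairs K U = {(A, B). toS A \<in> U \<and> A = lift_near 0 (toS A) \<and> toS B \<star> toS A = K \<star> toS A \<star> toS B}"

lemma hyp_pairs_exists:
  assumes "sdet K = 1" "a \<in> hyp_base K" "a \<in> U"
  shows "\<exists>B. (lift_near 0 a, B) \<in> hyp_pairs K U"
proof -
  have "toS (lift_near 0 a) = a" using assms by (intro toS_lift_near) (simp add: hyp_base_def)
  moreover have "sdet a = 1" "sdet (K \<star> a) = 1" "htr a > 1" "htr a = htr (K \<star> a)"
    using assms by (simp_all add: hyp_base_def sdet_mul)
  then obtain B where "toS B \<star> a = (K \<star> a) \<star> toS B"
    using hyp_intertwine[of a "K \<star> a"] by blast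
  ultimately have "(lift_near 0 a, B) \<in> hyp_pairs K U" using assms(3) by (simp add: hyp_pairs_def)
  then show ?thesis by blast
qed

lemma hyp_pairs_const:
  assumes dK: "sdet K = 1" and U: "U \<subseteq> hyp_base K" "connected U"
    and loc_const: "loc_const (hyp_pairs K U) \<kappa>"
    and tw: "\<And>A B Z. (A, B) \<in> hyp_pairs K U \<Longrightarrow> A \<odot> Z = Z \<odot> A \<Longrightarrow> \<kappa> (A, B \<odot> Z) = \<kappa> (A, B)"
    and xy: "x \<in> hyp_pairs K U" "y \<in> hyp_pairs K U"
  shows "\<kappa> x = \<kappa> y"
proof -
  let ?P = "hyp_pairs K U"
  define f where "f x = toS (fst x)" for x :: "cov \<times> cov"
  have img: "U = f ` ?P"
  proof (intro equalityI subsetI)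
    fix a assume a: "a \<in> U"
    then obtain B where B: "(lift_near 0 a, B) \<in> ?P" using hyp_pairs_exists[OF dK] U by blast
    have "f (lift_near 0 a, B) = a" using a U by (auto simp: f_def hyp_base_def intro!: toS_lift_near)
    then show "a \<in> f ` ?P" using B by (metis image_eqI)
  qed (auto simp: f_def hyp_pairs_def)
  have fib: "\<kappa> s = \<kappa> t" if st: "s \<in> ?P" "t \<in> ?P" "f s = f t" for s t
  proof -
    obtain A B A' B' where e: "s = (A, B)" "t = (A', B')" by (metis prod.collapse)
    have AA: "A' = A" using st by (simp add: e f_def hyp_pairs_def)
    have 1: "toS B \<star> toS A = K \<star> toS A \<star> toS B" "toS B' \<star> toS A = K \<star> toS A \<star> toS B'"
      using st by (auto simp: e AA hyp_pairs_def)
    define Z where "Z = cinv B \<odot> B'"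
    have "toS (A \<odot> Z) = toS A \<star> (sadj (toS B) \<star> toS B')" by (simp add: Z_def toS_mul toS_inv)
    have "sadj (toS B) \<star> (K \<star> toS A) = toS A \<star> sadj (toS B)"
    proof -
      have "sadj (toS B) \<star> (K \<star> toS A \<star> toS B) \<star> sadj (toS B) = sadj (toS B) \<star> (toS B \<star> toS A) \<star> sadj (toS B)"
        by (simp only: 1)
      then show ?thesis by (simp add: smul_assoc sadj_cancel sadj_id)
    qed
    then have "toS (Z \<odot> A) = toS (A \<odot> Z)"
      using 1(2) by (simp add: Z_def toS_mul toS_inv smul_assoc) (metis smul_assoc)
    then have "A \<odot> Z = Z \<odot> A" by (simp add: toS_mul toS_commute_iff)
    then have "\<kappa> (A, B \<odot> Z) = \<kappa> (A, B)" using tw st(1) by (simp add: e)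
    then show ?thesis by (simp add: e AA Z_def)
  qed
  have sec: "\<exists>\<sigma>. (\<sigma> \<longlongrightarrow> s) (at (f s) within U) \<and> (\<forall>\<^sub>F w in at (f s) within U. \<sigma> w \<in> ?P \<and> f (\<sigma> w) = w)"
    if s: "s \<in> ?P" for s
  proof -
    obtain A B where e: "s = (A, B)" by (rule prod.exhaust)
    let ?F = "at (toS A) within U"
    have a: "toS A \<in> hyp_base K" "A = lift_near 0 (toS A)" and AB: "toS B \<star> toS A = (K \<star> toS A) \<star> toS B"
      using s U by (auto simp: e hyp_pairs_def)
    have ns: "toS A \<noteq> sone" "toS A \<noteq> - sone" using a by (auto simp: hyp_base_def)
    have evU: "\<forall>\<^sub>F a in ?F. a \<in> U" by (auto simp: eventually_at_topological)
    have l1: "((\<lambda>a. a) \<longlongrightarrow> toS A) ?F" by (rule tendsto_ident_at)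
    have l2: "((\<lambda>a. K \<star> a) \<longlongrightarrow> K \<star> toS A) ?F" by (intro tendsto_intros)
    have ev: "\<forall>\<^sub>F a in ?F. sdet a = 1 \<and> sdet (K \<star> a) = 1 \<and> htr a = htr (K \<star> a)"
      using evU by eventually_elim (use U in \<open>auto simp: hyp_base_def sdet_mul dK\<close>)
    obtain B' where B': "(B' \<longlongrightarrow> toS B) ?F" "\<forall>\<^sub>F a in ?F. sdet (B' a) = 1 \<and> B' a \<star> a = (K \<star> a) \<star> B' a"
      by (rule sq_conj_section[OF sdet_toS ns sdet_toS AB l1 l2 ev])
    define \<sigma> where "\<sigma> a = (lift_near 0 a, lift_near (fst B) (B' a))" for a
    have "((\<lambda>a. lift_near 0 a) \<longlongrightarrow> lift_near 0 (toS A)) ?F"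
      by (rule tendsto_lift_near[OF l1 _ tendsto_const]) (use a in \<open>auto simp: hyp_base_def intro!: Re_pos_not_nonpos\<close>)
    moreover have "((\<lambda>a. lift_near (fst B) (B' a)) \<longlongrightarrow> B) ?F" by (rule lift_near_tendsto_self[OF B'(1)])
    ultimately have "(\<sigma> \<longlongrightarrow> s) ?F" unfolding \<sigma>_def e using a(2) by (intro tendsto_Pair) auto
    moreover have "\<forall>\<^sub>F w in ?F. \<sigma> w \<in> ?P \<and> f (\<sigma> w) = w"
      using B'(2) evU
    proof eventually_elim
      case (elim w)
      have w: "toS (lift_near 0 w) = w" using elim(2) U by (auto simp: hyp_base_def intro: toS_lift_near)
      then show ?case using elim by (auto simp: \<sigma>_def f_def hyp_pairs_def toS_lift_near)
    qed
    ultimately show ?thesis by (auto simp: e f_def)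
  qed
  obtain \<kappa>' where k: "loc_const U \<kappa>'" "\<And>s. s \<in> ?P \<Longrightarrow> \<kappa> s = \<kappa>' (f s)"
    using loc_const_fibre[OF loc_const fib sec img] by blast
  have "f x \<in> U" "f y \<in> U" using xy img by auto
  then have "\<kappa>' (f x) = \<kappa>' (f y)" by (rule loc_const_connected[OF U(2) k(1)])
  then show ?thesis using k(2) xy by simp
qed

lemma hyp_pairs_ccomm_const:
  assumes dK: "sdet K = 1" and U: "U \<subseteq> hyp_base K" "connected U" and xy: "(A, B) \<in> hyp_pairs K U" "(A', B') \<in> hyp_pairs K U"
  shows "ccomm A B = ccomm A' B'"
proof -
  have "(\<lambda>x. ccomm (fst x) (snd x)) (A, B) = (\<lambda>x. ccomm (fst x) (snd x)) (A', B')"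
  proof (rule hyp_pairs_const[OF dK U _ _ xy])
    show "loc_const (hyp_pairs K U) (\<lambda>x. ccomm (fst x) (snd x))"
      unfolding loc_const_def
    proof
      fix x assume x: "x \<in> hyp_pairs K U"
      let ?F = "at x within hyp_pairs K U"
      have t: "toS (ccomm (fst y) (snd y)) = sadj K" if "y \<in> hyp_pairs K U" for y
        using that toS_ccomm_iff[OF dK] by (auto simp: hyp_pairs_def)
      have "((\<lambda>y. ccomm (fst y) (snd y)) \<longlongrightarrow> ccomm (fst x) (snd x)) ?F" by (intro tendsto_intros)
      moreover have "\<forall>\<^sub>F y in ?F. y \<in> hyp_pairs K U" by (auto simp: eventually_at_topological)
      then have "\<forall>\<^sub>F y in ?F. toS (ccomm (fst y) (snd y)) = toS (ccomm (fst x) (snd x))"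
        by eventually_elim (simp add: t x)
      ultimately show "\<forall>\<^sub>F y in ?F. ccomm (fst y) (snd y) = ccomm (fst x) (snd x)"
        by (intro eventually_eq_of_toS[where a = "ccomm (fst x) (snd x)"]) auto
    qed
    fix A B Z assume "A \<odot> Z = Z \<odot> A"
    then show "(\<lambda>x. ccomm (fst x) (snd x)) (A, B \<odot> Z) = (\<lambda>x. ccomm (fst x) (snd x)) (A, B)"
      by (simp add: ccomm_twist)
  qed
  then show ?thesis by simp
qed

lemma hyp_pairs_kappa_const:
  assumes dK: "sdet K = 1" and U: "U \<subseteq> hyp_base K" "connected U" and F: "hyp_pairs K U \<subseteq> comm_fibre h"
    and loc_const: "loc_const (comm_fibre h) \<kappa>" "center_inv (comm_fibre h) \<kappa>"
    and xy: "x \<in> hyp_pairs K U" "y \<in> hyp_pairs K U"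
  shows "\<kappa> x = \<kappa> y"
  by (rule hyp_pairs_const[OF dK U loc_const_mono[OF loc_const(1) F] _ xy]) (use twist_right(2)[OF loc_const] F in blast)

lemma lift_unique:
  assumes "h \<in> shift_range 1 (- 1)" "h' \<in> shift_range 1 (- 1)" "toS h = toS h'" "htr (toS h) \<ge> - 1"
  shows "h = h'"
proof (rule toS_inj[OF assms(3)], rule ccontr)
  assume n: "\<not> \<bar>fst h - fst h'\<bar> < 2 * pi"
  have *: False if D: "x \<in> shift_range 1 (- 1)" "y \<in> shift_range 1 (- 1)" and e: "snd x = snd y" and g: "fst x \<ge> fst y + 2 * pi"
    and t: "htr (toS x) \<ge> - 1" for x y
  proof -
    let ?r = "arctan (cmod (snd x))"
    have r: "0 \<le> ?r" "?r < pi / 2" by (rule arctan_norm_bounds)+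
    have b: "fst x < pi + ?r" "fst y > - pi - ?r" using D e by (auto simp: shift_range_def min_shift_def max_shift_def)
    then have "\<bar>fst x - pi\<bar> < ?r" using g by linarith
    then have "cos ?r < cos \<bar>fst x - pi\<bar>" using r by (intro cos_monotone_0_pi) auto
    then have "1 / cc (snd x) < - cos (fst x)" by (simp add: cos_arctan_cc cos_diff)
    then have "cc (snd x) * cos (fst x) < - 1" by (simp add: field_simps)
    then show False using t by (simp add: htr_toS)
  qed
  have s: "snd h = snd h'" using assms(3) toS_eq_iff by blast
  show False
  proof (cases "fst h \<ge> fst h'")
    case True
    then show False using *[OF assms(1,2) s] n assms(4) by linarith
  next
    case False
    then show False using *[OF assms(2,1) s[symmetric]] n assms(3,4) by simp
  qed
qed

section \<open>Twisting to a hyperbolic element\<close>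

lemma conj_mul: "(g \<odot> A \<odot> cinv g) \<odot> (g \<odot> B \<odot> cinv g) = g \<odot> (A \<odot> B) \<odot> cinv g"
  by (simp add: cmul_assoc)

lemma conj_eq_iff: "g \<odot> A \<odot> cinv g = g \<odot> B \<odot> cinv g \<longleftrightarrow> A = B"
  by (simp add: cmul_assoc)

lemma htr_cov_conj: "htr (toS (g \<odot> A \<odot> cinv g)) = htr (toS A)"
proof (rule htr_conj(1))
  show "toS g \<star> toS A = toS (g \<odot> A \<odot> cinv g) \<star> toS g"
    by (simp add: toS_mul toS_inv smul_assoc sadj_id)
qed

lemma cov_normal_form:
  assumes "toS A \<noteq> sone" "toS A \<noteq> - sone"
  obtains g N where "toS (g \<odot> A \<odot> cinv g) = N"
    "(\<exists>c s. c > 1 \<and> s \<noteq> 0 \<and> c\<^sup>2 - s\<^sup>2 = 1 \<and> (N = hypN c s \<or> N = - hypN c s)) \<or>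
     (\<exists>\<theta>. sin \<theta> \<noteq> 0 \<and> N = (cis \<theta>, 0)) \<or> (\<exists>t. t \<noteq> 0 \<and> (N = parN t \<or> N = - parN t))"
proof -
  obtain g N where g: "toS g \<star> toS A = N \<star> toS g" and
    N: "(\<exists>c s. c > 1 \<and> s \<noteq> 0 \<and> c\<^sup>2 - s\<^sup>2 = 1 \<and> (N = hypN c s \<or> N = - hypN c s)) \<or>
     (\<exists>\<theta>. sin \<theta> \<noteq> 0 \<and> N = (cis \<theta>, 0)) \<or> (\<exists>t. t \<noteq> 0 \<and> (N = parN t \<or> N = - parN t))"
    by (rule normal_form[OF sdet_toS assms])
  have "toS (g \<odot> A \<odot> cinv g) = N" by (simp add: toS_mul toS_inv g smul_assoc sadj_id)
  then show ?thesis using N by (rule that)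
qed

definition hyperbolic :: "cov \<Rightarrow> bool" where "hyperbolic A \<longleftrightarrow> \<bar>htr (toS A)\<bar> > 1"

lemma hyperbolic_conj [simp]: "hyperbolic (g \<odot> A \<odot> cinv g) \<longleftrightarrow> hyperbolic A"
  by (simp only: hyperbolic_def htr_cov_conj)

lemma unbounded_affine:
  assumes "b \<noteq> (0::real)" shows "\<exists>t. \<bar>a + t * b\<bar> > 1"
  by (rule exI[of _ "(2 - a) / b"]) (use assms in simp)

lemma twist_B_normal:
  assumes ne: "A \<odot> B \<noteq> B \<odot> A"
    and N: "(\<exists>\<theta>. sin \<theta> \<noteq> 0 \<and> toS A = (cis \<theta>, 0)) \<or> (\<exists>t. t \<noteq> 0 \<and> (toS A = parN t \<or> toS A = - parN t))"
  shows "\<exists>Z. A \<odot> Z = Z \<odot> A \<and> hyperbolic (B \<odot> Z) \<and> (htr (toS A) \<noteq> 0 \<or> htr (toS (A \<odot> (B \<odot> Z))) \<noteq> 0)"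
  using N
proof
  assume "\<exists>\<theta>. sin \<theta> \<noteq> 0 \<and> toS A = (cis \<theta>, 0)"
  then obtain \<theta> where A: "sin \<theta> \<noteq> 0" "toS A = (cis \<theta>, 0)" by blast
  let ?a = "fst (toS B)" and ?b = "snd (toS B)"
  have "?b \<noteq> 0"
  proof
    assume "?b = 0"
    then have "toS A \<star> toS B = toS B \<star> toS A" by (simp add: A smul_def)
    then show False using ne toS_commute_iff by blast
  qed
  moreover have "(cmod ?a)\<^sup>2 = 1 + (cmod ?b)\<^sup>2" using sdet_toS[of B] unfolding sdet_def by simp
  ultimately have "(cmod ?a)\<^sup>2 > 1" by simp
  then have a1: "cmod ?a > 1" using power_le_one[of "cmod ?a" 2] by (meson norm_ge_zero not_less)
  define w where "w = (1 + 1 / cmod ?a) / 2"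
  have "1 / r < 1 \<and> 0 < 1 / r" if "r > 1" for r :: real using that by simp
  from this[OF a1] have r1: "1 / cmod ?a < 1" "0 < 1 / cmod ?a" by blast+
  have "q < (1 + q) / 2 \<and> (1 + q) / 2 < 1 \<and> 0 < (1 + q) / 2" if "q < 1" "0 < q" for q :: real using that by simp
  from this[OF r1] have w: "1 / cmod ?a < w" "w < 1" "0 < w" unfolding w_def by blast+
  define \<psi> where "\<psi> = arccos w"
  have mul_factor: "cos \<psi> = w" using w by (simp add: \<psi>_def cos_arccos)
  have sw: "sin \<psi> \<noteq> 0"
  proof
    assume "sin \<psi> = 0"
    then have "w\<^sup>2 = 1" using sin_cos_squared_add[of \<psi>] mul_factor by simp
    then show False using w by (simp add: power2_eq_1_iff)
  qed
  define Z :: cov where "Z = (\<psi> - Arg ?a, 0)"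
  have Zs: "toS Z = (cis (\<psi> - Arg ?a), 0)" by (simp add: Z_def toS_def)
  have comm: "A \<odot> Z = Z \<odot> A" unfolding toS_commute_iff[symmetric] by (simp add: A Zs smul_def cis_mult add.commute)
  have aZ: "?a * cis (\<psi> - Arg ?a) = complex_of_real (cmod ?a) * cis \<psi>"
  proof -
    have "?a * cis (\<psi> - Arg ?a) = complex_of_real (cmod ?a) * (cis (Arg ?a) * cis (\<psi> - Arg ?a))"
      using cis_Arg_cmod[of ?a] by (simp add: mult.assoc[symmetric])
    then show ?thesis by (simp add: cis_mult)
  qed
  have fBZ: "fst (toS (B \<odot> Z)) = complex_of_real (cmod ?a) * cis \<psi>" by (simp add: toS_mul Zs smul_def aZ)
  have "htr (toS (B \<odot> Z)) = cmod ?a * w" unfolding fBZ by (simp add: mul_factor)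
  moreover have "r * w > 1" if "1 / r < w" "r > 1" for r :: real
    using that by (simp add: pos_divide_less_eq mult.commute)
  from this[OF w(1) a1] have "cmod ?a * w > 1" .
  ultimately have h: "hyperbolic (B \<odot> Z)" by (simp add: hyperbolic_def)
  have "htr (toS (A \<odot> (B \<odot> Z))) = cmod ?a * cos (\<theta> + \<psi>)"
    by (simp only: toS_mul[of A] smul_def fst_conv snd_conv fBZ A) (simp add: cos_add algebra_simps)
  then have "htr (toS A) \<noteq> 0 \<or> htr (toS (A \<odot> (B \<odot> Z))) \<noteq> 0" using A sw a1 by (auto simp: cos_add)
  with comm h show ?thesis by blast
next
  assume "\<exists>t. t \<noteq> 0 \<and> (toS A = parN t \<or> toS A = - parN t)"
  then obtain t where t: "t \<noteq> 0" and A: "toS A = parN t \<or> toS A = - parN t" by blast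
  have h0: "htr (toS A) \<noteq> 0" using A by (auto simp: parN_def)
  let ?a = "fst (toS B)" and ?b = "snd (toS B)"
  show ?thesis
  proof (cases "Re ?b = Im ?a")
    case False
    have ht: "htr (toS (B \<odot> ray u 0)) = Re ?a + u * (Re ?b - Im ?a)" for u
      by (simp add: toS_mul toS_ray smul_def algebra_simps)
    obtain u where u: "\<bar>Re ?a + u * (Re ?b - Im ?a)\<bar> > 1" using unbounded_affine[of "Re ?b - Im ?a" "Re ?a"] False by auto
    have "parN t \<star> toS (ray u 0) = toS (ray u 0) \<star> parN t"
      by (simp add: toS_ray parN_def smul_def complex_eq_iff algebra_simps)
    then have "toS A \<star> toS (ray u 0) = toS (ray u 0) \<star> toS A" using A by auto
    then have "A \<odot> ray u 0 = ray u 0 \<odot> A" by (simp add: toS_commute_iff)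
    moreover have "hyperbolic (B \<odot> ray u 0)" using u by (simp add: hyperbolic_def ht)
    ultimately show ?thesis using h0 by blast
  next
    case True
    have d: "(Re ?a)\<^sup>2 = 1 + (Im ?b)\<^sup>2" using sdet_toS[of B] unfolding sdet_Re_Im True by simp
    have "Im ?b \<noteq> 0"
    proof
      assume z: "Im ?b = 0"
      have "parN t \<star> toS B = toS B \<star> parN t"
        using True z by (simp add: parN_def smul_def complex_eq_iff algebra_simps)
      then have "toS A \<star> toS B = toS B \<star> toS A" using A by auto
      then show False using ne toS_commute_iff by blast
    qed
    then have "(Re ?a)\<^sup>2 > 1" using d by simp
    then have "hyperbolic B" unfolding hyperbolic_def
      using abs_square_le_1[of "Re ?a"] by (meson not_less)
    then show ?thesis using h0 by (intro exI[of _ cid]) simp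
  qed
qed

lemma hypN_commute: "hypN c s \<star> hypN c' s' = hypN c' s' \<star> hypN c s"
  by (simp add: hypN_def smul_def algebra_simps)

lemma twist_A_normal:
  assumes N: "c > 1" "s \<noteq> 0" "c\<^sup>2 - s\<^sup>2 = 1" "toS B = hypN c s \<or> toS B = - hypN c s"
    and ne: "htr (toS A) \<noteq> 0 \<or> htr (toS (A \<odot> B)) \<noteq> 0"
  shows "\<exists>W. B \<odot> W = W \<odot> B \<and> hyperbolic (A \<odot> W)"
proof -
  define x p where "x = Re (fst (toS A))" and "p = Re (snd (toS A))"
  have "htr (toS (A \<odot> B)) = x * c + p * s \<or> htr (toS (A \<odot> B)) = - (x * c + p * s)"
    using N(4) by (auto simp: toS_mul smul_def hypN_def x_def p_def)
  then have xp: "x \<noteq> 0 \<or> p \<noteq> 0" using ne by (auto simp: x_def)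
  define W :: "real \<Rightarrow> cov" where "W t = (0, complex_of_real ((t - 1 / t) / 2))" for t
  have W: "toS (W t) = (complex_of_real ((t + 1 / t) / 2), complex_of_real ((t - 1 / t) / 2))" if "t > 0" for t
  proof -
    have "1 + ((t - 1 / t) / 2)\<^sup>2 = ((t + 1 / t) / 2)\<^sup>2" using that by (simp add: power2_eq_square field_simps)
    then have "cc (complex_of_real ((t - 1 / t) / 2)) = (t + 1 / t) / 2"
      unfolding cc_def norm_of_real power2_abs using that by simp
    then show ?thesis by (simp only: W_def toS_def fst_conv snd_conv cis_zero mult_1_right)
  qed
  have comm: "B \<odot> W t = W t \<odot> B" if "t > 0" for t
  proof -
    have "toS B \<star> toS (W t) = toS (W t) \<star> toS B"
      using N(4) hypN_commute[of c s] by (auto simp: W[OF that, folded hypN_def])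
    then show ?thesis by (simp add: toS_commute_iff)
  qed
  have ht: "htr (toS (A \<odot> W t)) = ((x + p) * t + (x - p) / t) / 2" if "t > 0" for t
    unfolding toS_mul smul_def W[OF that] fst_conv snd_conv by (simp add: x_def p_def add_divide_distrib diff_divide_distrib algebra_simps)
  have big: "\<exists>t\<ge>1. \<bar>u * t + v / t\<bar> / 2 > 1" if "u \<noteq> 0" for u v :: real
  proof -
    define t where "t = (3 + \<bar>v\<bar>) / \<bar>u\<bar> + 1"
    have t1: "t \<ge> 1" using that by (simp add: t_def)
    have "\<bar>v / t\<bar> \<le> \<bar>v\<bar>" using t1 by (simp add: divide_le_eq mult_le_cancel_left1)
    moreover have "\<bar>u * t\<bar> = \<bar>u\<bar> * t" using t1 by (simp add: abs_mult)
    moreover have "\<bar>u\<bar> * t = 3 + \<bar>v\<bar> + \<bar>u\<bar>" using that by (simp add: t_def field_simps)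
    ultimately have "\<bar>u * t + v / t\<bar> \<ge> 3" by linarith
    then show ?thesis using t1 by (intro exI[of _ t]) simp
  qed
  show ?thesis
  proof (cases "x + p = 0")
    case False
    obtain t where t: "t \<ge> 1" "\<bar>(x + p) * t + (x - p) / t\<bar> / 2 > 1" using big[OF False] by blast
    then have "hyperbolic (A \<odot> W t)" using ht[of t] by (simp add: hyperbolic_def)
    then show ?thesis using comm[of t] t by (intro exI[of _ "W t"]) simp
  next
    case True
    then have "x - p \<noteq> 0" using xp by auto
    from big[OF this, of "x + p"] obtain t where t: "t \<ge> 1" "\<bar>(x - p) * t + (x + p) / t\<bar> / 2 > 1" by blast
    have "((x + p) * (1 / t) + (x - p) / (1 / t)) / 2 = ((x - p) * t + (x + p) / t) / 2" by simp
    then have "hyperbolic (A \<odot> W (1 / t))" using ht[of "1 / t"] t by (simp add: hyperbolic_def)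
    then show ?thesis using comm[of "1 / t"] t by (intro exI[of _ "W (1 / t)"]) simp
  qed
qed

lemma twist_B:
  assumes ne: "A \<odot> B \<noteq> B \<odot> A" and nh: "\<not> hyperbolic A"
  shows "\<exists>Z. A \<odot> Z = Z \<odot> A \<and> hyperbolic (B \<odot> Z) \<and> (htr (toS A) \<noteq> 0 \<or> htr (toS (A \<odot> (B \<odot> Z))) \<noteq> 0)"
proof -
  have ns: "toS A \<noteq> sone" "toS A \<noteq> - sone" using ne unfolding toS_commute_iff[symmetric] by auto
  obtain g N where g: "toS (g \<odot> A \<odot> cinv g) = N" and
    N: "(\<exists>c s. c > 1 \<and> s \<noteq> 0 \<and> c\<^sup>2 - s\<^sup>2 = 1 \<and> (N = hypN c s \<or> N = - hypN c s)) \<or>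
     (\<exists>\<theta>. sin \<theta> \<noteq> 0 \<and> N = (cis \<theta>, 0)) \<or> (\<exists>t. t \<noteq> 0 \<and> (N = parN t \<or> N = - parN t))"
    by (rule cov_normal_form[OF ns])
  let ?c = "\<lambda>x. g \<odot> x \<odot> cinv g"
  have nh': "\<bar>htr N\<bar> \<le> 1" using nh htr_cov_conj[of g A] unfolding g by (simp add: hyperbolic_def)
  then have "\<not> (\<exists>c s. c > 1 \<and> s \<noteq> 0 \<and> c\<^sup>2 - s\<^sup>2 = 1 \<and> (N = hypN c s \<or> N = - hypN c s))"
    by (auto simp: hypN_def)
  then have N': "(\<exists>\<theta>. sin \<theta> \<noteq> 0 \<and> toS (?c A) = (cis \<theta>, 0)) \<or> (\<exists>t. t \<noteq> 0 \<and> (toS (?c A) = parN t \<or> toS (?c A) = - parN t))"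
    using N unfolding g by blast
  have ne': "?c A \<odot> ?c B \<noteq> ?c B \<odot> ?c A" unfolding conj_mul conj_eq_iff by (rule ne)
  obtain Z' where Z': "?c A \<odot> Z' = Z' \<odot> ?c A" "hyperbolic (?c B \<odot> Z')"
    "htr (toS (?c A)) \<noteq> 0 \<or> htr (toS (?c A \<odot> (?c B \<odot> Z'))) \<noteq> 0"
    using twist_B_normal[OF ne' N'] by blast
  define Z where "Z = cinv g \<odot> Z' \<odot> g"
  have e: "Z' = ?c Z" by (simp add: Z_def cmul_assoc)
  show ?thesis using Z' unfolding e conj_mul conj_eq_iff hyperbolic_conj htr_cov_conj by blast
qed

lemma twist_A:
  assumes h: "hyperbolic B" and ne: "htr (toS A) \<noteq> 0 \<or> htr (toS (A \<odot> B)) \<noteq> 0"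
  shows "\<exists>W. B \<odot> W = W \<odot> B \<and> hyperbolic (A \<odot> W)"
proof -
  have ns: "toS B \<noteq> sone" "toS B \<noteq> - sone" using h by (auto simp: hyperbolic_def)
  obtain g N where g: "toS (g \<odot> B \<odot> cinv g) = N" and
    N: "(\<exists>c s. c > 1 \<and> s \<noteq> 0 \<and> c\<^sup>2 - s\<^sup>2 = 1 \<and> (N = hypN c s \<or> N = - hypN c s)) \<or>
     (\<exists>\<theta>. sin \<theta> \<noteq> 0 \<and> N = (cis \<theta>, 0)) \<or> (\<exists>t. t \<noteq> 0 \<and> (N = parN t \<or> N = - parN t))"
    by (rule cov_normal_form[OF ns])
  let ?c = "\<lambda>x. g \<odot> x \<odot> cinv g"
  have h': "\<bar>htr N\<bar> > 1" using h htr_cov_conj[of g B] unfolding g by (simp add: hyperbolic_def)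
  have "\<not> (\<exists>\<theta>. sin \<theta> \<noteq> 0 \<and> N = (cis \<theta>, 0))"
    using h' abs_cos_le_one by (auto simp: not_less[symmetric])
  moreover have "\<not> (\<exists>t. t \<noteq> 0 \<and> (N = parN t \<or> N = - parN t))" using h' by (auto simp: parN_def)
  ultimately obtain c s where cs: "c > 1" "s \<noteq> 0" "c\<^sup>2 - s\<^sup>2 = 1" "N = hypN c s \<or> N = - hypN c s" using N by blast
  have "htr (toS (?c A)) \<noteq> 0 \<or> htr (toS (?c A \<odot> ?c B)) \<noteq> 0" using ne unfolding conj_mul htr_cov_conj .
  then obtain W' where W': "?c B \<odot> W' = W' \<odot> ?c B" "hyperbolic (?c A \<odot> W')"
    using twist_A_normal[OF cs(1,2,3), of "?c B" "?c A"] cs(4) g by blast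
  define W where "W = cinv g \<odot> W' \<odot> g"
  have e: "W' = ?c W" by (simp add: W_def cmul_assoc)
  show ?thesis using W' unfolding e conj_mul conj_eq_iff hyperbolic_conj by blast
qed

lemma lift_near0_shift:
  assumes "htr (toS A) \<noteq> 0"
  obtains k where "toS (central k \<odot> A) = (if htr (toS A) > 0 then toS A else - toS A)"
    "central k \<odot> A = lift_near 0 (toS (central k \<odot> A))"
proof -
  define s where "s = (if htr (toS A) > 0 then toS A else - toS A)"
  have s: "sdet s = 1" "htr s > 0" using assms by (auto simp: s_def)
  have t: "toS (lift_near 0 s) = s" by (rule toS_lift_near[OF s(1)])
  then obtain k where k: "lift_near 0 s = central k \<odot> A" using toS_pm[of "lift_near 0 s" A] by (auto simp: s_def split: if_splits)
  show ?thesis by (rule that[of k]) (use k t s_def in metis)+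
qed

lemma twist_to_hyperbolic:
  assumes loc_const: "loc_const (comm_fibre h) \<kappa>" "center_inv (comm_fibre h) \<kappa>" and AB: "(A, B) \<in> comm_fibre h" and h: "h \<noteq> cid"
  obtains A' B' where "(A', B') \<in> comm_fibre h" "\<kappa> (A', B') = \<kappa> (A, B)" "htr (toS A') > 1" "A' = lift_near 0 (toS A')"
proof -
  have ne: "A \<odot> B \<noteq> B \<odot> A" using AB h ccomm_eq_cid_iff[of A B] by (simp add: comm_fibre_def)
  have "\<exists>A1 B1. (A1, B1) \<in> comm_fibre h \<and> \<kappa> (A1, B1) = \<kappa> (A, B) \<and> hyperbolic A1"
  proof (cases "hyperbolic A")
    case True then show ?thesis using AB by blast
  next
    case False
    obtain Z where Z: "A \<odot> Z = Z \<odot> A" "hyperbolic (B \<odot> Z)" "htr (toS A) \<noteq> 0 \<or> htr (toS (A \<odot> (B \<odot> Z))) \<noteq> 0"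
      using twist_B[OF ne False] by blast
    note t1 = twist_right[OF loc_const AB Z(1)]
    obtain W where W: "(B \<odot> Z) \<odot> W = W \<odot> (B \<odot> Z)" "hyperbolic (A \<odot> W)" using twist_A[OF Z(2,3)] by blast
    note t2 = twist_left[OF loc_const t1(1) W(1)]
    show ?thesis using t1 t2 W by metis
  qed
  then obtain A1 B1 where 1: "(A1, B1) \<in> comm_fibre h" "\<kappa> (A1, B1) = \<kappa> (A, B)" "hyperbolic A1" by blast
  then have "htr (toS A1) \<noteq> 0" by (auto simp: hyperbolic_def)
  then obtain k where k: "toS (central k \<odot> A1) = (if htr (toS A1) > 0 then toS A1 else - toS A1)"
    "central k \<odot> A1 = lift_near 0 (toS (central k \<odot> A1))" by (rule lift_near0_shift)
  have "htr (toS (central k \<odot> A1)) > 1" using 1(3) k(1) by (auto simp: hyperbolic_def)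
  then show ?thesis using center_inv_shift[OF loc_const(2) 1(1), of k 0] 1(2) k(2)
    by (intro that[of "central k \<odot> A1" B1]) simp_all
qed

section \<open>The fibres of the commutator map\<close>

definition good_fibre :: "cov \<Rightarrow> bool" where "good_fibre h \<longleftrightarrow> comm_fibre h \<noteq> {} \<and> conn_mod_center (comm_fibre h)"

lemma comm_fibre_iff:
  assumes "h \<in> shift_range 1 (- 1)" "htr (toS h) \<ge> - 1"
  shows "(A, B) \<in> comm_fibre h \<longleftrightarrow> toS B \<star> toS A = sadj (toS h) \<star> toS A \<star> toS B"
proof -
  have "(A, B) \<in> comm_fibre h \<longleftrightarrow> toS (ccomm A B) = toS h"
  proof
    assume "toS (ccomm A B) = toS h"
    then have "h = ccomm A B" by (rule lift_unique[OF assms(1) ccomm_shift_range HOL.sym assms(2)])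
    then show "(A, B) \<in> comm_fibre h" by (simp add: comm_fibre_def)
  qed (simp add: comm_fibre_def)
  also have "\<dots> \<longleftrightarrow> toS B \<star> toS A = sadj (toS h) \<star> toS A \<star> toS B"
    using toS_ccomm_iff[of "sadj (toS h)" A B] by simp
  finally show ?thesis .
qed

lemma htr_intertwine:
  assumes "toS B \<star> a = K \<star> a \<star> toS B" shows "htr (K \<star> a) = htr a"
  by (rule htr_conj(1)[OF assms])

lemma comm_fibre_hyp_pairs:
  assumes "(A, B) \<in> comm_fibre h" "htr (toS A) > 1" "A = lift_near 0 (toS A)"
  shows "(A, B) \<in> hyp_pairs (sadj (toS h)) (hyp_base (sadj (toS h)))"
proof -
  have "toS (ccomm A B) = sadj (sadj (toS h))" using assms(1) by (simp add: comm_fibre_def)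
  then have e: "toS B \<star> toS A = sadj (toS h) \<star> toS A \<star> toS B"
    by (subst (asm) toS_ccomm_iff) simp_all
  then have "htr (sadj (toS h) \<star> toS A) = htr (toS A)" by (rule htr_intertwine)
  then show ?thesis using e assms by (simp add: hyp_pairs_def hyp_base_def)
qed

lemma good_fibre_of_connected_hyp_base:
  assumes h: "h \<in> shift_range 1 (- 1)" "htr (toS h) \<ge> - 1" "h \<noteq> cid" and K: "sadj (toS h) = K"
    and B: "connected (hyp_base K)" "hyp_base K \<noteq> {}"
  shows "good_fibre h"
proof -
  have dK: "sdet K = 1" using K by auto
  have PF: "hyp_pairs K (hyp_base K) \<subseteq> comm_fibre h" using comm_fibre_iff[OF h(1,2)] K by (auto simp: hyp_pairs_def)
  obtain a where a: "a \<in> hyp_base K" using B(2) by blast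
  obtain b where "(lift_near 0 a, b) \<in> hyp_pairs K (hyp_base K)" using hyp_pairs_exists[OF dK a a] by blast
  then have "comm_fibre h \<noteq> {}" using PF by blast
  moreover have "conn_mod_center (comm_fibre h)"
    unfolding conn_mod_center_def
  proof (intro allI impI)
    fix \<kappa> assume loc_const: "loc_const (comm_fibre h) \<kappa>" "center_inv (comm_fibre h) \<kappa>"
    have "\<kappa> x = \<kappa> (lift_near 0 a, b)" if x: "x \<in> comm_fibre h" for x
    proof -
      obtain A B where xe: "x = (A, B)" by (rule prod.exhaust)
      obtain A' B' where *: "(A', B') \<in> comm_fibre h" "\<kappa> (A', B') = \<kappa> (A, B)" "htr (toS A') > 1" "A' = lift_near 0 (toS A')"
        using twist_to_hyperbolic[OF loc_const _ h(3)] x xe by metis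
      have "(A', B') \<in> hyp_pairs K (hyp_base K)" using comm_fibre_hyp_pairs[OF *(1,3,4)] K by simp
      from hyp_pairs_kappa_const[OF dK subset_refl B(1) PF loc_const this \<open>(lift_near 0 a, b) \<in> hyp_pairs K (hyp_base K)\<close>]
      show ?thesis using *(2) xe by simp
    qed
    then show "\<exists>c. \<forall>x\<in>comm_fibre h. \<kappa> x = c" by blast
  qed
  ultimately show ?thesis by (simp add: good_fibre_def)
qed

lemma good_fibre_conj:
  assumes "good_fibre (g \<odot> h \<odot> cinv g)" shows "good_fibre h"
proof -
  let ?h = "g \<odot> h \<odot> cinv g"
  define \<Phi> where "\<Phi> x = (cinv g \<odot> fst x \<odot> g, cinv g \<odot> snd x \<odot> g)" for x :: "cov \<times> cov"
  define \<Psi> where "\<Psi> x = (g \<odot> fst x \<odot> cinv g, g \<odot> snd x \<odot> cinv g)" for x :: "cov \<times> cov"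
  have cc: "ccomm (cinv g \<odot> A \<odot> g) (cinv g \<odot> B \<odot> g) = cinv g \<odot> ccomm A B \<odot> g" for A B g
    by (simp add: ccomm_def cmul_assoc)
  have F1: "\<Phi> x \<in> comm_fibre h" if "x \<in> comm_fibre ?h" for x
    using that by (auto simp: comm_fibre_def \<Phi>_def cc) (simp add: cmul_assoc)
  have F2: "\<Psi> x \<in> comm_fibre ?h" if "x \<in> comm_fibre h" for x
    using that cc[of "cinv g"] by (auto simp: comm_fibre_def \<Psi>_def)
  have inv: "\<Phi> (\<Psi> x) = x" for x by (simp add: \<Phi>_def \<Psi>_def cmul_assoc)
  have "comm_fibre h \<noteq> {}" using assms F1 by (auto simp: good_fibre_def)
  moreover have "conn_mod_center (comm_fibre h)"
    unfolding conn_mod_center_def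
  proof (intro allI impI)
    fix \<kappa> assume loc_const: "loc_const (comm_fibre h) \<kappa>" "center_inv (comm_fibre h) \<kappa>"
    have "loc_const (comm_fibre ?h) (\<lambda>x. \<kappa> (\<Phi> x))"
      by (rule loc_const_compose[OF loc_const(1)]) (use F1 in \<open>auto simp: \<Phi>_def intro!: continuous_intros\<close>)
    moreover have "center_inv (comm_fibre ?h) (\<lambda>x. \<kappa> (\<Phi> x))"
      unfolding center_inv_def
    proof (intro allI impI)
      fix A B assume AB: "(A, B) \<in> comm_fibre ?h"
      have "\<Phi> (central 1 \<odot> A, B) = (central 1 \<odot> fst (\<Phi> (A, B)), snd (\<Phi> (A, B)))"
        "\<Phi> (A, central 1 \<odot> B) = (fst (\<Phi> (A, B)), central 1 \<odot> snd (\<Phi> (A, B)))"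
        by (simp_all add: \<Phi>_def cmul_assoc central_left_commute)
      then show "\<kappa> (\<Phi> (central 1 \<odot> A, B)) = \<kappa> (\<Phi> (A, B)) \<and> \<kappa> (\<Phi> (A, central 1 \<odot> B)) = \<kappa> (\<Phi> (A, B))"
        using loc_const(2) F1[OF AB] unfolding center_inv_def by (metis prod.collapse)
    qed
    ultimately obtain c where "\<forall>x\<in>comm_fibre ?h. \<kappa> (\<Phi> x) = c" using assms unfolding good_fibre_def conn_mod_center_def by blast
    then have "\<kappa> x = c" if "x \<in> comm_fibre h" for x using F2[OF that] inv by metis
    then show "\<exists>c. \<forall>x\<in>comm_fibre h. \<kappa> x = c" by blast
  qed
  ultimately show ?thesis by (simp add: good_fibre_def)
qed

lemma htr_mul: "htr (s \<star> t) = Re (fst s) * Re (fst t) - Im (fst s) * Im (fst t) + Re (snd s) * Re (snd t) + Im (snd s) * Im (snd t)"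
  by (simp add: smul_def)

lemma hyp_base_hyp:
  assumes cs: "c > 1" "s \<noteq> 0" "c\<^sup>2 - s\<^sup>2 = 1"
  shows "connected (hyp_base (hypN c s))" "hyp_base (hypN c s) \<noteq> {}"
proof -
  define k where "k = (c - 1) / s"
  have s2: "s\<^sup>2 = (c - 1) * (c + 1)" using cs(3) by (simp add: power2_eq_square algebra_simps)
  have "k\<^sup>2 = (c - 1) / (c + 1)" using cs(1) by (simp add: k_def power_divide s2) (simp add: power2_eq_square)
  then have k: "0 < k\<^sup>2" "k\<^sup>2 < 1" using cs(1) by simp_all
  define R where "R = {v::real \<times> real. (fst v)\<^sup>2 - (snd v)\<^sup>2 < k\<^sup>2}"
  define x where "x v = sqrt ((1 + (snd v)\<^sup>2 - (fst v)\<^sup>2) / (1 - k\<^sup>2))" for v :: "real \<times> real"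
  define f where "f v = (Complex (x v) (fst v), Complex (- k * x v) (snd v))" for v
  have x1: "x v > 1 \<and> (x v)\<^sup>2 * (1 - k\<^sup>2) = 1 + (snd v)\<^sup>2 - (fst v)\<^sup>2" if "v \<in> R" for v
  proof -
    have a: "(1 + (snd v)\<^sup>2 - (fst v)\<^sup>2) / (1 - k\<^sup>2) > 1" using that k by (simp add: R_def)
    then have "x v > 1" unfolding x_def by (metis real_sqrt_less_iff real_sqrt_one)
    moreover have "(x v)\<^sup>2 = (1 + (snd v)\<^sup>2 - (fst v)\<^sup>2) / (1 - k\<^sup>2)" unfolding x_def using a by (intro real_sqrt_pow2) linarith
    ultimately show ?thesis using k by simp
  qed
  have img: "hyp_base (hypN c s) = f ` R"
  proof (intro equalityI subsetI)
    fix a assume "a \<in> hyp_base (hypN c s)"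
    then have a: "sdet a = 1" "Re (fst a) > 1" "Re (fst a) * c + Re (snd a) * s = Re (fst a)"
      by (simp_all add: hyp_base_def htr_mul hypN_def mult.commute)
    have p: "Re (snd a) = - k * Re (fst a)" using a(3) cs(2) by (simp add: k_def field_simps)
    let ?v = "(Im (fst a), Im (snd a))"
    have d: "(Re (fst a))\<^sup>2 * (1 - k\<^sup>2) = 1 + (Im (snd a))\<^sup>2 - (Im (fst a))\<^sup>2"
      using a(1) unfolding sdet_Re_Im p by (simp add: power2_eq_square algebra_simps)
    have "(Re (fst a))\<^sup>2 > 1" using a(2) by (simp add: one_less_power)
    then have "1 * (1 - k\<^sup>2) < (Re (fst a))\<^sup>2 * (1 - k\<^sup>2)" using k by (intro mult_strict_right_mono) auto
    then have vR: "?v \<in> R" unfolding d by (simp add: R_def)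
    have "(1 + (Im (snd a))\<^sup>2 - (Im (fst a))\<^sup>2) / (1 - k\<^sup>2) = (Re (fst a))\<^sup>2"
      unfolding d[symmetric] using k by simp
    then have "x ?v = sqrt ((Re (fst a))\<^sup>2)" unfolding x_def by simp
    then have "x ?v = Re (fst a)" using a(2) by simp
    then have "a = f ?v" using p by (simp add: f_def prod_eq_iff complex_eq_iff)
    then show "a \<in> f ` R" using vR by blast
  next
    fix a assume "a \<in> f ` R"
    then obtain v where v: "v \<in> R" "a = f v" by blast
    have "Re (fst a) * c + Re (snd a) * s = Re (fst a)" using cs(2) by (simp add: v(2) f_def k_def field_simps)
    moreover have "sdet a = 1" unfolding sdet_Re_Im using x1[OF v(1)]
      by (simp add: v(2) f_def power_mult_distrib algebra_simps)
    ultimately show "a \<in> hyp_base (hypN c s)" using x1[OF v(1)]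
      by (simp add: hyp_base_def htr_mul hypN_def mult.commute) (simp add: v(2) f_def)
  qed
  have star: "t *\<^sub>R v \<in> R" if v: "v \<in> R" and t: "t \<in> {0..1}" for v t
  proof -
    have t2: "t\<^sup>2 \<le> 1" "0 \<le> t\<^sup>2" using t by (simp_all add: power_le_one)
    have "t\<^sup>2 * ((fst v)\<^sup>2 - (snd v)\<^sup>2) < k\<^sup>2"
    proof (cases "(fst v)\<^sup>2 - (snd v)\<^sup>2 \<ge> 0")
      case True
      then have "t\<^sup>2 * ((fst v)\<^sup>2 - (snd v)\<^sup>2) \<le> 1 * ((fst v)\<^sup>2 - (snd v)\<^sup>2)" using t2 by (intro mult_right_mono) auto
      then show ?thesis using v by (simp add: R_def)
    next
      case False
      then have "t\<^sup>2 * ((fst v)\<^sup>2 - (snd v)\<^sup>2) \<le> 0" using t2 by (intro mult_nonneg_nonpos) auto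
      then show ?thesis using k by linarith
    qed
    then show ?thesis by (simp add: R_def power_mult_distrib algebra_simps)
  qed
  have R0: "(0, 0) \<in> R" using k by (simp add: R_def)
  have "starlike R"
    unfolding starlike_def
  proof (intro bexI[of _ "(0,0)"] ballI R0)
    fix v assume v: "v \<in> R"
    show "closed_segment (0, 0) v \<subseteq> R"
    proof
      fix w assume "w \<in> closed_segment (0, 0) v"
      then obtain t where "t \<in> {0..1}" "w = (1 - t) *\<^sub>R (0, 0) + t *\<^sub>R v" by (auto simp: in_segment)
      then have "t \<in> {0..1}" "w = t *\<^sub>R v" by (auto simp: prod_eq_iff)
      then show "w \<in> R" using star[OF v] by blast
    qed
  qed
  then have "connected R" by (rule starlike_imp_connected)
  moreover have "continuous_on R f" unfolding f_def x_def using k by (intro continuous_intros) auto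
  ultimately show "connected (hyp_base (hypN c s))" unfolding img by (intro connected_continuous_image)
  show "hyp_base (hypN c s) \<noteq> {}" unfolding img using R0 by blast
qed

lemma hyp_base_ell:
  assumes th: "sin \<theta> \<noteq> 0"
  shows "connected (hyp_base (cis \<theta>, 0))" "hyp_base (cis \<theta>, 0) \<noteq> {}"
proof -
  define m where "m = (cos \<theta> - 1) / sin \<theta>"
  define r where "r v = sqrt ((fst v)\<^sup>2 * (1 + m\<^sup>2) - 1)" for v :: "real \<times> real"
  define f where "f v = (Complex (fst v) (m * fst v), complex_of_real (r v) * cis (snd v))" for v
  define R where "R = {1::real<..} \<times> (UNIV :: real set)"
  have r2: "(r v)\<^sup>2 = (fst v)\<^sup>2 * (1 + m\<^sup>2) - 1" if "fst v > 1" for v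
  proof -
    have "(fst v)\<^sup>2 * 1 \<le> (fst v)\<^sup>2 * (1 + m\<^sup>2)" by (intro mult_left_mono) auto
    moreover have "(fst v)\<^sup>2 > 1" using that by (simp add: one_less_power)
    ultimately show ?thesis unfolding r_def by (intro real_sqrt_pow2) linarith
  qed
  have img: "hyp_base (cis \<theta>, 0) = f ` R"
  proof (intro equalityI subsetI)
    fix a assume "a \<in> hyp_base (cis \<theta>, 0)"
    then have a: "sdet a = 1" "Re (fst a) > 1" "cos \<theta> * Re (fst a) - sin \<theta> * Im (fst a) = Re (fst a)"
      by (simp_all add: hyp_base_def htr_mul)
    have p: "Im (fst a) = m * Re (fst a)" using a(3) th by (simp add: m_def field_simps)
    let ?v = "(Re (fst a), Arg (snd a))"
    have "(cmod (snd a))\<^sup>2 = (Re (fst a))\<^sup>2 * (1 + m\<^sup>2) - 1"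
      using a(1) unfolding sdet_def cmod_power2[of "fst a"] p by (simp add: power_mult_distrib algebra_simps)
    then have "r ?v = cmod (snd a)" unfolding r_def by (metis fst_conv norm_ge_zero real_sqrt_abs abs_of_nonneg)
    then have "a = f ?v" using p cis_Arg_cmod[of "snd a"] by (simp add: f_def prod_eq_iff complex_eq_iff)
    moreover have "?v \<in> R" using a(2) by (simp add: R_def)
    ultimately show "a \<in> f ` R" by blast
  next
    fix a assume "a \<in> f ` R"
    then obtain v where v: "fst v > 1" "a = f v" by (auto simp: R_def)
    have "sdet a = 1" unfolding sdet_def v(2) f_def fst_conv snd_conv cmod_power2[of "Complex _ _"]
      using r2[OF v(1)] by (simp add: norm_mult power_mult_distrib algebra_simps)
    moreover have "cos \<theta> * Re (fst a) - sin \<theta> * Im (fst a) = Re (fst a)"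
      using th by (simp add: v(2) f_def m_def field_simps)
    ultimately show "a \<in> hyp_base (cis \<theta>, 0)" using v by (simp add: hyp_base_def htr_mul) (simp add: f_def)
  qed
  have "connected R" unfolding R_def by (intro connected_Times) (auto simp: convex_connected)
  moreover have "continuous_on R f" unfolding f_def r_def by (intro continuous_intros)
  ultimately show "connected (hyp_base (cis \<theta>, 0))" unfolding img by (intro connected_continuous_image)
  have "(2, 0) \<in> R" by (simp add: R_def)
  then show "hyp_base (cis \<theta>, 0) \<noteq> {}" unfolding img by blast
qed

lemma hyp_base_npar:
  assumes t: "t \<noteq> 0"
  shows "connected (hyp_base (- parN t))" "hyp_base (- parN t) \<noteq> {}"
proof -
  define y where "y v = (1 + (snd v)\<^sup>2 - (fst v)\<^sup>2 + 4 * (fst v)\<^sup>2 / t\<^sup>2) * t / (4 * fst v)" for v :: "real \<times> real"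
  define f where "f v = (Complex (fst v) (y v), Complex (y v - 2 * fst v / t) (snd v))" for v
  define R where "R = {1::real<..} \<times> (UNIV :: real set)"
  have img: "hyp_base (- parN t) = f ` R"
  proof (intro equalityI subsetI)
    fix a assume "a \<in> hyp_base (- parN t)"
    then have a: "sdet a = 1" "Re (fst a) > 1" "- Re (fst a) + t * Im (fst a) - t * Re (snd a) = Re (fst a)"
      by (simp_all add: hyp_base_def htr_mul parN_def)
    have p: "Re (snd a) = Im (fst a) - 2 * Re (fst a) / t" using a(3) t by (simp add: field_simps)
    let ?v = "(Re (fst a), Im (snd a))"
    have "4 * Re (fst a) * Im (fst a) / t = 1 + (Im (snd a))\<^sup>2 - (Re (fst a))\<^sup>2 + 4 * (Re (fst a))\<^sup>2 / t\<^sup>2"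
      using a(1) unfolding sdet_Re_Im p by (simp add: power2_eq_square algebra_simps)
    then have "y ?v = (4 * Re (fst a) * Im (fst a) / t) * t / (4 * Re (fst a))" unfolding y_def by simp
    then have "y ?v = Im (fst a)" using a(2) t by simp
    then have "a = f ?v" using p by (simp add: f_def prod_eq_iff complex_eq_iff)
    moreover have "?v \<in> R" using a(2) by (simp add: R_def)
    ultimately show "a \<in> f ` R" by blast
  next
    fix a assume "a \<in> f ` R"
    then obtain v where v: "fst v > 1" "a = f v" by (auto simp: R_def)
    have "4 * fst v * y v / t = 1 + (snd v)\<^sup>2 - (fst v)\<^sup>2 + 4 * (fst v)\<^sup>2 / t\<^sup>2"
      using v(1) t by (simp add: y_def)
    then have "sdet a = 1" unfolding sdet_Re_Im v(2) f_def by (simp add: power2_eq_square algebra_simps)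
    moreover have "- Re (fst a) + t * Im (fst a) - t * Re (snd a) = Re (fst a)"
      using t by (simp add: v(2) f_def field_simps)
    ultimately show "a \<in> hyp_base (- parN t)" using v by (simp add: hyp_base_def htr_mul parN_def) (simp add: f_def)
  qed
  have "connected R" unfolding R_def by (intro connected_Times) (auto simp: convex_connected)
  moreover have "continuous_on R f" unfolding f_def y_def using t by (intro continuous_intros) (auto simp: R_def)
  ultimately show "connected (hyp_base (- parN t))" unfolding img by (intro connected_continuous_image)
  have "(2, 0) \<in> R" by (simp add: R_def)
  then show "hyp_base (- parN t) \<noteq> {}" unfolding img by blast
qed

lemma hyp_base_parab:
  assumes t: "t \<noteq> 0" and e: "e = 1 \<or> e = (- 1::real)"
  shows "connected {a \<in> hyp_base (parN t). e * Im (snd a) > 0}"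
    and "a \<in> hyp_base (parN t) \<Longrightarrow> Im (snd a) \<noteq> 0"
proof -
  have B: "a \<in> hyp_base (parN t) \<longleftrightarrow> (Re (fst a))\<^sup>2 = 1 + (Im (snd a))\<^sup>2 \<and> Re (fst a) > 1 \<and> Re (snd a) = Im (fst a)" for a
    using t by (auto simp: hyp_base_def htr_mul parN_def sdet_Re_Im)
  show "Im (snd a) \<noteq> 0" if "a \<in> hyp_base (parN t)"
    using that by (auto simp: B power2_eq_1_iff)
  define f where "f v = (Complex (sqrt (1 + (snd v)\<^sup>2)) (fst v), Complex (fst v) (e * snd v))" for v :: "real \<times> real"
  define R where "R = (UNIV :: real set) \<times> {0::real<..}"
  have e2: "e * e = 1" using e by auto
  have img: "{a \<in> hyp_base (parN t). e * Im (snd a) > 0} = f ` R"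
  proof (intro equalityI subsetI)
    fix a assume a: "a \<in> {a \<in> hyp_base (parN t). e * Im (snd a) > 0}"
    let ?v = "(Im (fst a), e * Im (snd a))"
    have "sqrt (1 + (e * Im (snd a))\<^sup>2) = sqrt ((Re (fst a))\<^sup>2)" using a e by (auto simp: B)
    then have "sqrt (1 + (e * Im (snd a))\<^sup>2) = Re (fst a)" using a by (auto simp: B)
    then have "a = f ?v" using a e by (auto simp: f_def B prod_eq_iff complex_eq_iff)
    moreover have "?v \<in> R" using a by (simp add: R_def)
    ultimately show "a \<in> f ` R" by blast
  next
    fix a assume "a \<in> f ` R"
    then obtain v where v: "snd v > 0" "a = f v" by (auto simp: R_def)
    have "sqrt (1 + (snd v)\<^sup>2) > 1" using v(1) by simp
    moreover have "(sqrt (1 + (snd v)\<^sup>2))\<^sup>2 = 1 + (snd v)\<^sup>2" by (intro real_sqrt_pow2) (simp add: add_nonneg_nonneg)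
    ultimately have "a \<in> hyp_base (parN t)" using e by (auto simp: B v(2) f_def)
    moreover have "e * Im (snd a) > 0" using v e2 by (simp add: f_def mult.assoc[symmetric])
    ultimately show "a \<in> {a \<in> hyp_base (parN t). e * Im (snd a) > 0}" by simp
  qed
  have "connected R" unfolding R_def by (intro connected_Times) (auto simp: convex_connected)
  moreover have "continuous_on R f" unfolding f_def by (intro continuous_intros)
  ultimately show "connected {a \<in> hyp_base (parN t). e * Im (snd a) > 0}" unfolding img by (intro connected_continuous_image)
qed

lemma hyp_base_nhyp:
  assumes cs: "c > 1" "s \<noteq> 0" "c\<^sup>2 - s\<^sup>2 = 1" and e: "e = 1 \<or> e = (- 1::real)"
  shows "connected {a \<in> hyp_base (- hypN c s). e * Im (fst a) > 0}"
    and "{a \<in> hyp_base (- hypN c s). e * Im (fst a) > 0} \<noteq> {}"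
    and "a \<in> hyp_base (- hypN c s) \<Longrightarrow> Im (fst a) \<noteq> 0"
proof -
  define k where "k = (c + 1) / s"
  have s2: "s\<^sup>2 = (c - 1) * (c + 1)" using cs(3) by (simp add: power2_eq_square algebra_simps)
  have "k\<^sup>2 = (c + 1) / (c - 1)" using cs(1) by (simp add: k_def power_divide s2) (simp add: power2_eq_square)
  then have k: "k\<^sup>2 > 1" using cs(1) by simp
  have B: "a \<in> hyp_base (- hypN c s) \<longleftrightarrow> (Im (fst a))\<^sup>2 = 1 + (Im (snd a))\<^sup>2 + (k\<^sup>2 - 1) * (Re (fst a))\<^sup>2 \<and> Re (fst a) > 1 \<and> Re (snd a) = - k * Re (fst a)" for a
  proof -
    have "- (c * Re (fst a)) - s * Re (snd a) = Re (fst a) \<longleftrightarrow> Re (snd a) = - k * Re (fst a)"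
      using cs(2) by (auto simp: k_def field_simps)
    moreover have "sdet a = 1 \<longleftrightarrow> (Im (fst a))\<^sup>2 = 1 + (Im (snd a))\<^sup>2 + (k\<^sup>2 - 1) * (Re (fst a))\<^sup>2" if "Re (snd a) = - k * Re (fst a)"
      unfolding sdet_Re_Im that by (auto simp: power2_eq_square algebra_simps)
    ultimately show ?thesis by (auto simp: hyp_base_def htr_mul hypN_def)
  qed
  have pos: "1 + q\<^sup>2 + (k\<^sup>2 - 1) * x\<^sup>2 > 0" for x q :: real
    using k by (intro add_pos_nonneg mult_nonneg_nonneg) auto
  show "Im (fst a) \<noteq> 0" if "a \<in> hyp_base (- hypN c s)" using that pos[of "Im (snd a)" "Re (fst a)"] by (auto simp: B)
  define f where "f v = (Complex (fst v) (e * sqrt (1 + (snd v)\<^sup>2 + (k\<^sup>2 - 1) * (fst v)\<^sup>2)), Complex (- k * fst v) (snd v))" for v :: "real \<times> real"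
  define R where "R = {1::real<..} \<times> (UNIV :: real set)"
  have e2: "e * e = 1" "e\<^sup>2 = 1" using e by auto
  have img: "{a \<in> hyp_base (- hypN c s). e * Im (fst a) > 0} = f ` R"
  proof (intro equalityI subsetI)
    fix a assume a: "a \<in> {a \<in> hyp_base (- hypN c s). e * Im (fst a) > 0}"
    let ?v = "(Re (fst a), Im (snd a))"
    have "sqrt (1 + (Im (snd a))\<^sup>2 + (k\<^sup>2 - 1) * (Re (fst a))\<^sup>2) = sqrt ((Im (fst a))\<^sup>2)" using a by (simp add: B)
    also have "\<dots> = e * Im (fst a)" using a e by auto
    finally have "e * sqrt (1 + (Im (snd a))\<^sup>2 + (k\<^sup>2 - 1) * (Re (fst a))\<^sup>2) = Im (fst a)" using e2(1) by (simp add: mult.assoc[symmetric])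
    then have "a = f ?v" using a by (simp add: f_def B prod_eq_iff complex_eq_iff)
    moreover have "?v \<in> R" using a by (simp add: R_def B)
    ultimately show "a \<in> f ` R" by blast
  next
    fix a assume "a \<in> f ` R"
    then obtain v where v: "fst v > 1" "a = f v" by (auto simp: R_def)
    note p = pos[of "snd v" "fst v"]
    have "(e * sqrt (1 + (snd v)\<^sup>2 + (k\<^sup>2 - 1) * (fst v)\<^sup>2))\<^sup>2 = 1 + (snd v)\<^sup>2 + (k\<^sup>2 - 1) * (fst v)\<^sup>2"
      unfolding power_mult_distrib e2(2) using p by simp
    then have "a \<in> hyp_base (- hypN c s)" using v by (simp add: B f_def)
    moreover have "e * Im (fst a) > 0" using p e2(1) by (simp add: v(2) f_def mult.assoc[symmetric])
    ultimately show "a \<in> {a \<in> hyp_base (- hypN c s). e * Im (fst a) > 0}" by simp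
  qed
  have "connected R" unfolding R_def by (intro connected_Times) (auto simp: convex_connected)
  moreover have "continuous_on R f" unfolding f_def by (intro continuous_intros)
  ultimately show "connected {a \<in> hyp_base (- hypN c s). e * Im (fst a) > 0}" unfolding img by (intro connected_continuous_image)
  have "(2, 0) \<in> R" by (simp add: R_def)
  then show "{a \<in> hyp_base (- hypN c s). e * Im (fst a) > 0} \<noteq> {}" unfolding img by blast
qed

text \<open>For a parabolic commutator the two components of the hyperbolic part are joined by a twist
  inside the stabilizer of the fixed point.\<close>

lemma parab_link:
  assumes h: "h \<in> shift_range 1 (- 1)" "sadj (toS h) = parN t" and t: "t \<noteq> 0"
    and loc_const: "loc_const (comm_fibre h) \<kappa>" "center_inv (comm_fibre h) \<kappa>"
  obtains A B A' B' where "(A, B) \<in> hyp_pairs (parN t) {a \<in> hyp_base (parN t). 1 * Im (snd a) > 0}"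
    "(A', B') \<in> hyp_pairs (parN t) {a \<in> hyp_base (parN t). - 1 * Im (snd a) > 0}"
    "\<kappa> (A, B) = \<kappa> (A', B')"
proof -
  define D E :: sq where "D = (5/4, 3/4 * \<i>)" and "E = (5/4, - (3/4 * \<i>))"
  define N :: sq where "N = (\<i>, 1)"
  define u where "u r = sone + r *\<^sub>R N" for r :: real
  have pN: "parN r = u r" for r by (simp add: parN_def u_def N_def prod_eq_iff complex_eq_iff)
  have uu: "u r \<star> u r' = u (r + r')" for r r'
    by (simp add: u_def N_def smul_def prod_eq_iff complex_eq_iff)
  have u0: "u 0 = sone" by (simp add: u_def prod_eq_iff)
  have DE: "D \<star> E = sone" "E \<star> D = sone" by (simp_all add: D_def E_def smul_def complex_eq_iff prod_eq_iff)
  have Du: "D \<star> u r = u (4 * r) \<star> D" for r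
    by (simp add: D_def u_def N_def smul_def prod_eq_iff complex_eq_iff)
  have Eu: "E \<star> u r = u (r / 4) \<star> E" for r
    by (simp add: E_def u_def N_def smul_def prod_eq_iff complex_eq_iff)
  have det: "sdet (u r) = 1" "sdet D = 1" "sdet E = 1" for r
    by (simp_all add: sdet_Re_Im u_def N_def D_def E_def power2_eq_square)
  define A where "A = lift_near 0 D"
  define B where "B = lift_near 0 (u (- t / 3) \<star> D)"
  define W where "W = lift_near 0 (u (t / 9) \<star> E \<star> E \<star> u (- t / 9))"
  have sA: "toS A = D" and sB: "toS B = u (- t / 3) \<star> D" and sW: "toS W = u (t / 9) \<star> E \<star> E \<star> u (- t / 9)"
    unfolding A_def B_def W_def by (intro toS_lift_near; simp add: sdet_mul det)+
  have rel: "toS B \<star> toS A = parN t \<star> toS A \<star> toS B"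
  proof -
    have "parN t \<star> toS A \<star> toS B = u t \<star> (D \<star> u (- t / 3)) \<star> D" by (simp add: pN sA sB smul_assoc)
    also have "\<dots> = u t \<star> u (- 4 * t / 3) \<star> D \<star> D" unfolding Du by (simp add: smul_assoc)
    also have "\<dots> = u (- t / 3) \<star> D \<star> D" by (simp add: uu)
    finally show ?thesis by (simp add: sA sB)
  qed
  have "htr (toS h) \<ge> - 1"
  proof -
    have "htr (sadj (toS h)) = 1" unfolding h(2) by (simp add: parN_def)
    then show ?thesis by (simp add: sadj_def)
  qed
  then have F: "(A, B) \<in> comm_fibre h" using comm_fibre_iff[OF h(1)] rel h(2) by simp
  have BW: "B \<odot> W = W \<odot> B"
  proof -
    have sB': "toS B = u (t / 9) \<star> D \<star> u (- t / 9)"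
    proof -
      have "u (t / 9) \<star> D \<star> u (- t / 9) = u (t / 9) \<star> (D \<star> u (- t / 9))" by (simp add: smul_assoc)
      also have "\<dots> = u (t / 9) \<star> u (4 * (- t / 9)) \<star> D" unfolding Du by (simp add: smul_assoc)
      finally show ?thesis by (simp add: uu sB)
    qed
    have c: "u (- (t / 9)) \<star> (u (t / 9) \<star> x) = x" for x by (simp add: smul_assoc[symmetric] uu u0)
    have dd: "D \<star> (E \<star> x) = x" "E \<star> (D \<star> x) = x" for x by (simp_all add: smul_assoc[symmetric] DE)
    have "toS B \<star> toS W = toS W \<star> toS B" unfolding sB' sW by (simp add: smul_assoc c dd)
    then show ?thesis by (simp add: toS_commute_iff)
  qed
  note tw = twist_left[OF loc_const F BW]
  have sAW: "toS (A \<odot> W) = u (5 * t / 12) \<star> E"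
  proof -
    have "toS (A \<odot> W) = D \<star> u (t / 9) \<star> E \<star> (E \<star> u (- t / 9))" by (simp add: toS_mul sA sW smul_assoc)
    also have "\<dots> = u (4 * (t / 9)) \<star> (D \<star> E) \<star> (u (- t / 9 / 4) \<star> E)" unfolding Du Eu by (simp add: smul_assoc)
    finally show ?thesis by (simp add: DE smul_assoc[symmetric] uu)
  qed
  define A' where "A' = lift_near 0 (toS (A \<odot> W))"
  have sA': "toS A' = toS (A \<odot> W)" unfolding A'_def by (intro toS_lift_near) simp
  then obtain k where k: "A' = central k \<odot> (A \<odot> W)" using toS_pm by blast
  have FA': "(A', B) \<in> comm_fibre h" "\<kappa> (A', B) = \<kappa> (A \<odot> W, B)"
    using center_inv_shift[OF loc_const(2) tw(1), of k 0] by (simp_all add: k)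
  have hAW: "htr (toS A') = 5 / 4" "Im (snd (toS A')) = - 3 / 4"
    unfolding sA' sAW by (simp_all add: u_def N_def E_def smul_def)
  have "(A, B) \<in> hyp_pairs (sadj (toS h)) (hyp_base (sadj (toS h)))"
    by (rule comm_fibre_hyp_pairs[OF F]) (simp_all add: sA D_def, simp add: A_def D_def)
  moreover have "(A', B) \<in> hyp_pairs (sadj (toS h)) (hyp_base (sadj (toS h)))"
    by (rule comm_fibre_hyp_pairs[OF FA'(1)]) (simp_all add: hAW, simp add: sA', simp add: A'_def)
  ultimately show ?thesis
    using tw(2) FA'(2) hAW(2) sA
    by (intro that[of A B A' B]) (auto simp: h(2) hyp_pairs_def D_def)
qed

lemma good_fibre_parab:
  assumes h: "h \<in> shift_range 1 (- 1)" "h \<noteq> cid" "sadj (toS h) = parN t" and t: "t \<noteq> 0"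
  shows "good_fibre h"
proof -
  let ?K = "parN t"
  have dK: "sdet ?K = 1" using h(3) by (metis sdet_adj sdet_toS)
  have ht: "htr (toS h) \<ge> - 1"
  proof -
    have "htr (sadj (toS h)) = 1" unfolding h(3) by (simp add: parN_def)
    then show ?thesis by (simp add: sadj_def)
  qed
  define U where "U e = {a \<in> hyp_base ?K. e * Im (snd a) > 0}" for e :: real
  have UB: "U e \<subseteq> hyp_base ?K" for e by (auto simp: U_def)
  have PF: "hyp_pairs ?K V \<subseteq> comm_fibre h" for V using comm_fibre_iff[OF h(1) ht] h(3) by (auto simp: hyp_pairs_def)
  have conU: "connected (U 1)" "connected (U (- 1))" unfolding U_def by (rule hyp_base_parab[OF t]; simp)+
  have main: "(\<exists>c. \<forall>x\<in>comm_fibre h. \<kappa> x = c) \<and> comm_fibre h \<noteq> {}" if loc_const: "loc_const (comm_fibre h) \<kappa>" "center_inv (comm_fibre h) \<kappa>" for \<kappa>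
  proof -
    obtain A B A' B' where l: "(A, B) \<in> hyp_pairs ?K (U 1)" "(A', B') \<in> hyp_pairs ?K (U (- 1))" "\<kappa> (A, B) = \<kappa> (A', B')"
      unfolding U_def by (rule parab_link[OF h(1,3) t loc_const])
    have "\<kappa> x = \<kappa> (A, B)" if x: "x \<in> comm_fibre h" for x
    proof -
      obtain a b where xe: "x = (a, b)" by (rule prod.exhaust)
      obtain a' b' where *: "(a', b') \<in> comm_fibre h" "\<kappa> (a', b') = \<kappa> (a, b)" "htr (toS a') > 1" "a' = lift_near 0 (toS a')"
        using twist_to_hyperbolic[OF loc_const _ h(2)] x xe by metis
      have P: "(a', b') \<in> hyp_pairs ?K (hyp_base ?K)" using comm_fibre_hyp_pairs[OF *(1,3,4)] h(3) by simp
      then have "Im (snd (toS a')) \<noteq> 0" using hyp_base_parab(2)[OF t, of 1] by (auto simp: hyp_pairs_def)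
      then have "(a', b') \<in> hyp_pairs ?K (U 1) \<or> (a', b') \<in> hyp_pairs ?K (U (- 1))"
        using P by (auto simp: hyp_pairs_def U_def)
      then have "\<kappa> (a', b') = \<kappa> (A, B)"
      proof
        assume "(a', b') \<in> hyp_pairs ?K (U 1)"
        then show ?thesis by (rule hyp_pairs_kappa_const[OF dK UB conU(1) PF loc_const _ l(1)])
      next
        assume "(a', b') \<in> hyp_pairs ?K (U (- 1))"
        then have "\<kappa> (a', b') = \<kappa> (A', B')" by (rule hyp_pairs_kappa_const[OF dK UB conU(2) PF loc_const _ l(2)])
        then show ?thesis using l(3) by simp
      qed
      then show ?thesis using *(2) xe by simp
    qed
    moreover have "comm_fibre h \<noteq> {}" using l(1) PF by blast
    ultimately show ?thesis by blast
  qed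
  have "comm_fibre h \<noteq> {}" using main[of "\<lambda>_. True"] by (simp add: loc_const_def center_inv_def)
  moreover have "conn_mod_center (comm_fibre h)" unfolding conn_mod_center_def using main by blast
  ultimately show ?thesis by (simp add: good_fibre_def)
qed

lemma crefl_lift_near0: assumes "A = lift_near 0 (toS A)" "htr (toS A) > 0" shows "crefl A = lift_near 0 (toS (crefl A))"
proof -
  have "fst A = Arg (fst (toS A))" using arg_cong[OF assms(1), of fst] by (simp add: lift_near_def)
  then have "\<bar>fst A\<bar> < pi / 2" using assms(2) Arg_Re_pos[of "fst (toS A)"] by simp
  then have "\<bar>fst A\<bar> < pi" using pi_gt_zero by linarith
  then show ?thesis by (intro lift_near_toS[symmetric]) (auto simp: crefl_def)
qed

text \<open>The reflection exchanges the two components and the two lifts of the commutator.\<close>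

lemma good_fibre_nhyp:
  assumes h: "h \<in> shift_range 1 (- 1)" "h \<noteq> cid" "sadj (toS h) = - hypN c s"
    and cs: "c > 1" "s \<noteq> 0" "c\<^sup>2 - s\<^sup>2 = 1"
  shows "good_fibre h"
proof -
  let ?K = "- hypN c s"
  have dK: "sdet ?K = 1" using h(3) by (metis sdet_adj sdet_toS)
  define U where "U e = {a \<in> hyp_base ?K. e * Im (fst a) > 0}" for e :: real
  have UB: "U e \<subseteq> hyp_base ?K" for e by (auto simp: U_def)
  have conU: "connected (U e)" "U e \<noteq> {}" if "e = 1 \<or> e = - 1" for e
    unfolding U_def by (rule hyp_base_nhyp[OF cs that])+
  have Im0: "Im (fst a) \<noteq> 0" if "a \<in> hyp_base ?K" for a using hyp_base_nhyp(3)[OF cs, of 1] that by simp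
  have tc: "toS (ccomm A B) = toS h" if "(A, B) \<in> hyp_pairs ?K V" for A B V
    using that toS_ccomm_iff[OF dK, of A B] unfolding h(3)[symmetric] by (auto simp: hyp_pairs_def)
  have fh: "fst x = pi \<or> fst x = - pi" if "x \<in> shift_range 1 (- 1)" "toS x = toS h" for x
  proof -
    have "toS h = sadj ?K" using h(3) by (metis sadj_adj)
    then have t: "toS x = (complex_of_real (- c), complex_of_real s)" using that(2) by (simp add: hypN_def sadj_def)
    then have "fst (toS x) = complex_of_real (- c)" by simp
    then have "cc (snd x) * sin (fst x) = 0" "cc (snd x) * cos (fst x) = - c" by (simp_all add: toS_def complex_eq_iff)
    then have sn: "sin (fst x) = 0" and cn: "cos (fst x) < 0" using cs(1) by (simp, smt (verit) cc_pos(3) mult_nonneg_nonneg)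
    have "\<bar>fst x\<bar> < 3 * pi / 2" using that(1) arctan_norm_bounds[of "snd x"] by (auto simp: shift_range_def min_shift_def max_shift_def)
    obtain i :: int where i: "fst x = of_int i * pi" using sn sin_zero_iff_int2 by blast
    have "\<bar>real_of_int i\<bar> * pi < (3 / 2) * pi" using \<open>\<bar>fst x\<bar> < 3 * pi / 2\<close> by (simp add: i abs_mult)
    then have "\<bar>real_of_int i\<bar> < 3 / 2" by (subst (asm) mult_less_cancel_right_pos) auto
    then have "i = 0 \<or> i = 1 \<or> i = - 1" by linarith
    moreover have "i \<noteq> 0" using cn i by auto
    ultimately show ?thesis using i by auto
  qed
  have cr: "(crefl A, crefl B) \<in> hyp_pairs ?K (U (- e))" if P: "(A, B) \<in> hyp_pairs ?K (U e)" for A B e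
  proof -
    have sK: "srefl ?K = ?K" by (simp add: srefl_def hypN_def)
    have rel: "toS B \<star> toS A = ?K \<star> toS A \<star> toS B" and AU: "toS A \<in> hyp_base ?K" "e * Im (fst (toS A)) > 0" "A = lift_near 0 (toS A)"
      using P by (auto simp: hyp_pairs_def U_def)
    have "toS (crefl B) \<star> toS (crefl A) = ?K \<star> toS (crefl A) \<star> toS (crefl B)"
      using arg_cong[OF rel, of srefl] by (simp only: srefl_mul toS_refl sK)
    moreover have "htr (?K \<star> srefl (toS A)) = htr (?K \<star> toS A)" by (simp add: htr_mul srefl_def hypN_def)
    then have "toS (crefl A) \<in> hyp_base ?K" using AU(1) unfolding hyp_base_def toS_refl mem_Collect_eq
      by (simp add: srefl_def sdet_def)
    moreover have "crefl A = lift_near 0 (toS (crefl A))" using AU by (intro crefl_lift_near0) (auto simp: hyp_base_def)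
    moreover have "- e * Im (fst (toS (crefl A))) > 0" using AU(2) by (simp add: toS_refl srefl_def)
    ultimately show ?thesis unfolding hyp_pairs_def U_def by blast
  qed
  have crh: "toS (crefl x) = toS x" if "toS x = toS h" for x
  proof -
    have "toS h = sadj ?K" using h(3) by (metis sadj_adj)
    then show ?thesis using that by (simp add: toS_refl srefl_def hypN_def sadj_def)
  qed
  obtain a where a: "a \<in> U 1" using conU(2) by blast
  then obtain b where b: "(lift_near 0 a, b) \<in> hyp_pairs ?K (U 1)" using hyp_pairs_exists[OF dK _ a] UB by blast
  define h1 where "h1 = ccomm (lift_near 0 a) b"
  have h1: "h1 \<in> shift_range 1 (- 1)" "toS h1 = toS h" using tc[OF b] ccomm_shift_range by (auto simp: h1_def)
  have c1: "ccomm A B = h1" if "(A, B) \<in> hyp_pairs ?K (U 1)" for A B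
    unfolding h1_def by (rule hyp_pairs_ccomm_const[OF dK UB conU(1) that b]) simp
  have c2: "ccomm A B = crefl h1" if P: "(A, B) \<in> hyp_pairs ?K (U (- 1))" for A B
  proof -
    have "(crefl A, crefl B) \<in> hyp_pairs ?K (U 1)" using cr[OF P] by simp
    then have "crefl (ccomm A B) = h1" using c1 by (simp add: crefl_ccomm)
    then show ?thesis by auto
  qed
  have ne: "crefl h1 \<noteq> h1"
  proof
    assume "crefl h1 = h1"
    then have "fst h1 = 0" by (metis crefl_def equal_neg_zero fst_conv)
    then show False using fh[OF h1] pi_gt_zero by auto
  qed
  have sgn: "h = h1 \<or> h = crefl h1"
  proof -
    have "fst h = fst h1 \<or> fst h = fst (crefl h1)" using fh[OF h(1) HOL.refl] fh[OF h1] by (auto simp: crefl_def)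
    moreover have "snd h = snd h1" using h1(2) toS_eq_iff by metis
    moreover have "snd h = snd (crefl h1)" using crh[OF h1(2)] h1(2) toS_eq_iff by metis
    ultimately show ?thesis by (auto simp: prod_eq_iff)
  qed
  define e :: real where "e = (if h = h1 then 1 else - 1)"
  have e1: "e = 1 \<or> e = - 1" by (simp add: e_def)
  have ce: "ccomm A B = h" if "(A, B) \<in> hyp_pairs ?K (U e)" for A B
    using that c1 c2 sgn by (auto simp: e_def split: if_splits)
  have ce': "ccomm A B \<noteq> h" if "(A, B) \<in> hyp_pairs ?K (U (- e))" for A B
    using that c1 c2 sgn ne by (auto simp: e_def split: if_splits)
  have PF: "hyp_pairs ?K (U e) \<subseteq> comm_fibre h" using ce by (auto simp: comm_fibre_def)
  obtain a0 where a0: "a0 \<in> U e" using conU(2)[OF e1] by blast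
  then obtain b0 where b0: "(lift_near 0 a0, b0) \<in> hyp_pairs ?K (U e)" using hyp_pairs_exists[OF dK _ a0] UB by blast
  have "conn_mod_center (comm_fibre h)"
    unfolding conn_mod_center_def
  proof (intro allI impI)
    fix \<kappa> assume loc_const: "loc_const (comm_fibre h) \<kappa>" "center_inv (comm_fibre h) \<kappa>"
    have "\<kappa> x = \<kappa> (lift_near 0 a0, b0)" if x: "x \<in> comm_fibre h" for x
    proof -
      obtain A B where xe: "x = (A, B)" by (rule prod.exhaust)
      obtain A' B' where *: "(A', B') \<in> comm_fibre h" "\<kappa> (A', B') = \<kappa> (A, B)" "htr (toS A') > 1" "A' = lift_near 0 (toS A')"
        using twist_to_hyperbolic[OF loc_const _ h(2)] x xe by metis
      have P: "(A', B') \<in> hyp_pairs ?K (hyp_base ?K)" using comm_fibre_hyp_pairs[OF *(1,3,4)] h(3) by simp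
      then have "Im (fst (toS A')) \<noteq> 0" using Im0 by (auto simp: hyp_pairs_def)
      then have "e * Im (fst (toS A')) > 0 \<or> - e * Im (fst (toS A')) > 0" using e1 by auto
      then have "(A', B') \<in> hyp_pairs ?K (U e) \<or> (A', B') \<in> hyp_pairs ?K (U (- e))"
        using P by (auto simp: hyp_pairs_def U_def)
      moreover have "ccomm A' B' = h" using *(1) by (simp add: comm_fibre_def)
      ultimately have "(A', B') \<in> hyp_pairs ?K (U e)" using ce' by blast
      from hyp_pairs_kappa_const[OF dK UB conU(1)[OF e1] PF loc_const this b0]
      show ?thesis using *(2) xe by simp
    qed
    then show "\<exists>c. \<forall>x\<in>comm_fibre h. \<kappa> x = c" by blast
  qed
  moreover have "comm_fibre h \<noteq> {}" using b0 PF by blast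
  ultimately show ?thesis by (simp add: good_fibre_def)
qed

theorem commutator_fibres:
  assumes h: "h \<in> shift_range 1 (- 1)" "h \<noteq> cid" shows "good_fibre h"
proof -
  let ?K = "sadj (toS h)"
  have "toS h \<noteq> sone \<and> toS h \<noteq> - sone" using toS_sone_imp[of h] h central_shift_range1 central_0 by metis
  then have ns: "?K \<noteq> sone" "?K \<noteq> - sone"
    by (metis sadj_adj complex_cnj_one fst_conv minus_zero sadj_def snd_conv)
       (metis \<open>toS h \<noteq> sone \<and> toS h \<noteq> - sone\<close> sadj_adj sadj_def complex_cnj_minus complex_cnj_one fst_conv snd_conv uminus_Pair minus_zero)
  have dK: "sdet ?K = 1" by simp
  obtain g N where g: "toS g \<star> ?K = N \<star> toS g" and
    N: "(\<exists>c s. c > 1 \<and> s \<noteq> 0 \<and> c\<^sup>2 - s\<^sup>2 = 1 \<and> (N = hypN c s \<or> N = - hypN c s)) \<or>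
     (\<exists>\<theta>. sin \<theta> \<noteq> 0 \<and> N = (cis \<theta>, 0)) \<or> (\<exists>t. t \<noteq> 0 \<and> (N = parN t \<or> N = - parN t))"
    by (rule normal_form[OF dK ns])
  define h' where "h' = g \<odot> h \<odot> cinv g"
  have "sadj (toS h') = toS g \<star> ?K \<star> sadj (toS g)" by (simp add: h'_def toS_mul toS_inv sadj_mul smul_assoc)
  then have sh: "sadj (toS h') = N" unfolding g by (simp add: smul_assoc sadj_id)
  have h': "h' \<in> shift_range 1 (- 1)" using h(1) by (simp add: h'_def shift_range_conj)
  have h1: "h' \<noteq> cid"
  proof
    assume "h' = cid"
    then have "cinv g \<odot> h' \<odot> g = cid" by simp
    then show False using h(2) by (simp add: h'_def cmul_assoc)
  qed
  have ht: "htr (toS h') = htr N" unfolding sh[symmetric] by (simp add: sadj_def)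
  have "good_fibre h'"
    using N
  proof (elim disjE exE conjE)
    fix c s assume cs: "c > 1" "s \<noteq> 0" "c\<^sup>2 - s\<^sup>2 = 1" "N = hypN c s"
    show ?thesis by (rule good_fibre_of_connected_hyp_base[OF h' _ h1 sh])
      (use ht cs hyp_base_hyp[OF cs(1,2,3)] in \<open>auto simp: hypN_def\<close>)
  next
    fix c s assume cs: "c > 1" "s \<noteq> 0" "c\<^sup>2 - s\<^sup>2 = 1" "N = - hypN c s"
    show ?thesis by (rule good_fibre_nhyp[OF h' h1 _ cs(1,2,3)]) (simp add: sh cs(4))
  next
    fix \<theta> assume t: "sin \<theta> \<noteq> 0" "N = (cis \<theta>, 0)"
    show ?thesis by (rule good_fibre_of_connected_hyp_base[OF h' _ h1 sh])
      (use ht t hyp_base_ell[OF t(1)] in auto)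
  next
    fix t :: real assume t: "t \<noteq> 0" "N = parN t"
    show ?thesis by (rule good_fibre_parab[OF h' h1 _ t(1)]) (simp add: sh t(2))
  next
    fix t :: real assume t: "t \<noteq> 0" "N = - parN t"
    show ?thesis by (rule good_fibre_of_connected_hyp_base[OF h' _ h1 sh])
      (use ht t hyp_base_npar[OF t(1)] in \<open>auto simp: parN_def\<close>)
  qed
  then show ?thesis unfolding h'_def by (rule good_fibre_conj)
qed

section \<open>Lifted representations\<close>

definition lprod :: "nat \<Rightarrow> nat \<Rightarrow> (surface_gen \<Rightarrow> cov) \<Rightarrow> cov" where
  "lprod g p \<rho> = wlist (map (\<lambda>j. ccomm (\<rho> (Gen_a j)) (\<rho> (Gen_b j))) [0..<g] @ map (\<lambda>i. \<rho> (Gen_c i)) [0..<p])"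

definition Lifted :: "nat \<Rightarrow> nat \<Rightarrow> int \<Rightarrow> (nat \<Rightarrow> int) \<Rightarrow> (surface_gen \<Rightarrow> cov) set" where
  "Lifted g p n s = {\<rho>. (\<forall>x. x \<notin> surface_gens g p \<longrightarrow> \<rho> x = cid) \<and> (\<forall>i<p. \<rho> (Gen_c i) \<in> Parabolics (s i)) \<and> lprod g p \<rho> = central n}"

definition zinvariant :: "nat \<Rightarrow> (surface_gen \<Rightarrow> cov) set \<Rightarrow> ((surface_gen \<Rightarrow> cov) \<Rightarrow> bool) \<Rightarrow> bool" where
  "zinvariant g T \<kappa> \<longleftrightarrow> (\<forall>\<rho>\<in>T. \<forall>j<g. \<kappa> (\<rho>(Gen_a j := central 1 \<odot> \<rho> (Gen_a j))) = \<kappa> \<rho> \<and>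
     \<kappa> (\<rho>(Gen_b j := central 1 \<odot> \<rho> (Gen_b j))) = \<kappa> \<rho>)"

lemma surface_gens_iff [simp]:
  "Gen_a j \<in> surface_gens g p \<longleftrightarrow> j < g" "Gen_b j \<in> surface_gens g p \<longleftrightarrow> j < g" "Gen_c i \<in> surface_gens g p \<longleftrightarrow> i < p"
  by (auto simp: surface_gens_def)

lemma lprod_cong:
  assumes "\<And>j. j < g \<Longrightarrow> ccomm (\<rho> (Gen_a j)) (\<rho> (Gen_b j)) = ccomm (\<rho>' (Gen_a j)) (\<rho>' (Gen_b j))"
    "\<And>i. i < p \<Longrightarrow> \<rho> (Gen_c i) = \<rho>' (Gen_c i)"
  shows "lprod g p \<rho> = lprod g p \<rho>'"
proof -
  have "map (\<lambda>j. ccomm (\<rho> (Gen_a j)) (\<rho> (Gen_b j))) [0..<g] = map (\<lambda>j. ccomm (\<rho>' (Gen_a j)) (\<rho>' (Gen_b j))) [0..<g]"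
    using assms(1) by simp
  moreover have "map (\<lambda>i. \<rho> (Gen_c i)) [0..<p] = map (\<lambda>i. \<rho>' (Gen_c i)) [0..<p]" using assms(2) by simp
  ultimately show ?thesis by (simp only: lprod_def)
qed

lemma Lifted_handle:
  assumes "\<rho> \<in> Lifted g p n s" "j < g" "ccomm A B = ccomm (\<rho> (Gen_a j)) (\<rho> (Gen_b j))"
  shows "\<rho>(Gen_a j := A, Gen_b j := B) \<in> Lifted g p n s"
proof -
  have "lprod g p (\<rho>(Gen_a j := A, Gen_b j := B)) = lprod g p \<rho>"
    by (rule lprod_cong) (use assms(3) in auto)
  then show ?thesis using assms by (auto simp: Lifted_def)
qed

lemma zinvariant_shift:
  assumes z: "zinvariant g (Lifted g p n s) \<kappa>" and \<rho>: "\<rho> \<in> Lifted g p n s" and j: "j < g"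
  shows "\<kappa> (\<rho>(Gen_b j := central k \<odot> \<rho> (Gen_b j))) = \<kappa> \<rho>"
proof -
  let ?r = "\<lambda>x. \<rho>(Gen_b j := x)"
  have "\<kappa> (?r (central k \<odot> \<rho> (Gen_b j))) = \<kappa> (?r (\<rho> (Gen_b j)))"
  proof (rule zshift_induct)
    fix i
    have "\<rho>(Gen_a j := \<rho> (Gen_a j), Gen_b j := central i \<odot> \<rho> (Gen_b j)) \<in> Lifted g p n s"
      by (rule Lifted_handle[OF \<rho> j]) simp
    then have "?r (central i \<odot> \<rho> (Gen_b j)) \<in> Lifted g p n s" by simp
    then show "\<kappa> (?r (central 1 \<odot> (central i \<odot> \<rho> (Gen_b j)))) = \<kappa> (?r (central i \<odot> \<rho> (Gen_b j)))"
      using z j unfolding zinvariant_def by (metis fun_upd_same fun_upd_upd)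
  qed
  then show ?thesis by simp
qed

lemma Parabolics_ray:
  assumes "C \<in> Parabolics s" "s = 1 \<or> s = - 1"
  obtains \<sigma> \<phi> where "C = ray \<sigma> \<phi>" "of_int s * \<sigma> > 0"
proof (rule that[of "of_int s * cmod (snd C)" "Arg (of_int s * snd C) + of_int s * arctan (cmod (snd C))"])
  have f: "fst C = of_int s * arctan (cmod (snd C))" "snd C \<noteq> 0" using assms(1) by (auto simp: Parabolics_iff)
  have "complex_of_real (cmod (of_int s * snd C)) * cis (Arg (of_int s * snd C)) = of_int s * snd C" by (rule cis_Arg_cmod)
  moreover have "cmod (of_int s * snd C) = cmod (snd C)" using assms(2) by (auto simp: norm_mult)
  ultimately have "complex_of_real (of_int s * cmod (snd C)) * cis (Arg (of_int s * snd C)) = snd C"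
    using assms(2) by auto
  moreover have "arctan (of_int s * cmod (snd C)) = of_int s * arctan (cmod (snd C))" using assms(2) by (auto simp: arctan_minus)
  ultimately show "C = ray (of_int s * cmod (snd C)) (Arg (of_int s * snd C) + of_int s * arctan (cmod (snd C)))"
    using f(1) by (simp add: ray_def prod_eq_iff)
  show "of_int s * (of_int s * cmod (snd C)) > 0" using assms(2) f(2) by auto
qed

lemma ray_Parabolics: assumes "of_int s * \<sigma> > (0::real)" "s = 1 \<or> s = - 1" shows "ray \<sigma> \<phi> \<in> Parabolics s"
proof -
  have "\<sigma> = of_int s * \<bar>\<sigma>\<bar>" "\<sigma> \<noteq> 0" using assms by auto
  then show ?thesis using assms(2) by (auto simp: Parabolics_iff ray_def norm_mult arctan_minus)
qed

definition hyp_for :: "real \<Rightarrow> cov" where "hyp_for \<phi> = (0, \<i> * complex_of_real (3/4) * cis \<phi>)"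

lemma hyp_for_ray: "hyp_for \<phi> \<odot> ray \<tau> \<phi> = ray (4 * \<tau>) \<phi> \<odot> hyp_for \<phi>"
proof (rule toS_inj)
  have "cmod (\<i> * complex_of_real (3/4) * cis \<phi>) = 3/4" by (simp add: norm_mult)
  then have "cc (\<i> * complex_of_real (3/4) * cis \<phi>) = sqrt (25/16)" by (simp add: cc_def power2_eq_square)
  also have "\<dots> = 5/4" by (rule real_sqrt_unique) (simp_all add: power2_eq_square)
  finally have h: "toS (hyp_for \<phi>) = (complex_of_real (5/4), \<i> * complex_of_real (3/4) * cis \<phi>)"
    by (simp only: toS_def hyp_for_def fst_conv snd_conv cis_zero mult_1_right)
  have c: "cis \<phi> * cnj (cis \<phi>) = 1" by (simp add: cis_cnj cis_mult)
  have C: "Complex 1 t = 1 + \<i> * complex_of_real t" for t by (simp add: complex_eq_iff)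
  have f: "fst (toS (hyp_for \<phi>) \<star> toS (ray \<tau> \<phi>)) = fst (toS (ray (4 * \<tau>) \<phi>) \<star> toS (hyp_for \<phi>))"
  proof -
    have "fst (toS (hyp_for \<phi>) \<star> toS (ray \<tau> \<phi>)) = complex_of_real (5/4) * (1 + \<i> * complex_of_real \<tau>) + \<i> * complex_of_real (3/4) * complex_of_real \<tau> * (cis \<phi> * cnj (cis \<phi>))"
      by (simp add: h toS_ray smul_def C)
    moreover have "fst (toS (ray (4 * \<tau>) \<phi>) \<star> toS (hyp_for \<phi>)) = complex_of_real (5/4) * (1 + \<i> * complex_of_real (4 * \<tau>)) - \<i> * complex_of_real (3/4) * complex_of_real (4 * \<tau>) * (cis \<phi> * cnj (cis \<phi>))"
      by (simp add: h toS_ray smul_def C)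
    ultimately show ?thesis unfolding c by (simp add: complex_eq_iff)
  qed
  have s: "snd (toS (hyp_for \<phi>) \<star> toS (ray \<tau> \<phi>)) = snd (toS (ray (4 * \<tau>) \<phi>) \<star> toS (hyp_for \<phi>))"
    by (simp add: h toS_ray smul_def C field_simps)
  show "toS (hyp_for \<phi> \<odot> ray \<tau> \<phi>) = toS (ray (4 * \<tau>) \<phi> \<odot> hyp_for \<phi>)"
    unfolding toS_mul using f s by (rule prod_eqI)
  show "\<bar>fst (hyp_for \<phi> \<odot> ray \<tau> \<phi>) - fst (ray (4 * \<tau>) \<phi> \<odot> hyp_for \<phi>)\<bar> < 2 * pi"
    using cmul_angle[of "hyp_for \<phi>" "ray \<tau> \<phi>"] cmul_angle[of "ray (4 * \<tau>) \<phi>" "hyp_for \<phi>"]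
      arctan_bounded[of \<tau>] arctan_bounded[of "4 * \<tau>"] unfolding ray_def hyp_for_def fst_conv by linarith
qed

lemma cinv_ray: "cinv (ray \<tau> \<phi>) = ray (- \<tau>) \<phi>"
  by (rule cinv_unique[symmetric]) (simp add: ray_add)

lemma ccomm_hyp_for: "ccomm (hyp_for \<phi>) (ray \<tau> \<phi>) = ray (3 * \<tau>) \<phi>"
  by (simp add: ccomm_def hyp_for_ray cinv_ray) (simp add: cmul_assoc ray_add)

lemma ray_eq_cid: "ray \<tau> \<phi> = cid \<longleftrightarrow> \<tau> = 0"
proof
  assume "ray \<tau> \<phi> = cid"
  then have "fst (ray \<tau> \<phi>) = 0" by simp
  then show "\<tau> = 0" by (simp add: ray_def)
qed simp

text \<open>A handle with commuting generators is moved to one with non-commuting generators, at the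
  cost of rescaling the last parabolic element.\<close>

lemma desingularize:
  assumes p: "p \<ge> 1" and s: "\<And>i. i < p \<Longrightarrow> s i = 1 \<or> s i = - 1"
    and loc_const: "loc_const (Lifted g p n s) \<kappa>" and z: "zinvariant g (Lifted g p n s) \<kappa>"
    and \<rho>: "\<rho> \<in> Lifted g p n s" and j: "j < g"
    and sing: "ccomm (\<rho> (Gen_a j)) (\<rho> (Gen_b j)) = cid"
  obtains \<rho>' where "\<rho>' \<in> Lifted g p n s" "\<kappa> \<rho>' = \<kappa> \<rho>" "ccomm (\<rho>' (Gen_a j)) (\<rho>' (Gen_b j)) \<noteq> cid"
    "\<And>i. i \<noteq> j \<Longrightarrow> \<rho>' (Gen_a i) = \<rho> (Gen_a i) \<and> \<rho>' (Gen_b i) = \<rho> (Gen_b i)"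
proof -
  let ?T = "Lifted g p n s"
  define A B where "A = \<rho> (Gen_a j)" and "B = \<rho> (Gen_b j)"
  define r where "r x y = \<rho>(Gen_a j := x, Gen_b j := y)" for x y
  have rT: "r x y \<in> ?T" if "ccomm x y = cid" for x y
    unfolding r_def by (rule Lifted_handle[OF \<rho> j]) (simp add: that sing)
  obtain Z' :: "real \<Rightarrow> cov" and k where Z': "continuous_on {0..1} Z'" "Z' 0 = cid" "Z' 1 = central k \<odot> B"
    "\<And>t A. t \<in> {0..1} \<Longrightarrow> A \<odot> B = B \<odot> A \<Longrightarrow> A \<odot> Z' t = Z' t \<odot> A"
    using centralizer_path[of B] by blast
  have "\<kappa> (r A (Z' 0)) = \<kappa> (r A (Z' 1))"
  proof (rule loc_const_path[OF loc_const, where \<gamma> = "\<lambda>t. r A (Z' t)" and S = "{0..1::real}"])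
    show "continuous_on {0..1} (\<lambda>t. r A (Z' t))" unfolding r_def by (intro continuous_intros Z'(1))
    show "r A (Z' t) \<in> ?T" if "t \<in> {0..1}" for t
      using Z'(4)[OF that] sing by (intro rT) (simp add: ccomm_eq_cid_iff A_def B_def)
  qed auto
  moreover have "r A (Z' 1) = \<rho>(Gen_b j := central k \<odot> \<rho> (Gen_b j))" by (simp add: r_def Z'(3) A_def B_def)
  ultimately have 1: "\<kappa> (r A cid) = \<kappa> \<rho>" using zinvariant_shift[OF z \<rho> j] Z'(2) by simp
  have 2: "\<kappa> (r A cid) = \<kappa> (r H cid)" for H
  proof -
    have "\<kappa> (r ((1 - 0) *\<^sub>R A + 0 *\<^sub>R H) cid) = \<kappa> (r ((1 - 1) *\<^sub>R A + 1 *\<^sub>R H) cid)"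
    proof (rule loc_const_path[OF loc_const, where \<gamma> = "\<lambda>t. r ((1 - t) *\<^sub>R A + t *\<^sub>R H) cid" and S = "{0..1::real}"])
      show "continuous_on {0..1} (\<lambda>t. r ((1 - t) *\<^sub>R A + t *\<^sub>R H) cid)" unfolding r_def by (intro continuous_intros)
      show "r ((1 - t) *\<^sub>R A + t *\<^sub>R H) cid \<in> ?T" for t by (intro rT) (simp add: ccomm_eq_cid_iff)
    qed auto
    moreover have "(1 - 0) *\<^sub>R A + 0 *\<^sub>R H = A" "(1 - 1) *\<^sub>R A + 1 *\<^sub>R H = H" by (simp_all add: prod_eq_iff)
    ultimately show ?thesis by simp
  qed
  define c where "c = Gen_c (p - 1)"
  have sp: "s (p - 1) = 1 \<or> s (p - 1) = - 1" using s p by simp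
  have "\<rho> c \<in> Parabolics (s (p - 1))" using \<rho> p by (simp add: Lifted_def c_def)
  then obtain \<sigma> \<phi> where C: "\<rho> c = ray \<sigma> \<phi>" "of_int (s (p - 1)) * \<sigma> > 0" by (rule Parabolics_ray[OF _ sp])
  define pre where "pre = wlist (map (\<lambda>i. ccomm (\<rho> (Gen_a i)) (\<rho> (Gen_b i))) [0..<j])"
  define suf where "suf = wlist (map (\<lambda>i. ccomm (\<rho> (Gen_a i)) (\<rho> (Gen_b i))) [Suc j..<g] @ map (\<lambda>i. \<rho> (Gen_c i)) [0..<p - 1])"
  have split: "lprod g p \<rho>' = wlist (map (\<lambda>i. ccomm (\<rho>' (Gen_a i)) (\<rho>' (Gen_b i))) [0..<j]) \<odot>
     ccomm (\<rho>' (Gen_a j)) (\<rho>' (Gen_b j)) \<odot>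
     wlist (map (\<lambda>i. ccomm (\<rho>' (Gen_a i)) (\<rho>' (Gen_b i))) [Suc j..<g] @ map (\<lambda>i. \<rho>' (Gen_c i)) [0..<p - 1]) \<odot> \<rho>' c" for \<rho>'
  proof -
    have "[0..<g] = [0..<j] @ j # [Suc j..<g]" proof -
      have "[0..<j + (g - j)] = [0..<j] @ [j..<j + (g - j)]" by (rule upt_add_eq_append) simp
      then show ?thesis using j upt_conv_Cons[OF j] by simp
    qed
    moreover have "[0..<p] = [0..<p - 1] @ [p - 1]" using p by (metis Suc_diff_1 upt_Suc_append zero_le less_le_trans zero_less_one)
    ultimately show ?thesis by (simp add: lprod_def wlist_append cmul_assoc c_def)
  qed
  have tot: "pre \<odot> suf \<odot> ray \<sigma> \<phi> = central n"
    using \<rho> split[of \<rho>] by (simp add: Lifted_def pre_def suf_def sing C(1))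
  define H where "H = suf \<odot> hyp_for \<phi> \<odot> cinv suf"
  define P where "P t = suf \<odot> ray (- (\<sigma> * t) / 3) \<phi> \<odot> cinv suf" for t
  define R where "R t = (r H (P t))(c := ray (\<sigma> * (1 + t)) \<phi>)" for t
  have HP: "ccomm H (P t) = suf \<odot> ray (- (\<sigma> * t)) \<phi> \<odot> cinv suf" for t
  proof -
    have "ccomm H (P t) = suf \<odot> ccomm (hyp_for \<phi>) (ray (- (\<sigma> * t) / 3) \<phi>) \<odot> cinv suf"
      by (simp add: H_def P_def ccomm_def cmul_assoc)
    then show ?thesis by (simp add: ccomm_hyp_for)
  qed
  have Rab: "R t (Gen_a i) = (if i = j then H else \<rho> (Gen_a i))" "R t (Gen_b i) = (if i = j then P t else \<rho> (Gen_b i))" for t i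
    by (simp_all add: R_def r_def c_def)
  have Rc: "R t (Gen_c i) = (if i = p - 1 then ray (\<sigma> * (1 + t)) \<phi> else \<rho> (Gen_c i))" for t i
    by (simp add: R_def r_def c_def)
  have RT: "R t \<in> ?T" if t: "t \<ge> 0" for t
  proof -
    have m1: "map (\<lambda>i. ccomm (R t (Gen_a i)) (R t (Gen_b i))) [0..<j] = map (\<lambda>i. ccomm (\<rho> (Gen_a i)) (\<rho> (Gen_b i))) [0..<j]"
      "map (\<lambda>i. ccomm (R t (Gen_a i)) (R t (Gen_b i))) [Suc j..<g] = map (\<lambda>i. ccomm (\<rho> (Gen_a i)) (\<rho> (Gen_b i))) [Suc j..<g]"
      "map (\<lambda>i. R t (Gen_c i)) [0..<p - 1] = map (\<lambda>i. \<rho> (Gen_c i)) [0..<p - 1]"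
      by (simp_all add: Rab Rc)
    have "lprod g p (R t) = pre \<odot> ccomm H (P t) \<odot> suf \<odot> ray (\<sigma> * (1 + t)) \<phi>"
      unfolding split[of "R t"] m1 by (simp add: Rab Rc c_def pre_def suf_def)
    also have "\<dots> = pre \<odot> suf \<odot> (ray (- (\<sigma> * t)) \<phi> \<odot> ray (\<sigma> * (1 + t)) \<phi>)" by (simp add: HP cmul_assoc)
    also have "\<dots> = central n" using tot by (simp add: ray_add algebra_simps)
    finally have l: "lprod g p (R t) = central n" .
    have "of_int (s (p - 1)) * (\<sigma> * (1 + t)) = (of_int (s (p - 1)) * \<sigma>) * (1 + t)" by simp
    moreover have "q * (1 + t) > 0" if "q > 0" for q :: real using that t by simp
    from this[OF C(2)] have "(of_int (s (p - 1)) * \<sigma>) * (1 + t) > 0" .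
    ultimately have "of_int (s (p - 1)) * (\<sigma> * (1 + t)) > 0" by simp
    then have "ray (\<sigma> * (1 + t)) \<phi> \<in> Parabolics (s (p - 1))" using sp by (rule ray_Parabolics)
    then have "\<forall>i<p. R t (Gen_c i) \<in> Parabolics (s i)" using \<rho> by (auto simp: Rc Lifted_def)
    moreover have "\<forall>x. x \<notin> surface_gens g p \<longrightarrow> R t x = cid"
      using \<rho> j p by (auto simp: R_def r_def c_def Lifted_def)
    ultimately show ?thesis using l by (simp add: Lifted_def)
  qed
  have "\<kappa> (R 0) = \<kappa> (R 1)"
  proof (rule loc_const_path[OF loc_const, where \<gamma> = R and S = "{0..1::real}"])
    show "continuous_on {0..1} R" unfolding R_def r_def P_def by (intro continuous_intros) auto
  qed (auto intro: RT)
  moreover have "R 0 = r H cid"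
  proof -
    have "P 0 = cid" by (simp add: P_def)
    moreover have "r H (P 0) c = ray \<sigma> \<phi>" using C(1) by (simp add: r_def c_def)
    ultimately show ?thesis by (simp add: R_def fun_upd_idem)
  qed
  ultimately have "\<kappa> (R 1) = \<kappa> \<rho>" using 1 2[of H] by simp
  moreover have "ccomm (R 1 (Gen_a j)) (R 1 (Gen_b j)) \<noteq> cid"
  proof
    assume "ccomm (R 1 (Gen_a j)) (R 1 (Gen_b j)) = cid"
    then have "suf \<odot> ray (- \<sigma>) \<phi> \<odot> cinv suf = cid" by (simp add: Rab HP)
    then have "cinv suf \<odot> (suf \<odot> ray (- \<sigma>) \<phi> \<odot> cinv suf) \<odot> suf = cid" by simp
    then have "ray (- \<sigma>) \<phi> = cid" by (simp add: cmul_assoc)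
    then show False using C(2) by (simp add: ray_eq_cid)
  qed
  ultimately show ?thesis by (intro that[of "R 1"] RT) (simp_all add: Rab)
qed

definition Lifted_ns :: "nat \<Rightarrow> nat \<Rightarrow> int \<Rightarrow> (nat \<Rightarrow> int) \<Rightarrow> (surface_gen \<Rightarrow> cov) set" where
  "Lifted_ns g p n s = {\<rho> \<in> Lifted g p n s. \<forall>j<g. ccomm (\<rho> (Gen_a j)) (\<rho> (Gen_b j)) \<noteq> cid}"

lemma to_nonsingular:
  assumes p: "p \<ge> 1" and s: "\<And>i. i < p \<Longrightarrow> s i = 1 \<or> s i = - 1"
    and loc_const: "loc_const (Lifted g p n s) \<kappa>" and z: "zinvariant g (Lifted g p n s) \<kappa>"
    and \<rho>: "\<rho> \<in> Lifted g p n s"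
  shows "\<exists>\<rho>'\<in>Lifted_ns g p n s. \<kappa> \<rho>' = \<kappa> \<rho>"
proof -
  have "\<exists>\<rho>'\<in>Lifted g p n s. \<kappa> \<rho>' = \<kappa> \<rho> \<and> (\<forall>j<k. ccomm (\<rho>' (Gen_a j)) (\<rho>' (Gen_b j)) \<noteq> cid)" if "k \<le> g" for k
    using that
  proof (induction k)
    case 0
    then show ?case using \<rho> by auto
  next
    case (Suc k)
    then obtain \<rho>' where r: "\<rho>' \<in> Lifted g p n s" "\<kappa> \<rho>' = \<kappa> \<rho>" "\<And>j. j < k \<Longrightarrow> ccomm (\<rho>' (Gen_a j)) (\<rho>' (Gen_b j)) \<noteq> cid"
      by auto
    show ?case
    proof (cases "ccomm (\<rho>' (Gen_a k)) (\<rho>' (Gen_b k)) = cid")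
      case False
      then show ?thesis using r by (intro bexI[of _ \<rho>']) (auto simp: less_Suc_eq)
    next
      case True
      have kg: "k < g" using Suc.prems by simp
      obtain \<rho>'' where r': "\<rho>'' \<in> Lifted g p n s" "\<kappa> \<rho>'' = \<kappa> \<rho>'" "ccomm (\<rho>'' (Gen_a k)) (\<rho>'' (Gen_b k)) \<noteq> cid"
        "\<And>i. i \<noteq> k \<Longrightarrow> \<rho>'' (Gen_a i) = \<rho>' (Gen_a i) \<and> \<rho>'' (Gen_b i) = \<rho>' (Gen_b i)"
        using desingularize[OF p s loc_const z r(1) kg True] by blast
      have "\<forall>j<Suc k. ccomm (\<rho>'' (Gen_a j)) (\<rho>'' (Gen_b j)) \<noteq> cid"
        using r(3) r'(3,4) by (metis less_SucE)
      then show ?thesis using r' r(2) by auto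
    qed
  qed
  from this[of g] show ?thesis by (auto simp: Lifted_ns_def)
qed

context peeling
begin

lemma tuples_necessary:
  assumes m: "1 \<le> m" and S0: "S 0 = shift_range 1 (- 1) - {cid}" and y: "y \<in> tuples n"
  shows "0 < n + 1 + sum U {1..<m}" "n - 1 - sum L {1..<m} < 0"
proof -
  have yS: "y k \<in> S k" if "k < m" for k using y that by (auto simp: tuples_def dest: spec[of _ k])
  have w: "y 0 \<odot> wprod y (Suc 0) m = central n" using y m by (simp add: tuples_def wprod_rec)
  then have "wprod y (Suc 0) m = cinv (y 0) \<odot> central n" using cinv_cancel(1)[of "y 0" "wprod y (Suc 0) m"] by simp
  then have "wprod y (Suc 0) m = central n \<odot> cinv (y 0)" by (simp add: central_commute)
  moreover have "central n \<odot> cinv (y 0) \<in> shift_range (n + 1) (n - 1)"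
    unfolding shift_range_central shift_range_cinv using yS[of 0] m S0 by simp
  ultimately have "wprod y 1 m \<in> shift_range (n + 1) (n - 1)" by simp
  then have "cid \<in> shift_range (n + 1 + sum U {1..<m}) (n - 1 - sum L {1..<m})"
    by (intro necessary[of 1 y]) (use yS m in auto)
  then show "0 < n + 1 + sum U {1..<m}" "n - 1 - sum L {1..<m} < 0" by (auto simp: cid_shift_range)
qed

end

locale surface_data =
  fixes g p :: nat and s :: "nat \<Rightarrow> int"
  assumes g1: "g \<ge> 1" and p1: "p \<ge> 1" and s1: "\<And>i. i < p \<Longrightarrow> s i = 1 \<or> s i = - 1"
begin

definition S :: "nat \<Rightarrow> cov set" where "S k = (if k < g then shift_range 1 (- 1) - {cid} else Parabolics (s (k - g)))"
definition U :: "nat \<Rightarrow> int" where "U k = (if k < g then 2 else if s (k - g) = 1 then 0 else 1)"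
definition L :: "nat \<Rightarrow> int" where "L k = (if k < g then 2 else if s (k - g) = 1 then 1 else 0)"

sublocale peeling S U L "g + p"
proof
  fix k assume "k < g + p"
  then show "peel (S k) (U k) (L k)"
    using peel_shift_range1 peel_Parabolics[OF s1[of "k - g"]] by (auto simp: S_def U_def L_def)
qed (auto simp: U_def L_def)

definition factors :: "(surface_gen \<Rightarrow> cov) \<Rightarrow> nat \<Rightarrow> cov" where
  "factors \<rho> k = (if k < g then ccomm (\<rho> (Gen_a k)) (\<rho> (Gen_b k)) else if k < g + p then \<rho> (Gen_c (k - g)) else cid)"

lemma wprod_factors: "wprod (factors \<rho>) 0 (g + p) = lprod g p \<rho>"
proof -
  have "[0..<g + p] = [0..<g] @ map (\<lambda>i. i + g) [0..<p]"
    by (simp add: map_add_upt upt_add_eq_append[of 0 g p, simplified] add.commute)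
  moreover have "map (factors \<rho>) [0..<g] = map (\<lambda>j. ccomm (\<rho> (Gen_a j)) (\<rho> (Gen_b j))) [0..<g]"
    by (simp add: factors_def)
  moreover have "map (factors \<rho>) (map (\<lambda>i. i + g) [0..<p]) = map (\<lambda>i. \<rho> (Gen_c i)) [0..<p]"
    by (simp add: factors_def)
  ultimately show ?thesis by (simp only: wprod_def lprod_def map_append)
qed

lemma factors_tuples: "\<rho> \<in> Lifted_ns g p n s \<Longrightarrow> factors \<rho> \<in> tuples n"
  using wprod_factors[of \<rho>] ccomm_shift_range by (auto simp: tuples_def Lifted_ns_def Lifted_def factors_def S_def)

lemma sums: "sum U {1..<g + p} = 2 * int g - 2 + int (num_neg p s)" "sum L {1..<g + p} = 2 * int g - 2 + int (num_pos p s)"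
proof -
  have sp: "sum f {1..<g + p} = sum f {1..<g} + (\<Sum>i<p. f (g + i))" for f :: "nat \<Rightarrow> int"
  proof -
    have "sum f {1..<g + p} = sum f {1..<g} + sum f {g..<g + p}" using g1 by (simp add: sum.atLeastLessThan_concat)
    also have "sum f {g..<g + p} = (\<Sum>i<p. f (g + i))"
      using sum.shift_bounds_nat_ivl[of f 0 g p] by (simp add: add.commute lessThan_atLeast0)
    finally show ?thesis .
  qed
  have 2: "(\<Sum>k\<in>{1..<g}. 2) = 2 * int g - 2" using g1 by simp
  have "(\<Sum>i<p. if s i = 1 then 0 else 1::int) = (\<Sum>i\<in>{i. i < p \<and> s i = - 1}. 1)"
    by (rule sum.mono_neutral_cong_right) (use s1 in auto)
  moreover have "(\<Sum>i<p. if s i = 1 then 1 else 0::int) = (\<Sum>i\<in>{i. i < p \<and> s i = 1}. 1)"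
    by (rule sum.mono_neutral_cong_right) auto
  ultimately show "sum U {1..<g + p} = 2 * int g - 2 + int (num_neg p s)" "sum L {1..<g + p} = 2 * int g - 2 + int (num_pos p s)"
    unfolding sp using 2 by (simp_all add: U_def L_def num_neg_def num_pos_def)
qed

lemma num_add: "num_pos p s + num_neg p s = p"
proof -
  have "card {i. i < p \<and> s i = 1} + card {i. i < p \<and> s i = - 1} = card ({i. i < p \<and> s i = 1} \<union> {i. i < p \<and> s i = - 1})"
    by (rule card_Un_disjoint[symmetric]) auto
  also have "{i. i < p \<and> s i = 1} \<union> {i. i < p \<and> s i = - 1} = {..<p}" using s1 by auto
  finally show ?thesis by (simp add: num_pos_def num_neg_def)
qed

lemma S0: "S 0 = shift_range 1 (- 1) - {cid}" using g1 by (simp add: S_def)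

lemma tuples_iff: "tuples n \<noteq> {} \<longleftrightarrow> surface_euler_char g p + int (num_pos p s) \<le> n \<and> n \<le> - surface_euler_char g p - int (num_neg p s)"
proof -
  have "tuples n \<noteq> {} \<longleftrightarrow> 0 < n + 1 + sum U {1..<g + p} \<and> n - 1 - sum L {1..<g + p} < 0"
    using tuples_connected(2)[OF _ S0, of n] tuples_necessary[OF _ S0, of _ n] g1 p1 by auto
  then show ?thesis unfolding sums surface_euler_char_def using num_add by auto
qed

lemma tuples_S: "w \<in> tuples n \<Longrightarrow> k < g + p \<Longrightarrow> w k \<in> S k"
  by (auto simp: tuples_def dest: spec[of _ k])

definition assemble :: "(nat \<Rightarrow> cov \<times> cov) \<Rightarrow> (nat \<Rightarrow> cov) \<Rightarrow> surface_gen \<Rightarrow> cov" where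
  "assemble h w x = (case x of Gen_a j \<Rightarrow> if j < g then fst (h j) else cid
     | Gen_b j \<Rightarrow> if j < g then snd (h j) else cid | Gen_c i \<Rightarrow> if i < p then w (g + i) else cid)"

lemma assemble_in:
  assumes w: "w \<in> tuples n" and h: "\<And>j. j < g \<Longrightarrow> ccomm (fst (h j)) (snd (h j)) = w j"
  shows "assemble h w \<in> Lifted_ns g p n s" "factors (assemble h w) = w"
proof -
  show f: "factors (assemble h w) = w"
  proof
    fix k
    have "w k = cid" if "\<not> k < g + p" using w that by (auto simp: tuples_def dest: spec[of _ k])
    then show "factors (assemble h w) k = w k" using h by (auto simp: factors_def assemble_def)
  qed
  have "lprod g p (assemble h w) = central n" using wprod_factors[of "assemble h w"] w unfolding f by (simp add: tuples_def)
  moreover have "assemble h w x = cid" if "x \<notin> surface_gens g p" for x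
    using that by (cases x) (auto simp: assemble_def)
  moreover have "assemble h w (Gen_c i) \<in> Parabolics (s i)" if "i < p" for i
    using tuples_S[OF w, of "g + i"] that by (simp add: assemble_def S_def)
  moreover have "w j \<noteq> cid" if "j < g" for j using tuples_S[OF w, of j] that by (simp add: S_def)
  ultimately show "assemble h w \<in> Lifted_ns g p n s" using h by (auto simp: Lifted_ns_def Lifted_def assemble_def)
qed

lemma Lifted_ns_iff: "Lifted_ns g p n s \<noteq> {} \<longleftrightarrow> tuples n \<noteq> {}"
proof
  assume "Lifted_ns g p n s \<noteq> {}"
  then show "tuples n \<noteq> {}" using factors_tuples by blast
next
  assume "tuples n \<noteq> {}"
  then obtain w where w: "w \<in> tuples n" by blast
  have "\<exists>x. ccomm (fst x) (snd x) = w j" if "j < g" for j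
  proof -
    have "good_fibre (w j)" using tuples_S[OF w, of j] that by (intro commutator_fibres) (auto simp: S_def)
    then show ?thesis by (auto simp: good_fibre_def comm_fibre_def)
  qed
  then obtain h where "\<And>j. j < g \<Longrightarrow> ccomm (fst (h j)) (snd (h j)) = w j" by metis
  then show "Lifted_ns g p n s \<noteq> {}" using assemble_in(1)[OF w] by blast
qed

lemma Lifted_iff: "Lifted g p n s \<noteq> {} \<longleftrightarrow> surface_euler_char g p + int (num_pos p s) \<le> n \<and> n \<le> - surface_euler_char g p - int (num_neg p s)"
proof -
  have "Lifted g p n s \<noteq> {} \<longleftrightarrow> Lifted_ns g p n s \<noteq> {}"
  proof
    assume "Lifted g p n s \<noteq> {}"
    then obtain \<rho> where "\<rho> \<in> Lifted g p n s" by blast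
    moreover have "loc_const (Lifted g p n s) (\<lambda>_. True)" "zinvariant g (Lifted g p n s) (\<lambda>_. True)"
      by (simp_all add: loc_const_def zinvariant_def)
    ultimately show "Lifted_ns g p n s \<noteq> {}" using to_nonsingular[where s = s, OF p1 s1] by blast
  qed (auto simp: Lifted_ns_def)
  then show ?thesis using Lifted_ns_iff tuples_iff by blast
qed

lemma fibre_const:
  assumes loc_const: "loc_const (Lifted g p n s) \<kappa>" and z: "zinvariant g (Lifted g p n s) \<kappa>"
    and r: "\<rho> \<in> Lifted_ns g p n s" "\<rho>' \<in> Lifted_ns g p n s" and f: "factors \<rho> = factors \<rho>'"
  shows "\<kappa> \<rho> = \<kappa> \<rho>'"
proof -
  let ?T = "Lifted g p n s"
  define m where "m i x = (case x of Gen_a j \<Rightarrow> if j < i then \<rho>' x else \<rho> x | Gen_b j \<Rightarrow> if j < i then \<rho>' x else \<rho> x | Gen_c j \<Rightarrow> \<rho> x)" for i x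
  have cm: "ccomm (\<rho> (Gen_a j)) (\<rho> (Gen_b j)) = ccomm (\<rho>' (Gen_a j)) (\<rho>' (Gen_b j))" if "j < g" for j
    using fun_cong[OF f, of j] that by (simp add: factors_def)
  have mT: "m i \<in> ?T" for i
  proof -
    have "lprod g p (m i) = lprod g p \<rho>" by (rule lprod_cong) (use cm in \<open>auto simp: m_def\<close>)
    then show ?thesis using r by (auto simp: Lifted_ns_def Lifted_def m_def split: surface_gen.splits)
  qed
  have step: "\<kappa> (m (Suc i)) = \<kappa> (m i)" if i: "i < g" for i
  proof -
    define h where "h = ccomm (\<rho> (Gen_a i)) (\<rho> (Gen_b i))"
    have "h \<noteq> cid" using r(1) i by (simp add: h_def Lifted_ns_def)
    then have "conn_mod_center (comm_fibre h)" using commutator_fibres[of h] ccomm_shift_range by (simp add: h_def good_fibre_def)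
    moreover define \<kappa>' where "\<kappa>' x = \<kappa> ((m i)(Gen_a i := fst x, Gen_b i := snd x))" for x
    have hm: "ccomm (m i (Gen_a i)) (m i (Gen_b i)) = h" by (simp add: m_def h_def)
    have FT: "(m i)(Gen_a i := fst x, Gen_b i := snd x) \<in> ?T" if "x \<in> comm_fibre h" for x
      by (rule Lifted_handle[OF mT i]) (use that hm in \<open>auto simp: comm_fibre_def\<close>)
    have "loc_const (comm_fibre h) \<kappa>'" unfolding \<kappa>'_def
      by (rule loc_const_compose[OF loc_const _ FT]) (intro continuous_intros)
    moreover have "center_inv (comm_fibre h) \<kappa>'"
      unfolding center_inv_def
    proof (intro allI impI)
      fix A B assume AB: "(A, B) \<in> comm_fibre h"
      have "((m i)(Gen_a i := A, Gen_b i := B)) \<in> ?T" using FT[OF AB] by simp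
      then show "\<kappa>' (central 1 \<odot> A, B) = \<kappa>' (A, B) \<and> \<kappa>' (A, central 1 \<odot> B) = \<kappa>' (A, B)"
      proof -
        let ?r = "(m i)(Gen_a i := A, Gen_b i := B)"
        have "?r(Gen_a i := central 1 \<odot> ?r (Gen_a i)) = (m i)(Gen_a i := central 1 \<odot> A, Gen_b i := B)"
          "?r(Gen_b i := central 1 \<odot> ?r (Gen_b i)) = (m i)(Gen_a i := A, Gen_b i := central 1 \<odot> B)"
          by (auto simp: fun_eq_iff)
        moreover have "\<kappa> (?r(Gen_a i := central 1 \<odot> ?r (Gen_a i))) = \<kappa> ?r \<and> \<kappa> (?r(Gen_b i := central 1 \<odot> ?r (Gen_b i))) = \<kappa> ?r"
          using z i \<open>?r \<in> ?T\<close> unfolding zinvariant_def by blast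
        ultimately show ?thesis unfolding \<kappa>'_def fst_conv snd_conv by (simp only:)
      qed
    qed
    ultimately obtain c where c: "\<forall>x\<in>comm_fibre h. \<kappa>' x = c" unfolding conn_mod_center_def by blast
    have "(\<rho> (Gen_a i), \<rho> (Gen_b i)) \<in> comm_fibre h" "(\<rho>' (Gen_a i), \<rho>' (Gen_b i)) \<in> comm_fibre h"
      using cm[OF i] by (auto simp: comm_fibre_def h_def)
    then have "\<kappa>' (\<rho> (Gen_a i), \<rho> (Gen_b i)) = \<kappa>' (\<rho>' (Gen_a i), \<rho>' (Gen_b i))" using c by simp
    moreover have "(m i)(Gen_a i := \<rho> (Gen_a i), Gen_b i := \<rho> (Gen_b i)) = m i" by (auto simp: m_def fun_eq_iff)
    moreover have "(m i)(Gen_a i := \<rho>' (Gen_a i), Gen_b i := \<rho>' (Gen_b i)) = m (Suc i)"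
      by (auto simp: m_def fun_eq_iff less_Suc_eq split: surface_gen.splits)
    ultimately show ?thesis by (simp add: \<kappa>'_def)
  qed
  have "\<kappa> (m i) = \<kappa> (m 0)" if "i \<le> g" for i
    using that by (induction i) (auto simp: step)
  from this[OF order_refl] have "\<kappa> (m g) = \<kappa> (m 0)" .
  moreover have "m 0 = \<rho>" by (auto simp: m_def fun_eq_iff split: surface_gen.splits)
  moreover have "m g = \<rho>'"
  proof
    fix x
    show "m g x = \<rho>' x"
    proof (cases x)
      case (Gen_a j)
      then show ?thesis using r by (auto simp: m_def Lifted_ns_def Lifted_def)
    next
      case (Gen_b j)
      then show ?thesis using r by (auto simp: m_def Lifted_ns_def Lifted_def)
    next
      case (Gen_c j)
      show ?thesis
      proof (cases "j < p")
        case True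
        then show ?thesis using fun_cong[OF f, of "g + j"] Gen_c by (simp add: m_def factors_def)
      next
        case False
        then show ?thesis using r Gen_c by (auto simp: m_def Lifted_ns_def Lifted_def)
      qed
    qed
  qed
  ultimately show ?thesis by simp
qed

theorem Lifted_connected:
  assumes loc_const: "loc_const (Lifted g p n s) \<kappa>" and z: "zinvariant g (Lifted g p n s) \<kappa>"
    and r: "\<rho> \<in> Lifted g p n s" "\<rho>' \<in> Lifted g p n s"
  shows "\<kappa> \<rho> = \<kappa> \<rho>'"
proof -
  let ?N = "Lifted_ns g p n s"
  have NT: "?N \<subseteq> Lifted g p n s" by (auto simp: Lifted_ns_def)
  have img: "tuples n = factors ` ?N"
  proof (intro equalityI subsetI)
    fix w assume w: "w \<in> tuples n"
    have "\<exists>x. ccomm (fst x) (snd x) = w j" if "j < g" for j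
    proof -
      have "good_fibre (w j)" using tuples_S[OF w, of j] that by (intro commutator_fibres) (auto simp: S_def)
      then show ?thesis by (auto simp: good_fibre_def comm_fibre_def)
    qed
    then obtain h where "\<And>j. j < g \<Longrightarrow> ccomm (fst (h j)) (snd (h j)) = w j" by metis
    from assemble_in[OF w this] show "w \<in> factors ` ?N" by (metis image_eqI)
  qed (use factors_tuples in blast)
  have sec: "\<exists>\<sigma>. (\<sigma> \<longlongrightarrow> r) (at (factors r) within tuples n) \<and> (\<forall>\<^sub>F w in at (factors r) within tuples n. \<sigma> w \<in> ?N \<and> factors (\<sigma> w) = w)"
    if rN: "r \<in> ?N" for r
  proof -
    let ?F = "at (factors r) within tuples n"
    have "\<forall>j\<in>{..<g}. \<exists>\<sigma>. (\<sigma> \<longlongrightarrow> (r (Gen_a j), r (Gen_b j))) (nhds (factors r j)) \<and>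
      (\<forall>\<^sub>F h in nhds (factors r j). ccomm (fst (\<sigma> h)) (snd (\<sigma> h)) = h)"
    proof
      fix j assume "j \<in> {..<g}"
      then have that: "j < g" by simp
      have "factors r j = ccomm (r (Gen_a j)) (r (Gen_b j))" using that by (simp add: factors_def)
      moreover have "ccomm (r (Gen_a j)) (r (Gen_b j)) \<noteq> cid" using rN that by (simp add: Lifted_ns_def)
      then obtain \<sigma> where "(\<sigma> \<longlongrightarrow> (r (Gen_a j), r (Gen_b j))) (nhds (ccomm (r (Gen_a j)) (r (Gen_b j))))"
        "\<forall>\<^sub>F h in nhds (ccomm (r (Gen_a j)) (r (Gen_b j))). ccomm (fst (\<sigma> h)) (snd (\<sigma> h)) = h"
        by (rule ccomm_section)
      ultimately show "\<exists>\<sigma>. (\<sigma> \<longlongrightarrow> (r (Gen_a j), r (Gen_b j))) (nhds (factors r j)) \<and>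
          (\<forall>\<^sub>F h in nhds (factors r j). ccomm (fst (\<sigma> h)) (snd (\<sigma> h)) = h)"
        by (simp only:) blast
    qed
    from bchoice[OF this] obtain \<sigma> where \<sigma>: "\<And>j. j < g \<Longrightarrow> (\<sigma> j \<longlongrightarrow> (r (Gen_a j), r (Gen_b j))) (nhds (factors r j))"
      "\<And>j. j < g \<Longrightarrow> \<forall>\<^sub>F h in nhds (factors r j). ccomm (fst (\<sigma> j h)) (snd (\<sigma> j h)) = h" by auto
    define \<tau> where "\<tau> w = assemble (\<lambda>j. \<sigma> j (w j)) w" for w
    have lw: "((\<lambda>w. w k) \<longlongrightarrow> factors r k) ?F" for k by (rule tendsto_coord) (rule tendsto_ident_at)
    have ls: "((\<lambda>w. \<sigma> j (w j)) \<longlongrightarrow> (r (Gen_a j), r (Gen_b j))) ?F" if "j < g" for j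
      by (rule filterlim_compose[OF \<sigma>(1)[OF that] lw])
    have r0: "r x = cid" if "x \<notin> surface_gens g p" for x using rN that by (simp add: Lifted_ns_def Lifted_def)
    have "(\<tau> \<longlongrightarrow> r) ?F"
    proof (rule tendsto_from_coords)
      fix x
      show "((\<lambda>w. \<tau> w x) \<longlongrightarrow> r x) ?F"
      proof (cases x)
        case (Gen_a j)
        then show ?thesis using tendsto_fst[OF ls[of j]] r0[of x] by (cases "j < g") (auto simp: \<tau>_def assemble_def)
      next
        case (Gen_b j)
        then show ?thesis using tendsto_snd[OF ls[of j]] r0[of x] by (cases "j < g") (auto simp: \<tau>_def assemble_def)
      next
        case (Gen_c i)
        then show ?thesis using lw[of "g + i"] r0[of x] by (cases "i < p") (auto simp: \<tau>_def assemble_def factors_def)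
      qed
    qed
    moreover have "\<forall>\<^sub>F w in ?F. \<forall>j\<in>{..<g}. ccomm (fst (\<sigma> j (w j))) (snd (\<sigma> j (w j))) = w j"
    proof (rule eventually_ball_finite)
      show "\<forall>j\<in>{..<g}. \<forall>\<^sub>F w in ?F. ccomm (fst (\<sigma> j (w j))) (snd (\<sigma> j (w j))) = w j"
      proof
        fix j assume "j \<in> {..<g}"
        then have "j < g" by simp
        from eventually_compose_filterlim[OF \<sigma>(2)[OF this] lw[of j]]
        show "\<forall>\<^sub>F w in ?F. ccomm (fst (\<sigma> j (w j))) (snd (\<sigma> j (w j))) = w j" .
      qed
    qed simp
    moreover have "\<forall>\<^sub>F w in ?F. w \<in> tuples n" by (auto simp: eventually_at_topological)
    ultimately have "\<forall>\<^sub>F w in ?F. \<tau> w \<in> ?N \<and> factors (\<tau> w) = w"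
    proof -
      assume e: "\<forall>\<^sub>F w in ?F. \<forall>j\<in>{..<g}. ccomm (fst (\<sigma> j (w j))) (snd (\<sigma> j (w j))) = w j" "\<forall>\<^sub>F w in ?F. w \<in> tuples n"
      show ?thesis using e
      proof eventually_elim
        case (elim w)
        then have "\<And>j. j < g \<Longrightarrow> ccomm (fst (\<sigma> j (w j))) (snd (\<sigma> j (w j))) = w j" by simp
        from assemble_in[OF elim(2) this] show ?case by (simp add: \<tau>_def)
      qed
    qed
    with \<open>(\<tau> \<longlongrightarrow> r) ?F\<close> show ?thesis by blast
  qed
  obtain \<kappa>' where k: "loc_const (tuples n) \<kappa>'" "\<And>r. r \<in> ?N \<Longrightarrow> \<kappa> r = \<kappa>' (factors r)"
    using loc_const_fibre[OF loc_const_mono[OF loc_const NT] fibre_const[OF loc_const z] sec img] by blast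
  have con: "connected (tuples n)" using tuples_connected(1)[OF _ S0] g1 p1 by simp
  obtain r1 r2 where r12: "r1 \<in> ?N" "r2 \<in> ?N" "\<kappa> r1 = \<kappa> \<rho>" "\<kappa> r2 = \<kappa> \<rho>'"
    using to_nonsingular[where s = s, OF p1 s1 loc_const z] r by metis
  have "\<kappa>' (factors r1) = \<kappa>' (factors r2)"
    by (rule loc_const_connected[OF con k(1)]) (use r12 factors_tuples in auto)
  then show ?thesis using k(2) r12 by metis
qed

end

section \<open>Identification with matrices\<close>

text \<open>The basis \<open>1, - \<i>\<close> of the plane is used, so that translation by \<open>+ \<pi>\<close> corresponds to \<open>cover_z\<close>.\<close>

definition to_mat :: "sq \<Rightarrow> mat2" where
  "to_mat s = mat2 (Re (fst s) + Re (snd s)) (Im (fst s) - Im (snd s)) (- Im (fst s) - Im (snd s)) (Re (fst s) - Re (snd s))"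

definition of_mat :: "mat2 \<Rightarrow> sq" where
  "of_mat A = (Complex ((A$1$1 + A$2$2) / 2) ((A$1$2 - A$2$1) / 2), Complex ((A$1$1 - A$2$2) / 2) (- (A$1$2 + A$2$1) / 2))"

lemma mat2_nth [simp]: "mat2 a b c d $ 1 $ 1 = a" "mat2 a b c d $ 1 $ 2 = b" "mat2 a b c d $ 2 $ 1 = c" "mat2 a b c d $ 2 $ 2 = d"
  by (simp_all add: mat2_def)

lemma mat2_eqI: "A$1$1 = B$1$1 \<Longrightarrow> A$1$2 = B$1$2 \<Longrightarrow> A$2$1 = B$2$1 \<Longrightarrow> A$2$2 = B$2$2 \<Longrightarrow> A = B" for A B :: mat2
  by (simp add: vec_eq_iff forall_2)

lemma mat_one_nth: "(mat 1 :: mat2) $ 1 $ 1 = 1" "(mat 1 :: mat2) $ 1 $ 2 = 0" "(mat 1 :: mat2) $ 2 $ 1 = 0" "(mat 1 :: mat2) $ 2 $ 2 = 1"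
  by (simp_all add: mat_def)

lemma to_mat_of_mat [simp]: "to_mat (of_mat A) = A"
  by (rule mat2_eqI) (simp_all add: to_mat_def of_mat_def field_simps)

lemma of_mat_to_mat [simp]: "of_mat (to_mat s) = s"
  by (simp add: to_mat_def of_mat_def prod_eq_iff complex_eq_iff)

lemma to_mat_mul: "to_mat (s \<star> t) = to_mat s ** to_mat t"
  by (rule mat2_eqI) (simp_all add: to_mat_def smul_def matrix_matrix_mult_def sum_2 algebra_simps)

lemma to_mat_one [simp]: "to_mat sone = mat 1"
  by (rule mat2_eqI) (simp_all add: to_mat_def mat_one_nth)

lemma to_mat_minus: "to_mat (- s) = - to_mat s"
  by (rule mat2_eqI) (simp_all add: to_mat_def)

lemma to_mat_add: "to_mat (s + t) = to_mat s + to_mat t"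
  by (rule mat2_eqI) (simp_all add: to_mat_def)

lemma to_mat_scaleR: "to_mat (r *\<^sub>R s) = r *\<^sub>R to_mat s"
  by (rule mat2_eqI) (simp_all add: to_mat_def algebra_simps)

lemma to_mat_inj [simp]: "to_mat s = to_mat t \<longleftrightarrow> s = t" by (metis of_mat_to_mat)

lemma det_to_mat: "det (to_mat s) = sdet s"
  by (simp add: det_2 to_mat_def sdet_Re_Im power2_eq_square algebra_simps)

lemma trace_to_mat: "trace (to_mat s) = 2 * htr s"
  by (simp add: trace_def sum_2 to_mat_def)

lemma sdet_of_mat: "sdet (of_mat A) = det A" using det_to_mat[of "of_mat A"] by simp

lemma of_mat_minus: "of_mat (- A) = - of_mat A" by (metis of_mat_to_mat to_mat_of_mat to_mat_minus)

lemma continuous_on_of_mat: "continuous_on S f \<Longrightarrow> continuous_on S (\<lambda>x. of_mat (f x))"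
  unfolding of_mat_def by (intro continuous_intros) auto

lemma continuous_on_to_mat: "continuous_on S f \<Longrightarrow> continuous_on S (\<lambda>x. to_mat (f x))"
proof -
  assume f: "continuous_on S f"
  have "to_mat s = Re (fst s) *\<^sub>R to_mat (1, 0) + Im (fst s) *\<^sub>R to_mat (\<i>, 0) + Re (snd s) *\<^sub>R to_mat (0, 1) + Im (snd s) *\<^sub>R to_mat (0, \<i>)" for s
    unfolding to_mat_scaleR[symmetric] to_mat_add[symmetric] to_mat_inj by (simp add: prod_eq_iff complex_eq_iff)
  then have "(\<lambda>x. to_mat (f x)) = (\<lambda>x. Re (fst (f x)) *\<^sub>R to_mat (1, 0) + Im (fst (f x)) *\<^sub>R to_mat (\<i>, 0) + Re (snd (f x)) *\<^sub>R to_mat (0, 1) + Im (snd (f x)) *\<^sub>R to_mat (0, \<i>))"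
    by blast
  then show ?thesis by (simp only:) (intro continuous_intros f)
qed

definition psl :: "cov \<Rightarrow> mat2 set" where "psl x = to_PSL (to_mat (toS x))"

lemma to_PSL_eq_iff: "to_PSL A = to_PSL B \<longleftrightarrow> A = B \<or> A = - B"
  by (auto simp: to_PSL_eq doubleton_eq_iff)

lemma psl_eq_iff: "psl x = psl y \<longleftrightarrow> (\<exists>k. x = central k \<odot> y)"
proof
  assume "psl x = psl y"
  then have "toS x = toS y \<or> toS x = - toS y" by (simp add: psl_def to_PSL_eq_iff to_mat_minus[symmetric])
  then show "\<exists>k. x = central k \<odot> y" by (rule toS_pm)
next
  assume "\<exists>k. x = central k \<odot> y"
  then obtain k where "x = central k \<odot> y" by blast
  then show "psl x = psl y" by (simp add: psl_def to_PSL_eq_iff toS_central to_mat_minus)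
qed

lemma psl_central [simp]: "psl (central k \<odot> x) = psl x" using psl_eq_iff by blast

lemma carrier_SL2R: "carrier SL2R = {A. det A = 1}" by (simp add: SL2R_def)

lemma psl_carrier [simp]: "psl x \<in> carrier PSL2R"
  by (simp add: psl_def carrier_PSL2R carrier_SL2R det_to_mat)

lemma psl_surj: assumes "X \<in> carrier PSL2R" shows "\<exists>x. X = psl x"
proof -
  obtain A where A: "det A = 1" "X = to_PSL A" using assms by (auto simp: carrier_PSL2R carrier_SL2R)
  have "toS (lift_near 0 (of_mat A)) = of_mat A" using A(1) by (intro toS_lift_near) (simp add: sdet_of_mat)
  then have "X = psl (lift_near 0 (of_mat A))" by (simp add: psl_def A(2))
  then show ?thesis by blast
qed

lemma psl_mul: "psl (x \<odot> y) = psl x \<otimes>\<^bsub>PSL2R\<^esub> psl y"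
proof -
  interpret normal "{mat 1, - mat 1}" SL2R by (rule normal_center)
  have "psl x \<otimes>\<^bsub>PSL2R\<^esub> psl y = to_PSL (to_mat (toS x) \<otimes>\<^bsub>SL2R\<^esub> to_mat (toS y))"
    unfolding PSL2R_def psl_def to_PSL_def
    using rcos_sum[of "to_mat (toS x)" "to_mat (toS y)"] by (simp add: FactGroup_def carrier_SL2R det_to_mat)
  then show ?thesis by (simp add: psl_def toS_mul to_mat_mul SL2R_def)
qed

lemma psl_one: "psl cid = \<one>\<^bsub>PSL2R\<^esub>"
proof -
  have "{mat 1, - mat 1} #>\<^bsub>SL2R\<^esub> mat 1 = {mat 1, - mat 1}" using to_PSL_eq[of "mat 1"] by (simp add: to_PSL_def)
  then show ?thesis by (simp add: psl_def PSL2R_def FactGroup_def to_PSL_def)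
qed

lemma psl_inv: "psl (cinv x) = inv\<^bsub>PSL2R\<^esub> (psl x)"
proof -
  interpret group PSL2R by (rule group_PSL2R)
  have "psl (cinv x) \<otimes>\<^bsub>PSL2R\<^esub> psl x = \<one>\<^bsub>PSL2R\<^esub>" by (simp add: psl_mul[symmetric] psl_one)
  then show ?thesis by (intro inv_equality[symmetric]) simp_all
qed

lemma psl_eq_one: "psl x = \<one>\<^bsub>PSL2R\<^esub> \<longleftrightarrow> (\<exists>k. x = central k)"
  using psl_eq_iff[of x cid] by (simp add: psl_one)

lemma topspace_PSL [simp]: "topspace PSL2R_topology = carrier PSL2R"
  using quotient_map_to_PSL by (auto simp: quotient_map_def carrier_PSL2R)

lemma continuous_map_psl:
  assumes "continuous_on S f" shows "continuous_map (top_of_set S) PSL2R_topology (\<lambda>t. psl (f t))"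
proof -
  have "continuous_map (top_of_set S) (top_of_set (carrier SL2R)) (\<lambda>t. to_mat (toS (f t)))"
    using assms by (auto simp: continuous_map_in_subtopology carrier_SL2R det_to_mat intro!: continuous_on_to_mat continuous_intros)
  from continuous_map_compose[OF this quotient_imp_continuous_map[OF quotient_map_to_PSL]]
  show ?thesis by (simp add: o_def psl_def)
qed

text \<open>Coordinates on \<open>PSL2R\<close> that are insensitive to the sign of the matrix.\<close>

definition sq_coords :: "sq \<Rightarrow> complex \<times> complex" where
  "sq_coords s = (fst s * fst s / complex_of_real ((cmod (fst s))\<^sup>2), snd s * cnj (fst s) / complex_of_real (cmod (fst s)))"

lemma sq_coords_minus: "sq_coords (- s) = sq_coords s" by (simp add: sq_coords_def)

lemma sq_coords_toS: "sq_coords (toS x) = (cis (2 * fst x), snd x)"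
proof -
  have 1: "cmod (fst (toS x)) = cc (snd x)" by (simp add: toS_def norm_mult)
  have c: "cc (snd x) \<noteq> 0" using cc_ge1[of "snd x"] by linarith
  have "fst (toS x) * fst (toS x) = complex_of_real ((cc (snd x))\<^sup>2) * cis (2 * fst x)"
    using cis_mult[of "fst x" "fst x"] by (simp add: toS_def power2_eq_square mult_2 algebra_simps flip: cis_mult)
  moreover have "snd (toS x) * cnj (fst (toS x)) = complex_of_real (cc (snd x)) * snd x * (cis (fst x) * cnj (cis (fst x)))"
    by (simp add: toS_def)
  moreover have "cis (fst x) * cnj (cis (fst x)) = 1" by (simp add: cis_cnj cis_mult)
  ultimately show ?thesis unfolding sq_coords_def 1 using c by simp
qed

definition psl_coords :: "mat2 set \<Rightarrow> complex \<times> complex" where "psl_coords X = sq_coords (of_mat (SOME A. A \<in> X))"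

lemma psl_coords_to_PSL: "psl_coords (to_PSL A) = sq_coords (of_mat A)"
proof -
  have "(SOME B. B \<in> to_PSL A) \<in> to_PSL A" by (rule someI_ex) (auto simp: to_PSL_eq)
  then have "(SOME B. B \<in> to_PSL A) = A \<or> (SOME B. B \<in> to_PSL A) = - A" by (simp add: to_PSL_eq)
  then show ?thesis unfolding psl_coords_def by (auto simp: of_mat_minus sq_coords_minus)
qed

lemma psl_coords_psl: "psl_coords (psl x) = (cis (2 * fst x), snd x)"
  by (simp add: psl_def psl_coords_to_PSL sq_coords_toS)

lemma continuous_map_psl_coords: "continuous_map PSL2R_topology euclidean psl_coords"
proof (rule continuous_compose_quotient_map[OF quotient_map_to_PSL])
  have "fst (of_mat A) \<noteq> 0" if "A \<in> carrier SL2R" for A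
    using that sdet1_nz[of "of_mat A"] by (simp add: carrier_SL2R sdet_of_mat)
  then have "continuous_on (carrier SL2R) (\<lambda>A. sq_coords (of_mat A))"
    unfolding sq_coords_def by (intro continuous_intros continuous_on_of_mat) auto
  then show "continuous_map (top_of_set (carrier SL2R)) euclidean (psl_coords \<circ> to_PSL)"
    by (simp add: o_def psl_coords_to_PSL)
qed

section \<open>Lifting paths and homotopies\<close>

lemma lift_exists:
  fixes S :: "'a::real_normed_vector set"
  assumes S: "convex S" "s0 \<in> S" and \<gamma>: "continuous_map (top_of_set S) PSL2R_topology \<gamma>" and x0: "psl x0 = \<gamma> s0"
  obtains l where "continuous_on S l" "\<forall>s\<in>S. psl (l s) = \<gamma> s" "l s0 = x0"
proof -
  have gc: "\<gamma> s \<in> carrier PSL2R" if "s \<in> S" for s using \<gamma> that by (auto simp: continuous_map_def)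
  have cu: "continuous_on S (\<lambda>s. psl_coords (\<gamma> s))"
    using continuous_map_compose[OF \<gamma> continuous_map_psl_coords] by (simp add: o_def)
  have nz: "fst (psl_coords (\<gamma> s)) \<noteq> 0" if s: "s \<in> S" for s
  proof -
    obtain y where "\<gamma> s = psl y" using psl_surj[OF gc[OF s]] by blast
    then show ?thesis by (simp add: psl_coords_psl)
  qed
  obtain f where f: "continuous_on S f" "\<And>s. s \<in> S \<Longrightarrow> fst (psl_coords (\<gamma> s)) = exp (f s)"
    using continuous_logarithm_on_contractible[of S "\<lambda>s. fst (psl_coords (\<gamma> s))"] cu nz convex_imp_contractible[OF S(1)]
    by (metis continuous_on_fst)
  define l where "l s = (Im (f s) / 2, snd (psl_coords (\<gamma> s)))" for s
  have cl: "continuous_on S l" unfolding l_def by (intro continuous_intros f cu) auto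
  have pl: "psl (l s) = \<gamma> s" if s: "s \<in> S" for s
  proof -
    obtain y where y: "\<gamma> s = psl y" using psl_surj[OF gc[OF s]] by blast
    have e: "exp (f s) = cis (2 * fst y)" using f(2)[OF s] by (simp add: y psl_coords_psl)
    then have "cmod (exp (f s)) = 1" by simp
    then have "Re (f s) = 0" by simp
    then have "exp (f s) = cis (Im (f s))" by (simp add: exp_eq_polar)
    then have "cis (Im (f s)) = cis (2 * fst y)" using e by simp
    then have "\<exists>k::int. Im (f s) = 2 * fst y + 2 * pi * k"
      using sin_cos_eq_iff[of "Im (f s)" "2 * fst y"] by (simp add: complex_eq_iff)
    then obtain k :: int where "Im (f s) = 2 * fst y + 2 * pi * k" by blast
    then have "l s = central k \<odot> y" by (simp add: l_def central_mul y psl_coords_psl)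
    then show ?thesis by (simp add: y)
  qed
  obtain k where k: "x0 = central k \<odot> l s0" using x0 pl[OF S(2)] psl_eq_iff by metis
  show ?thesis
    by (rule that[of "\<lambda>s. central k \<odot> l s"]) (use cl pl k in \<open>auto intro!: continuous_intros\<close>)
qed

lemma lift_unique_path:
  assumes S: "connected S" "s0 \<in> S" "s \<in> S" and l: "continuous_on S l" "continuous_on S l'"
    and psl: "\<And>t. t \<in> S \<Longrightarrow> psl (l t) = psl (l' t)" and s0: "l s0 = l' s0"
  shows "l s = l' s"
proof -
  have k: "\<exists>k. l t = central k \<odot> l' t" if "t \<in> S" for t using psl[OF that] by (simp add: psl_eq_iff)
  define f where "f t = fst (l t) - fst (l' t)" for t
  have f: "\<exists>k::int. f t = pi * k" if "t \<in> S" for t using k[OF that] by (auto simp: f_def central_mul)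
  have "loc_const S f"
    unfolding loc_const_def
  proof
    fix t assume t: "t \<in> S"
    have "(f \<longlongrightarrow> f t) (at t within S)" unfolding f_def using l t by (intro tendsto_intros) (auto simp: continuous_on_def)
    then have "\<forall>\<^sub>F u in at t within S. dist (f u) (f t) < pi" by (rule tendstoD) simp
    moreover have "\<forall>\<^sub>F u in at t within S. u \<in> S" by (auto simp: eventually_at_topological)
    ultimately show "\<forall>\<^sub>F u in at t within S. f u = f t"
    proof eventually_elim
      case (elim u)
      obtain j k :: int where jk: "f u = pi * j" "f t = pi * k" using f t elim(2) by meson
      have "pi * \<bar>real_of_int (j - k)\<bar> < pi * 1" using elim(1) unfolding jk dist_real_def
        by (simp add: right_diff_distrib[symmetric] abs_mult)
      then have "\<bar>real_of_int (j - k)\<bar> < 1" by (rule mult_left_less_imp_less) simp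
      then have "j = k" by linarith
      then show ?case by (simp add: jk)
    qed
  qed
  then have "f s = f s0" by (rule loc_const_connected[OF S(1) _ S(3,2)])
  then have "fst (l s) = fst (l' s)" using s0 by (simp add: f_def)
  moreover have "snd (l s) = snd (l' s)" using k[OF S(3)] by (auto simp: central_mul)
  ultimately show ?thesis by (rule prod_eqI)
qed

definition cover_cls :: "cov \<Rightarrow> (real \<Rightarrow> mat2 set) set" where
  "cover_cls x = {\<delta>. \<exists>l. continuous_on {0..1} l \<and> (\<forall>t\<in>{0..1}. psl (l t) = \<delta> t) \<and> l 0 = cid \<and> l 1 = x}"

lemma cover_cls_pathin: assumes "\<delta> \<in> cover_cls x" shows "pathin PSL2R_topology \<delta>" "\<delta> 0 = \<one>\<^bsub>PSL2R\<^esub>" "\<delta> 1 = psl x"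
proof -
  obtain l where l: "continuous_on {0..1::real} l" "\<forall>t\<in>{0..1}. psl (l t) = \<delta> t" "l 0 = cid" "l 1 = x"
    using assms by (auto simp: cover_cls_def)
  have "pathin PSL2R_topology (\<lambda>t. psl (l t))" unfolding pathin_def by (rule continuous_map_psl[OF l(1)])
  then show "pathin PSL2R_topology \<delta>" unfolding pathin_def by (rule continuous_map_eq) (use l in auto)
  show "\<delta> 0 = \<one>\<^bsub>PSL2R\<^esub>" using bspec[OF l(2), of 0] l(3) psl_one by simp
  show "\<delta> 1 = psl x" using bspec[OF l(2), of 1] l(4) by simp
qed

lemma pathin_lift:
  assumes "pathin PSL2R_topology \<gamma>" "\<gamma> 0 = \<one>\<^bsub>PSL2R\<^esub>"
  obtains l where "continuous_on {0..1} l" "\<forall>t\<in>{0..1}. psl (l t) = \<gamma> t" "l 0 = cid"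
  by (rule lift_exists[of "{0..1::real}" 0 \<gamma> cid]) (use assms in \<open>auto simp: pathin_def psl_one\<close>)

lemma path_class_eq_cover_cls:
  assumes l: "continuous_on {0..1} l" "\<And>t. t \<in> {0..1} \<Longrightarrow> psl (l t) = \<gamma> t" "l 0 = cid"
  shows "path_class PSL2R_topology \<gamma> = cover_cls (l 1)"
proof (intro equalityI subsetI)
  fix \<delta> assume "\<delta> \<in> path_class PSL2R_topology \<gamma>"
  then obtain h where h: "continuous_map (prod_topology (top_of_set {0..1}) (top_of_set {0..1})) PSL2R_topology h"
    "\<And>x. h (0::real, x::real) = \<gamma> x" "\<And>x. h (1, x) = \<delta> x" "\<And>t. t \<in> {0..1} \<Longrightarrow> h (t, 0) = \<gamma> 0 \<and> h (t, 1) = \<gamma> 1"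
    by (auto simp: path_class_def path_homotopic_def homotopic_with_def)
  let ?Q = "{0..1::real} \<times> {0..1::real}"
  have h1: "continuous_map (top_of_set ?Q) PSL2R_topology h"
    using h(1) by (simp add: subtopology_Times[symmetric])
  have conv: "convex ?Q" by (intro convex_Times) auto
  obtain H where H: "continuous_on ?Q H" "\<forall>s\<in>?Q. psl (H s) = h s" "H (0, 0) = cid"
    by (rule lift_exists[OF conv _ h1, of "(0, 0)" cid]) (use h(2)[of 0] l(2)[of 0] l(3) in auto)
  have cH: "continuous_on {0..1} (\<lambda>t. H (u t, v t))" if "continuous_on {0..1} u" "continuous_on {0..1} v"
    "\<And>t. t \<in> {0..1} \<Longrightarrow> u t \<in> {0..1} \<and> v t \<in> {0..1}" for u v :: "real \<Rightarrow> real"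
  proof (rule continuous_on_compose2[OF H(1)])
    show "continuous_on {0..1} (\<lambda>t. (u t, v t))" using that(1,2) by (rule continuous_on_Pair)
    show "(\<lambda>t. (u t, v t)) ` {0..1} \<subseteq> ?Q" using that(3) by blast
  qed
  have con: "connected {0..1::real}" by simp
  have Hl: "H (0, t) = l t" if "t \<in> {0..1}" for t
    by (rule lift_unique_path[of _ 0 _ "\<lambda>t. H (0, t)", OF con _ that cH l(1)]) (use H l h(2) in \<open>auto intro!: continuous_intros\<close>)
  have H0: "H (t, 0) = cid" if "t \<in> {0..1}" for t
    by (rule lift_unique_path[of _ 0 _ "\<lambda>t. H (t, 0)" "\<lambda>_. cid", OF con _ that cH]) (use H h(4) l(2)[of 0] l(3) in \<open>auto intro!: continuous_intros\<close>)
  have H1: "H (t, 1) = l 1" if "t \<in> {0..1}" for t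
    by (rule lift_unique_path[of _ 0 _ "\<lambda>t. H (t, 1)" "\<lambda>_. l 1", OF con _ that cH]) (use H h(4) l(2)[of 1] Hl in \<open>auto intro!: continuous_intros\<close>)
  show "\<delta> \<in> cover_cls (l 1)"
    unfolding cover_cls_def mem_Collect_eq
    by (rule exI[of _ "\<lambda>t. H (1, t)"]) (use H h(3) H0[of 1] H1[of 1] cH[of "\<lambda>_. 1" "\<lambda>t. t"] in \<open>auto intro!: continuous_intros\<close>)
next
  fix \<delta> assume "\<delta> \<in> cover_cls (l 1)"
  then obtain l' where l': "continuous_on {0..1} l'" "\<And>t. t \<in> {0..1} \<Longrightarrow> psl (l' t) = \<delta> t" "l' 0 = cid" "l' 1 = l 1"
    by (auto simp: cover_cls_def)
  define H where "H u = (1 - fst u) *\<^sub>R l (snd u) + fst u *\<^sub>R l' (snd u)" for u :: "real \<times> real"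
  define h where "h u = (if snd u \<in> {0..1} then psl (H u) else if fst u = 0 then \<gamma> (snd u) else \<delta> (snd u))" for u :: "real \<times> real"
  let ?Q = "{0..1::real} \<times> {0..1::real}"
  have "continuous_on ?Q H" unfolding H_def
    by (intro continuous_intros continuous_on_compose2[OF l(1)] continuous_on_compose2[OF l'(1)]) auto
  then have "continuous_map (top_of_set ?Q) PSL2R_topology (\<lambda>u. psl (H u))" by (rule continuous_map_psl)
  then have "continuous_map (top_of_set ?Q) PSL2R_topology h" by (rule continuous_map_eq) (auto simp: h_def)
  then have 1: "continuous_map (prod_topology (top_of_set {0..1}) (top_of_set {0..1})) PSL2R_topology h"
    by (simp add: subtopology_Times[symmetric])
  have e: "(1 - t) *\<^sub>R x + t *\<^sub>R x = x" for t :: real and x :: cov by (simp add: scaleR_left_diff_distrib)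
  have "H (0, x) = l x" "H (1, x) = l' x" for x by (simp_all add: H_def prod_eq_iff)
  then have 2: "h (0, x) = \<gamma> x" "h (1, x) = \<delta> x" for x using l(2) l'(2) by (auto simp: h_def)
  have "H (t, 0) = l 0" "H (t, 1) = l 1" for t using l'(3,4) l(3) e by (simp_all add: H_def)
  then have 3: "h (t, 0) = \<gamma> 0" "h (t, 1) = \<gamma> 1" for t using l(2) by (auto simp: h_def)
  show "\<delta> \<in> path_class PSL2R_topology \<gamma>"
    unfolding path_class_def path_homotopic_def homotopic_with_def mem_Collect_eq
    by (rule exI[of _ h]) (use 1 2 3 in auto)
qed

lemma segment_lift: "continuous_on {0..1::real} (\<lambda>t. t *\<^sub>R (x::cov))" "0 *\<^sub>R (x::cov) = cid" "1 *\<^sub>R x = x"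
  by (auto intro!: continuous_intros simp: prod_eq_iff)

lemma segment_in_cover_cls: "(\<lambda>t. psl (t *\<^sub>R x)) \<in> cover_cls x"
  unfolding cover_cls_def mem_Collect_eq by (rule exI[of _ "\<lambda>t. t *\<^sub>R x"]) (use segment_lift[of x] in auto)

lemma cover_cls_eq_iff [simp]: "cover_cls x = cover_cls y \<longleftrightarrow> x = y"
proof
  assume "cover_cls x = cover_cls y"
  then have "(\<lambda>t. psl (t *\<^sub>R x)) \<in> cover_cls y" using segment_in_cover_cls by blast
  then obtain l where l: "continuous_on {0..1::real} l" "\<forall>t\<in>{0..1}. psl (l t) = psl (t *\<^sub>R x)" "l 0 = cid" "l 1 = y"
    by (auto simp: cover_cls_def)
  have "l 1 = 1 *\<^sub>R x"
    by (rule lift_unique_path[of "{0..1::real}" 0 1 l "\<lambda>t. t *\<^sub>R x"]) (use l segment_lift[of x] in auto)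
  then show "x = y" using l(4) by simp
qed simp

lemma cover_carrier: "carrier SL2R_cover = range cover_cls"
proof (intro equalityI subsetI)
  fix X assume "X \<in> carrier SL2R_cover"
  then obtain \<gamma> where g: "pathin PSL2R_topology \<gamma>" "\<gamma> 0 = \<one>\<^bsub>PSL2R\<^esub>" "X = path_class PSL2R_topology \<gamma>"
    by (auto simp: SL2R_cover_def universal_cover_def)
  obtain l where "continuous_on {0..1} l" "\<forall>t\<in>{0..1}. psl (l t) = \<gamma> t" "l 0 = cid" by (rule pathin_lift[OF g(1,2)])
  then have "path_class PSL2R_topology \<gamma> = cover_cls (l 1)" by (intro path_class_eq_cover_cls) auto
  then show "X \<in> range cover_cls" using g(3) by blast
next
  fix X assume "X \<in> range cover_cls"
  then obtain x where x: "X = cover_cls x" by blast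
  let ?\<gamma> = "\<lambda>t. psl (t *\<^sub>R x)"
  have "path_class PSL2R_topology ?\<gamma> = cover_cls (1 *\<^sub>R x)"
    by (rule path_class_eq_cover_cls) (use segment_lift[of x] in auto)
  then have "X = path_class PSL2R_topology ?\<gamma>" by (simp add: x)
  then show "X \<in> carrier SL2R_cover"
    using cover_cls_pathin[OF segment_in_cover_cls[of x]] by (auto simp: SL2R_cover_def universal_cover_def)
qed

lemma cover_mult: "cover_cls x \<otimes>\<^bsub>SL2R_cover\<^esub> cover_cls y = cover_cls (x \<odot> y)"
proof -
  have "path_class PSL2R_topology (\<lambda>t. \<alpha> t \<otimes>\<^bsub>PSL2R\<^esub> \<beta> t) = cover_cls (x \<odot> y)" if \<alpha>\<beta>: "\<alpha> \<in> cover_cls x" "\<beta> \<in> cover_cls y" for \<alpha> \<beta>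
  proof -
    obtain l where l: "continuous_on {0..1::real} l" "\<forall>t\<in>{0..1}. psl (l t) = \<alpha> t" "l 0 = cid" "l 1 = x"
      using \<alpha>\<beta>(1) by (auto simp: cover_cls_def)
    obtain l' where l': "continuous_on {0..1::real} l'" "\<forall>t\<in>{0..1}. psl (l' t) = \<beta> t" "l' 0 = cid" "l' 1 = y"
      using \<alpha>\<beta>(2) by (auto simp: cover_cls_def)
    have "path_class PSL2R_topology (\<lambda>t. \<alpha> t \<otimes>\<^bsub>PSL2R\<^esub> \<beta> t) = cover_cls ((\<lambda>t. l t \<odot> l' t) 1)"
      by (rule path_class_eq_cover_cls) (use l l' in \<open>auto simp: psl_mul intro!: continuous_intros\<close>)
    then show ?thesis by (simp add: l l')
  qed
  moreover have "cover_cls x \<noteq> {}" "cover_cls y \<noteq> {}" using segment_in_cover_cls by blast+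
  ultimately have "(\<Union>\<alpha>\<in>cover_cls x. \<Union>\<beta>\<in>cover_cls y. path_class PSL2R_topology (\<lambda>t. \<alpha> t \<otimes>\<^bsub>PSL2R\<^esub> \<beta> t)) = cover_cls (x \<odot> y)"
    by auto
  then show ?thesis by (simp add: SL2R_cover_def universal_cover_def)
qed

lemma cover_one: "\<one>\<^bsub>SL2R_cover\<^esub> = cover_cls cid"
proof -
  have "path_class PSL2R_topology (\<lambda>t. \<one>\<^bsub>PSL2R\<^esub>) = cover_cls ((\<lambda>_. cid) (1::real))"
    by (rule path_class_eq_cover_cls) (auto simp: psl_one intro!: continuous_intros)
  then show ?thesis by (simp add: SL2R_cover_def universal_cover_def)
qed

lemma group_cover: "group SL2R_cover"
proof (rule groupI)
  fix x assume "x \<in> carrier SL2R_cover"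
  then obtain u where u: "x = cover_cls u" by (auto simp: cover_carrier)
  then show "\<one>\<^bsub>SL2R_cover\<^esub> \<otimes>\<^bsub>SL2R_cover\<^esub> x = x" by (simp add: cover_one cover_mult)
  show "\<exists>y\<in>carrier SL2R_cover. y \<otimes>\<^bsub>SL2R_cover\<^esub> x = \<one>\<^bsub>SL2R_cover\<^esub>"
    by (rule bexI[of _ "cover_cls (cinv u)"]) (simp_all add: u cover_one cover_mult cover_carrier)
qed (auto simp: cover_carrier cover_mult cover_one cmul_assoc)

lemma cover_inv: "inv\<^bsub>SL2R_cover\<^esub> (cover_cls x) = cover_cls (cinv x)"
proof -
  interpret group SL2R_cover by (rule group_cover)
  show ?thesis by (rule inv_equality) (simp_all add: cover_mult cover_one cover_carrier)
qed

lemma cover_commutator: "group_commutator SL2R_cover (cover_cls x) (cover_cls y) = cover_cls (ccomm x y)"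
  by (simp add: group_commutator_def cover_mult cover_inv ccomm_def)

lemma cover_list_prod: "group_list_prod SL2R_cover (map cover_cls xs) = cover_cls (wlist xs)"
  by (induction xs) (simp_all add: group_list_prod_def cover_one cover_mult)

lemma cover_pow: "cover_cls (central 1) [^]\<^bsub>SL2R_cover\<^esub> (n::int) = cover_cls (central n)"
proof -
  interpret group SL2R_cover by (rule group_cover)
  have nat: "cover_cls (central 1) [^]\<^bsub>SL2R_cover\<^esub> (m::nat) = cover_cls (central (int m))" for m
    by (induction m) (simp_all add: cover_one cover_mult central_add add.commute)
  show ?thesis
  proof (cases n rule: int_cases2)
    case (nonneg m)
    show ?thesis unfolding nonneg int_pow_int by (rule nat)
  next
    case (nonpos m)
    have "cover_cls (central 1) [^]\<^bsub>SL2R_cover\<^esub> (- int m) = inv\<^bsub>SL2R_cover\<^esub> (cover_cls (central 1) [^]\<^bsub>SL2R_cover\<^esub> m)"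
      by (rule int_pow_neg_int) (simp add: cover_carrier)
    also have "\<dots> = cover_cls (central (- int m))" unfolding nat cover_inv by simp
    finally show ?thesis by (simp only: nonpos)
  qed
qed

lemma cover_proj_cover_cls [simp]: "cover_proj (cover_cls x) = psl x"
  unfolding cover_proj_def
proof (rule the_equality)
  show "\<forall>\<gamma>\<in>cover_cls x. \<gamma> 1 = psl x" using cover_cls_pathin(3) by blast
  then show "a = psl x" if "\<forall>\<gamma>\<in>cover_cls x. \<gamma> 1 = a" for a using that segment_in_cover_cls[of x] by metis
qed

lemma is_cover_lift_iff: "is_cover_lift X Y \<longleftrightarrow> (\<exists>x. X = cover_cls x \<and> psl x = Y)"
  by (auto simp: is_cover_lift_def cover_carrier)

section \<open>The exponential map and parabolic elements\<close>

lemma mat2_scaleR_mult: "(r *\<^sub>R A) ** B = r *\<^sub>R (A ** B)" "A ** (r *\<^sub>R B) = r *\<^sub>R (A ** B)" for A B :: mat2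
  by (simp_all add: scalar_matrix_assoc matrix_scalar_ac)

lemma mat_power:
  fixes X :: mat2
  assumes X: "X ** X = r *\<^sub>R mat 1"
  shows "((**) (t *\<^sub>R X) ^^ k) (mat 1) = (r ^ (k div 2) * t ^ k) *\<^sub>R (if even k then mat 1 else X)"
proof (induction k)
  case (Suc k)
  have "((**) (t *\<^sub>R X) ^^ Suc k) (mat 1) = (t *\<^sub>R X) ** ((r ^ (k div 2) * t ^ k) *\<^sub>R (if even k then mat 1 else X))"
    using Suc.IH by simp
  also have "\<dots> = (t * (r ^ (k div 2) * t ^ k)) *\<^sub>R (X ** (if even k then mat 1 else X))"
    unfolding mat2_scaleR_mult by simp
  also have "\<dots> = (r ^ (Suc k div 2) * t ^ Suc k) *\<^sub>R (if even (Suc k) then mat 1 else X)"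
  proof (cases "even k")
    case True
    then have "Suc k div 2 = k div 2" by simp
    then show ?thesis using True by (simp add: mult_ac)
  next
    case False
    then have "Suc k div 2 = Suc (k div 2)" by (auto elim: oddE)
    then show ?thesis using False by (simp add: X mult_ac)
  qed
  finally show ?case .
qed simp

lemma mat_exp_sums:
  assumes X: "X ** X = r *\<^sub>R mat 1"
    and c: "(\<lambda>k. if even k then r ^ (k div 2) * t ^ k / fact k else 0) sums c"
    and d: "(\<lambda>k. if even k then 0 else r ^ (k div 2) * t ^ k / fact k) sums d"
  shows "mat_exp (t *\<^sub>R X) = c *\<^sub>R mat 1 + d *\<^sub>R X"
proof -
  have "(\<lambda>k. (((**) (t *\<^sub>R X) ^^ k) (mat 1)) /\<^sub>R fact k) =
    (\<lambda>k. (if even k then r ^ (k div 2) * t ^ k / fact k else 0) *\<^sub>R mat 1 + (if even k then 0 else r ^ (k div 2) * t ^ k / fact k) *\<^sub>R X)"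
    unfolding mat_power[OF X] by (rule ext) (simp add: field_simps)
  then have "(\<lambda>k. (((**) (t *\<^sub>R X) ^^ k) (mat 1)) /\<^sub>R fact k) sums (c *\<^sub>R mat 1 + d *\<^sub>R X)"
    using sums_add[OF sums_scaleR_left[OF c, of "mat 1"] sums_scaleR_left[OF d, of X]] by simp
  then show ?thesis unfolding mat_exp_def by (rule sums_unique[symmetric])
qed

lemma mat_exp_nilpotent:
  assumes X: "X ** X = 0" shows "mat_exp (t *\<^sub>R X) = mat 1 + t *\<^sub>R X"
proof -
  have "(\<lambda>k. if even k then 0 ^ (k div 2) * t ^ k / fact k else 0) sums (\<Sum>k\<in>{0}. if even k then 0 ^ (k div 2) * t ^ k / fact k else 0)"
    by (rule sums_finite) (auto elim!: evenE)
  moreover have "(\<lambda>k. if even k then 0 else 0 ^ (k div 2) * t ^ k / fact k) sums (\<Sum>k\<in>{1}. if even k then 0 else 0 ^ (k div 2) * t ^ k / fact k)"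
    by (rule sums_finite) (auto elim!: oddE)
  ultimately have "mat_exp (t *\<^sub>R X) = 1 *\<^sub>R mat 1 + t *\<^sub>R X" by (intro mat_exp_sums[of X 0]) (simp_all add: X)
  then show ?thesis by simp
qed

lemma mat_exp_elliptic:
  assumes X: "X ** X = - (w\<^sup>2) *\<^sub>R mat 1" and w: "w \<noteq> 0"
  shows "mat_exp (t *\<^sub>R X) = cos (w * t) *\<^sub>R mat 1 + (sin (w * t) / w) *\<^sub>R X"
proof (rule mat_exp_sums[OF X])
  have e: "(- (w\<^sup>2)) ^ m = (- 1) ^ m * w ^ (2 * m)" for m by (simp add: power_mult power_minus[of "w\<^sup>2"])
  have "(\<lambda>k. if even k then (- (w\<^sup>2)) ^ (k div 2) * t ^ k / fact k else 0) = (\<lambda>k. cos_coeff k *\<^sub>R (w * t) ^ k)"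
    by (rule ext) (auto simp: cos_coeff_def e power_mult_distrib elim!: evenE)
  then show "(\<lambda>k. if even k then (- (w\<^sup>2)) ^ (k div 2) * t ^ k / fact k else 0) sums cos (w * t)"
    using cos_converges[of "w * t"] by simp
  have "(\<lambda>k. if even k then 0 else (- (w\<^sup>2)) ^ (k div 2) * t ^ k / fact k) = (\<lambda>k. (sin_coeff k *\<^sub>R (w * t) ^ k) / w)"
    using w by (intro ext) (auto simp: sin_coeff_def e power_mult_distrib elim!: oddE)
  then show "(\<lambda>k. if even k then 0 else (- (w\<^sup>2)) ^ (k div 2) * t ^ k / fact k) sums (sin (w * t) / w)"
    using sums_divide[OF sin_converges[of "w * t"], of w] by simp
qed

lemma mat_exp_hyperbolic:
  assumes X: "X ** X = (w\<^sup>2) *\<^sub>R mat 1" and w: "w \<noteq> 0"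
  shows "mat_exp (t *\<^sub>R X) = cosh (w * t) *\<^sub>R mat 1 + (sinh (w * t) / w) *\<^sub>R X"
proof (rule mat_exp_sums[OF X])
  have e: "(w\<^sup>2) ^ m = w ^ (2 * m)" for m by (simp add: power_mult)
  have "(\<lambda>k. if even k then (w\<^sup>2) ^ (k div 2) * t ^ k / fact k else 0) = (\<lambda>k. if even k then (w * t) ^ k /\<^sub>R fact k else 0)"
    by (rule ext) (auto simp: e power_mult_distrib field_simps elim!: evenE)
  then show "(\<lambda>k. if even k then (w\<^sup>2) ^ (k div 2) * t ^ k / fact k else 0) sums cosh (w * t)"
    using cosh_converges[of "w * t"] by simp
  have "(\<lambda>k. if even k then 0 else (w\<^sup>2) ^ (k div 2) * t ^ k / fact k) = (\<lambda>k. (if even k then 0 else (w * t) ^ k /\<^sub>R fact k) / w)"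
    using w by (intro ext) (auto simp: e power_mult_distrib field_simps elim!: oddE)
  then show "(\<lambda>k. if even k then 0 else (w\<^sup>2) ^ (k div 2) * t ^ k / fact k) sums (sinh (w * t) / w)"
    using sums_divide[OF sinh_converges[of "w * t"], of w] by simp
qed

lemma trace_zero_square:
  assumes "X \<in> sl2" shows "X ** X = (- det X) *\<^sub>R mat 1"
proof -
  have "X$2$2 = - X$1$1" using assms by (simp add: sl2_def trace_def sum_2)
  then show ?thesis
    by (intro mat2_eqI) (simp_all add: matrix_matrix_mult_def sum_2 det_2 mat_one_nth)
qed

lemma mat_exp_closed_form:
  assumes "X \<in> sl2"
  obtains c d :: "real \<Rightarrow> real" where "\<And>t. mat_exp (t *\<^sub>R X) = c t *\<^sub>R mat 1 + d t *\<^sub>R X"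
    "continuous_on UNIV c" "continuous_on UNIV d" "c 0 = 1" "d 0 = 0" "\<And>t. (c t)\<^sup>2 + det X * (d t)\<^sup>2 = 1"
proof -
  note sq = trace_zero_square[OF assms]
  consider "det X = 0" | "det X > 0" | "det X < 0" by linarith
  then show ?thesis
  proof cases
    case 1
    then have "X ** X = 0" using sq by simp
    then show ?thesis using 1 by (intro that[of "\<lambda>_. 1" "\<lambda>t. t"]) (simp_all add: mat_exp_nilpotent)
  next
    case 2
    define w where "w = sqrt (det X)"
    have w: "w \<noteq> 0" "det X = w\<^sup>2" using 2 by (auto simp: w_def)
    have "X ** X = - (w\<^sup>2) *\<^sub>R mat 1" using sq w(2) by simp
    note e = mat_exp_elliptic[OF this w(1)]
    show ?thesis
      by (rule that[of "\<lambda>t. cos (w * t)" "\<lambda>t. sin (w * t) / w"])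
        (use w e in \<open>auto intro!: continuous_intros simp: power_divide\<close>)
  next
    case 3
    define w where "w = sqrt (- det X)"
    have w: "w \<noteq> 0" "det X = - (w\<^sup>2)" using 3 by (auto simp: w_def)
    have "X ** X = (w\<^sup>2) *\<^sub>R mat 1" using sq w(2) by simp
    note e = mat_exp_hyperbolic[OF this w(1)]
    show ?thesis
      by (rule that[of "\<lambda>t. cosh (w * t)" "\<lambda>t. sinh (w * t) / w"])
        (use w e in \<open>auto intro!: continuous_intros simp: power_divide cosh_square_eq\<close>)
  qed
qed

lemma pathin_to_PSL:
  assumes f: "continuous_on {0..1} f" and d: "\<And>t. det (f t) = 1"
  shows "pathin PSL2R_topology (\<lambda>t. to_PSL (f t))"
proof -
  have "continuous_map (top_of_set {0..1}) (top_of_set (carrier SL2R)) f"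
    using assms by (auto simp: continuous_map_in_subtopology carrier_SL2R)
  from continuous_map_compose[OF this quotient_imp_continuous_map[OF quotient_map_to_PSL]]
  show ?thesis by (simp add: o_def pathin_def)
qed

lemma cover_exp_cover_cls:
  assumes "X \<in> sl2" obtains x where "cover_exp X = cover_cls x" "psl x = to_PSL (mat_exp X)"
proof -
  obtain c d :: "real \<Rightarrow> real" where cd: "\<And>t. mat_exp (t *\<^sub>R X) = c t *\<^sub>R mat 1 + d t *\<^sub>R X"
    "continuous_on UNIV c" "continuous_on UNIV d" "c 0 = 1" "d 0 = 0" "\<And>t. (c t)\<^sup>2 + det X * (d t)\<^sup>2 = 1"
    using mat_exp_closed_form[OF assms] by blast
  let ?f = "\<lambda>t. c t *\<^sub>R mat 1 + d t *\<^sub>R X"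
  have X: "X$2$2 = - X$1$1" using assms by (simp add: sl2_def trace_def sum_2)
  have "det (?f t) = (c t)\<^sup>2 + det X * (d t)\<^sup>2" for t
    by (simp add: det_2 mat_one_nth X power2_eq_square algebra_simps)
  then have det: "det (?f t) = 1" for t using cd(6)[of t] by simp
  have c: "continuous_on {0..1} ?f"
    by (intro continuous_intros continuous_on_subset[OF cd(2)] continuous_on_subset[OF cd(3)]) auto
  have p: "pathin PSL2R_topology (\<lambda>t. to_PSL (mat_exp (t *\<^sub>R X)))" unfolding cd(1) by (rule pathin_to_PSL[OF c det])
  have "mat_exp (0 *\<^sub>R X) = mat 1" unfolding cd(1) cd(4,5) by simp
  then have 0: "to_PSL (mat_exp (0 *\<^sub>R X)) = \<one>\<^bsub>PSL2R\<^esub>" unfolding psl_one[symmetric] psl_def by simp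
  obtain l where l: "continuous_on {0..1} l" "\<forall>t\<in>{0..1}. psl (l t) = to_PSL (mat_exp (t *\<^sub>R X))" "l 0 = cid"
    by (rule pathin_lift[OF p 0])
  have "cover_exp X = cover_cls (l 1)" unfolding cover_exp_def by (rule path_class_eq_cover_cls) (use l in auto)
  moreover have "psl (l 1) = to_PSL (mat_exp X)" using bspec[OF l(2), of 1] by simp
  ultimately show ?thesis by (rule that)
qed

lemma parabolic_psl: assumes "x \<in> Parabolics s" "s = 1 \<or> s = - 1" shows "PSL_parabolic (psl x)"
proof -
  obtain \<sigma> \<phi> where x: "x = ray \<sigma> \<phi>" "of_int s * \<sigma> > 0" by (rule Parabolics_ray[OF assms])
  then have s: "toS x = (Complex 1 \<sigma>, complex_of_real \<sigma> * cis \<phi>)" "\<sigma> \<noteq> 0" by (auto simp: toS_ray)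
  have "psl x \<noteq> \<one>\<^bsub>PSL2R\<^esub>"
  proof
    assume "psl x = \<one>\<^bsub>PSL2R\<^esub>"
    then obtain k where "x = central k" by (auto simp: psl_eq_one)
    then have "toS x = sone \<or> toS x = - sone" using toS_central[of k cid] by auto
    then show False using s by (auto simp: complex_eq_iff)
  qed
  moreover have "to_mat (toS x) \<in> psl x" by (simp add: psl_def to_PSL_eq)
  moreover have "trace (to_mat (toS x)) = 2" by (simp add: trace_to_mat s)
  ultimately show ?thesis unfolding PSL_parabolic_def by (metis abs_numeral psl_carrier)
qed

lemma parabolic_lift:
  assumes "PSL_parabolic Y" shows "\<exists>s x. (s = 1 \<or> s = - 1) \<and> x \<in> Parabolics s \<and> psl x = Y"
proof -
  obtain A where A: "Y \<in> carrier PSL2R" "Y \<noteq> \<one>\<^bsub>PSL2R\<^esub>" "A \<in> Y" "\<bar>trace A\<bar> = 2" using assms by (auto simp: PSL_parabolic_def)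
  obtain y where y: "Y = psl y" using psl_surj[OF A(1)] by blast
  have "A = to_mat (toS y) \<or> A = to_mat (- toS y)" using A(3) by (simp add: y psl_def to_PSL_eq to_mat_minus)
  then have "htr (toS y) = 1 \<or> htr (- toS y) = 1" using A(4) by (auto simp: trace_to_mat)
  then obtain t where t: "t = toS y \<or> t = - toS y" "htr t = 1" by metis
  have "sdet t = 1" using t(1) using sdet_toS[of y] by (auto simp del: sdet_toS simp: sdet_def)
  define x where "x = lift_near 0 t"
  have tx: "toS x = t" unfolding x_def by (rule toS_lift_near) fact
  then have px: "psl x = Y" using t(1) by (auto simp: y psl_def to_PSL_eq_iff to_mat_minus)
  have "\<bar>fst x\<bar> \<le> pi" using Arg_bounded[of "fst t"] by (simp add: x_def lift_near_def abs_le_iff)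
  then have b: "\<bar>fst x\<bar> = arctan (cmod (snd x))" using htr_gt1_iff(2)[of x] t(2) tx by simp
  have "snd x \<noteq> 0"
  proof
    assume "snd x = 0"
    then have "x = cid" using b by (simp add: prod_eq_iff)
    then show False using px A(2) psl_one by simp
  qed
  then have "x \<in> Parabolics (if fst x \<ge> 0 then 1 else - 1)" using b by (auto simp: Parabolics_iff)
  then show ?thesis using px by (intro exI[of _ "if fst x \<ge> 0 then 1 else - 1"] exI[of _ x]) auto
qed

lemma nilpotent_if_parabolic:
  assumes X: "X \<in> sl2" and p: "PSL_parabolic (to_PSL (mat_exp X))"
  shows "mat_exp X = mat 1 + X"
proof (cases "det X = 0")
  case True
  then have "X ** X = 0" using trace_zero_square[OF X] by simp
  then show ?thesis using mat_exp_nilpotent[of X 1] by simp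
next
  case False
  obtain c d :: "real \<Rightarrow> real" where cd: "\<And>t. mat_exp (t *\<^sub>R X) = c t *\<^sub>R mat 1 + d t *\<^sub>R X" "\<And>t. (c t)\<^sup>2 + det X * (d t)\<^sup>2 = 1"
    using mat_exp_closed_form[OF assms(1)] by metis
  have e: "mat_exp X = c 1 *\<^sub>R mat 1 + d 1 *\<^sub>R X" using cd(1)[of 1] by simp
  have X2: "X$1$1 + X$2$2 = 0" using X by (simp add: sl2_def trace_def sum_2)
  have "trace (mat_exp X) = 2 * c 1 + d 1 * (X$1$1 + X$2$2)" unfolding e by (simp add: trace_def sum_2 mat_one_nth algebra_simps)
  then have tr: "trace (mat_exp X) = 2 * c 1" using X2 by simp
  obtain A where A: "A \<in> to_PSL (mat_exp X)" "\<bar>trace A\<bar> = 2" using p by (auto simp: PSL_parabolic_def)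
  have "trace (- B) = - trace B" for B :: mat2 by (simp add: trace_def sum_2)
  then have "\<bar>c 1\<bar> = 1" using A tr by (auto simp: to_PSL_eq)
  then have "(c 1)\<^sup>2 = 1" by (metis power2_abs power_one)
  then have "d 1 = 0" using cd(2)[of 1] False by simp
  then have "mat_exp X = mat 1 \<or> mat_exp X = - mat 1" using e \<open>\<bar>c 1\<bar> = 1\<close> by (auto simp: abs_if split: if_splits)
  then have "to_PSL (mat_exp X) = psl cid" by (auto simp: psl_def to_PSL_eq_iff)
  then show ?thesis using p by (auto simp: PSL_parabolic_def psl_one)
qed

lemma exp_lift_psl: assumes "x \<in> Parabolics s" "s = 1 \<or> s = - 1" shows "exp_lift (psl x) = cover_cls x"
proof -
  obtain \<sigma> \<phi> where x: "x = ray \<sigma> \<phi>" "of_int s * \<sigma> > 0" by (rule Parabolics_ray[OF assms])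
  let ?N = "to_mat (Complex 0 \<sigma>, complex_of_real \<sigma> * cis \<phi>)"
  have d: "det (t *\<^sub>R ?N) = 0" for t
    unfolding to_mat_scaleR[symmetric] det_to_mat by (simp add: sdet_def norm_mult complex_norm power_mult_distrib)
  have sl: "t *\<^sub>R ?N \<in> sl2" for t unfolding to_mat_scaleR[symmetric] by (simp add: sl2_def trace_to_mat)
  have "t *\<^sub>R ?N ** (t *\<^sub>R ?N) = 0" for t using trace_zero_square[OF sl[of t]] d[of t] by simp
  from mat_exp_nilpotent[OF this, of 1] have e: "mat_exp (t *\<^sub>R ?N) = mat 1 + t *\<^sub>R ?N" for t by simp
  have "toS (ray (t * \<sigma>) \<phi>) = sone + t *\<^sub>R (Complex 0 \<sigma>, complex_of_real \<sigma> * cis \<phi>)" for t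
    by (simp add: toS_ray complex_eq_iff)
  then have r: "psl (ray (t * \<sigma>) \<phi>) = to_PSL (mat_exp (t *\<^sub>R ?N))" for t
    by (simp only: psl_def e to_mat_add to_mat_scaleR to_mat_one)
  have "path_class PSL2R_topology (\<lambda>t. to_PSL (mat_exp (t *\<^sub>R ?N))) = cover_cls (ray (1 * \<sigma>) \<phi>)"
    by (rule path_class_eq_cover_cls) (auto intro!: continuous_intros simp: r)
  then have ex: "cover_exp ?N = cover_cls x" by (simp add: cover_exp_def x)
  show ?thesis
    unfolding exp_lift_def
  proof (rule the_equality)
    show "cover_cls x \<in> cover_exp ` sl2 \<and> cover_proj (cover_cls x) = psl x" using ex sl[of 1] by (metis cover_proj_cover_cls imageI scaleR_one)
    fix Z assume Z: "Z \<in> cover_exp ` sl2 \<and> cover_proj Z = psl x"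
    then obtain X where X: "X \<in> sl2" "Z = cover_exp X" by blast
    obtain y where y: "cover_exp X = cover_cls y" "psl y = to_PSL (mat_exp X)" by (rule cover_exp_cover_cls[OF X(1)])
    have px: "psl x = to_PSL (mat_exp X)" using Z X y by simp
    then have "mat_exp X = mat 1 + X" using nilpotent_if_parabolic[OF X(1)] parabolic_psl[OF assms] by simp
    moreover have "psl x = to_PSL (mat 1 + ?N)" using r[of 1] e[of 1] x(1) by simp
    ultimately have "mat 1 + X = mat 1 + ?N \<or> mat 1 + X = - (mat 1 + ?N)" using px by (metis to_PSL_eq_iff)
    moreover have "mat 1 + X \<noteq> - (mat 1 + ?N)"
    proof
      assume "mat 1 + X = - (mat 1 + ?N)"
      then have "trace (mat 1 + X) = trace (- (mat 1 + ?N))" by (rule arg_cong)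
      then show False using X(1) sl[of 1] by (simp add: sl2_def trace_def sum_2 mat_one_nth)
    qed
    ultimately have "X = ?N" by simp
    then show "Z = cover_cls x" using X ex by simp
  qed
qed

lemma cover_z_eq: "cover_z = cover_cls (central 1)"
proof -
  let ?X = "mat2 0 pi (- pi) 0"
  have X: "?X = to_mat (Complex 0 pi, 0)" by (simp add: to_mat_def)
  have "?X \<in> sl2" "det ?X = pi\<^sup>2" by (simp_all add: sl2_def trace_def sum_2 det_2 power2_eq_square)
  then have "?X ** ?X = - (pi\<^sup>2) *\<^sub>R mat 1" using trace_zero_square[of ?X] by simp
  then have e: "mat_exp (t *\<^sub>R ?X) = cos (pi * t) *\<^sub>R mat 1 + (sin (pi * t) / pi) *\<^sub>R ?X" for t
    by (rule mat_exp_elliptic) simp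
  have "toS (pi * t, 0) = cos (pi * t) *\<^sub>R sone + (sin (pi * t) / pi) *\<^sub>R (Complex 0 pi, 0)" for t
    by (simp add: toS_def complex_eq_iff)
  then have p: "psl (pi * t, 0) = to_PSL (mat_exp (t *\<^sub>R ?X))" for t
    unfolding e by (simp only: psl_def to_mat_add to_mat_scaleR to_mat_one X)
  have "path_class PSL2R_topology (\<lambda>t. to_PSL (mat_exp (t *\<^sub>R ?X))) = cover_cls (pi * 1, 0)"
    by (rule path_class_eq_cover_cls) (auto intro!: continuous_intros simp: p)
  then show ?thesis by (simp add: cover_z_def cover_exp_def central_def)
qed

lemma PSL_conjI:
  assumes "toS g \<star> toS x = toS y \<star> toS g" shows "PSL_conj (psl x) (psl y)"
proof -
  have e: "psl (g \<odot> x) = psl (y \<odot> g)" using assms by (simp add: psl_def toS_mul)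
  have "psl x = psl (cinv g \<odot> (g \<odot> x))" by simp
  also have "\<dots> = psl (cinv g) \<otimes>\<^bsub>PSL2R\<^esub> psl (y \<odot> g)" by (simp only: psl_mul[of "cinv g"] e)
  also have "\<dots> = psl (cinv g \<odot> y \<odot> cinv (cinv g))" unfolding psl_mul[symmetric] by (simp add: cmul_assoc)
  also have "\<dots> = psl (cinv g) \<otimes>\<^bsub>PSL2R\<^esub> psl y \<otimes>\<^bsub>PSL2R\<^esub> inv\<^bsub>PSL2R\<^esub> (psl (cinv g))"
    unfolding psl_mul psl_inv[of "cinv g"] ..
  finally show ?thesis unfolding PSL_conj_def using psl_carrier by blast
qed

lemma to_PSL_standard: "to_PSL (mat2 1 (2 * \<sigma>) 0 1) = psl (ray \<sigma> (- pi / 2))"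
proof -
  have "toS (ray \<sigma> (- pi / 2)) = (Complex 1 \<sigma>, Complex 0 (- \<sigma>))" by (simp add: toS_ray complex_eq_iff)
  then show ?thesis by (simp add: psl_def to_mat_def)
qed

lemma Parabolics_conj_standard:
  assumes "x \<in> Parabolics s" and s: "s = 1 \<or> s = - 1" shows "PSL_conj (psl x) (psl (ray (of_int s / 2) (- pi / 2)))"
proof -
  obtain \<sigma> \<phi> where x: "x = ray \<sigma> \<phi>" "of_int s * \<sigma> > 0" by (rule Parabolics_ray[OF assms])
  define r where "r = \<bar>\<sigma>\<bar>"
  have r: "r > 0" "\<sigma> = of_int s * r" using x(2) s by (auto simp: r_def)
  define u where "u = 1 / (2 * r)"
  define C where "C = (u + 1 / u) / 2"
  define S where "S = of_int s * (u - 1 / u) / 2"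
  have u: "u > 0" "r * u = 1 / 2" using r by (simp_all add: u_def)
  have CS: "C\<^sup>2 - S\<^sup>2 = 1" "C \<ge> 1"
  proof -
    have "C\<^sup>2 - S\<^sup>2 = ((u + 1 / u) / 2)\<^sup>2 - ((u - 1 / u) / 2)\<^sup>2" using s by (auto simp: C_def S_def power2_eq_square)
    also have "\<dots> = 1" using u by (simp add: power2_eq_square field_simps)
    finally show "C\<^sup>2 - S\<^sup>2 = 1" .
    have "u + 1 / u - 2 = (u - 1)\<^sup>2 / u" using u by (simp add: power2_eq_square field_simps)
    also have "\<dots> \<ge> 0" using u by simp
    finally show "C \<ge> 1" by (simp add: C_def)
  qed
  have Cu: "C + of_int s * S = u" "of_int s * C + S = of_int s * u" using s u by (auto simp: C_def S_def field_simps)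
  have "\<sigma> * C + r * S = r * (of_int s * C + S)" "\<sigma> * S + r * C = r * (C + of_int s * S)" by (simp_all add: r(2) algebra_simps)
  then have n: "\<sigma> * C + r * S = of_int s / 2" "\<sigma> * S + r * C = 1 / 2" unfolding Cu using u(2) by (simp_all add: mult.left_commute)
  have "toS x = (Complex 1 \<sigma>, complex_of_real \<sigma> * cis \<phi>)" by (simp add: x toS_ray)
  moreover have "cmod (complex_of_real r) = cmod (complex_of_real \<sigma> * cis \<phi>)" by (simp add: norm_mult r_def)
  ultimately obtain g1 where g1: "toS g1 \<star> toS x = (Complex 1 \<sigma>, complex_of_real r) \<star> toS g1"
    using rotate_conj by metis
  obtain g2 where g2: "toS g2 \<star> (Complex 1 \<sigma>, complex_of_real r) = (Complex 1 (of_int s / 2), complex_of_real (1 / 2)) \<star> toS g2"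
    using boost_conj[OF CS, of 1 \<sigma> r] unfolding n by blast
  have "cmod (complex_of_real (of_int s / 2) * cis (- pi / 2)) = cmod (complex_of_real (1 / 2))" using s by (auto simp: norm_mult)
  then obtain g3 where g3: "toS g3 \<star> (Complex 1 (of_int s / 2), complex_of_real (1 / 2)) = toS (ray (of_int s / 2) (- pi / 2)) \<star> toS g3"
    unfolding toS_ray using rotate_conj by metis
  show ?thesis by (rule PSL_conjI[OF conj_trans[OF conj_trans[OF g1 g2] g3]])
qed

lemma Parabolics_one_not_conj:
  assumes x: "x \<in> Parabolics (- 1)" and y: "y \<in> Parabolics 1" shows "\<not> PSL_conj (psl x) (psl y)"
proof
  assume "PSL_conj (psl x) (psl y)"
  then obtain G where G: "G \<in> carrier PSL2R" "psl x = G \<otimes>\<^bsub>PSL2R\<^esub> psl y \<otimes>\<^bsub>PSL2R\<^esub> inv\<^bsub>PSL2R\<^esub> G" by (auto simp: PSL_conj_def)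
  obtain g where "G = psl g" using psl_surj[OF G(1)] by blast
  then have "psl x = psl (g \<odot> y \<odot> cinv g)" using G(2) by (simp add: psl_mul psl_inv)
  then obtain k where k: "x = central k \<odot> (g \<odot> y \<odot> cinv g)" by (auto simp: psl_eq_iff)
  have hx: "htr (toS x) = 1" "htr (toS y) = 1" using x y Parabolics_iff_htr by auto
  have "htr (toS (g \<odot> y \<odot> cinv g)) = htr (toS y)" by (rule htr_cov_conj)
  then have "even k" using hx k by (auto simp: toS_central split: if_splits)
  have my: "min_shift y = 0" "max_shift y > 0" "max_shift y < pi" using y arctan_norm_bounds(1,2)[of "snd y"] by (auto simp: Parabolics_iff min_shift_def max_shift_def)
  have min_shift: "min_shift x > - pi" "min_shift x \<le> 0" "max_shift x = 0" using x arctan_norm_bounds(1,2)[of "snd x"] by (auto simp: Parabolics_iff min_shift_def max_shift_def)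
  have c: "min_shift (g \<odot> y \<odot> cinv g) < pi" "\<not> min_shift (g \<odot> y \<odot> cinv g) < 0" "max_shift (g \<odot> y \<odot> cinv g) > 0"
    using min_shift_conj[where g = g and x = y and k = 1] min_shift_conj[where g = g and x = y and k = 0] max_shift_conj[where g = g and x = y and k = 0] my by auto
  have e: "min_shift x = min_shift (g \<odot> y \<odot> cinv g) + pi * k" "max_shift x = max_shift (g \<odot> y \<odot> cinv g) + pi * k" unfolding k by (simp_all add: max_shift_central)
  have "pi * real_of_int k > pi * (- 2)" using c e min_shift by (simp add: algebra_simps)
  then have "real_of_int k > - 2" by (rule mult_left_less_imp_less) simp
  then have "k > - 2" by linarith
  moreover have "pi * real_of_int k < 0" using c e min_shift by linarith
  then have "k < 0" by (simp add: mult_less_0_iff)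
  ultimately have "k = - 1" by linarith
  then show False using \<open>even k\<close> by simp
qed

lemma parabolic_sign_psl: assumes "x \<in> Parabolics s" and s: "s = 1 \<or> s = - 1" shows "parabolic_sign (psl x) = s"
proof -
  note c = Parabolics_conj_standard[OF assms]
  have st: "to_PSL (mat2 1 1 0 1) = psl (ray (1 / 2) (- pi / 2))" "to_PSL (mat2 1 (- 1) 0 1) = psl (ray (- 1 / 2) (- pi / 2))"
    using to_PSL_standard[of "1 / 2"] to_PSL_standard[of "- 1 / 2"] by simp_all
  show ?thesis
  proof (cases "s = 1")
    case True
    then show ?thesis using c by (simp add: parabolic_sign_def PSL_pos_parabolic_def st)
  next
    case False
    then have m: "s = - 1" using s by simp
    have "ray (1 / 2) (- pi / 2) \<in> Parabolics 1" by (rule ray_Parabolics) auto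
    then have "\<not> PSL_pos_parabolic (psl x)" unfolding PSL_pos_parabolic_def st using Parabolics_one_not_conj assms(1) m by simp
    moreover have "PSL_neg_parabolic (psl x)" using c unfolding PSL_neg_parabolic_def st m by simp
    ultimately show ?thesis by (simp add: parabolic_sign_def m)
  qed
qed

section \<open>From lifted tuples to representations\<close>

definition eval_word :: "(surface_gen \<Rightarrow> cov) \<Rightarrow> surface_gen word \<Rightarrow> cov" where
  "eval_word \<rho> w = wlist (map (\<lambda>(x, b). if b then \<rho> x else cinv (\<rho> x)) w)"

lemma eval_word_simps [simp]: "eval_word \<rho> [] = cid" "eval_word \<rho> ((x, b) # w) = (if b then \<rho> x else cinv (\<rho> x)) \<odot> eval_word \<rho> w"
  by (simp_all add: eval_word_def)

lemma eval_word_append: "eval_word \<rho> (u @ v) = eval_word \<rho> u \<odot> eval_word \<rho> v" by (simp add: eval_word_def wlist_append)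

lemma eval_word_relator: "eval_word \<rho> (surface_relator g p) = lprod g p \<rho>"
proof -
  have "eval_word \<rho> (map (\<lambda>i. (Gen_c i, True)) is) = wlist (map (\<lambda>i. \<rho> (Gen_c i)) is)" for "is"
    by (induction "is") simp_all
  moreover have "eval_word \<rho> (concat (map (\<lambda>j. [(Gen_a j, True), (Gen_b j, True), (Gen_a j, False), (Gen_b j, False)]) js)) =
    wlist (map (\<lambda>j. ccomm (\<rho> (Gen_a j)) (\<rho> (Gen_b j))) js)" for js
    by (induction js) (simp_all add: ccomm_def cmul_assoc)
  ultimately show ?thesis by (simp add: surface_relator_def lprod_def eval_word_append wlist_append)
qed

lemma surface_relator_words: "surface_relator g p \<in> words (surface_gens g p)"
  by (auto simp: surface_relator_def words_def in_lists_conv_set)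

lemma psl_eval_word_equiv:
  assumes "(u, v) \<in> word_equiv (surface_gens g p) {surface_relator g p}" "lprod g p \<rho> = central n"
  shows "psl (eval_word \<rho> u) = psl (eval_word \<rho> v)"
  using assms(1)
proof (induction rule: word_equiv.induct)
  case (cancel u v x b)
  show ?case by (cases b) (simp_all add: eval_word_append)
next
  case (relator u v r)
  then have "eval_word \<rho> r = central n" using assms(2) by (simp add: eval_word_relator)
  then show ?case by (simp add: eval_word_append central_left_commute)
qed simp_all

lemma psl_eval_word_cong:
  assumes "\<And>x. psl (\<rho> x) = psl (\<rho>' x)" shows "psl (eval_word \<rho> w) = psl (eval_word \<rho>' w)"
proof (induction w)
  case (Cons y w)
  then show ?case by (cases y) (simp add: psl_mul psl_inv assms)
qed simp

lemma continuous_on_eval_word: "continuous_on T (\<lambda>\<rho>. eval_word \<rho> w)"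
proof (induction w)
  case (Cons y w)
  have "continuous_on T (\<lambda>\<rho>. \<rho> x)" for x :: surface_gen by (rule continuous_on_coord[OF continuous_on_id])
  moreover obtain x b where "y = (x, b)" by (rule prod.exhaust)
  ultimately show ?case using Cons by (cases b) (auto intro!: continuous_intros)
qed simp

definition rep_of :: "nat \<Rightarrow> nat \<Rightarrow> (surface_gen \<Rightarrow> cov) \<Rightarrow> surface_gen word set \<Rightarrow> mat2 set" where
  "rep_of g p \<rho> = (\<lambda>X\<in>carrier (surface_group g p). psl (eval_word \<rho> (SOME w. w \<in> X)))"

abbreviation wcls :: "nat \<Rightarrow> nat \<Rightarrow> surface_gen word \<Rightarrow> surface_gen word set" where
  "wcls g p \<equiv> word_class (surface_gens g p) {surface_relator g p}"

lemma carrier_surface_group: "carrier (surface_group g p) = wcls g p ` words (surface_gens g p)"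
  by (simp add: surface_group_def carrier_presented_group)

lemma rep_of_wcls:
  assumes "lprod g p \<rho> = central n" "w \<in> words (surface_gens g p)"
  shows "rep_of g p \<rho> (wcls g p w) = psl (eval_word \<rho> w)"
proof -
  have "w \<in> wcls g p w" using assms(2) by (auto simp: word_class_def intro: word_equiv.refl)
  then have "(SOME v. v \<in> wcls g p w) \<in> wcls g p w" by (rule someI)
  then have "(w, SOME v. v \<in> wcls g p w) \<in> word_equiv (surface_gens g p) {surface_relator g p}" by (simp add: word_class_def)
  from psl_eval_word_equiv[OF this assms(1)] show ?thesis using assms(2) by (simp add: rep_of_def carrier_surface_group)
qed

lemma single_word: "x \<in> surface_gens g p \<Longrightarrow> [(x, b)] \<in> words (surface_gens g p)"
  by (simp add: words_def)

lemma rep_of_elem: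
  assumes "lprod g p \<rho> = central n" "x \<in> surface_gens g p"
  shows "rep_of g p \<rho> (surface_elem g p x) = psl (\<rho> x)"
  using rep_of_wcls[OF assms(1) single_word[OF assms(2), of True]] by (simp add: surface_elem_def)

lemma rep_of_Rep: assumes "lprod g p \<rho> = central n" shows "rep_of g p \<rho> \<in> Rep g p"
proof -
  have "rep_of g p \<rho> (x \<otimes>\<^bsub>surface_group g p\<^esub> y) = rep_of g p \<rho> x \<otimes>\<^bsub>PSL2R\<^esub> rep_of g p \<rho> y"
    if xy: "x \<in> carrier (surface_group g p)" "y \<in> carrier (surface_group g p)" for x y
  proof -
    obtain u v where uv: "x = wcls g p u" "y = wcls g p v" "u \<in> words (surface_gens g p)" "v \<in> words (surface_gens g p)"
      using xy by (auto simp: carrier_surface_group)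
    then have "x \<otimes>\<^bsub>surface_group g p\<^esub> y = wcls g p (u @ v)" by (simp add: surface_group_def mult_word_class)
    then show ?thesis using uv rep_of_wcls[OF assms] by (simp add: words_append eval_word_append psl_mul)
  qed
  moreover have "rep_of g p \<rho> x \<in> carrier PSL2R" if "x \<in> carrier (surface_group g p)" for x
    using that by (simp add: rep_of_def)
  moreover have "rep_of g p \<rho> \<in> extensional (carrier (surface_group g p))" by (simp add: rep_of_def)
  ultimately show ?thesis by (simp add: Rep_def hom_def)
qed

lemma rel_euler_class_eq:
  assumes L: "\<rho> \<in> Lifted g p n s" and s: "\<forall>i<p. s i = 1 \<or> s i = - 1"
    and \<phi>: "\<And>x. x \<in> surface_gens g p \<Longrightarrow> \<phi> (surface_elem g p x) = psl (\<rho> x)"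
  shows "rel_euler_class g p \<phi> = n"
proof -
  have l: "lprod g p \<rho> = central n" and c: "\<And>i. i < p \<Longrightarrow> \<rho> (Gen_c i) \<in> Parabolics (s i)" using L by (auto simp: Lifted_def)
  have ex: "map (\<lambda>i. exp_lift (\<phi> (surface_elem g p (Gen_c i)))) [0..<p] = map cover_cls (map (\<lambda>i. \<rho> (Gen_c i)) [0..<p])"
    using exp_lift_psl[OF c] s by (simp add: \<phi>)
  have key: "group_list_prod SL2R_cover
       (map (\<lambda>j. group_commutator SL2R_cover (\<alpha> j) (\<beta> j)) [0..<g] @
        map (\<lambda>i. exp_lift (\<phi> (surface_elem g p (Gen_c i)))) [0..<p]) = cover_cls (central n)"
    if ab: "\<forall>j<g. is_cover_lift (\<alpha> j) (\<phi> (surface_elem g p (Gen_a j))) \<and> is_cover_lift (\<beta> j) (\<phi> (surface_elem g p (Gen_b j)))"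
    for \<alpha> \<beta>
  proof -
    have "group_commutator SL2R_cover (\<alpha> j) (\<beta> j) = cover_cls (ccomm (\<rho> (Gen_a j)) (\<rho> (Gen_b j)))" if j: "j < g" for j
    proof -
      obtain a b where ab': "\<alpha> j = cover_cls a" "psl a = psl (\<rho> (Gen_a j))" "\<beta> j = cover_cls b" "psl b = psl (\<rho> (Gen_b j))"
        using ab j by (auto simp: is_cover_lift_iff \<phi>)
      then obtain k m where "a = central k \<odot> \<rho> (Gen_a j)" "b = central m \<odot> \<rho> (Gen_b j)" by (auto simp: psl_eq_iff)
      then show ?thesis by (simp add: ab' cover_commutator)
    qed
    then have "map (\<lambda>j. group_commutator SL2R_cover (\<alpha> j) (\<beta> j)) [0..<g] = map cover_cls (map (\<lambda>j. ccomm (\<rho> (Gen_a j)) (\<rho> (Gen_b j))) [0..<g])"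
      by simp
    then show ?thesis unfolding ex map_append[symmetric] cover_list_prod l[symmetric] lprod_def by (simp only: map_append[symmetric] cover_list_prod)
  qed
  show ?thesis
    unfolding rel_euler_class_def cover_z_eq cover_pow
  proof (rule the_equality)
    fix m assume m: "\<forall>\<alpha> \<beta>. (\<forall>j<g. is_cover_lift (\<alpha> j) (\<phi> (surface_elem g p (Gen_a j))) \<and> is_cover_lift (\<beta> j) (\<phi> (surface_elem g p (Gen_b j)))) \<longrightarrow>
     group_list_prod SL2R_cover
       (map (\<lambda>j. group_commutator SL2R_cover (\<alpha> j) (\<beta> j)) [0..<g] @
        map (\<lambda>i. exp_lift (\<phi> (surface_elem g p (Gen_c i)))) [0..<p]) = cover_cls (central m)"
    have h: "\<forall>j<g. is_cover_lift (cover_cls (\<rho> (Gen_a j))) (\<phi> (surface_elem g p (Gen_a j))) \<and>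
        is_cover_lift (cover_cls (\<rho> (Gen_b j))) (\<phi> (surface_elem g p (Gen_b j)))"
      by (auto simp: is_cover_lift_iff \<phi>)
    have "cover_cls (central n) = cover_cls (central m)" using key[OF h] mp[OF spec[OF spec[OF m]] h] by simp
    then show "m = n" by simp
  qed (use key in blast)
qed

lemma rep_of_in:
  assumes L: "\<rho> \<in> Lifted g p n s" and s: "s \<in> {..<p} \<rightarrow>\<^sub>E {1, - 1}"
  shows "rep_of g p \<rho> \<in> Rep_n_s g p n s"
proof -
  have l: "lprod g p \<rho> = central n" and c: "\<And>i. i < p \<Longrightarrow> \<rho> (Gen_c i) \<in> Parabolics (s i)" using L by (auto simp: Lifted_def)
  have s1: "\<forall>i<p. s i = 1 \<or> s i = - 1" using s by auto
  note e = rep_of_elem[OF l]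
  have "type_preserving g p (rep_of g p \<rho>)" unfolding type_preserving_def using parabolic_psl[OF c] s1 by (simp add: e)
  moreover have "rep_sign g p (rep_of g p \<rho>) = s"
  proof
    fix i
    show "rep_sign g p (rep_of g p \<rho>) i = s i"
    proof (cases "i < p")
      case True
      then have "parabolic_sign (psl (\<rho> (Gen_c i))) = s i" using parabolic_sign_psl[OF c] s1 by blast
      then show ?thesis using True by (simp add: rep_sign_def e)
    next
      case False
      then show ?thesis using PiE_arb[OF s, of i] by (simp add: rep_sign_def)
    qed
  qed
  moreover have "rel_euler_class g p (rep_of g p \<rho>) = n" by (rule rel_euler_class_eq[OF L s1 e])
  ultimately show ?thesis using rep_of_Rep[OF l] by (simp add: Rep_n_s_def)
qed

lemma rep_wcls:
  assumes \<phi>: "\<phi> \<in> Rep g p" and \<rho>: "\<And>x. x \<in> surface_gens g p \<Longrightarrow> \<phi> (surface_elem g p x) = psl (\<rho> x)"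
    and w: "w \<in> words (surface_gens g p)"
  shows "\<phi> (wcls g p w) = psl (eval_word \<rho> w)"
proof -
  interpret G: group "surface_group g p" unfolding surface_group_def by (rule group_presented_group)
  interpret H: group PSL2R by (rule group_PSL2R)
  interpret h: group_hom "surface_group g p" PSL2R \<phi>
    by unfold_locales (use \<phi> in \<open>simp add: Rep_def\<close>)
  have nil: "[] \<in> words (surface_gens g p)" by (simp add: words_def)
  have one: "wcls g p [] = \<one>\<^bsub>surface_group g p\<^esub>" by (simp add: surface_group_def one_presented_group)
  have mult: "wcls g p (u @ v) = wcls g p u \<otimes>\<^bsub>surface_group g p\<^esub> wcls g p v"
    if "u \<in> words (surface_gens g p)" "v \<in> words (surface_gens g p)" for u v
    using that by (simp add: surface_group_def mult_word_class)
  have car: "wcls g p u \<in> carrier (surface_group g p)" if "u \<in> words (surface_gens g p)" for u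
    using that by (simp add: carrier_surface_group)
  have letter: "\<phi> (wcls g p [(x, b)]) = psl (if b then \<rho> x else cinv (\<rho> x))" if x: "x \<in> surface_gens g p" for x b
  proof (cases b)
    case True
    then show ?thesis using \<rho>[OF x] by (simp add: surface_elem_def)
  next
    case False
    have "([(x, False), (x, True)], []) \<in> word_equiv (surface_gens g p) {surface_relator g p}"
      using word_equiv.cancel[OF nil nil x, of False] by simp
    then have "wcls g p ([(x, False)] @ [(x, True)]) = wcls g p []"
      using word_class_eq_iff word_equiv_words by fastforce
    then have "wcls g p [(x, False)] \<otimes>\<^bsub>surface_group g p\<^esub> wcls g p [(x, True)] = \<one>\<^bsub>surface_group g p\<^esub>"
      unfolding one mult[OF single_word[OF x] single_word[OF x]] .
    then have "wcls g p [(x, False)] = inv\<^bsub>surface_group g p\<^esub> (wcls g p [(x, True)])"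
      by (rule G.inv_equality[symmetric]) (use car single_word x in auto)
    then show ?thesis using False \<rho>[OF x] car[OF single_word[OF x]] by (simp add: surface_elem_def psl_inv)
  qed
  show ?thesis using w
  proof (induction w)
    case Nil
    then show ?case by (simp add: one psl_one)
  next
    case (Cons y w)
    obtain x b where y: "y = (x, b)" by (rule prod.exhaust)
    have x: "x \<in> surface_gens g p" "w \<in> words (surface_gens g p)" using Cons.prems by (auto simp: y words_def)
    have "\<phi> (wcls g p (y # w)) = \<phi> (wcls g p [(x, b)]) \<otimes>\<^bsub>PSL2R\<^esub> \<phi> (wcls g p w)"
      using mult[OF single_word[OF x(1)] x(2), of b] car[OF single_word[OF x(1)], of b] car[OF x(2)] by (simp add: y)
    then show ?case unfolding letter[OF x(1)] Cons.IH[OF x(2)] y by (simp add: psl_mul)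
  qed
qed

lemma rep_of_surj:
  assumes \<phi>: "\<phi> \<in> Rep_n_s g p n s" and s: "s \<in> {..<p} \<rightarrow>\<^sub>E {1, - 1}"
  shows "\<exists>\<rho>\<in>Lifted g p n s. \<phi> = rep_of g p \<rho>"
proof -
  have R: "\<phi> \<in> Rep g p" and tp: "type_preserving g p \<phi>" and e: "rel_euler_class g p \<phi> = n" and sg: "rep_sign g p \<phi> = s"
    using \<phi> by (auto simp: Rep_n_s_def)
  have s1: "\<forall>i<p. s i = 1 \<or> s i = - 1" using s by auto
  let ?P = "\<lambda>x u. psl u = \<phi> (surface_elem g p x) \<and> (\<forall>i<p. x = Gen_c i \<longrightarrow> u \<in> Parabolics (s i))"
  have ex: "\<exists>u. ?P x u" if x: "x \<in> surface_gens g p" for x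
  proof (cases "\<exists>i. x = Gen_c i")
    case True
    then obtain i where i: "x = Gen_c i" by blast
    then have ip: "i < p" using x by simp
    then have "PSL_parabolic (\<phi> (surface_elem g p x))" using tp by (simp add: type_preserving_def i)
    then obtain s' u where u: "s' = 1 \<or> s' = - 1" "u \<in> Parabolics s'" "psl u = \<phi> (surface_elem g p x)" using parabolic_lift by blast
    have "s i = parabolic_sign (psl u)" using ip by (simp add: sg[symmetric] rep_sign_def u(3) i)
    also have "\<dots> = s'" by (rule parabolic_sign_psl[OF u(2,1)])
    finally show ?thesis using u i by (intro exI[of _ u]) auto
  next
    case False
    have "surface_elem g p x \<in> carrier (surface_group g p)"
      using single_word[OF x] by (simp add: carrier_surface_group surface_elem_def)
    then have "\<phi> (surface_elem g p x) \<in> carrier PSL2R" using R by (auto simp: Rep_def hom_def)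
    then obtain u where "psl u = \<phi> (surface_elem g p x)" using psl_surj by metis
    then show ?thesis using False by blast
  qed
  define \<rho> where "\<rho> x = (if x \<in> surface_gens g p then SOME u. ?P x u else cid)" for x
  have \<rho>: "?P x (\<rho> x)" if "x \<in> surface_gens g p" for x
  proof -
    have e: "\<rho> x = (SOME u. ?P x u)" by (simp only: \<rho>_def that if_True)
    show ?thesis unfolding e by (rule someI_ex[OF ex[OF that]])
  qed
  then have el: "\<phi> (surface_elem g p x) = psl (\<rho> x)" if "x \<in> surface_gens g p" for x using that by simp
  have wc: "\<phi> (wcls g p w) = psl (eval_word \<rho> w)" if "w \<in> words (surface_gens g p)" for w
    by (rule rep_wcls[OF R el that])
  let ?r = "surface_relator g p"
  have nil: "[] \<in> words (surface_gens g p)" by (simp add: words_def)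
  have "(?r, []) \<in> word_equiv (surface_gens g p) {?r}"
    using word_equiv.relator[OF nil nil _ surface_relator_words, of "{?r}"] by simp
  then have "wcls g p ?r = wcls g p []" using word_class_eq_iff[OF surface_relator_words nil] by blast
  then have "psl (lprod g p \<rho>) = psl cid" using wc[OF surface_relator_words] wc[OF nil] by (simp add: eval_word_relator)
  then obtain m where m: "lprod g p \<rho> = central m" by (auto simp: psl_one psl_eq_one)
  have "\<rho> (Gen_c i) \<in> Parabolics (s i)" if "i < p" for i using \<rho>[of "Gen_c i"] that by simp
  then have L: "\<rho> \<in> Lifted g p m s" using m by (simp add: Lifted_def \<rho>_def)
  have "m = n" using rel_euler_class_eq[OF L s1 el] e by simp
  moreover have "\<phi> = rep_of g p \<rho>"
  proof (rule extensionalityI[of _ "carrier (surface_group g p)"])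
    show "\<phi> \<in> extensional (carrier (surface_group g p))" using R by (simp add: Rep_def)
    show "rep_of g p \<rho> \<in> extensional (carrier (surface_group g p))" by (simp add: rep_of_def)
    show "\<phi> x = rep_of g p \<rho> x" if "x \<in> carrier (surface_group g p)" for x
      using that wc rep_of_wcls[OF m] by (auto simp: carrier_surface_group)
  qed
  ultimately show ?thesis using L by blast
qed

lemma continuous_map_rep_of:
  "continuous_map (top_of_set (Lifted g p n s)) (Rep_topology g p) (rep_of g p)"
proof -
  let ?T = "Lifted g p n s"
  have l: "lprod g p \<rho> = central n" if "\<rho> \<in> ?T" for \<rho> using that by (simp add: Lifted_def)
  have "continuous_map (top_of_set ?T) PSL2R_topology (\<lambda>\<rho>. rep_of g p \<rho> X)" if X: "X \<in> carrier (surface_group g p)" for X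
    using continuous_map_psl[OF continuous_on_eval_word] X by (simp add: rep_of_def)
  moreover have "rep_of g p ` ?T \<subseteq> extensional (carrier (surface_group g p))" by (auto simp: rep_of_def)
  ultimately have "continuous_map (top_of_set ?T) (product_topology (\<lambda>_. PSL2R_topology) (carrier (surface_group g p))) (rep_of g p)"
    by (simp add: continuous_map_componentwise)
  then show ?thesis unfolding Rep_topology_def
    using rep_of_Rep[OF l] by (auto simp: continuous_map_in_subtopology)
qed

lemma rep_of_shift:
  "rep_of g p (\<rho>(x := central k \<odot> \<rho> x)) = rep_of g p \<rho>"
  unfolding rep_of_def by (intro restrict_ext psl_eval_word_cong) simp

lemma connectedin_Rep_n_s:
  assumes g: "g \<ge> 1" and p: "p \<ge> 1" and s: "s \<in> {..<p} \<rightarrow>\<^sub>E {1, - 1}"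
  shows "connectedin (Rep_topology g p) (Rep_n_s g p n s)"
  unfolding connectedin
proof (intro conjI notI)
  interpret surface_data g p s by unfold_locales (use g p s in auto)
  let ?T = "Lifted g p n s"
  have "Rep_n_s g p n s \<subseteq> rep_of g p ` ?T" using rep_of_surj[OF _ s] by blast
  moreover have "rep_of g p ` ?T \<subseteq> topspace (Rep_topology g p)"
    using continuous_map_image_subset_topspace[OF continuous_map_rep_of] by simp
  ultimately show "Rep_n_s g p n s \<subseteq> topspace (Rep_topology g p)" by blast
  assume "\<exists>U V. openin (Rep_topology g p) U \<and> openin (Rep_topology g p) V \<and> Rep_n_s g p n s \<subseteq> U \<union> V \<and>
    U \<inter> V \<inter> Rep_n_s g p n s = {} \<and> U \<inter> Rep_n_s g p n s \<noteq> {} \<and> V \<inter> Rep_n_s g p n s \<noteq> {}"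
  then obtain U V where U: "openin (Rep_topology g p) U" and V: "openin (Rep_topology g p) V"
    and UV: "Rep_n_s g p n s \<subseteq> U \<union> V" "U \<inter> V \<inter> Rep_n_s g p n s = {}"
    and ne: "U \<inter> Rep_n_s g p n s \<noteq> {}" "V \<inter> Rep_n_s g p n s \<noteq> {}" by blast
  define \<kappa> where "\<kappa> \<rho> = (rep_of g p \<rho> \<in> U)" for \<rho>
  have TR: "rep_of g p \<rho> \<in> Rep_n_s g p n s" if "\<rho> \<in> ?T" for \<rho> using rep_of_in[OF that s] .
  have op: "\<exists>W. open W \<and> (\<forall>\<rho>\<in>?T. rep_of g p \<rho> \<in> Q \<longleftrightarrow> \<rho> \<in> W)" if Q: "openin (Rep_topology g p) Q" for Q
  proof -
    have "openin (top_of_set ?T) {\<rho> \<in> topspace (top_of_set ?T). rep_of g p \<rho> \<in> Q}"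
      by (rule openin_continuous_map_preimage[OF continuous_map_rep_of Q])
    then obtain W where "open W" "{\<rho> \<in> ?T. rep_of g p \<rho> \<in> Q} = ?T \<inter> W" by (auto simp: openin_open)
    then show ?thesis by blast
  qed
  obtain U' where U': "open U'" "\<And>\<rho>. \<rho> \<in> ?T \<Longrightarrow> rep_of g p \<rho> \<in> U \<longleftrightarrow> \<rho> \<in> U'" using op[OF U] by blast
  obtain V' where V': "open V'" "\<And>\<rho>. \<rho> \<in> ?T \<Longrightarrow> rep_of g p \<rho> \<in> V \<longleftrightarrow> \<rho> \<in> V'" using op[OF V] by blast
  have "loc_const ?T \<kappa>"
    unfolding loc_const_def eventually_at_topological
  proof
    fix \<rho> assume r: "\<rho> \<in> ?T"
    have iff: "\<kappa> \<sigma> \<longleftrightarrow> \<sigma> \<in> U'" "\<not> \<kappa> \<sigma> \<longleftrightarrow> \<sigma> \<in> V'" if "\<sigma> \<in> ?T" for \<sigma>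
      using U'(2)[OF that] V'(2)[OF that] UV TR[OF that] by (auto simp: \<kappa>_def)
    show "\<exists>W. open W \<and> \<rho> \<in> W \<and> (\<forall>\<sigma>\<in>W. \<sigma> \<noteq> \<rho> \<longrightarrow> \<sigma> \<in> ?T \<longrightarrow> \<kappa> \<sigma> = \<kappa> \<rho>)"
      by (rule exI[of _ "if \<kappa> \<rho> then U' else V'"]) (use iff r U'(1) V'(1) in auto)
  qed
  moreover have "zinvariant g ?T \<kappa>" by (simp add: zinvariant_def \<kappa>_def rep_of_shift)
  moreover obtain \<phi> where \<phi>: "\<phi> \<in> U" "\<phi> \<in> Rep_n_s g p n s" using ne(1) by blast
  then obtain \<rho> where \<rho>: "\<rho> \<in> ?T" "\<phi> = rep_of g p \<rho>" using rep_of_surj[OF _ s] by blast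
  moreover obtain \<psi> where \<psi>: "\<psi> \<in> V" "\<psi> \<in> Rep_n_s g p n s" using ne(2) by blast
  then obtain \<rho>' where \<rho>': "\<rho>' \<in> ?T" "\<psi> = rep_of g p \<rho>'" using rep_of_surj[OF _ s] by blast
  ultimately have "\<kappa> \<rho> = \<kappa> \<rho>'" by (intro Lifted_connected)
  then show False using \<phi> \<psi> \<rho>(2) \<rho>'(2) UV(2) by (auto simp: \<kappa>_def)
qed

lemma Rep_n_s_empty_iff:
  assumes g: "g \<ge> 1" and p: "p \<ge> 1" and s: "s \<in> {..<p} \<rightarrow>\<^sub>E {1, - 1}"
  shows "Rep_n_s g p n s \<noteq> {} \<longleftrightarrow>
    surface_euler_char g p + int (num_pos p s) \<le> n \<and> n \<le> - surface_euler_char g p - int (num_neg p s)"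
proof -
  interpret surface_data g p s by unfold_locales (use g p s in auto)
  have "Rep_n_s g p n s \<noteq> {} \<longleftrightarrow> Lifted g p n s \<noteq> {}"
    using rep_of_surj[OF _ s, of _ g n] rep_of_in[OF _ s, of _ g n] by blast
  then show ?thesis by (simp only: Lifted_iff)
qed

theorem theorem1p1:
  fixes g p :: nat and n :: int and s :: "nat \<Rightarrow> int"
  assumes "g \<ge> 1" and "p \<ge> 1"
    and "s \<in> {..<p} \<rightarrow>\<^sub>E {1, - 1}"
  shows "(Rep_n_s g p n s \<noteq> {} \<longleftrightarrow>
            surface_euler_char g p + int (num_pos p s) \<le> n \<and>
            n \<le> - surface_euler_char g p - int (num_neg p s)) \<and>
         (Rep_n_s g p n s \<noteq> {} \<longrightarrow> connectedin (Rep_topology g p) (Rep_n_s g p n s))"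
  using Rep_n_s_empty_iff[OF assms] connectedin_Rep_n_s[OF assms] by blast

end
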